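(* Let $A$ be a simple tracially $\mathcal{Z}$-absorbing C*-algebra and let $B$ be a hereditary C*-subalgebra of $A$. Then $B$ is also tracially $\mathcal{Z}$-absorbing.
   Context: C*-algebras are not assumed unital. Simple means having no closed two-sided ideals other than $0$ and the whole algebra (the zero algebra is allowed). For positive elements $a,b$ of a C*-algebra $A$, $a \precsim b$ (Cuntz subequivalence) means there is a sequence $(v_n)$ in $A$ with $\|a - v_n b v_n^*\| \to 0$. For self-adjoint $c$ and $\varepsilon>0$, $(c-\varepsilon)_+$ is obtained by applying $t \mapsto \max(t-\varepsilon,0)$. $M_n=M_n(\mathbb{C})$, $[y,z]=yz-zy$. A completely positive contractive (c.p.c.) map $\varphi$ has order zero if $\varphi(y)\varphi(z)=0$ whenever $y,z$ are positive with $yz=0$. A simple C*-algebra $A$ is tracially $\mathcal{Z}$-absorbing if $A \not\cong \mathbb{C}$ and for every $x,a \in A_+$ with $a \neq 0$, every finite set $F \subseteq A$, every $\varepsilon>0$, and every $n \in \mathbb{N}$, there is a c.p.c. order zero map $\varphi\colon M_n \to A$ such that (i) $(x^2 - x\varphi(1)x - \varepsilon)_+ \precsim a$, and (ii) $\|[\varphi(z),b]\| < \varepsilon$ for all $z \in M_n$ with $\|z\| \le 1$ and all $b \in F$. *)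

theory Defs
  imports
    "HOL-Analysis.Uniform_Limit"
    "HOL-Analysis.L2_Norm"
    "HOL-Computational_Algebra.Polynomial"
    "Jordan_Normal_Form.Matrix"
begin

section \<open>C*-algebras\<close>

text \<open>
  There is no unit in this class, and the zero algebra is allowed.
\<close>

class cstar_algebra = real_normed_algebra + banach +
  fixes scaleC :: "complex \<Rightarrow> 'a \<Rightarrow> 'a"
    and star :: "'a \<Rightarrow> 'a"
  assumes scaleC_add_right: "scaleC c (x + y) = scaleC c x + scaleC c y"
    and scaleC_add_left: "scaleC (c + d) x = scaleC c x + scaleC d x"
    and scaleC_scaleC: "scaleC c (scaleC d x) = scaleC (c * d) x"
    and scaleC_of_real: "scaleC (complex_of_real r) x = r *\<^sub>R x"
    and norm_scaleC: "norm (scaleC c x) = cmod c * norm x"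
    and scaleC_mult_left: "scaleC c x * y = scaleC c (x * y)"
    and scaleC_mult_right: "x * scaleC c y = scaleC c (x * y)"
    and star_add: "star (x + y) = star x + star y"
    and star_scaleC: "star (scaleC c x) = scaleC (cnj c) (star x)"
    and star_mult: "star (x * y) = star y * star x"
    and star_star: "star (star x) = x"
    and norm_star_mult_self: "norm (star x * x) = (norm x)\<^sup>2"

instantiation complex :: cstar_algebra
begin

definition scaleC_complex :: "complex \<Rightarrow> complex \<Rightarrow> complex"
  where "scaleC_complex c x = c * x"

definition star_complex :: "complex \<Rightarrow> complex"
  where "star_complex x = cnj x"

instance
  by standard
    (simp_all add: scaleC_complex_def star_complex_def algebra_simps norm_mult
      scaleR_conv_of_real power2_eq_square)

end

text \<open>
  In order to treat an algebra and its subalgebras alike, every C*-algebra is represented by its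
  carrier: a closed *-subalgebra \<open>A\<close> of a type of class \<open>cstar_algebra\<close>
  (for \<open>A = UNIV\<close> it is the type itself). All notions below are relative to this carrier and do
  not refer to elements outside of it.
\<close>

definition cstar_subalgebra :: "'a::cstar_algebra set \<Rightarrow> bool"
  where "cstar_subalgebra A \<longleftrightarrow>
    closed A \<and> 0 \<in> A \<and>
    (\<forall>x\<in>A. \<forall>y\<in>A. x + y \<in> A \<and> x * y \<in> A) \<and>
    (\<forall>c. \<forall>x\<in>A. scaleC c x \<in> A) \<and>
    (\<forall>x\<in>A. star x \<in> A)"

definition closed_ideal :: "'a::cstar_algebra set \<Rightarrow> 'a set \<Rightarrow> bool"
  where "closed_ideal I A \<longleftrightarrow>
    I \<subseteq> A \<and> closed I \<and> 0 \<in> I \<and>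
    (\<forall>x\<in>I. \<forall>y\<in>I. x + y \<in> I) \<and>
    (\<forall>c. \<forall>x\<in>I. scaleC c x \<in> I) \<and>
    (\<forall>a\<in>A. \<forall>x\<in>I. a * x \<in> I \<and> x * a \<in> I)"

definition simple_cstar :: "'a::cstar_algebra set \<Rightarrow> bool"
  where "simple_cstar A \<longleftrightarrow>
    cstar_subalgebra A \<and> (\<forall>I. closed_ideal I A \<longrightarrow> I = {0} \<or> I = A)"

definition star_isomorphic :: "'a::cstar_algebra set \<Rightarrow> 'b::cstar_algebra set \<Rightarrow> bool"
  where "star_isomorphic A B \<longleftrightarrow>
    (\<exists>f. bij_betw f A B \<and>
      (\<forall>x\<in>A. \<forall>y\<in>A. f (x + y) = f x + f y \<and> f (x * y) = f x * f y) \<and>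
      (\<forall>c. \<forall>x\<in>A. f (scaleC c x) = scaleC c (f x)) \<and>
      (\<forall>x\<in>A. f (star x) = star (f x)))"

definition positives :: "'a::cstar_algebra set \<Rightarrow> 'a set"
  where "positives A = {star c * c | c. c \<in> A}"

definition hereditary_subalgebra :: "'a::cstar_algebra set \<Rightarrow> 'a set \<Rightarrow> bool"
  where "hereditary_subalgebra B A \<longleftrightarrow>
    cstar_subalgebra B \<and> B \<subseteq> A \<and>
    (\<forall>a\<in>positives A. \<forall>b\<in>positives B. b - a \<in> positives A \<longrightarrow> a \<in> B)"

definition cuntz_le :: "'a::cstar_algebra set \<Rightarrow> 'a \<Rightarrow> 'a \<Rightarrow> bool"
  where "cuntz_le A a b \<longleftrightarrow>
    (\<exists>v::nat \<Rightarrow> 'a. (\<forall>n. v n \<in> A) \<and> (\<lambda>n. norm (a - v n * b * star (v n))) \<longlonglongrightarrow> 0)"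


section \<open>Functional calculus\<close>

text \<open>
  The spectrum is the one in the algebra \<open>A\<close> with a unit adjoined, so it always contains 0. For
  \<open>l \<noteq> 0\<close>, the element \<open>l 1 - c\<close> is invertible there iff \<open>1 - c/l\<close> has an inverse, which is
  necessarily of the form \<open>1 - b\<close> with \<open>b\<close> in \<open>A\<close>.
\<close>

definition spectrum_in :: "'a::cstar_algebra set \<Rightarrow> 'a \<Rightarrow> complex set"
  where "spectrum_in A c =
    insert 0 {l. l \<noteq> 0 \<and>
      \<not> (\<exists>b\<in>A. (let a = scaleC (inverse l) c in a + b - a * b = 0 \<and> a + b - b * a = 0))}"

text \<open>\<open>power_Suc x k\<close> is the power of \<open>x\<close> with exponent \<open>k + 1\<close>.\<close>

primrec power_Suc :: "'a::cstar_algebra \<Rightarrow> nat \<Rightarrow> 'a"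
  where
    "power_Suc x 0 = x"
  | "power_Suc x (Suc k) = x * power_Suc x k"

text \<open>Evaluation of a polynomial at an element; only meaningful if the constant term is 0.\<close>

definition poly_at :: "real poly \<Rightarrow> 'a::cstar_algebra \<Rightarrow> 'a"
  where "poly_at p x = (\<Sum>i<degree p. coeff p (Suc i) *\<^sub>R power_Suc x i)"

text \<open>
  For self-adjoint \<open>c\<close> and \<open>f\<close> continuous with \<open>f 0 = 0\<close>, the element \<open>f(c)\<close> is the norm limit of
  \<open>p n (c)\<close> for polynomials \<open>p n\<close> without constant term that converge to \<open>f\<close> uniformly on the
  spectrum of \<open>c\<close> (the limit does not depend on their choice).
\<close>

definition fun_calc :: "'a::cstar_algebra set \<Rightarrow> (real \<Rightarrow> real) \<Rightarrow> 'a \<Rightarrow> 'a"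
  where "fun_calc A f c =
    (THE d. \<exists>p::nat \<Rightarrow> real poly.
      (\<forall>n. poly (p n) 0 = 0) \<and>
      uniform_limit {t. complex_of_real t \<in> spectrum_in A c} (\<lambda>n t. poly (p n) t) f sequentially \<and>
      (\<lambda>n. poly_at (p n) c) \<longlonglongrightarrow> d)"

text \<open>The element \<open>(c - e)\<^sub>+\<close>.\<close>

definition cut_down :: "'a::cstar_algebra set \<Rightarrow> 'a \<Rightarrow> real \<Rightarrow> 'a"
  where "cut_down A c e = fun_calc A (\<lambda>t. max (t - e) 0) c"


section \<open>Matrices and order zero maps\<close>

definition mat_star :: "'a::cstar_algebra mat \<Rightarrow> 'a mat"
  where "mat_star X = map_mat star (transpose_mat X)"

text \<open>The positive elements of the algebra of \<open>k \<times> k\<close> matrices over \<open>A\<close>.\<close>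

definition positive_mats :: "'a::cstar_algebra set \<Rightarrow> nat \<Rightarrow> 'a mat set"
  where "positive_mats A k = {mat_star C * C | C. C \<in> carrier_mat k k \<and> elements_mat C \<subseteq> A}"

definition vec_l2 :: "complex vec \<Rightarrow> real"
  where "vec_l2 v = L2_set (\<lambda>i. cmod (v $ i)) {..<dim_vec v}"

text \<open>The C*-norm on \<open>n \<times> n\<close> complex matrices.\<close>

definition op_norm :: "nat \<Rightarrow> complex mat \<Rightarrow> real"
  where "op_norm n z = Sup {vec_l2 (z *\<^sub>v v) | v. v \<in> carrier_vec n \<and> vec_l2 v \<le> 1}"

text \<open>
  A \<open>k \<times> k\<close> matrix over the \<open>n \<times> n\<close> complex matrices is identified, in the usual way, with the
  \<open>k * n \<times> k * n\<close> complex matrix \<open>X\<close> that has it as its matrix of blocks.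
\<close>

definition block :: "nat \<Rightarrow> complex mat \<Rightarrow> nat \<Rightarrow> nat \<Rightarrow> complex mat"
  where "block n X i j = mat n n (\<lambda>(p, q). X $$ (i * n + p, j * n + q))"

definition amplification ::
    "nat \<Rightarrow> nat \<Rightarrow> (complex mat \<Rightarrow> 'a::cstar_algebra) \<Rightarrow> complex mat \<Rightarrow> 'a mat"
  where "amplification k n \<phi> X = mat k k (\<lambda>(i, j). \<phi> (block n X i j))"

definition linear_from_mats :: "nat \<Rightarrow> 'a::cstar_algebra set \<Rightarrow> (complex mat \<Rightarrow> 'a) \<Rightarrow> bool"
  where "linear_from_mats n A \<phi> \<longleftrightarrow>
    (\<forall>y\<in>carrier_mat n n. \<phi> y \<in> A) \<and>
    (\<forall>y\<in>carrier_mat n n. \<forall>z\<in>carrier_mat n n. \<phi> (y + z) = \<phi> y + \<phi> z) \<and>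
    (\<forall>c. \<forall>y\<in>carrier_mat n n. \<phi> (c \<cdot>\<^sub>m y) = scaleC c (\<phi> y))"

definition completely_positive :: "nat \<Rightarrow> 'a::cstar_algebra set \<Rightarrow> (complex mat \<Rightarrow> 'a) \<Rightarrow> bool"
  where "completely_positive n A \<phi> \<longleftrightarrow>
    linear_from_mats n A \<phi> \<and>
    (\<forall>k\<ge>1. \<forall>X\<in>positive_mats UNIV (k * n). amplification k n \<phi> X \<in> positive_mats A k)"

definition cpc_order_zero :: "nat \<Rightarrow> 'a::cstar_algebra set \<Rightarrow> (complex mat \<Rightarrow> 'a) \<Rightarrow> bool"
  where "cpc_order_zero n A \<phi> \<longleftrightarrow>
    completely_positive n A \<phi> \<and>
    (\<forall>z\<in>carrier_mat n n. norm (\<phi> z) \<le> op_norm n z) \<and>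
    (\<forall>y\<in>positive_mats UNIV n. \<forall>z\<in>positive_mats UNIV n.
      y * z = 0\<^sub>m n n \<longrightarrow> \<phi> y * \<phi> z = 0)"


section \<open>Tracial Z-absorption\<close>

text \<open>
  The notion is only defined for simple algebras, so simplicity is part of it. The size \<open>n\<close> of the
  matrices is at least 1.
\<close>

definition tracially_Z_absorbing :: "'a::cstar_algebra set \<Rightarrow> bool"
  where "tracially_Z_absorbing A \<longleftrightarrow>
    simple_cstar A \<and>
    \<not> star_isomorphic A (UNIV :: complex set) \<and>
    (\<forall>x\<in>positives A. \<forall>a\<in>positives A. \<forall>F \<epsilon>. \<forall>n::nat.
      a \<noteq> 0 \<and> finite F \<and> F \<subseteq> A \<and> \<epsilon> > 0 \<and> n \<ge> 1 \<longrightarrow>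
      (\<exists>\<phi>. cpc_order_zero n A \<phi> \<and>
        cuntz_le A (cut_down A (x * x - x * \<phi> (1\<^sub>m n) * x) \<epsilon>) a \<and>
        (\<forall>z\<in>carrier_mat n n. \<forall>b\<in>F. op_norm n z \<le> 1 \<longrightarrow> norm (\<phi> z * b - b * \<phi> z) < \<epsilon>)))"

end

theory Submission
  imports Defs "HOL-Analysis.Generalised_Binomial_Theorem" "HOL-Analysis.Weierstrass_Theorems"
    "HOL-Analysis.Operator_Norm"
    "HOL-Computational_Algebra.Fundamental_Theorem_Algebra"
begin

text \<open>
  Let \<open>e \<in> B\<close> be a positive contraction that almost acts as a unit on the given elements of \<open>B\<close>,
  and let \<open>\<phi> : M\<^sub>n \<rightarrow> A\<close> be an order zero map as provided by the absorption property of \<open>A\<close>, almost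
  commuting with \<open>e\<close> and these elements. Any \<open>w\<^sub>0, \<dots>, w\<^sub>n\<^sub>-\<^sub>1 \<in> B\<close> with \<open>w\<^sub>i w\<^sub>j\<^sup>* = \<delta>\<^sub>i\<^sub>j d\<close> and
  \<open>\<parallel>d\<parallel> \<le> 1\<close> define an order zero map \<open>e\<^sub>i\<^sub>j \<mapsto> w\<^sub>i\<^sup>* d w\<^sub>j\<close> into \<open>B\<close>; inserting \<open>d\<close> gives the image of a
  positive matrix an explicit square root, which is what complete positivity asks for. Rows
  obtained from \<open>e \<phi>(e\<^sub>0\<^sub>j) e\<close> satisfy the relations approximately, and these relations are stable.
  The resulting map is close to \<open>e\<^sup>8 \<phi>(\<cdot>)\<close>, so it still almost commutes with the given elements, and
  the Cuntz subequivalence follows by perturbation, first in \<open>A\<close> and then, since \<open>B A B \<subseteq> B\<close>, in \<open>B\<close>.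
\<close>

section \<open>Basic facts on C*-algebras\<close>

text \<open>Compressing \<open>\<phi>\<close> by \<open>e\<close> destroys orthogonality, while an
  order zero map into \<open>B\<close> needs the relations exactly. Usually this is handled by
  projectivity of the cone over the matrices and by the structure theorem for order zero maps. Here
  both are replaced by identities between the images of matrix units, namely
  \<open>\<phi>(e_ij) \<phi>(e_kl) = 0\<close> for \<open>j \<noteq> k\<close> and
  \<open>\<phi>(e_ij) \<phi>(e_jl) = \<phi>(1) \<phi>(e_il)\<close>, and by an explicit repair of
  rows. A map built from rows has degree four in them, as
  \<open>w_i^* d w_j = w_i^* w_0 w_0^* w_j\<close>: the rows must behave like fourth roots, hence a
  correction of order \<open>-3/4\<close> in \<open>\<phi>(1)\<close>, and each of the four factors
  carries \<open>e\<close> on both sides, hence \<open>e^8\<close>. Errors are treated by sequences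
  of maps with tolerance tending to 0 and equality up to null sequences. Functional calculus is
  built in a unitization, starting from the binomial series for square roots. That \<open>B\<close>
  is not the complex numbers needs an argument of its own.\<close>

lemma scaleC_0_left [simp]: "scaleC 0 (x::'a::cstar_algebra) = 0"
  using norm_scaleC[of 0 x] by simp

lemma scaleC_0_right [simp]: "scaleC c (0::'a::cstar_algebra) = 0"
  using norm_scaleC[of c 0] by simp

lemma scaleC_1 [simp]: "scaleC 1 (x::'a::cstar_algebra) = x"
  using scaleC_of_real[of 1 x] by simp

lemma scaleC_minus_left: "scaleC (- c) (x::'a::cstar_algebra) = - scaleC c x"
  using scaleC_add_left[of c "- c" x] by (simp add: eq_neg_iff_add_eq_0 add.commute)

lemma scaleC_minus_right: "scaleC c (- x::'a::cstar_algebra) = - scaleC c x"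
  using scaleC_add_right[of c x "- x"] by (simp add: eq_neg_iff_add_eq_0 add.commute)

lemma scaleC_diff_left: "scaleC (c - d) (x::'a::cstar_algebra) = scaleC c x - scaleC d x"
  using scaleC_add_left[of c "- d" x] by (simp add: scaleC_minus_left)

lemma scaleC_diff_right: "scaleC c (x - y::'a::cstar_algebra) = scaleC c x - scaleC c y"
  using scaleC_add_right[of c x "- y"] by (simp add: scaleC_minus_right)

lemma scaleC_sum_right: "scaleC c (\<Sum>i\<in>S. f i) = (\<Sum>i\<in>S. scaleC c (f i :: 'a::cstar_algebra))"
  by (induction S rule: infinite_finite_induct) (auto simp: scaleC_add_right)

lemma scaleC_sum_left: "scaleC (\<Sum>i\<in>S. f i) (x::'a::cstar_algebra) = (\<Sum>i\<in>S. scaleC (f i) x)"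
  by (induction S rule: infinite_finite_induct) (auto simp: scaleC_add_left)

lemma star_0 [simp]: "star (0::'a::cstar_algebra) = 0"
  using star_scaleC[of 0 0] by simp

lemma star_minus [simp]: "star (- x::'a::cstar_algebra) = - star x"
  using star_add[of x "- x"] by (simp add: eq_neg_iff_add_eq_0 add.commute)

lemma star_diff [simp]: "star (x - y::'a::cstar_algebra) = star x - star y"
  using star_add[of x "- y"] by simp

lemma star_scaleR [simp]: "star (r *\<^sub>R x::'a::cstar_algebra) = r *\<^sub>R star x"
  by (simp flip: scaleC_of_real add: star_scaleC)

lemma star_sum: "star (\<Sum>i\<in>S. f i) = (\<Sum>i\<in>S. star (f i :: 'a::cstar_algebra))"
  by (induction S rule: infinite_finite_induct) (auto simp: star_add)

lemmas star_simps = star_add star_scaleC star_mult star_star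

lemma norm_star [simp]: "norm (star x) = norm (x::'a::cstar_algebra)"
proof -
  have le: "norm y \<le> norm (star y)" for y :: 'a
  proof (cases "y = 0")
    case False
    have "norm y * norm y \<le> norm (star y) * norm y"
      using norm_mult_ineq[of "star y" y] by (simp add: norm_star_mult_self power2_eq_square)
    with False show ?thesis by simp
  qed simp
  show ?thesis using le[of x] le[of "star x"] by (simp add: star_star)
qed

lemma norm_mult_star_self: "norm (x * star x) = (norm (x::'a::cstar_algebra))\<^sup>2"
  using norm_star_mult_self[of "star x"] by (simp add: star_star)

lemma star_mult_self_eq_0: "star x * x = 0 \<longleftrightarrow> (x::'a::cstar_algebra) = 0"
  using norm_star_mult_self[of x] by auto

lemma star_eq_0 [simp]: "star x = 0 \<longleftrightarrow> (x::'a::cstar_algebra) = 0"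
  by (metis norm_star norm_eq_zero)

lemma bounded_linear_star: "bounded_linear (star :: 'a::cstar_algebra \<Rightarrow> 'a)"
  by (rule bounded_linear_intro[where K = 1]) (simp_all add: star_add)

lemmas tendsto_star [tendsto_intros] = bounded_linear.tendsto[OF bounded_linear_star]

lemma bounded_linear_scaleC: "bounded_linear (scaleC c :: 'a::cstar_algebra \<Rightarrow> 'a)"
  by (rule bounded_linear_intro[where K = "cmod c"])
    (simp_all add: scaleC_add_right scaleC_scaleC norm_scaleC mult.commute flip: scaleC_of_real)

lemmas tendsto_scaleC [tendsto_intros] = bounded_linear.tendsto[OF bounded_linear_scaleC]

section \<open>Unital C*-algebras\<close>

class cstar_algebra_1 = cstar_algebra + real_normed_algebra_1

lemma star_1 [simp]: "star (1::'a::cstar_algebra_1) = 1"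
  by (metis mult.left_neutral mult.right_neutral star_mult star_star)

lemma star_of_real [simp]: "star (of_real r :: 'a::cstar_algebra_1) = of_real r"
  by (simp add: of_real_def)

lemma star_power: "star (x ^ n) = star (x::'a::cstar_algebra_1) ^ n"
  by (induction n) (simp_all add: star_mult power_commutes)

lemma scaleC_1_mult: "scaleC c 1 * x = scaleC c (x::'a::cstar_algebra_1)"
  by (simp add: scaleC_mult_left)

lemma scaleC_of_real_1: "scaleC (complex_of_real r) 1 = (of_real r::'a::cstar_algebra_1)"
  unfolding scaleC_of_real by (simp add: of_real_def)

definition invertible_elt :: "'a::ring_1 \<Rightarrow> bool"
  where "invertible_elt x \<longleftrightarrow> (\<exists>y. x * y = 1 \<and> y * x = 1)"

lemma invertible_elt_mult:
  assumes "invertible_elt x" "invertible_elt y" shows "invertible_elt (x * y)"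
proof -
  obtain x' y' where "x * x' = 1" "x' * x = 1" "y * y' = 1" "y' * y = 1"
    using assms by (auto simp: invertible_elt_def)
  then have "(x * y) * (y' * x') = 1" "(y' * x') * (x * y) = 1"
    by (metis mult.assoc mult.right_neutral)+
  then show ?thesis unfolding invertible_elt_def by blast
qed

text \<open>The inverse \<open>z\<close> of the product yields a right inverse \<open>y * z\<close>
  and, by commutation, a left inverse \<open>z * y\<close>; these must agree.\<close>

lemma invertible_elt_commuting_factor:
  assumes "invertible_elt (x * y)" "x * y = y * x" shows "invertible_elt x"
proof -
  obtain z where z: "x * y * z = 1" "z * (x * y) = 1"
    using assms(1) by (auto simp: invertible_elt_def)
  have "x * (y * z) = 1" using z by (simp add: mult.assoc)
  moreover have "(z * y) * x = 1" using z assms(2) by (simp add: mult.assoc)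
  ultimately have "z * y = y * z" by (metis mult.assoc mult.left_neutral mult.right_neutral)
  then show ?thesis unfolding invertible_elt_def
    using \<open>x * (y * z) = 1\<close> \<open>(z * y) * x = 1\<close> by metis
qed

lemma invertible_elt_minus: "invertible_elt (- x) \<longleftrightarrow> invertible_elt x"
  unfolding invertible_elt_def by (metis minus_mult_commute minus_minus mult_minus_left)

lemma invertible_elt_scaleR:
  fixes x :: "'a::real_algebra_1"
  assumes "r \<noteq> 0" shows "invertible_elt (r *\<^sub>R x) \<longleftrightarrow> invertible_elt x"
proof -
  have *: "invertible_elt (s *\<^sub>R y)" if s: "s \<noteq> 0" and y: "invertible_elt y" for s and y :: 'a
  proof -
    obtain z where "y * z = 1" "z * y = 1" using y by (auto simp: invertible_elt_def)
    then have "(s *\<^sub>R y) * (inverse s *\<^sub>R z) = 1" "(inverse s *\<^sub>R z) * (s *\<^sub>R y) = 1"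
      using s by simp_all
    then show ?thesis unfolding invertible_elt_def by blast
  qed
  show ?thesis using *[of r x] *[of "inverse r" "r *\<^sub>R x"] assms by auto
qed

lemma invertible_elt_one_minus:
  fixes x :: "'a::{real_normed_algebra_1, banach}"
  assumes "norm x < 1"
  shows "(1 - x) * (\<Sum>n. x ^ n) = 1" "(\<Sum>n. x ^ n) * (1 - x) = 1" "invertible_elt (1 - x)"
proof -
  have s: "summable (\<lambda>n. x ^ n)" by (rule complete_algebra_summable_geometric[OF assms])
  have e: "(\<Sum>n. x ^ n) = 1 + (\<Sum>n. x ^ Suc n)"
    using suminf_split_initial_segment[OF s, of 1] by simp
  have "(\<Sum>n. x ^ Suc n) = x * (\<Sum>n. x ^ n)"
    using suminf_mult[OF s, of x] by simp
  with e show 1: "(1 - x) * (\<Sum>n. x ^ n) = 1" by (simp add: algebra_simps)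
  have "(\<Sum>n. x ^ Suc n) = (\<Sum>n. x ^ n) * x"
    using suminf_mult2[OF s, of x] by (simp add: power_commutes)
  with e show 2: "(\<Sum>n. x ^ n) * (1 - x) = 1" by (simp add: algebra_simps)
  show "invertible_elt (1 - x)" using 1 2 unfolding invertible_elt_def by blast
qed

subsection \<open>The square root of a perturbation of the unit\<close>

text \<open>Binomial series with exponent \<open>1/2\<close>: by Vandermonde's convolution its
  Cauchy square is the series with exponent 1. It provides square roots before a functional calculus
  exists, which is why commutation is part of the statement.\<close>

lemma sqrt_one_minus_exists:
  fixes b :: "'a::cstar_algebra_1"
  assumes b: "norm b < 1" and sa: "star b = b"
  shows "\<exists>s. star s = s \<and> s * s = 1 - b \<and> (\<forall>y. b * y = y * b \<longrightarrow> s * y = y * s)"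
proof -
  define u where "u k = ((1/2::real) gchoose k) *\<^sub>R (- b) ^ k" for k
  have sumn: "summable (\<lambda>k. norm (u k))"
  proof (rule summable_comparison_test)
    have "conv_radius (\<lambda>n. (1/2::real) gchoose n) = (if (1/2::real) \<in> \<nat> then \<infinity> else 1)"
      by (rule conv_radius_gchoose)
    moreover have "(1/2::real) \<notin> \<nat>"
    proof
      assume "(1/2::real) \<in> \<nat>"
      then obtain n where "(1/2::real) = of_nat n" by (auto elim: Nats_cases)
      then have "real (2 * n) = real 1" by simp
      then show False by (metis of_nat_eq_iff dvd_triv_left odd_one)
    qed
    ultimately have "ereal (norm (norm b)) < conv_radius (\<lambda>n. (1/2::real) gchoose n)"
      using b by simp
    then have "summable (\<lambda>n. norm (((1/2::real) gchoose n) * norm b ^ n))"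
      by (rule abs_summable_in_conv_radius)
    then show "summable (\<lambda>n. \<bar>(1/2::real) gchoose n\<bar> * norm b ^ n)"
      by (simp add: abs_mult)
    show "\<exists>N. \<forall>n\<ge>N. norm (norm (u n)) \<le> \<bar>(1/2::real) gchoose n\<bar> * norm b ^ n"
      using norm_power_ineq[of "- b"] by (auto simp: u_def intro!: mult_left_mono)
  qed
  then have sum: "summable u" by (rule summable_norm_cancel)
  define s where "s = (\<Sum>k. u k)"
  have us: "u sums s" using sum by (simp add: s_def summable_sums)
  have "(\<lambda>k. star (u k)) sums star s"
    by (rule bounded_linear.sums[OF bounded_linear_star us])
  moreover have "star (u k) = u k" for k by (simp add: u_def star_power sa)
  ultimately have "star s = s" using us by (simp add: sums_unique2)
  moreover have "s * s = 1 - b"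
  proof -
    have "(\<Sum>i\<le>k. u i * u (k - i)) = ((1::real) gchoose k) *\<^sub>R (- b) ^ k" for k
    proof -
      have "(\<Sum>i\<le>k. u i * u (k - i)) =
        (\<Sum>i\<le>k. (((1/2::real) gchoose i) * ((1/2) gchoose (k - i))) *\<^sub>R (- b) ^ k)"
        by (rule sum.cong) (auto simp: u_def power_add[symmetric])
      also have "\<dots> = (\<Sum>i\<le>k. ((1/2::real) gchoose i) * ((1/2) gchoose (k - i))) *\<^sub>R (- b) ^ k"
        by (simp add: scaleR_sum_left)
      also have "(\<Sum>i\<le>k. ((1/2::real) gchoose i) * ((1/2) gchoose (k - i))) = (1/2 + 1/2) gchoose k"
        by (simp only: gbinomial_Vandermonde atMost_atLeast0)
      finally show ?thesis by simp
    qed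
    then have "(\<lambda>k. ((1::real) gchoose k) *\<^sub>R (- b) ^ k) sums (s * s)"
      using Cauchy_product_sums[OF sumn sumn] by (simp add: s_def)
    moreover have "(\<lambda>k. ((1::real) gchoose k) *\<^sub>R (- b) ^ k) sums
      (\<Sum>k\<in>{0,1}. ((1::real) gchoose k) *\<^sub>R (- b) ^ k)"
    proof (rule sums_finite)
      fix n assume "n \<notin> {0::nat, 1}"
      then have "1 < n" by auto
      then have "(1::real) gchoose n = 0"
        using binomial_gbinomial[of 1 n, where 'a = real] by (simp add: binomial_eq_0)
      then show "((1::real) gchoose n) *\<^sub>R (- b) ^ n = 0" by simp
    qed simp
    ultimately have "s * s = (\<Sum>k\<in>{0,1}. ((1::real) gchoose k) *\<^sub>R (- b) ^ k)"
      by (rule sums_unique2)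
    then show ?thesis by simp
  qed
  moreover have "s * y = y * s" if y: "b * y = y * b" for y
  proof -
    have "(- b) ^ k * y = y * (- b) ^ k" for k
      by (rule power_commuting_commutes) (use y in simp)
    then have "u k * y = y * u k" for k by (simp add: u_def)
    then show ?thesis
      using sums_mult2[OF us, of y] sums_mult[OF us, of y] by (simp add: sums_unique2)
  qed
  ultimately show ?thesis by blast
qed

text \<open>The element \<open>x = a + \<i> m\<close> satisfies
  \<open>x * star x = a * a + m * m\<close> by commutation, and \<open>a\<close> is its real part,
  so \<open>norm a \<le> norm x\<close>. This stands in for monotonicity of the norm while
  positivity is not yet available.\<close>

lemma norm_le_norm_add_sq:
  fixes a m :: "'a::cstar_algebra"
  assumes "star a = a" "star m = m" "a * m = m * a"
  shows "(norm a)\<^sup>2 \<le> norm (a * a + m * m)"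
proof -
  define x where "x = a + scaleC \<i> m"
  have sx: "star x = a - scaleC \<i> m"
    using assms by (simp add: x_def star_simps scaleC_minus_left)
  have "x * star x = a * a + m * m"
    unfolding sx using assms(3)
    by (simp add: x_def algebra_simps scaleC_mult_left scaleC_mult_right scaleC_scaleC scaleC_minus_left
        scaleC_add_right)
  then have n: "norm (a * a + m * m) = (norm x)\<^sup>2" by (metis norm_mult_star_self)
  have "2 *\<^sub>R a = x + star x" unfolding sx by (simp add: x_def scaleR_2)
  then have "2 * norm a = norm (x + star x)" by (metis norm_scaleR abs_numeral)
  also have "\<dots> \<le> 2 * norm x" using norm_triangle_ineq[of x "star x"] by simp
  finally show ?thesis unfolding n by (simp add: power_mono)
qed

text \<open>\<open>1 - b * b\<close> is a square \<open>s * s\<close>, and the squares of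
  \<open>s\<close> and \<open>b\<close> add up to 1, so the preceding bound gives
  \<open>(norm s)\<^sup>2 \<le> 1\<close>.\<close>

lemma norm_one_minus_sq_le:
  fixes b :: "'a::cstar_algebra_1"
  assumes "star b = b" "norm b < 1"
  shows "norm (1 - b * b) \<le> 1"
proof -
  have "norm (b * b) \<le> norm b * norm b" by (rule norm_mult_ineq)
  also have "\<dots> \<le> norm b * 1" by (rule mult_left_mono) (use assms in auto)
  finally have nb: "norm (b * b) < 1" using assms by simp
  have "star (b * b) = b * b" using assms(1) by (simp add: star_mult)
  then obtain s where s: "star s = s" "s * s = 1 - b * b" "\<forall>y. b * b * y = y * (b * b) \<longrightarrow> s * y = y * s"
    using sqrt_one_minus_exists[OF nb] by blast
  have "(norm s)\<^sup>2 \<le> norm (s * s + b * b)"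
  proof (rule norm_le_norm_add_sq)
    have "b * b * b = b * (b * b)" by (rule mult.assoc)
    with s(3) show "s * b = b * s" by blast
  qed (fact s(1) assms(1))+
  also have "\<dots> = 1" using s(2) by simp
  finally show ?thesis using norm_star_mult_self[of s] s(1,2) by simp
qed

lemma invertible_one_plus_sq:
  fixes b :: "'a::cstar_algebra_1"
  assumes b: "star b = b"
  shows "invertible_elt (1 + b * b)"
proof -
  \<comment> \<open>Scaling by \<open>M\<close> makes \<open>c\<close> a strict contraction; then
    \<open>1 + b * b\<close> is \<open>1 + M\<^sup>2\<close> times a perturbation of the unit by an
    element of norm below 1.\<close>
  define M where "M = norm b + 1"
  have M: "M > 0" "norm b < M" by (auto simp: M_def add_nonneg_pos)
  define c where "c = inverse M *\<^sub>R b"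
  have c: "star c = c" "norm c < 1" using M b by (auto simp: c_def field_simps)
  have "norm ((M\<^sup>2 / (1 + M\<^sup>2)) *\<^sub>R (1 - c * c)) \<le> M\<^sup>2 / (1 + M\<^sup>2) * 1"
    unfolding norm_scaleR using M
    by (intro mult_mono norm_one_minus_sq_le c) auto
  also have "\<dots> < 1" using M by (simp add: field_simps add_pos_nonneg)
  finally have "invertible_elt (1 - (M\<^sup>2 / (1 + M\<^sup>2)) *\<^sub>R (1 - c * c))"
    by (rule invertible_elt_one_minus)
  then have "invertible_elt ((1 + M\<^sup>2) *\<^sub>R (1 - (M\<^sup>2 / (1 + M\<^sup>2)) *\<^sub>R (1 - c * c)))"
    by (subst invertible_elt_scaleR) (auto simp: add_nonneg_eq_0_iff)
  moreover have "(1 + M\<^sup>2) *\<^sub>R (1 - (M\<^sup>2 / (1 + M\<^sup>2)) *\<^sub>R (1 - c * c)) = 1 + b * b"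
  proof -
    have p: "1 + M\<^sup>2 \<noteq> 0" by (simp add: add_nonneg_eq_0_iff)
    have "(1 + M\<^sup>2) *\<^sub>R (1 - (M\<^sup>2 / (1 + M\<^sup>2)) *\<^sub>R (1 - c * c)) =
       (1 + M\<^sup>2) *\<^sub>R 1 - M\<^sup>2 *\<^sub>R (1 - c * c)"
      using p by (simp add: scaleR_diff_right)
    also have "\<dots> = 1 + M\<^sup>2 *\<^sub>R (c * c)" by (simp add: algebra_simps)
    also have "M\<^sup>2 *\<^sub>R (c * c) = (M * inverse M)\<^sup>2 *\<^sub>R (b * b)"
      by (simp add: c_def power2_eq_square mult_ac)
    also have "\<dots> = b * b" using M by simp
    finally show ?thesis .
  qed
  ultimately show ?thesis by simp
qed

text \<open>
  If \<open>1 - a\<^sup>2\<close> were invertible, then for some \<open>k > 0\<close> and all \<open>t < 1\<close> close to 1 the element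
  \<open>1 - t a\<^sup>2 - k\<close> would be a square \<open>m\<^sup>2\<close>, so that \<open>t \<parallel>a\<parallel>\<^sup>2 \<le> \<parallel>t a\<^sup>2 + m\<^sup>2\<parallel> = 1 - k\<close>.
  This avoids the spectral radius formula.
\<close>

lemma not_invertible_one_minus_sq:
  fixes a :: "'a::cstar_algebra_1"
  assumes sa: "star a = a" and na: "norm a = 1"
  shows "\<not> invertible_elt (1 - a * a)"
proof
  assume "invertible_elt (1 - a * a)"
  then obtain v where v: "(1 - a * a) * v = 1" "v * (1 - a * a) = 1"
    by (auto simp: invertible_elt_def)
  have v0: "v \<noteq> 0" using v by auto
  define K where "K = norm v"
  have K: "K > 0" using v0 by (simp add: K_def)
  have sv: "star v = v"
  proof -
    have "(1 - a * a) * star v = star (v * (1 - a * a))" using sa by (simp add: star_mult)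
    then have "(1 - a * a) * star v = 1" using v by simp
    then have "v * ((1 - a * a) * star v) = v" by simp
    then show ?thesis using v by (simp add: mult.assoc[symmetric])
  qed
  have cv: "a * v = v * a"
  proof -
    have "v * ((1 - a * a) * a) * v = v * (a * (1 - a * a)) * v" by (simp add: algebra_simps)
    then have "(v * (1 - a * a)) * a * v = v * a * ((1 - a * a) * v)" by (simp add: mult.assoc)
    then show ?thesis using v by simp
  qed
  \<comment> \<open>The bound \<open>norm V \<le> 2 * K\<close> below needs
    \<open>(1 - t) * K \<le> 1/2\<close>; with \<open>k * K = 1/4\<close> it makes
    \<open>k *\<^sub>R V\<close> a strict contraction, so that \<open>1 - k *\<^sub>R V\<close> has
    a root. The requirement \<open>1 - t < k\<close> contradicts \<open>t \<le> 1 - k\<close> at the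
    end.\<close>
  define k where "k = 1 / (4 * K)"
  define t where "t = 1 - min (1/2) (min (k / 2) (1 / (2 * K)))"
  have k: "k > 0" "k * K = 1/4" using K by (auto simp: k_def)
  have "1 - t \<le> k / 2" by (simp add: t_def)
  then have t: "0 < t" "t < 1" "1 - t < k"
    using K k(1) by (auto simp: t_def min_def)
  have "1 - t \<le> 1 / (2 * K)" by (simp add: t_def)
  then have tK: "(1 - t) * K \<le> 1/2" using K by (simp add: field_simps)
  define T where "T = 1 - t *\<^sub>R (a * a)"
  have naa: "norm (a * a) \<le> 1" using norm_mult_ineq[of a a] na by simp
  have nT: "norm (t *\<^sub>R (a * a)) < 1"
  proof -
    have "norm (t *\<^sub>R (a * a)) \<le> t * 1"
      unfolding norm_scaleR using t naa by (intro mult_mono) auto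
    with t show ?thesis by linarith
  qed
  obtain V where V: "T * V = 1" "V * T = 1"
    using invertible_elt_one_minus(3)[OF nT] by (auto simp: T_def invertible_elt_def)
  have nV: "norm V \<le> 2 * K"
  proof -
    \<comment> \<open>Resolvent identity: \<open>V\<close> differs from \<open>v\<close> by at most
      half of its own norm, which is absorbed on the left.\<close>
    have "V * (1 - a * a) = 1 - (1 - t) *\<^sub>R (V * (a * a))"
      using V(2) by (simp add: T_def algebra_simps)
    then have "V * (1 - a * a) * v = (1 - (1 - t) *\<^sub>R (V * (a * a))) * v" by (rule arg_cong)
    then have "V * ((1 - a * a) * v) = v - (1 - t) *\<^sub>R (V * (a * a) * v)"
      by (simp only: mult.assoc left_diff_distrib[of 1 _ v] mult_1_left mult_scaleR_left)
    then have "V = v - (1 - t) *\<^sub>R (V * (a * a) * v)" using v by simp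
    then have "norm V \<le> norm v + norm ((1 - t) *\<^sub>R (V * (a * a) * v))"
      by (metis norm_triangle_ineq4)
    also have "norm ((1 - t) *\<^sub>R (V * (a * a) * v)) \<le> (1 - t) * (norm V * 1 * K)"
      unfolding norm_scaleR K_def using t
      by (intro mult_mono order_trans[OF norm_mult_ineq] naa) auto
    also have "(1 - t) * (norm V * 1 * K) = norm V * ((1 - t) * K)" by simp
    also have "\<dots> \<le> norm V * (1 / 2)" by (intro mult_left_mono tK) auto
    finally show ?thesis by (simp add: K_def)
  qed
  have sT: "star T = T" using sa by (simp add: T_def star_mult)
  have sV: "star V = V"
    by (metis V(1) V(2) mult.assoc mult.left_neutral mult.right_neutral sT star_1 star_mult)
  have cV: "V * y = y * V" if y: "a * y = y * a" for y
  proof -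
    have "a * a * y = y * (a * a)" using y by (metis mult.assoc)
    then have "T * y = y * T" by (simp add: T_def left_diff_distrib right_diff_distrib)
    then show ?thesis by (metis V(1) V(2) mult.assoc mult.left_neutral mult.right_neutral)
  qed
  have "norm (k *\<^sub>R V) \<le> k * (2 * K)" using k nV by simp
  then have nkV: "norm (k *\<^sub>R V) < 1" using k by (simp only: mult.left_commute[of k 2])
  obtain q where q: "star q = q" "q * q = 1 - k *\<^sub>R V"
    "\<forall>z. k *\<^sub>R V * z = z * (k *\<^sub>R V) \<longrightarrow> q * z = z * q"
    using sqrt_one_minus_exists[OF nkV] star_scaleR[of k V] unfolding sV by blast
  obtain s where s: "star s = s" "s * s = T"
    "\<forall>z. t *\<^sub>R (a * a) * z = z * (t *\<^sub>R (a * a)) \<longrightarrow> s * z = z * s"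
    using sqrt_one_minus_exists[OF nT] star_scaleR[of t "a * a"] unfolding star_mult sa T_def by blast
  have qa: "q * a = a * q" using q(3) cV[of a] by simp
  have sa': "s * a = a * s" using s(3) by (simp add: mult.assoc)
  have "a * a * q = q * (a * a)" using qa by (metis mult.assoc)
  then have sq: "s * q = q * s" using s(3) by simp
  have "norm (sqrt t *\<^sub>R a) ^ 2 \<le> norm ((sqrt t *\<^sub>R a) * (sqrt t *\<^sub>R a) + (s * q) * (s * q))"
  proof (rule norm_le_norm_add_sq)
    show "star (s * q) = s * q" using s(1) q(1) sq by (simp add: star_mult)
    show "sqrt t *\<^sub>R a * (s * q) = s * q * (sqrt t *\<^sub>R a)"
      using qa sa' by (simp add: mult.assoc) (metis mult.assoc)
  qed (use sa in simp)
  also have "(s * q) * (s * q) = s * s * (q * q)" using sq by (metis mult.assoc)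
  also have "\<dots> = T - k *\<^sub>R 1" using s(2) q(2) V by (simp add: right_diff_distrib)
  also have "(sqrt t *\<^sub>R a) * (sqrt t *\<^sub>R a) + (T - k *\<^sub>R 1) = (1 - k) *\<^sub>R 1"
    using t by (simp add: T_def algebra_simps)
  finally have "t \<le> \<bar>1 - k\<bar>" using na t by simp
  moreover have "k \<le> 1"
  proof -
    have "1 = norm ((1 - a * a) * v)" using v by simp
    also have "\<dots> \<le> (1 + 1) * K" unfolding K_def
      by (intro order_trans[OF norm_mult_ineq] mult_right_mono order_trans[OF norm_triangle_ineq4] add_mono naa) auto
    finally show ?thesis using K by (simp add: k_def)
  qed
  ultimately show False using t by simp
qed

subsection \<open>Polynomials and the spectrum of a self-adjoint element\<close>

definition cpoly_at :: "complex poly \<Rightarrow> 'a::cstar_algebra_1 \<Rightarrow> 'a"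
  where "cpoly_at p x = fold_coeffs (\<lambda>a y. scaleC a 1 + x * y) p 0"

lemma cpoly_at_0 [simp]: "cpoly_at 0 x = 0"
  by (simp add: cpoly_at_def)

lemma cpoly_at_pCons [simp]: "cpoly_at (pCons a p) x = scaleC a 1 + x * cpoly_at p x"
  by (cases "a = 0 \<and> p = 0") (auto simp: cpoly_at_def)

lemma cpoly_at_add [simp]: "cpoly_at (p + q) x = cpoly_at p x + cpoly_at q x"
  by (induction p q rule: poly_induct2) (simp_all add: scaleC_add_left algebra_simps)

lemma cpoly_at_smult [simp]: "cpoly_at (Polynomial.smult a p) x = scaleC a (cpoly_at p x)"
  by (induction p) (simp_all add: scaleC_scaleC scaleC_add_right scaleC_mult_right)

lemma cpoly_at_mult [simp]: "cpoly_at (p * q) x = cpoly_at p x * cpoly_at q x"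
  by (induction p) (simp_all add: scaleC_mult_left algebra_simps)

text \<open>A complex root splits off a linear factor; if that factor is invertible at
  \<open>x\<close>, the cofactor of smaller degree is not, and the induction continues with it. This
  is the inclusion of the spectral mapping theorem that is used below.\<close>

lemma not_invertible_cpoly_at_root:
  assumes "\<not> invertible_elt (cpoly_at p x)" "p \<noteq> 0"
  shows "\<exists>z. poly p z = 0 \<and> \<not> invertible_elt (scaleC z 1 - x)"
  using assms
proof (induction "degree p" arbitrary: p rule: less_induct)
  case less
  show ?case
  proof (cases "degree p = 0")
    case True
    then obtain a where p: "p = [:a:]" "a \<noteq> 0"
      using less.prems degree_eq_zeroE by (metis pCons_0_0)
    have "scaleC a 1 * scaleC (inverse a) 1 = (1::'a)" "scaleC (inverse a) 1 * scaleC a 1 = (1::'a)"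
      using p(2) by (simp_all add: scaleC_1_mult scaleC_scaleC)
    then have "invertible_elt (cpoly_at p x)" using p(1) by (auto simp: invertible_elt_def)
    with less.prems show ?thesis by simp
  next
    case False
    then have "\<not> constant (poly p)" by (simp add: constant_degree)
    then obtain z where z: "poly p z = 0" using fundamental_theorem_of_algebra by blast
    then obtain q where q: "p = [:- z, 1:] * q" by (auto simp: poly_eq_0_iff_dvd dvd_def)
    have q0: "q \<noteq> 0" using q less.prems by auto
    have "degree p = degree [:- z, 1:] + degree q"
      unfolding q by (rule degree_mult_eq) (use q0 in auto)
    then have dq: "degree q < degree p" by simp
    show ?thesis
    proof (cases "invertible_elt (scaleC z 1 - x)")
      case True
      then have "invertible_elt (cpoly_at [:- z, 1:] x)"
        using invertible_elt_minus[of "scaleC z 1 - x"] by (simp add: scaleC_minus_left)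
      then have "\<not> invertible_elt (cpoly_at q x)"
        using less.prems(1) invertible_elt_mult unfolding q cpoly_at_mult by blast
      then show ?thesis using less.hyps[OF dq] q0 unfolding q by auto
    qed (use z in auto)
  qed
qed

definition rpoly_at :: "real poly \<Rightarrow> 'a::real_algebra_1 \<Rightarrow> 'a"
  where "rpoly_at p x = fold_coeffs (\<lambda>a y. of_real a + x * y) p 0"

lemma rpoly_at_0 [simp]: "rpoly_at 0 x = 0"
  by (simp add: rpoly_at_def)

lemma rpoly_at_pCons [simp]: "rpoly_at (pCons a p) x = of_real a + x * rpoly_at p x"
  by (cases "a = 0 \<and> p = 0") (auto simp: rpoly_at_def)

lemma rpoly_at_1 [simp]: "rpoly_at 1 x = 1"
  by (simp add: one_pCons)

lemma rpoly_at_add [simp]: "rpoly_at (p + q) x = rpoly_at p x + rpoly_at q x"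
  by (induction p q rule: poly_induct2) (simp_all add: algebra_simps)

lemma rpoly_at_smult [simp]: "rpoly_at (Polynomial.smult a p) x = a *\<^sub>R rpoly_at p x"
  by (induction p) (simp_all add: scaleR_add_right of_real_def)

lemma rpoly_at_mult [simp]: "rpoly_at (p * q) x = rpoly_at p x * rpoly_at q x"
  by (induction p) (simp_all add: algebra_simps of_real_def)

lemma rpoly_at_minus [simp]: "rpoly_at (- p) x = - rpoly_at p x"
  by (induction p) simp_all

lemma rpoly_at_diff [simp]: "rpoly_at (p - q) x = rpoly_at p x - rpoly_at q x"
  using rpoly_at_add[of p "- q" x] by simp

lemma rpoly_at_commute:
  assumes "x * y = y * x" shows "rpoly_at p x * y = y * rpoly_at p x"
proof (induction p)
  case (pCons a p)
  have "x * rpoly_at p x * y = y * (x * rpoly_at p x)"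
    using pCons.IH assms by (metis mult.assoc)
  then show ?case by (simp add: algebra_simps of_real_def)
qed simp

lemma star_rpoly_at:
  assumes "star x = x" shows "star (rpoly_at p x) = rpoly_at p (x :: 'a::cstar_algebra_1)"
  by (induction p) (simp_all add: star_simps assms rpoly_at_commute)

lemma rpoly_at_conv_cpoly_at: "rpoly_at p x = cpoly_at (map_poly complex_of_real p) x"
  by (induction p) (simp_all add: map_poly_pCons scaleC_of_real_1)

definition real_spectrum :: "'a::cstar_algebra_1 \<Rightarrow> real set"
  where "real_spectrum x = {t. \<not> invertible_elt (of_real t - x)}"

text \<open>After normalization the claim concerns \<open>\<i> - b\<close>, whose product with
  \<open>- \<i> - b\<close> in either order is the invertible element
  \<open>1 + b * b\<close>.\<close>

lemma invertible_nonreal_minus_self_adjoint: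
  fixes x :: "'a::cstar_algebra_1"
  assumes x: "star x = x" and z: "Im z \<noteq> 0"
  shows "invertible_elt (scaleC z 1 - x)"
proof -
  define b where "b = inverse (Im z) *\<^sub>R (x - of_real (Re z))"
  have "star b = b" using x by (simp add: b_def)
  then have 1: "invertible_elt (1 + b * b)" by (rule invertible_one_plus_sq)
  have xb: "x = of_real (Re z) + Im z *\<^sub>R b" using z by (simp add: b_def)
  have zz: "scaleC z (1::'a) = of_real (Re z) + Im z *\<^sub>R scaleC \<i> 1"
  proof -
    have "scaleC z (1::'a) = scaleC (of_real (Re z) + of_real (Im z) * \<i>) 1"
      by (metis complex_eq mult.commute)
    also have "\<dots> = of_real (Re z) + Im z *\<^sub>R scaleC \<i> 1"
      unfolding scaleC_add_left scaleC_scaleC[symmetric] scaleC_of_real by (simp add: of_real_def)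
    finally show ?thesis .
  qed
  have "(scaleC \<i> 1 - b) * (- scaleC \<i> 1 - b) = 1 + b * b"
    by (simp add: algebra_simps scaleC_mult_left scaleC_mult_right scaleC_scaleC scaleC_minus_left
        scaleC_diff_right scaleC_minus_right)
  moreover have "(- scaleC \<i> 1 - b) * (scaleC \<i> 1 - b) = 1 + b * b"
    by (simp add: algebra_simps scaleC_mult_left scaleC_mult_right scaleC_scaleC scaleC_minus_left
        scaleC_diff_right scaleC_minus_right)
  ultimately have "invertible_elt (scaleC \<i> 1 - b)"
    using 1 invertible_elt_commuting_factor by metis
  then have "invertible_elt (Im z *\<^sub>R (scaleC \<i> 1 - b))" using z by (simp add: invertible_elt_scaleR)
  moreover have "Im z *\<^sub>R (scaleC \<i> 1 - b) = scaleC z 1 - x"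
    unfolding zz by (subst xb) (simp add: scaleR_diff_right)
  ultimately show ?thesis by simp
qed

text \<open>For \<open>b = a / norm a\<close> the factors of
  \<open>1 - b * b = (1 - b) * (1 + b)\<close> cannot both be invertible; the factor that fails
  decides the sign of \<open>t\<close>.\<close>

lemma real_spectrum_norm:
  fixes a :: "'a::cstar_algebra_1"
  assumes a: "star a = a"
  shows "\<exists>t\<in>real_spectrum a. \<bar>t\<bar> = norm a"
proof (cases "a = 0")
  case True
  then have "0 \<in> real_spectrum a" by (simp add: real_spectrum_def invertible_elt_def)
  then show ?thesis using True by force
next
  case False
  define b where "b = inverse (norm a) *\<^sub>R a"
  have b: "star b = b" "norm b = 1" using a False by (simp_all add: b_def)
  have ab: "a = norm a *\<^sub>R b" using False by (simp add: b_def)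
  have "\<not> invertible_elt ((1 - b) * (1 + b))"
    using not_invertible_one_minus_sq[OF b] by (simp add: algebra_simps)
  then have "\<not> invertible_elt (1 - b) \<or> \<not> invertible_elt (1 + b)"
    using invertible_elt_mult by blast
  then have "\<not> invertible_elt (norm a *\<^sub>R (1 - b)) \<or> \<not> invertible_elt ((- norm a) *\<^sub>R (1 + b))"
    using False by (subst (1 2) invertible_elt_scaleR) auto
  moreover have "norm a *\<^sub>R (1 - b) = of_real (norm a) - a"
    using ab by (simp add: scaleR_diff_right of_real_def)
  moreover have "(- norm a) *\<^sub>R (1 + b) = of_real (- norm a) - a"
    using ab by (simp add: scaleR_add_right of_real_def)
  ultimately have "norm a \<in> real_spectrum a \<or> - norm a \<in> real_spectrum a"
    by (simp add: real_spectrum_def)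
  then show ?thesis by force
qed

lemma real_spectrum_le_norm:
  fixes a :: "'a::cstar_algebra_1"
  assumes "t \<in> real_spectrum a" shows "\<bar>t\<bar> \<le> norm a"
proof (rule ccontr)
  assume "\<not> \<bar>t\<bar> \<le> norm a"
  then have t: "norm a < \<bar>t\<bar>" "t \<noteq> 0" using norm_ge_zero[of a] by linarith+
  then have "norm (inverse t *\<^sub>R a) < 1" by (simp add: field_simps)
  then have "invertible_elt (t *\<^sub>R (1 - inverse t *\<^sub>R a))"
    using invertible_elt_one_minus t invertible_elt_scaleR by blast
  moreover have "t *\<^sub>R (1 - inverse t *\<^sub>R a) = of_real t - a"
    using t by (simp add: scaleR_diff_right of_real_def)
  ultimately show False using assms by (simp add: real_spectrum_def)
qed

lemma real_spectrum_rpoly_at: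
  fixes c :: "'a::cstar_algebra_1"
  assumes c: "star c = c" and t: "t \<in> real_spectrum (rpoly_at p c)"
  shows "\<exists>s\<in>real_spectrum c. poly p s = t"
proof -
  define q where "q = map_poly complex_of_real ([:t:] - p)"
  have q: "cpoly_at q c = of_real t - rpoly_at p c"
    unfolding q_def rpoly_at_conv_cpoly_at[symmetric] by simp
  have pq: "poly q (of_real s) = of_real (t - poly p s)" for s
  proof -
    have "poly (map_poly complex_of_real r) (of_real s) = of_real (poly r s)" for r
      by (induction r) (simp_all add: map_poly_pCons)
    then show ?thesis unfolding q_def by simp
  qed
  have ni: "\<not> invertible_elt (cpoly_at q c)" using t q by (simp add: real_spectrum_def)
  show ?thesis
  proof (cases "q = 0")
    \<comment> \<open>\<open>p\<close> is then the constant \<open>t\<close>, and it only remains to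
      know that the spectrum is nonempty.\<close>
    case True
    then have "poly p s = t" for s using pq[of s] by (simp del: of_real_diff)
    then show ?thesis using real_spectrum_norm[OF c] by blast
  next
    case False
    then obtain z where z: "poly q z = 0" "\<not> invertible_elt (scaleC z 1 - c)"
      using not_invertible_cpoly_at_root ni by blast
    then have "Im z = 0" using invertible_nonreal_minus_self_adjoint[OF c] by blast
    then have zr: "z = of_real (Re z)" by (simp add: complex_eq_iff)
    then have "Re z \<in> real_spectrum c"
      using z(2) scaleC_of_real_1[of "Re z"] by (metis mem_Collect_eq real_spectrum_def)
    moreover have "poly p (Re z) = t" using z(1) pq[of "Re z"] zr by (metis eq_iff_diff_eq_0 of_real_eq_0_iff)
    ultimately show ?thesis by blast
  qed
qed

text \<open>The norm of the self-adjoint \<open>rpoly_at p c\<close> is attained on its spectrum,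
  hence by \<open>poly p\<close> on the spectrum of \<open>c\<close>. The functional calculus rests
  on this estimate.\<close>

lemma norm_rpoly_at_le:
  fixes c :: "'a::cstar_algebra_1"
  assumes "star c = c" "\<And>t. t \<in> real_spectrum c \<Longrightarrow> \<bar>poly p t\<bar> \<le> M"
  shows "norm (rpoly_at p c) \<le> M"
  using real_spectrum_norm[OF star_rpoly_at[OF assms(1), of p]] real_spectrum_rpoly_at[OF assms(1)] assms(2)
  by metis

subsection \<open>Continuous functional calculus\<close>

lemma poly_approx_seq:
  fixes f :: "real \<Rightarrow> real"
  assumes "continuous_on UNIV f"
  shows "\<exists>p. uniform_limit {- M..M} (\<lambda>n t. poly (p n) t) f sequentially"
proof -
  have "\<exists>p. \<forall>t\<in>{-M..M}. \<bar>f t - poly p t\<bar> < inverse (real (Suc n))" for n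
  proof -
    obtain g where g: "real_polynomial_function g" "\<And>t. t \<in> {-M..M} \<Longrightarrow> \<bar>f t - g t\<bar> < inverse (real (Suc n))"
    proof (rule Stone_Weierstrass_real_polynomial_function)
      show "continuous_on {-M..M} f" using assms continuous_on_subset by blast
    qed auto
    obtain a m where "g = (\<lambda>x. \<Sum>i\<le>m. a i * x ^ i)"
      using g(1) real_polynomial_function_iff_sum by blast
    then have "g t = poly (\<Sum>i\<le>m. monom (a i) i) t" for t
      by (simp add: poly_sum poly_monom)
    with g(2) show ?thesis by metis
  qed
  then obtain p where p: "\<And>n t. t \<in> {-M..M} \<Longrightarrow> \<bar>f t - poly (p n) t\<bar> < inverse (real (Suc n))"
    by metis
  have "uniform_limit {-M..M} (\<lambda>n t. poly (p n) t) f sequentially"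
  proof (rule uniform_limitI)
    fix e :: real assume "e > 0"
    then obtain N where N: "inverse (real (Suc N)) < e" using reals_Archimedean by blast
    have "dist (poly (p n) t) (f t) < e" if "n \<ge> N" "t \<in> {-M..M}" for n t
    proof -
      have "dist (poly (p n) t) (f t) < inverse (real (Suc n))"
        using p[OF that(2), of n] by (simp add: dist_real_def abs_minus_commute)
      also have "\<dots> \<le> inverse (real (Suc N))" using that by simp
      finally show ?thesis using N by simp
    qed
    then show "\<forall>\<^sub>F n in sequentially. \<forall>t\<in>{-M..M}. dist (poly (p n) t) (f t) < e"
      unfolding eventually_sequentially by blast
  qed
  then show ?thesis by blast
qed

lemma rpoly_at_Cauchy:
  fixes c :: "'a::cstar_algebra_1"
  assumes c: "star c = c"
    and u: "uniform_limit (real_spectrum c) (\<lambda>n t. poly (p n) t) f sequentially"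
  shows "convergent (\<lambda>n. rpoly_at (p n) c)"
proof (rule Cauchy_convergent, rule metric_CauchyI)
  fix e :: real assume e: "e > 0"
  then have "\<forall>\<^sub>F n in sequentially. \<forall>t\<in>real_spectrum c. dist (poly (p n) t) (f t) < e / 4"
    using uniform_limitD[OF u, of "e / 4"] by simp
  then obtain N where N: "\<And>n t. n \<ge> N \<Longrightarrow> t \<in> real_spectrum c \<Longrightarrow> dist (poly (p n) t) (f t) < e / 4"
    unfolding eventually_sequentially by blast
  have "dist (rpoly_at (p m) c) (rpoly_at (p n) c) < e" if "m \<ge> N" "n \<ge> N" for m n
  proof -
    have "norm (rpoly_at (p m - p n) c) \<le> e / 2"
    proof (rule norm_rpoly_at_le[OF c])
      fix t assume t: "t \<in> real_spectrum c"
      show "\<bar>poly (p m - p n) t\<bar> \<le> e / 2"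
        using N[OF that(1) t] N[OF that(2) t] unfolding dist_real_def poly_diff by linarith
    qed
    then show ?thesis using e by (simp add: dist_norm)
  qed
  then show "\<exists>N. \<forall>m\<ge>N. \<forall>n\<ge>N. dist (rpoly_at (p m) c) (rpoly_at (p n) c) < e" by blast
qed

lemma rpoly_at_limit_unique:
  fixes c :: "'a::cstar_algebra_1"
  assumes c: "star c = c"
    and u: "uniform_limit (real_spectrum c) (\<lambda>n t. poly (p n) t) f sequentially"
    and v: "uniform_limit (real_spectrum c) (\<lambda>n t. poly (q n) t) f sequentially"
    and d: "(\<lambda>n. rpoly_at (p n) c) \<longlonglongrightarrow> d"
  shows "(\<lambda>n. rpoly_at (q n) c) \<longlonglongrightarrow> d"
proof -
  have "(\<lambda>n. rpoly_at (q n - p n) c) \<longlonglongrightarrow> 0"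
  proof (rule LIMSEQ_I)
    fix e :: real assume e: "e > 0"
    have "\<forall>\<^sub>F n in sequentially. \<forall>t\<in>real_spectrum c. dist (poly (p n) t) (f t) < e / 4"
      "\<forall>\<^sub>F n in sequentially. \<forall>t\<in>real_spectrum c. dist (poly (q n) t) (f t) < e / 4"
      using e uniform_limitD[OF u, of "e / 4"] uniform_limitD[OF v, of "e / 4"] by simp_all
    then have "\<forall>\<^sub>F n in sequentially. norm (rpoly_at (q n - p n) c - 0) < e"
    proof eventually_elim
      case (elim n)
      have "norm (rpoly_at (q n - p n) c) \<le> e / 2"
      proof (rule norm_rpoly_at_le[OF c])
        fix t assume t: "t \<in> real_spectrum c"
        show "\<bar>poly (q n - p n) t\<bar> \<le> e / 2"
          using bspec[OF elim(1) t] bspec[OF elim(2) t] unfolding dist_real_def poly_diff by linarith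
      qed
      then show ?case using e by simp
    qed
    then show "\<exists>N. \<forall>n\<ge>N. norm (rpoly_at (q n - p n) c - 0) < e"
      by (simp add: eventually_sequentially)
  qed
  from tendsto_add[OF this d] show ?thesis by simp
qed

definition cfc :: "(real \<Rightarrow> real) \<Rightarrow> 'a::cstar_algebra_1 \<Rightarrow> 'a"
  where "cfc f c = (THE d. \<exists>p. uniform_limit (real_spectrum c) (\<lambda>n t. poly (p n) t) f sequentially
    \<and> (\<lambda>n. rpoly_at (p n) c) \<longlonglongrightarrow> d)"

lemma cfc_eqI:
  assumes "star c = c" "uniform_limit (real_spectrum c) (\<lambda>n t. poly (p n) t) f sequentially"
    "(\<lambda>n. rpoly_at (p n) c) \<longlonglongrightarrow> d"
  shows "cfc f c = d"
  unfolding cfc_def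
proof (rule the_equality)
  fix d' assume "\<exists>p. uniform_limit (real_spectrum c) (\<lambda>n t. poly (p n) t) f sequentially
    \<and> (\<lambda>n. rpoly_at (p n) c) \<longlonglongrightarrow> d'"
  then obtain q where "uniform_limit (real_spectrum c) (\<lambda>n t. poly (q n) t) f sequentially"
    "(\<lambda>n. rpoly_at (q n) c) \<longlonglongrightarrow> d'" by blast
  then show "d' = d"
    using rpoly_at_limit_unique[OF assms(1,2)] assms(3) LIMSEQ_unique by blast
qed (use assms in blast)

lemma cfc_limit:
  assumes c: "star c = c" and u: "uniform_limit (real_spectrum c) (\<lambda>n t. poly (p n) t) f sequentially"
  shows "(\<lambda>n. rpoly_at (p n) c) \<longlonglongrightarrow> cfc f c"
  using rpoly_at_Cauchy[OF c u] cfc_eqI[OF c u] by (metis convergent_def)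

text \<open>Convergence on an interval is kept besides convergence on the spectrum because 0 need
  not lie in the spectrum of \<open>c\<close> and because composition evaluates the polynomials at
  values of another function.\<close>

lemma cfc_approx:
  fixes c :: "'a::cstar_algebra_1"
  assumes c: "star c = c" and f: "continuous_on UNIV f" and M: "norm c \<le> M"
  obtains p where "uniform_limit {-M..M} (\<lambda>n t. poly (p n) t) f sequentially"
    "uniform_limit (real_spectrum c) (\<lambda>n t. poly (p n) t) f sequentially"
    "(\<lambda>n. rpoly_at (p n) c) \<longlonglongrightarrow> cfc f c"
proof -
  obtain p where p: "uniform_limit {-M..M} (\<lambda>n t. poly (p n) t) f sequentially"
    using poly_approx_seq[OF f] by blast
  moreover have "real_spectrum c \<subseteq> {-M..M}"
    using real_spectrum_le_norm[of _ c] M by fastforce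
  ultimately have "uniform_limit (real_spectrum c) (\<lambda>n t. poly (p n) t) f sequentially"
    using uniform_limit_on_subset by blast
  with p show ?thesis using that cfc_limit[OF c] by blast
qed

lemma star_cfc [simp]:
  assumes c: "star c = c" and f: "continuous_on UNIV f" shows "star (cfc f c) = cfc f c"
proof -
  obtain p where p: "(\<lambda>n. rpoly_at (p n) c) \<longlonglongrightarrow> cfc f c"
    using cfc_approx[OF c f order_refl] by blast
  from tendsto_star[OF this] have "(\<lambda>n. rpoly_at (p n) c) \<longlonglongrightarrow> star (cfc f c)"
    by (simp add: star_rpoly_at c)
  with p show ?thesis using LIMSEQ_unique by blast
qed

lemma cfc_cong:
  assumes "\<And>t. t \<in> real_spectrum c \<Longrightarrow> f t = g t" shows "cfc f c = cfc g c"
proof -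
  have "uniform_limit (real_spectrum c) p f sequentially = uniform_limit (real_spectrum c) p g sequentially" for p
    by (rule uniform_limit_cong') (use assms in auto)
  then show ?thesis unfolding cfc_def by presburger
qed

lemma cfc_poly: "star c = c \<Longrightarrow> cfc (poly p) c = rpoly_at p c"
  by (rule cfc_eqI[where p = "\<lambda>_. p"]) (auto intro: uniform_limit_const)

lemma cfc_const: "star c = c \<Longrightarrow> cfc (\<lambda>_. r) c = of_real r"
  using cfc_poly[of c "[:r:]"] cfc_cong[of c "\<lambda>_. r" "poly [:r:]"] by simp

lemma cfc_ident: "star c = c \<Longrightarrow> cfc (\<lambda>t. t) c = c"
  using cfc_poly[of c "[:0, 1:]"] cfc_cong[of c "\<lambda>t. t" "poly [:0, 1:]"] by simp

lemma cfc_add: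
  assumes c: "star c = c" and f: "continuous_on UNIV f" and g: "continuous_on UNIV g"
  shows "cfc (\<lambda>t. f t + g t) c = cfc f c + cfc g c"
proof -
  obtain p where p: "uniform_limit (real_spectrum c) (\<lambda>n t. poly (p n) t) f sequentially"
    "(\<lambda>n. rpoly_at (p n) c) \<longlonglongrightarrow> cfc f c" using cfc_approx[OF c f order_refl] by blast
  obtain q where q: "uniform_limit (real_spectrum c) (\<lambda>n t. poly (q n) t) g sequentially"
    "(\<lambda>n. rpoly_at (q n) c) \<longlonglongrightarrow> cfc g c" using cfc_approx[OF c g order_refl] by blast
  show ?thesis
    by (rule cfc_eqI[where p = "\<lambda>n. p n + q n"])
      (use uniform_limit_add[OF p(1) q(1)] tendsto_add[OF p(2) q(2)] c in simp_all)
qed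

lemma cfc_scaleR:
  assumes c: "star c = c" and f: "continuous_on UNIV f"
  shows "cfc (\<lambda>t. r * f t) c = r *\<^sub>R cfc f c"
proof -
  obtain p where p: "uniform_limit (real_spectrum c) (\<lambda>n t. poly (p n) t) f sequentially"
    "(\<lambda>n. rpoly_at (p n) c) \<longlonglongrightarrow> cfc f c" using cfc_approx[OF c f order_refl] by blast
  have "uniform_limit (real_spectrum c) (\<lambda>n t. r * poly (p n) t) (\<lambda>t. r * f t) sequentially"
    using bounded_linear.uniform_limit[OF bounded_linear_mult_right p(1)] .
  then show ?thesis
    by (intro cfc_eqI[where p = "\<lambda>n. Polynomial.smult r (p n)"])
      (use tendsto_scaleR[OF tendsto_const p(2)] c in simp_all)
qed

lemma cfc_minus:
  assumes c: "star c = c" and f: "continuous_on UNIV f"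
  shows "cfc (\<lambda>t. - f t) c = - cfc f c"
  using cfc_scaleR[OF assms, of "-1"] by simp

lemma cfc_diff:
  assumes c: "star c = c" and f: "continuous_on UNIV f" and g: "continuous_on UNIV g"
  shows "cfc (\<lambda>t. f t - g t) c = cfc f c - cfc g c"
  using cfc_add[OF c f, of "\<lambda>t. - g t"] cfc_minus[OF c g] continuous_on_minus[OF g] by simp

lemma cfc_norm_le:
  assumes c: "star c = c" and f: "continuous_on UNIV f"
    and M: "\<And>t. t \<in> real_spectrum c \<Longrightarrow> \<bar>f t\<bar> \<le> M"
  shows "norm (cfc f c) \<le> M"
proof (rule field_le_epsilon)
  fix e :: real assume e: "e > 0"
  obtain p where p: "uniform_limit (real_spectrum c) (\<lambda>n t. poly (p n) t) f sequentially"
    "(\<lambda>n. rpoly_at (p n) c) \<longlonglongrightarrow> cfc f c" using cfc_approx[OF c f order_refl] by blast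
  have "\<forall>\<^sub>F n in sequentially. norm (rpoly_at (p n) c) \<le> M + e"
    using uniform_limitD[OF p(1) e]
  proof eventually_elim
    case (elim n)
    show ?case
    proof (rule norm_rpoly_at_le[OF c])
      fix t assume "t \<in> real_spectrum c"
      then show "\<bar>poly (p n) t\<bar> \<le> M + e"
        using elim M[of t] by (force simp: dist_real_def)
    qed
  qed
  then show "norm (cfc f c) \<le> M + e"
    by (rule tendsto_upperbound[OF tendsto_norm[OF p(2)]]) simp
qed

lemma bounded_image_real_spectrum:
  assumes "continuous_on UNIV f" shows "bounded (f ` real_spectrum c)"
proof -
  have "compact (f ` {- norm c..norm c})"
    by (rule compact_continuous_image[OF continuous_on_subset[OF assms]]) auto
  moreover have "real_spectrum c \<subseteq> {- norm c..norm c}"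
    using real_spectrum_le_norm[of _ c] by fastforce
  ultimately show ?thesis by (meson bounded_subset compact_imp_bounded image_mono)
qed

lemma cfc_mult:
  assumes c: "star c = c" and f: "continuous_on UNIV f" and g: "continuous_on UNIV g"
  shows "cfc (\<lambda>t. f t * g t) c = cfc f c * cfc g c"
proof -
  obtain p where p: "uniform_limit (real_spectrum c) (\<lambda>n t. poly (p n) t) f sequentially"
    "(\<lambda>n. rpoly_at (p n) c) \<longlonglongrightarrow> cfc f c" using cfc_approx[OF c f order_refl] by blast
  obtain q where q: "uniform_limit (real_spectrum c) (\<lambda>n t. poly (q n) t) g sequentially"
    "(\<lambda>n. rpoly_at (q n) c) \<longlonglongrightarrow> cfc g c" using cfc_approx[OF c g order_refl] by blast
  have "uniform_limit (real_spectrum c) (\<lambda>n t. poly (p n) t * poly (q n) t) (\<lambda>t. f t * g t) sequentially"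
    by (rule uniform_lim_mult[OF p(1) q(1)]) (intro bounded_image_real_spectrum f g)+
  then show ?thesis
    by (intro cfc_eqI[where p = "\<lambda>n. p n * q n"])
      (use tendsto_mult[OF p(2) q(2)] c in simp_all)
qed

lemma cfc_commute:
  assumes c: "star c = c" and f: "continuous_on UNIV f" and y: "c * y = y * c"
  shows "cfc f c * y = y * cfc f c"
proof -
  obtain p where p: "(\<lambda>n. rpoly_at (p n) c) \<longlonglongrightarrow> cfc f c" using cfc_approx[OF c f order_refl] by blast
  have "(\<lambda>n. rpoly_at (p n) c * y) \<longlonglongrightarrow> cfc f c * y" "(\<lambda>n. y * rpoly_at (p n) c) \<longlonglongrightarrow> y * cfc f c"
    by (intro tendsto_intros p)+
  then show ?thesis using LIMSEQ_unique by (simp add: rpoly_at_commute[OF y])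
qed

lemma cfc_compose:
  assumes c: "star c = c" and f: "continuous_on UNIV f" and g: "continuous_on UNIV g"
  shows "cfc f (cfc g c) = cfc (\<lambda>t. f (g t)) c"
proof -
  obtain M where M: "\<And>t. t \<in> real_spectrum c \<Longrightarrow> \<bar>g t\<bar> \<le> M"
    using bounded_image_real_spectrum[OF g, of c] by (auto simp: bounded_real)
  have n: "norm (cfc g c) \<le> M" by (rule cfc_norm_le[OF c g M])
  obtain p where p: "uniform_limit {-M..M} (\<lambda>n t. poly (p n) t) f sequentially"
    "(\<lambda>n. rpoly_at (p n) (cfc g c)) \<longlonglongrightarrow> cfc f (cfc g c)"
    using cfc_approx[OF star_cfc[OF c g] f n] by blast
  have cont: "continuous_on UNIV (\<lambda>t. poly q (g t))" for q :: "real poly"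
    by (intro continuous_intros g)
  \<comment> \<open>Multiplicativity reduces composition with a polynomial to induction; uniform
    convergence on \<open>{-M..M}\<close>, which contains the values of \<open>g\<close> on the
    spectrum, does the rest.\<close>
  have pg: "rpoly_at q (cfc g c) = cfc (\<lambda>t. poly q (g t)) c" for q
  proof (induction q)
    case 0 show ?case using cfc_const[OF c, of 0] by simp
  next
    case (pCons a q)
    have "cfc (\<lambda>t. a + g t * poly q (g t)) c = cfc (\<lambda>_. a) c + cfc (\<lambda>t. g t * poly q (g t)) c"
      by (rule cfc_add[OF c]) (intro continuous_intros g)+
    also have "\<dots> = of_real a + cfc g c * cfc (\<lambda>t. poly q (g t)) c"
      by (simp add: cfc_const[OF c] cfc_mult[OF c g cont])
    finally show ?case using pCons.IH by simp
  qed
  have "(\<lambda>n. cfc (\<lambda>t. poly (p n) (g t)) c) \<longlonglongrightarrow> cfc (\<lambda>t. f (g t)) c"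
  proof (rule LIMSEQ_I)
    fix e :: real assume e: "e > 0"
    have "\<forall>\<^sub>F n in sequentially. norm (cfc (\<lambda>t. poly (p n) (g t)) c - cfc (\<lambda>t. f (g t)) c) < e"
      using uniform_limitD[OF p(1) half_gt_zero[OF e]]
    proof eventually_elim
      case (elim n)
      have fg: "continuous_on UNIV (\<lambda>t. f (g t))"
        using continuous_on_compose2[OF f g] by simp
      have "norm (cfc (\<lambda>t. poly (p n) (g t) - f (g t)) c) \<le> e / 2"
      proof (rule cfc_norm_le[OF c])
        fix t assume "t \<in> real_spectrum c"
        then have "g t \<in> {-M..M}" using M[of t] by auto
        then show "\<bar>poly (p n) (g t) - f (g t)\<bar> \<le> e / 2" using elim by (force simp: dist_real_def)
      qed (intro continuous_intros cont fg)
      then show ?case using e cfc_diff[OF c cont fg] by simp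
    qed
    then show "\<exists>N. \<forall>n\<ge>N. norm (cfc (\<lambda>t. poly (p n) (g t)) c - cfc (\<lambda>t. f (g t)) c) < e"
      by (simp add: eventually_sequentially)
  qed
  with p(2) show ?thesis unfolding pg using LIMSEQ_unique by blast
qed

lemma real_spectrum_cfc:
  assumes c: "star c = c" and f: "continuous_on UNIV f" and f0: "\<And>t. t \<in> real_spectrum c \<Longrightarrow> 0 \<le> f t"
  shows "t \<in> real_spectrum (cfc f c) \<Longrightarrow> 0 \<le> t"
proof (rule ccontr)
  assume t: "t \<in> real_spectrum (cfc f c)" "\<not> 0 \<le> t"
  \<comment> \<open>The maximum keeps the denominator negative on the whole line; on the spectrum of
    \<open>c\<close> it equals \<open>f s\<close>, so \<open>cfc g c\<close> inverts
    \<open>t - f(c)\<close>.\<close>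
  define g where "g s = 1 / (t - max (f s) 0)" for s
  have g: "continuous_on UNIV g" unfolding g_def
    by (intro continuous_intros f) (use t in auto)
  have tf: "continuous_on UNIV (\<lambda>s. t - f s)" by (intro continuous_intros f)
  have "cfc (\<lambda>s. (t - f s) * g s) c = cfc (\<lambda>_. 1) c"
  proof (rule cfc_cong)
    fix s assume "s \<in> real_spectrum c"
    then show "(t - f s) * g s = 1" using f0[of s] t by (simp add: g_def max_def)
  qed
  then have "cfc (\<lambda>s. t - f s) c * cfc g c = 1" by (simp add: cfc_mult[OF c tf g] cfc_const[OF c])
  moreover have "cfc (\<lambda>s. t - f s) c = of_real t - cfc f c"
    by (subst cfc_diff[OF c _ f]) (auto simp: cfc_const[OF c])
  moreover have "cfc g c * cfc (\<lambda>s. t - f s) c = cfc (\<lambda>s. t - f s) c * cfc g c"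
    unfolding cfc_mult[OF c g tf, symmetric] cfc_mult[OF c tf g, symmetric] by (simp add: mult.commute)
  ultimately have "invertible_elt (of_real t - cfc f c)" by (metis invertible_elt_def)
  with t show False by (simp add: real_spectrum_def)
qed

subsection \<open>Positive elements\<close>

definition cpos :: "'a::cstar_algebra_1 \<Rightarrow> bool"
  where "cpos a \<longleftrightarrow> star a = a \<and> real_spectrum a \<subseteq> {0..}"

lemma cpos_star: "cpos a \<Longrightarrow> star a = a"
  by (simp add: cpos_def)

lemma cpos_cfc:
  assumes "star c = c" "continuous_on UNIV f" "\<And>t. t \<in> real_spectrum c \<Longrightarrow> 0 \<le> f t"
  shows "cpos (cfc f c)"
  using real_spectrum_cfc[OF assms] by (auto simp: cpos_def assms)

lemma cpos_square:
  fixes s :: "'a::cstar_algebra_1"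
  assumes s: "star s = s" shows "cpos (s * s)"
proof -
  have "cpos (cfc (\<lambda>t. t * t) s)"
    by (rule cpos_cfc) (auto intro!: continuous_intros s)
  then show ?thesis using cfc_mult[of s "\<lambda>t. t" "\<lambda>t. t"] s by (simp add: cfc_ident)
qed

lemma sqrt_cfc:
  fixes a :: "'a::cstar_algebra_1"
  assumes "cpos a" shows "cfc sqrt a * cfc sqrt a = a"
proof -
  have sa: "star a = a" using assms by (simp add: cpos_def)
  have c: "continuous_on UNIV sqrt" by (intro continuous_intros)
  have "cfc sqrt a * cfc sqrt a = cfc (\<lambda>t. sqrt t * sqrt t) a"
    by (rule cfc_mult[OF sa c c, symmetric])
  also have "\<dots> = cfc (\<lambda>t. t) a" by (rule cfc_cong) (use assms in \<open>auto simp: cpos_def\<close>)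
  finally show ?thesis using sa by (simp add: cfc_ident)
qed

lemma cpos_iff_square: "cpos a \<longleftrightarrow> (\<exists>s. star s = s \<and> a = s * s)"
proof
  assume a: "cpos a"
  have "star (cfc sqrt a) = cfc sqrt a"
    using a by (intro star_cfc) (auto simp: cpos_def intro: continuous_intros)
  with sqrt_cfc[OF a] show "\<exists>s. star s = s \<and> a = s * s" by metis
qed (use cpos_square in blast)

lemma cpos_of_real: "0 \<le> r \<Longrightarrow> cpos (of_real r)"
  unfolding cpos_iff_square
  by (intro exI[of _ "of_real (sqrt r)"]) (simp flip: of_real_mult)

lemma cpos_0 [simp]: "cpos 0"
  using cpos_of_real[of 0] by simp

lemma real_spectrum_diff_of_real:
  "t \<in> real_spectrum (of_real M - a) \<longleftrightarrow> M - t \<in> real_spectrum a"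
proof -
  have e: "of_real t - (of_real M - a) = - (of_real (M - t) - a)" by simp
  show ?thesis unfolding real_spectrum_def mem_Collect_eq e invertible_elt_minus ..
qed

text \<open>For self-adjoint \<open>a\<close>, distance at most \<open>M\<close> from
  \<open>of_real M\<close> means spectrum inside \<open>{0..2 * M}\<close>. In the norm form,
  closure under sums is just the triangle inequality.\<close>

lemma cpos_iff_norm:
  assumes "star a = a" shows "cpos a \<longleftrightarrow> (\<exists>M. norm (of_real M - a) \<le> M)"
proof
  assume a: "cpos a"
  have "\<exists>t\<in>real_spectrum (of_real (norm a) - a). \<bar>t\<bar> = norm (of_real (norm a) - a)"
    by (rule real_spectrum_norm) (simp add: assms)
  then obtain t where t: "norm a - t \<in> real_spectrum a" "\<bar>t\<bar> = norm (of_real (norm a) - a)"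
    using real_spectrum_diff_of_real by blast
  have "0 \<le> norm a - t" using t(1) a by (auto simp: cpos_def)
  moreover have "\<bar>norm a - t\<bar> \<le> norm a" using real_spectrum_le_norm[OF t(1)] .
  ultimately have "\<bar>t\<bar> \<le> norm a" by linarith
  with t show "\<exists>M. norm (of_real M - a) \<le> M" by metis
next
  assume "\<exists>M. norm (of_real M - a) \<le> M"
  then obtain M where M: "norm (of_real M - a) \<le> M" by blast
  have "0 \<le> t" if "t \<in> real_spectrum a" for t
  proof -
    have "M - t \<in> real_spectrum (of_real M - a)" using that by (simp add: real_spectrum_diff_of_real)
    then show ?thesis using real_spectrum_le_norm M by fastforce
  qed
  then show "cpos a" using assms by (auto simp: cpos_def)
qed

lemma cpos_add:
  assumes "cpos a" "cpos b" shows "cpos (a + b)"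
proof -
  obtain M N where MN: "norm (of_real M - a) \<le> M" "norm (of_real N - b) \<le> N"
    using assms cpos_iff_norm cpos_star by metis
  have "norm (of_real (M + N) - (a + b)) \<le> norm (of_real M - a) + norm (of_real N - b)"
    by (rule order_trans[OF _ norm_triangle_ineq]) (simp add: algebra_simps)
  with MN have "norm (of_real (M + N) - (a + b)) \<le> M + N" by linarith
  moreover have "star (a + b) = a + b" using assms by (simp add: star_add cpos_star)
  ultimately show ?thesis using cpos_iff_norm by blast
qed

lemma cpos_sum: "(\<And>i. i \<in> I \<Longrightarrow> cpos (f i)) \<Longrightarrow> cpos (\<Sum>i\<in>I. f i)"
  by (induction I rule: infinite_finite_induct) (auto intro: cpos_add)

lemma cpos_scaleR:
  assumes "cpos a" "0 \<le> r" shows "cpos (r *\<^sub>R a)"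
proof -
  obtain s where s: "star s = s" "a = s * s" using assms cpos_iff_square by blast
  have "cpos ((sqrt r *\<^sub>R s) * (sqrt r *\<^sub>R s))" by (rule cpos_square) (simp add: s)
  then show ?thesis using assms s by simp
qed

lemma cpos_antisym:
  assumes "cpos a" "cpos (- a)" shows "a = 0"
proof -
  obtain t where t: "t \<in> real_spectrum a" "\<bar>t\<bar> = norm a"
    using real_spectrum_norm assms(1) cpos_star by blast
  have "- t \<in> real_spectrum (- a)"
    using real_spectrum_diff_of_real[of "- t" 0 a] t by simp
  then have "- t \<in> {0..}" using assms(2) unfolding cpos_def by blast
  moreover have "t \<in> {0..}" using t(1) assms(1) unfolding cpos_def by blast
  ultimately have "t = 0" by simp
  with t show ?thesis by simp
qed

text \<open>If \<open>z\<close> inverts \<open>t - y x\<close>, then \<open>(1 + x z y) / t\<close>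
  inverts \<open>t - x y\<close>.\<close>

lemma real_spectrum_swap:
  fixes x :: "'a::cstar_algebra_1"
  assumes "t \<in> real_spectrum (x * y)" "t \<noteq> 0" shows "t \<in> real_spectrum (y * x)"
proof (rule ccontr)
  assume "t \<notin> real_spectrum (y * x)"
  then obtain z where z: "(of_real t - y * x) * z = 1" "z * (of_real t - y * x) = 1"
    by (auto simp: real_spectrum_def invertible_elt_def)
  define w where "w = inverse t *\<^sub>R (1 + x * z * y)"
  have z1: "y * x * z = t *\<^sub>R z - 1" using z(1) by (simp add: algebra_simps of_real_def)
  have z2: "z * y * x = t *\<^sub>R z - 1" using z(2) by (simp add: algebra_simps of_real_def)
  have "x * y * (x * z * y) = x * (y * x * z) * y" by (simp add: mult.assoc)
  also have "\<dots> = t *\<^sub>R (x * z * y) - x * y" unfolding z1 by (simp add: algebra_simps)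
  finally have 1: "(of_real t - x * y) * (1 + x * z * y) = of_real t"
    by (simp add: algebra_simps of_real_def)
  have "x * z * y * (x * y) = x * (z * y * x) * y" by (simp add: mult.assoc)
  also have "\<dots> = t *\<^sub>R (x * z * y) - x * y" unfolding z2 by (simp add: algebra_simps)
  finally have 2: "(1 + x * z * y) * (of_real t - x * y) = of_real t"
    by (simp add: algebra_simps of_real_def)
  have "(of_real t - x * y) * w = 1" "w * (of_real t - x * y) = 1"
    using 1 2 assms(2) by (simp_all add: w_def of_real_def)
  then show False using assms(1) by (auto simp: real_spectrum_def invertible_elt_def)
qed

text \<open>
  Kaplansky's argument: for \<open>d = c a\<^sub>-\<close>, where \<open>a = c\<^sup>* c\<close>, both \<open>- d\<^sup>* d\<close> and \<open>- d d\<^sup>*\<close> are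
  positive, and so is the sum \<open>d\<^sup>* d + d d\<^sup>*\<close>.
\<close>

lemma cpos_star_mult_self:
  fixes c :: "'a::cstar_algebra_1"
  shows "cpos (star c * c)"
proof -
  define a where "a = star c * c"
  have sa: "star a = a" by (simp add: a_def star_simps)
  define f where "f t = max (- t) 0" for t :: real
  have f: "continuous_on UNIV f" unfolding f_def by (intro continuous_intros)
  define n where "n = cfc f a"
  have sn: "star n = n" using sa f by (simp add: n_def)
  define d where "d = c * n"
  have dd: "star d * d = - (n * (n * n))"
  proof -
    have "star d * d = n * a * n" by (simp add: d_def star_mult sn a_def mult.assoc)
    also have "\<dots> = cfc f a * cfc (\<lambda>t. t) a * cfc f a" using sa by (simp add: n_def cfc_ident)
    also have "\<dots> = cfc (\<lambda>t. f t * t * f t) a"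
      using sa f by (simp add: cfc_mult continuous_on_mult continuous_on_id)
    also have "\<dots> = cfc (\<lambda>t. - (f t * (f t * f t))) a"
      by (rule cfc_cong) (auto simp: f_def max_def)
    also have "\<dots> = - (n * (n * n))"
      using sa f by (simp add: cfc_minus cfc_mult continuous_on_mult n_def)
    finally show ?thesis .
  qed
  have "cpos (cfc (\<lambda>t. f t * (f t * f t)) a)"
    by (rule cpos_cfc[OF sa]) (auto intro!: continuous_intros f simp: f_def)
  then have p: "cpos (- (star d * d))"
    using sa f by (simp add: dd cfc_mult continuous_on_mult n_def)
  have p': "cpos (- (d * star d))"
  proof -
    have "0 \<le> t" if t: "t \<in> real_spectrum (- (d * star d))" for t
    proof (cases "t = 0")
      case False
      have "t \<in> real_spectrum (star d * (- d))"
        by (rule real_spectrum_swap) (use t False in simp_all)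
      then show ?thesis using p by (auto simp: cpos_def)
    qed simp
    then show ?thesis by (auto simp: cpos_def star_simps)
  qed
  define x where "x = (1/2) *\<^sub>R (d + star d)"
  define y where "y = scaleC (- \<i> / 2) (d - star d)"
  have xy: "star x = x" "star y = y"
    by (simp_all add: x_def y_def star_simps scaleC_diff_right scaleC_minus_left add.commute)
  have "star d * d + d * star d = 2 *\<^sub>R (x * x) + 2 *\<^sub>R (y * y)"
  proof -
    have x2: "4 *\<^sub>R (x * x) = (d + star d) * (d + star d)" by (simp add: x_def)
    have "4 *\<^sub>R (y * y) = scaleC 4 (y * y)" using scaleC_of_real[of 4 "y * y"] by simp
    also have "\<dots> = - ((d - star d) * (d - star d))"
      by (simp add: y_def scaleC_mult_left scaleC_mult_right scaleC_scaleC scaleC_minus_left scaleC_minus_right)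
    finally have y2: "4 *\<^sub>R (y * y) = - ((d - star d) * (d - star d))" .
    have "2 *\<^sub>R (2 *\<^sub>R (x * x) + 2 *\<^sub>R (y * y)) = 4 *\<^sub>R (x * x) + 4 *\<^sub>R (y * y)"
      by (simp add: scaleR_add_right)
    also have "\<dots> = 2 *\<^sub>R (star d * d + d * star d)"
      unfolding x2 y2 by (simp add: algebra_simps scaleR_2)
    finally show ?thesis by simp
  qed
  then have "star d * d = 2 *\<^sub>R (x * x) + 2 *\<^sub>R (y * y) + - (d * star d)" by (simp add: algebra_simps)
  moreover have "cpos (2 *\<^sub>R (x * x) + 2 *\<^sub>R (y * y) + - (d * star d))"
    by (intro cpos_add cpos_scaleR cpos_square xy p') auto
  ultimately have "cpos (star d * d)" by simp
  then have "star d * d = 0" using p by (rule cpos_antisym)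
  \<comment> \<open>From the vanishing cube the C*-identity gives \<open>n * n = 0\<close> and then
    \<open>n = 0\<close>: the negative part of \<open>a\<close> is zero.\<close>
  then have "n * (n * n) = 0" using dd by simp
  then have "star (n * n) * (n * n) = 0" using sn by (simp add: star_mult mult.assoc)
  then have "n * n = 0" by (simp add: star_mult_self_eq_0)
  then have n0: "n = 0" using star_mult_self_eq_0[of n] sn by simp
  have "cfc (\<lambda>t. t + f t) a = a"
    using n0 sa f by (simp add: cfc_add cfc_ident n_def)
  moreover have "cpos (cfc (\<lambda>t. t + f t) a)"
    by (rule cpos_cfc[OF sa]) (auto intro!: continuous_intros f simp: f_def)
  ultimately show ?thesis by (simp add: a_def)
qed

lemma cpos_mult_star_self: "cpos (c * star c)"
  using cpos_star_mult_self[of "star c"] by (simp add: star_star)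

lemma cpos_conj:
  assumes "cpos a" shows "cpos (star y * a * y)"
proof -
  obtain s where "star s = s" "a = s * s" using assms cpos_iff_square by blast
  then have "star y * a * y = star (s * y) * (s * y)" by (simp add: star_mult mult.assoc)
  then show ?thesis by (simp add: cpos_star_mult_self)
qed

lemma cpos_norm_minus:
  assumes "star a = a" "norm a \<le> M" shows "cpos (of_real M - a)"
proof -
  have "0 \<le> t" if "t \<in> real_spectrum (of_real M - a)" for t
    using that real_spectrum_le_norm[of "M - t" a] assms by (auto simp: real_spectrum_diff_of_real)
  then show ?thesis using assms by (auto simp: cpos_def)
qed

lemma cpos_norm_mono:
  assumes "cpos a" "cpos (b - a)" shows "norm a \<le> norm b"
proof -
  have sb: "star b = b" using assms cpos_star[OF cpos_add[OF assms]] by simp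
  have "cpos (of_real (norm b) - b)" by (rule cpos_norm_minus) (simp_all add: sb)
  from cpos_add[OF this assms(2)] have p: "cpos (of_real (norm b) - a)" by simp
  obtain t where t: "t \<in> real_spectrum a" "\<bar>t\<bar> = norm a"
    using real_spectrum_norm assms(1) cpos_star by blast
  have "norm b - t \<in> real_spectrum (of_real (norm b) - a)"
    using t by (simp add: real_spectrum_diff_of_real)
  then have "t \<le> norm b" using p by (auto simp: cpos_def)
  moreover have "0 \<le> t" using t assms by (auto simp: cpos_def)
  ultimately show ?thesis using t by simp
qed

lemma cpos_cfc_mono:
  assumes c: "star c = c" and f: "continuous_on UNIV f" and g: "continuous_on UNIV g"
    and "\<And>t. t \<in> real_spectrum c \<Longrightarrow> f t \<le> g t"
  shows "cpos (cfc g c - cfc f c)"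
proof -
  have "cpos (cfc (\<lambda>t. g t - f t) c)"
    by (rule cpos_cfc[OF c]) (use assms in \<open>auto intro!: continuous_intros\<close>)
  then show ?thesis by (simp add: cfc_diff[OF c g f])
qed

lemma sum_star_mult_eq_0:
  fixes c :: "'i \<Rightarrow> 'a::cstar_algebra_1"
  assumes "finite I" "(\<Sum>i\<in>I. star (c i) * c i) = 0" "i \<in> I"
  shows "c i = 0"
proof -
  have "(\<Sum>i\<in>I. star (c i) * c i) - star (c i) * c i = (\<Sum>j\<in>I - {i}. star (c j) * c j)"
    using assms by (simp add: sum_diff1)
  also have "cpos \<dots>" by (intro cpos_sum cpos_star_mult_self)
  finally have "norm (star (c i) * c i) \<le> norm (\<Sum>i\<in>I. star (c i) * c i)"
    by (intro cpos_norm_mono cpos_star_mult_self)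
  then show ?thesis using assms by (simp add: star_mult_self_eq_0)
qed

subsection \<open>Asymptotic equality of sequences\<close>

text \<open>Equality in the quotient of the bounded sequences by the null sequences. It respects
  products only for bounded sequences, whence the \<open>Bseq\<close> conditions below.\<close>

definition asymp_eq :: "(nat \<Rightarrow> 'a::real_normed_vector) \<Rightarrow> (nat \<Rightarrow> 'a) \<Rightarrow> bool"  (infix "\<doteq>" 50)
  where "X \<doteq> Y \<longleftrightarrow> (\<lambda>n. X n - Y n) \<longlonglongrightarrow> 0"

lemma asymp_eq_refl [simp]: "X \<doteq> X"
  by (simp add: asymp_eq_def)

lemma asymp_eq_sym: "X \<doteq> Y \<Longrightarrow> Y \<doteq> X"
  unfolding asymp_eq_def using tendsto_minus by fastforce

lemma asymp_eq_trans [trans]: "X \<doteq> Y \<Longrightarrow> Y \<doteq> Z \<Longrightarrow> X \<doteq> Z"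
  unfolding asymp_eq_def using tendsto_add by fastforce

lemma asymp_eq_tendsto_0: "X \<doteq> (\<lambda>_. 0) \<longleftrightarrow> X \<longlonglongrightarrow> 0"
  by (simp add: asymp_eq_def)

lemma asymp_eq_add: "X \<doteq> X' \<Longrightarrow> Y \<doteq> Y' \<Longrightarrow> (\<lambda>n. X n + Y n) \<doteq> (\<lambda>n. X' n + Y' n)"
  unfolding asymp_eq_def by (drule (1) tendsto_add) (simp add: algebra_simps)

lemma asymp_eq_sum:
  "(\<And>i. i \<in> I \<Longrightarrow> X i \<doteq> Y i) \<Longrightarrow> (\<lambda>n. \<Sum>i\<in>I. X i n) \<doteq> (\<lambda>n. \<Sum>i\<in>I. Y i n)"
  unfolding asymp_eq_def sum_subtractf[symmetric] by (rule tendsto_null_sum)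

lemma asymp_eq_star: "X \<doteq> Y \<Longrightarrow> (\<lambda>n. star (X n)) \<doteq> (\<lambda>n. star (Y n :: 'a::cstar_algebra))"
  unfolding asymp_eq_def star_diff[symmetric] using tendsto_star by fastforce

lemma Bseq_mult':
  fixes X Y :: "nat \<Rightarrow> 'a::real_normed_algebra"
  assumes "Bseq X" "Bseq Y" shows "Bseq (\<lambda>n. X n * Y n)"
proof -
  obtain K L where "\<And>n. norm (X n) \<le> K" "\<And>n. norm (Y n) \<le> L" using assms by (auto elim!: BseqE)
  then have "norm (X n * Y n) \<le> K * L" for n
    by (intro order_trans[OF norm_mult_ineq] mult_mono) (auto intro: order_trans[OF norm_ge_zero])
  then show ?thesis by (rule BseqI')
qed

lemma Bseq_star: "Bseq X \<Longrightarrow> Bseq (\<lambda>n. star (X n :: 'a::cstar_algebra))"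
  by (simp add: Bseq_def)

lemma Bseq_const: "Bseq (\<lambda>_. c :: 'a::real_normed_vector)"
  by (rule BseqI'[of _ "norm c"]) simp

lemma Bseq_add':
  fixes X Y :: "nat \<Rightarrow> 'a::real_normed_vector"
  assumes "Bseq X" "Bseq Y" shows "Bseq (\<lambda>n. X n + Y n)"
proof -
  obtain K L where "\<And>n. norm (X n) \<le> K" "\<And>n. norm (Y n) \<le> L" using assms by (auto elim!: BseqE)
  then have "norm (X n + Y n) \<le> K + L" for n
    by (intro norm_triangle_le add_mono)
  then show ?thesis by (rule BseqI')
qed

lemma Bseq_asymp_eq:
  assumes "Bseq X" "X \<doteq> Y" shows "Bseq Y"
proof -
  have "Bseq (\<lambda>n. Y n - X n)"
    using asymp_eq_sym[OF assms(2)] by (auto simp: asymp_eq_def intro: convergent_imp_Bseq convergentI)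
  from Bseq_add'[OF this assms(1)] show ?thesis by simp
qed

lemma Bseq_mult_null:
  fixes X Z :: "nat \<Rightarrow> 'a::real_normed_algebra"
  assumes "Bseq X" "Z \<longlonglongrightarrow> 0"
  shows "(\<lambda>n. X n * Z n) \<longlonglongrightarrow> 0" "(\<lambda>n. Z n * X n) \<longlonglongrightarrow> 0"
proof -
  obtain K where K: "\<And>n. norm (X n) \<le> K" using BseqD[OF assms(1)] by blast
  have lim: "(\<lambda>n. K * norm (Z n)) \<longlonglongrightarrow> 0"
    using tendsto_mult_right_zero[OF tendsto_norm_zero[OF assms(2)]] .
  show "(\<lambda>n. X n * Z n) \<longlonglongrightarrow> 0"
    by (rule Lim_null_comparison[OF _ lim])
      (auto intro!: always_eventually order_trans[OF norm_mult_ineq] mult_right_mono K)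
  show "(\<lambda>n. Z n * X n) \<longlonglongrightarrow> 0"
    by (rule Lim_null_comparison[OF _ lim])
      (auto intro!: always_eventually order_trans[OF norm_mult_ineq] mult_left_mono K simp: mult.commute[of K])
qed

lemma asymp_eq_mult:
  fixes X Y :: "nat \<Rightarrow> 'a::real_normed_algebra"
  assumes "X \<doteq> X'" "Y \<doteq> Y'" "Bseq X" "Bseq Y'"
  shows "(\<lambda>n. X n * Y n) \<doteq> (\<lambda>n. X' n * Y' n)"
proof -
  have "(\<lambda>n. X n * (Y n - Y' n)) \<longlonglongrightarrow> 0"
    using assms by (intro Bseq_mult_null) (auto simp: asymp_eq_def)
  moreover have "(\<lambda>n. (X n - X' n) * Y' n) \<longlonglongrightarrow> 0"
    using assms by (intro Bseq_mult_null) (auto simp: asymp_eq_def)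
  ultimately have "(\<lambda>n. X n * (Y n - Y' n) + (X n - X' n) * Y' n) \<longlonglongrightarrow> 0 + 0"
    by (rule tendsto_add)
  then show ?thesis by (simp add: asymp_eq_def algebra_simps)
qed

lemma asymp_eq_mult_left:
  fixes X Y :: "nat \<Rightarrow> 'a::real_normed_algebra"
  assumes "Y \<doteq> Y'" "Bseq X" shows "(\<lambda>n. X n * Y n) \<doteq> (\<lambda>n. X n * Y' n)"
proof -
  have "(\<lambda>n. X n * (Y n - Y' n)) \<longlonglongrightarrow> 0"
    using assms by (intro Bseq_mult_null) (auto simp: asymp_eq_def)
  then show ?thesis by (simp add: asymp_eq_def algebra_simps)
qed

lemma asymp_eq_mult_right:
  fixes X Y :: "nat \<Rightarrow> 'a::real_normed_algebra"
  assumes "X \<doteq> X'" "Bseq Y" shows "(\<lambda>n. X n * Y n) \<doteq> (\<lambda>n. X' n * Y n)"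
proof -
  have "(\<lambda>n. (X n - X' n) * Y n) \<longlonglongrightarrow> 0"
    using assms by (intro Bseq_mult_null) (auto simp: asymp_eq_def)
  then show ?thesis by (simp add: asymp_eq_def algebra_simps)
qed

lemma asymp_eq_commute_rpoly_at:
  fixes a b y :: "nat \<Rightarrow> 'a::real_normed_algebra_1"
  assumes ay: "(\<lambda>n. a n * y n) \<doteq> (\<lambda>n. y n * b n)" and B: "Bseq a" "Bseq b"
  shows "(\<lambda>n. rpoly_at p (a n) * y n) \<doteq> (\<lambda>n. y n * rpoly_at p (b n))"
proof (induction p)
  case (pCons r p)
  have Bp: "Bseq (\<lambda>n. rpoly_at p (b n))"
    by (induction p) (auto intro!: Bseq_add' Bseq_mult' Bseq_const B)
  have "(\<lambda>n. a n * (rpoly_at p (a n) * y n)) \<doteq> (\<lambda>n. a n * (y n * rpoly_at p (b n)))"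
    by (rule asymp_eq_mult_left[OF pCons.IH B(1)])
  also have "(\<lambda>n. a n * (y n * rpoly_at p (b n))) \<doteq> (\<lambda>n. y n * (b n * rpoly_at p (b n)))"
    using asymp_eq_mult_right[OF ay Bp] by (simp add: mult.assoc)
  finally have "(\<lambda>n. of_real r * y n + a n * (rpoly_at p (a n) * y n)) \<doteq>
      (\<lambda>n. of_real r * y n + y n * (b n * rpoly_at p (b n)))"
    by (intro asymp_eq_add asymp_eq_refl)
  then show ?case by (simp add: algebra_simps of_real_def)
qed simp

text \<open>One polynomial approximates \<open>f\<close> within \<open>d\<close> on an interval
  containing all the spectra, and for polynomials the claim is algebraic. Intertwining by
  \<open>y\<close> covers both almost commuting elements (\<open>a = b\<close>) and continuity of
  \<open>cfc f\<close> (\<open>y = 1\<close>).\<close>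

lemma asymp_eq_commute_cfc:
  fixes a b y :: "nat \<Rightarrow> 'a::cstar_algebra_1"
  assumes ay: "(\<lambda>n. a n * y n) \<doteq> (\<lambda>n. y n * b n)" and B: "Bseq a" "Bseq b" "Bseq y"
    and sa: "\<And>n. star (a n) = a n" "\<And>n. star (b n) = b n" and f: "continuous_on UNIV f"
  shows "(\<lambda>n. cfc f (a n) * y n) \<doteq> (\<lambda>n. y n * cfc f (b n))"
  unfolding asymp_eq_def
proof (rule LIMSEQ_I)
  fix e :: real assume e: "e > 0"
  obtain K where K: "\<And>n. norm (a n) \<le> K" "\<And>n. norm (b n) \<le> K"
  proof -
    obtain k l where "\<And>n. norm (a n) \<le> k" "\<And>n. norm (b n) \<le> l" using B by (auto elim!: BseqE)
    then show ?thesis using that[of "max k l"] by (simp add: le_max_iff_disj)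
  qed
  obtain L where L: "0 < L" "\<And>n. norm (y n) \<le> L" using B(3) by (auto elim: BseqE)
  define d where "d = e / (4 * L)"
  have d: "d > 0" using e L by (simp add: d_def)
  obtain p where p: "uniform_limit {-K..K} (\<lambda>n t. poly (p n) t) f sequentially"
    using poly_approx_seq[OF f] by blast
  obtain m where m: "\<And>t. t \<in> {-K..K} \<Longrightarrow> \<bar>poly (p m) t - f t\<bar> \<le> d"
    using uniform_limitD[OF p d] unfolding eventually_sequentially dist_real_def by (metis less_imp_le order_refl)
  have near: "norm (cfc f c - rpoly_at (p m) c) \<le> d" if c: "star c = c" "norm c \<le> K" for c :: 'a
  proof -
    have cp: "continuous_on UNIV (poly (p m))" by (intro continuous_intros)
    have "norm (cfc (\<lambda>t. f t - poly (p m) t) c) \<le> d"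
    proof (rule cfc_norm_le[OF c(1)])
      fix t assume "t \<in> real_spectrum c"
      then have "\<bar>t\<bar> \<le> K" using real_spectrum_le_norm c(2) order_trans by blast
      then have "t \<in> {-K..K}" by auto
      from m[OF this] show "\<bar>f t - poly (p m) t\<bar> \<le> d" by (simp add: abs_minus_commute)
    qed (intro continuous_intros f)
    then show ?thesis using cfc_diff[OF c(1) f cp] c by (simp add: cfc_poly)
  qed
  have "(\<lambda>n. rpoly_at (p m) (a n) * y n - y n * rpoly_at (p m) (b n)) \<longlonglongrightarrow> 0"
    using asymp_eq_commute_rpoly_at[OF ay B(1,2)] by (simp add: asymp_eq_def)
  from LIMSEQ_D[OF this, of "e / 4"] e obtain N where
    N: "\<And>n. n \<ge> N \<Longrightarrow> norm (rpoly_at (p m) (a n) * y n - y n * rpoly_at (p m) (b n)) < e / 4"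
    by auto
  have "norm (cfc f (a n) * y n - y n * cfc f (b n)) < e" if n: "n \<ge> N" for n
  proof -
    have eq: "cfc f (a n) * y n - y n * cfc f (b n) =
      (cfc f (a n) - rpoly_at (p m) (a n)) * y n +
      (rpoly_at (p m) (a n) * y n - y n * rpoly_at (p m) (b n)) -
      y n * (cfc f (b n) - rpoly_at (p m) (b n))" by (simp add: algebra_simps)
    have 1: "norm ((cfc f (a n) - rpoly_at (p m) (a n)) * y n) \<le> d * L"
      by (intro order_trans[OF norm_mult_ineq] mult_mono near sa K L) (use d in auto)
    have 2: "norm (y n * (cfc f (b n) - rpoly_at (p m) (b n))) \<le> L * d"
      by (intro order_trans[OF norm_mult_ineq] mult_mono near sa K L) (use L in auto)
    have "d * L = e / 4" using L by (simp add: d_def)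
    with 1 2 N[OF n] show ?thesis
      unfolding eq mult.commute[of L d] using e
        norm_triangle_ineq4[of "(cfc f (a n) - rpoly_at (p m) (a n)) * y n +
          (rpoly_at (p m) (a n) * y n - y n * rpoly_at (p m) (b n))"
          "y n * (cfc f (b n) - rpoly_at (p m) (b n))"]
        norm_triangle_ineq[of "(cfc f (a n) - rpoly_at (p m) (a n)) * y n"
          "rpoly_at (p m) (a n) * y n - y n * rpoly_at (p m) (b n)"]
      by linarith
  qed
  then show "\<exists>N. \<forall>n\<ge>N. norm (cfc f (a n) * y n - y n * cfc f (b n) - 0) < e" by auto
qed

lemma asymp_eq_cfc:
  fixes a b :: "nat \<Rightarrow> 'a::cstar_algebra_1"
  assumes "a \<doteq> b" "Bseq a" "\<And>n. star (a n) = a n" "\<And>n. star (b n) = b n" "continuous_on UNIV f"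
  shows "(\<lambda>n. cfc f (a n)) \<doteq> (\<lambda>n. cfc f (b n))"
  using asymp_eq_commute_cfc[of a "\<lambda>_. 1" b f] assms Bseq_asymp_eq[OF assms(2,1)] Bseq_const by simp

lemma Bseq_cfc:
  fixes a :: "nat \<Rightarrow> 'a::cstar_algebra_1"
  assumes a: "Bseq a" "\<And>n. star (a n) = a n" and f: "continuous_on UNIV f"
  shows "Bseq (\<lambda>n. cfc f (a n))"
proof -
  obtain K where K: "\<And>n. norm (a n) \<le> K" using BseqD[OF a(1)] by blast
  have "compact (f ` {-K..K})"
    by (rule compact_continuous_image[OF continuous_on_subset[OF f]]) auto
  then have "bounded (f ` {-K..K})" by (rule compact_imp_bounded)
  then obtain L where "\<forall>x\<in>f ` {-K..K}. \<bar>x\<bar> \<le> L" unfolding bounded_real by blast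
  then have L: "\<bar>f t\<bar> \<le> L" if "t \<in> {-K..K}" for t using that by blast
  have "norm (cfc f (a n)) \<le> L" for n
  proof (rule cfc_norm_le[OF a(2) f L])
    fix t assume "t \<in> real_spectrum (a n)"
    from real_spectrum_le_norm[OF this] K[of n] show "t \<in> {-K..K}" by auto
  qed
  then show ?thesis by (rule BseqI')
qed

subsection \<open>Functional calculus in subalgebras\<close>

lemma cstar_subalgebraD:
  assumes "cstar_subalgebra B"
  shows "closed B" "0 \<in> B" "\<And>x y. x \<in> B \<Longrightarrow> y \<in> B \<Longrightarrow> x + y \<in> B"
    "\<And>x y. x \<in> B \<Longrightarrow> y \<in> B \<Longrightarrow> x * y \<in> B" "\<And>c x. x \<in> B \<Longrightarrow> scaleC c x \<in> B"
    "\<And>x. x \<in> B \<Longrightarrow> star x \<in> B" "\<And>r x. x \<in> B \<Longrightarrow> r *\<^sub>R x \<in> B"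
    "\<And>x. x \<in> B \<Longrightarrow> - x \<in> B" "\<And>x y. x \<in> B \<Longrightarrow> y \<in> B \<Longrightarrow> x - y \<in> B"
proof -
  show s: "\<And>c x. x \<in> B \<Longrightarrow> scaleC c x \<in> B" and a: "\<And>x y. x \<in> B \<Longrightarrow> y \<in> B \<Longrightarrow> x + y \<in> B"
    using assms by (auto simp: cstar_subalgebra_def)
  show r: "r *\<^sub>R x \<in> B" if "x \<in> B" for r x using s[OF that, of "of_real r"] by (simp add: scaleC_of_real)
  show m: "- x \<in> B" if "x \<in> B" for x using r[OF that, of "-1"] by simp
  show "x - y \<in> B" if "x \<in> B" "y \<in> B" for x y using a[OF that(1) m[OF that(2)]] by simp
qed (use assms in \<open>auto simp: cstar_subalgebra_def\<close>)

lemma cstar_subalgebra_sum: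
  assumes "cstar_subalgebra B" "\<And>i. i \<in> I \<Longrightarrow> f i \<in> B" shows "(\<Sum>i\<in>I. f i) \<in> B"
  using assms(2) by (induction I rule: infinite_finite_induct) (auto intro: cstar_subalgebraD[OF assms(1)])

lemma cfc_in_subalgebra:
  fixes c :: "'a::cstar_algebra_1"
  assumes B: "cstar_subalgebra B" and c: "star c = c" "c \<in> B"
    and f: "continuous_on UNIV f" "f 0 = 0"
  shows "cfc f c \<in> B"
proof -
  obtain p where p: "uniform_limit {- norm c..norm c} (\<lambda>n t. poly (p n) t) f sequentially"
    "(\<lambda>n. rpoly_at (p n) c) \<longlonglongrightarrow> cfc f c" using cfc_approx[OF c(1) f(1) order_refl] by blast
  have "(\<lambda>n. poly (p n) 0) \<longlonglongrightarrow> 0"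
    using tendsto_uniform_limitI[OF p(1), of 0] f(2) by simp
  then have "(\<lambda>n. of_real (poly (p n) 0) :: 'a) \<longlonglongrightarrow> of_real 0" by (rule tendsto_of_real)
  from tendsto_diff[OF p(2) this]
  have lim: "(\<lambda>n. rpoly_at (p n) c - of_real (poly (p n) 0)) \<longlonglongrightarrow> cfc f c" by simp
  have mem: "c * rpoly_at q c \<in> B" for q
  proof (induction q)
    case (pCons r q)
    have "c * rpoly_at (pCons r q) c = r *\<^sub>R c + c * (c * rpoly_at q c)"
      by (simp add: distrib_left of_real_def)
    also have "\<dots> \<in> B" by (intro cstar_subalgebraD(3,4,7)[OF B] c(2) pCons.IH)
    finally show ?case .
  qed (simp add: cstar_subalgebraD(2)[OF B])
  have "rpoly_at q c - of_real (poly q 0) \<in> B" for q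
    using mem by (cases q) simp
  then show ?thesis using closed_sequentially[OF cstar_subalgebraD(1)[OF B] _ lim] by blast
qed

section \<open>Unitization\<close>

datatype 'a unitization = Unz (upart: 'a) (uscal: complex)

text \<open>
  The norm is the maximum of the norm of the scalar part and the operator norm of left
  multiplication on \<open>'a\<close>; without the first component it would only be a seminorm if \<open>'a\<close>
  already has a unit.
\<close>

definition lmult :: "'a::cstar_algebra unitization \<Rightarrow> 'a \<Rightarrow> 'a"
  where "lmult u x = upart u * x + scaleC (uscal u) x"

lemma bounded_linear_lmult: "bounded_linear (lmult u)"
  unfolding lmult_def
  by (intro bounded_linear_add bounded_linear_mult_right bounded_linear_scaleC)

instantiation unitization :: (cstar_algebra) real_algebra_1
begin

definition "0 = Unz 0 0"
definition "1 = Unz 0 1"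
definition "u + v = Unz (upart u + upart v) (uscal u + uscal v)"
definition "u - v = Unz (upart u - upart v) (uscal u - uscal v)"
definition "- u = Unz (- upart u) (- uscal u)"
definition "r *\<^sub>R u = Unz (r *\<^sub>R upart u) (r *\<^sub>R uscal u)"
definition "u * v = Unz (upart u * upart v + scaleC (uscal u) (upart v) + scaleC (uscal v) (upart u))
  (uscal u * uscal v)"

lemmas unitization_defs = zero_unitization_def one_unitization_def plus_unitization_def
  minus_unitization_def uminus_unitization_def scaleR_unitization_def times_unitization_def

instance
proof
  fix u v w :: "'a unitization" and r s :: real
  have sR: "scaleC (r *\<^sub>R c) x = r *\<^sub>R scaleC c x" "scaleC c (r *\<^sub>R x) = r *\<^sub>R scaleC c x"
    for r c and x :: 'a
    by (simp_all add: scaleC_scaleC scaleR_conv_of_real mult.commute flip: scaleC_of_real)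
  show "u * v * w = u * (v * w)"
    by (simp add: unitization_defs algebra_simps scaleC_add_right scaleC_mult_left scaleC_mult_right
        scaleC_scaleC)
  show "(u + v) * w = u * w + v * w" "u * (v + w) = u * v + u * w"
    by (simp_all add: unitization_defs algebra_simps scaleC_add_right scaleC_add_left)
  show "r *\<^sub>R u * v = r *\<^sub>R (u * v)" "u * r *\<^sub>R v = r *\<^sub>R (u * v)"
    by (simp_all add: unitization_defs algebra_simps sR)
qed (auto simp: unitization_defs algebra_simps unitization.expand)

end

lemma lmult_simps:
  "lmult (u + v) x = lmult u x + lmult v x" "lmult (u - v) x = lmult u x - lmult v x"
  "lmult (r *\<^sub>R u) x = r *\<^sub>R lmult u x" "lmult (u * v) x = lmult u (lmult v x)" "lmult 1 x = x"
  "lmult 0 x = 0"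
  by (simp_all add: lmult_def unitization_defs algebra_simps scaleC_add_right scaleC_add_left
      scaleC_diff_left scaleC_mult_left scaleC_mult_right scaleC_scaleC scaleR_conv_of_real
      flip: scaleC_of_real)

definition lnorm :: "'a::cstar_algebra unitization \<Rightarrow> real"
  where "lnorm u = onorm (lmult u)"

lemma norm_lmult_le: "norm (lmult u x) \<le> lnorm u * norm x"
  unfolding lnorm_def by (rule onorm[OF bounded_linear_lmult])

lemma lnorm_nonneg: "0 \<le> lnorm u"
  unfolding lnorm_def by (rule onorm_pos_le[OF bounded_linear_lmult])

lemma lnorm_le: "0 \<le> b \<Longrightarrow> (\<And>x. norm (lmult u x) \<le> b * norm x) \<Longrightarrow> lnorm u \<le> b"
  unfolding lnorm_def by (rule onorm_bound)

lemma lnorm_triangle: "lnorm (u + v) \<le> lnorm u + lnorm v"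
  unfolding lnorm_def lmult_simps by (rule onorm_triangle[OF bounded_linear_lmult bounded_linear_lmult])

lemma lnorm_mult: "lnorm (u * v) \<le> lnorm u * lnorm v"
proof (rule lnorm_le)
  show "0 \<le> lnorm u * lnorm v" by (intro mult_nonneg_nonneg lnorm_nonneg)
  show "norm (lmult (u * v) x) \<le> lnorm u * lnorm v * norm x" for x
    unfolding lmult_simps mult.assoc
    by (intro order_trans[OF norm_lmult_le] mult_left_mono norm_lmult_le lnorm_nonneg)
qed

lemma lnorm_scaleR: "lnorm (r *\<^sub>R u) = \<bar>r\<bar> * lnorm u"
  unfolding lnorm_def lmult_simps by (rule onorm_scaleR[OF bounded_linear_lmult])

text \<open>The lower bound comes from testing left multiplication on \<open>star (upart u)\<close>
  and using the C*-identity.\<close>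

lemma lnorm_upart: "uscal u = 0 \<Longrightarrow> lnorm u = norm (upart u)"
proof (rule antisym)
  assume u: "uscal u = 0"
  show "lnorm u \<le> norm (upart u)"
    by (rule lnorm_le) (simp_all add: lmult_def u norm_mult_ineq)
  have "norm (upart u) * norm (upart u) \<le> lnorm u * norm (upart u)"
    using norm_lmult_le[of u "star (upart u)"]
    by (simp add: lmult_def u norm_mult_star_self power2_eq_square)
  then show "norm (upart u) \<le> lnorm u"
    using lnorm_nonneg[of u] by (cases "upart u = 0") auto
qed

instantiation unitization :: (cstar_algebra) real_normed_algebra_1
begin

definition "norm u = max (cmod (uscal u)) (lnorm u)"
definition "sgn u = inverse (norm u) *\<^sub>R (u::'a unitization)"
definition "dist u v = norm (u - v :: 'a unitization)"
definition [code del]: "(uniformity :: ('a unitization \<times> 'a unitization) filter) =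
  (INF e\<in>{0 <..}. principal {(x, y). dist x y < e})"
definition [code del]: "open (U :: 'a unitization set) \<longleftrightarrow>
  (\<forall>x\<in>U. eventually (\<lambda>(x', y). x' = x \<longrightarrow> y \<in> U) uniformity)"

instance
proof
  fix u v :: "'a unitization" and r :: real and U :: "'a unitization set"
  show "norm u = 0 \<longleftrightarrow> u = 0"
  proof
    assume "norm u = 0"
    then have "uscal u = 0" "lnorm u = 0"
      using lnorm_nonneg[of u] norm_ge_zero[of "uscal u"] unfolding norm_unitization_def max_def
      by (auto split: if_splits)
    then show "u = 0" using lnorm_upart[of u]
      by (simp add: zero_unitization_def unitization.expand)
  next
    assume "u = 0"
    moreover have "lnorm (0::'a unitization) = 0"
      using lnorm_upart[of "0::'a unitization"] by (simp add: zero_unitization_def)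
    moreover have "uscal (0::'a unitization) = 0" by (simp add: zero_unitization_def)
    ultimately show "norm u = 0" by (simp add: norm_unitization_def)
  qed
  show "norm (u + v) \<le> norm u + norm v"
    using lnorm_triangle[of u v] norm_triangle_ineq[of "uscal u" "uscal v"]
    unfolding norm_unitization_def by (simp add: plus_unitization_def[of u v]) (simp add: max_def)
  show "norm (r *\<^sub>R u) = \<bar>r\<bar> * norm u"
  proof -
    have "uscal (r *\<^sub>R u) = r *\<^sub>R uscal u" by (simp add: scaleR_unitization_def)
    then show ?thesis by (simp add: norm_unitization_def lnorm_scaleR max_mult_distrib_left)
  qed
  show "norm (u * v) \<le> norm u * norm v"
  proof -
    have "lnorm (u * v) \<le> norm u * norm v"
      by (rule order_trans[OF lnorm_mult], rule mult_mono)
        (auto simp: norm_unitization_def lnorm_nonneg le_max_iff_disj)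
    moreover have "cmod (uscal (u * v)) \<le> norm u * norm v"
      unfolding times_unitization_def unitization.sel norm_mult
      by (rule mult_mono) (auto simp: norm_unitization_def le_max_iff_disj)
    ultimately show ?thesis by (simp add: norm_unitization_def[of "u * v"])
  qed
  show "norm (1 :: 'a unitization) = 1"
  proof -
    have "lnorm (1 :: 'a unitization) \<le> 1" by (rule lnorm_le) (simp_all add: lmult_simps)
    then show ?thesis by (simp add: norm_unitization_def one_unitization_def)
  qed
qed (simp_all add: sgn_unitization_def dist_unitization_def uniformity_unitization_def
      open_unitization_def)

end

abbreviation emb :: "'a::cstar_algebra \<Rightarrow> 'a unitization"
  where "emb x \<equiv> Unz x 0"

lemma norm_emb: "norm (emb x) = norm x"
  by (simp add: norm_unitization_def lnorm_upart le_max_iff_disj max_absorb2)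

lemma cmod_uscal_le: "cmod (uscal u) \<le> norm u"
  by (simp add: norm_unitization_def)

text \<open>Serves completeness, where both components have to be Cauchy. Removing the scalar part
  costs at most another \<open>norm u\<close>, hence the factor 2.\<close>

lemma norm_upart_le: "norm (upart u) \<le> 2 * norm u"
proof -
  have "emb (upart u) = u - Unz 0 (uscal u)" by (simp add: minus_unitization_def)
  then have "norm (upart u) \<le> norm u + norm (Unz (0::'a) (uscal u))"
    by (metis norm_emb norm_triangle_ineq4)
  also have "norm (Unz (0::'a) (uscal u)) \<le> norm u"
  proof -
    have "lnorm (Unz (0::'a) (uscal u)) \<le> cmod (uscal u)"
      by (rule lnorm_le) (simp_all add: lmult_def norm_scaleC)
    then have "norm (Unz (0::'a) (uscal u)) \<le> cmod (uscal u)" by (simp add: norm_unitization_def)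
    then show ?thesis using cmod_uscal_le order_trans by blast
  qed
  finally show ?thesis by simp
qed

instance unitization :: (cstar_algebra) banach
proof
  fix X :: "nat \<Rightarrow> 'a unitization" assume X: "Cauchy X"
  have "Cauchy (\<lambda>n. upart (X n))"
  proof (rule metric_CauchyI)
    fix e :: real assume "e > 0"
    then obtain N where N: "\<And>m n. m \<ge> N \<Longrightarrow> n \<ge> N \<Longrightarrow> dist (X m) (X n) < e / 2"
      using metric_CauchyD[OF X, of "e / 2"] by auto
    have "dist (upart (X m)) (upart (X n)) < e" if "m \<ge> N" "n \<ge> N" for m n
      using N[OF that] norm_upart_le[of "X m - X n"]
      by (simp add: dist_norm minus_unitization_def[of "X m"])
    then show "\<exists>N. \<forall>m\<ge>N. \<forall>n\<ge>N. dist (upart (X m)) (upart (X n)) < e" by blast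
  qed
  then obtain a where a: "(\<lambda>n. upart (X n)) \<longlonglongrightarrow> a" by (auto simp: Cauchy_convergent_iff convergent_def)
  have "Cauchy (\<lambda>n. uscal (X n))"
  proof (rule metric_CauchyI)
    fix e :: real assume "e > 0"
    then obtain N where N: "\<And>m n. m \<ge> N \<Longrightarrow> n \<ge> N \<Longrightarrow> dist (X m) (X n) < e"
      using metric_CauchyD[OF X] by blast
    have "dist (uscal (X m)) (uscal (X n)) < e" if "m \<ge> N" "n \<ge> N" for m n
      using N[OF that] cmod_uscal_le[of "X m - X n"]
      by (simp add: dist_norm minus_unitization_def[of "X m"])
    then show "\<exists>N. \<forall>m\<ge>N. \<forall>n\<ge>N. dist (uscal (X m)) (uscal (X n)) < e" by blast
  qed
  then obtain l where l: "(\<lambda>n. uscal (X n)) \<longlonglongrightarrow> l" by (auto simp: Cauchy_convergent_iff convergent_def)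
  have bound: "norm (X n - Unz a l) \<le> norm (upart (X n) - a) + cmod (uscal (X n) - l)" for n
  proof -
    have "X n - Unz a l = emb (upart (X n) - a) + Unz 0 (uscal (X n) - l)"
      by (simp add: minus_unitization_def plus_unitization_def)
    moreover have "norm (Unz (0::'a) (uscal (X n) - l)) \<le> cmod (uscal (X n) - l)"
      by (auto simp: norm_unitization_def lmult_def norm_scaleC intro!: lnorm_le)
    ultimately show ?thesis
      using norm_triangle_ineq[of "emb (upart (X n) - a)" "Unz 0 (uscal (X n) - l)"]
      by (simp add: norm_emb)
  qed
  have lim: "(\<lambda>n. norm (upart (X n) - a) + cmod (uscal (X n) - l)) \<longlonglongrightarrow> 0"
    by (intro tendsto_add_zero tendsto_norm_zero LIM_zero a l)
  have "(\<lambda>n. X n - Unz a l) \<longlonglongrightarrow> 0"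
    by (rule Lim_null_comparison[OF always_eventually lim]) (rule allI, rule bound)
  then have "X \<longlonglongrightarrow> Unz a l" by (rule LIM_zero_cancel)
  then show "convergent X" by (auto simp: convergent_def)
qed

instantiation unitization :: (cstar_algebra) cstar_algebra_1
begin

definition "scaleC c u = Unz (scaleC c (upart u)) (c * uscal u)"
definition "star u = Unz (star (upart u)) (cnj (uscal u))"

lemma lmult_star: "star (lmult u x) * lmult u x = star x * lmult (star u * u) x"
  for u :: "'a unitization"
  by (simp add: lmult_def star_unitization_def times_unitization_def star_simps algebra_simps
      scaleC_mult_left scaleC_mult_right scaleC_scaleC scaleC_add_left scaleC_add_right)

text \<open>By \<open>lmult_star\<close> the squared norm of \<open>lmult v x\<close> is the norm of
  \<open>star x * lmult (star v * v) x\<close>, so the C*-identity of the original algebra passes to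
  \<open>lnorm\<close>.\<close>

lemma lnorm_star_mult_self: "lnorm (star u * u) = (lnorm u)\<^sup>2"
  for u :: "'a unitization"
proof -
  have le: "(lnorm v)\<^sup>2 \<le> lnorm (star v * v)" for v :: "'a unitization"
  proof -
    have "lnorm v \<le> sqrt (lnorm (star v * v))"
    proof (rule lnorm_le)
      fix x
      have "(norm (lmult v x))\<^sup>2 = norm (star x * lmult (star v * v) x)"
        by (simp only: norm_star_mult_self[symmetric] lmult_star)
      also have "\<dots> \<le> norm x * (lnorm (star v * v) * norm x)"
        by (rule order_trans[OF norm_mult_ineq]) (simp add: mult_left_mono norm_lmult_le)
      also have "\<dots> = (sqrt (lnorm (star v * v)) * norm x)\<^sup>2"
        by (simp add: power_mult_distrib lnorm_nonneg) (simp add: power2_eq_square)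
      finally show "norm (lmult v x) \<le> sqrt (lnorm (star v * v)) * norm x"
        by (rule power2_le_imp_le) (simp add: lnorm_nonneg)
    qed (simp add: lnorm_nonneg)
    then have "(lnorm v)\<^sup>2 \<le> (sqrt (lnorm (star v * v)))\<^sup>2" by (rule power_mono) (rule lnorm_nonneg)
    then show ?thesis by (simp add: lnorm_nonneg)
  qed
  have le': "lnorm v \<le> lnorm (star v)" for v :: "'a unitization"
  proof (cases "lnorm v = 0")
    case False
    have "lnorm v * lnorm v \<le> lnorm (star v) * lnorm v"
      using le[of v] lnorm_mult[of "star v" v] by (simp add: power2_eq_square)
    with False lnorm_nonneg[of v] show ?thesis by simp
  qed (simp add: lnorm_nonneg)
  have "star (star u) = u" by (simp add: star_unitization_def star_star unitization.expand)
  then have "lnorm (star u) = lnorm u" using le'[of u] le'[of "star u"] by simp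
  then show ?thesis using le[of u] lnorm_mult[of "star u" u] by (simp add: power2_eq_square)
qed

instance
proof
  fix u v :: "'a unitization" and c d :: complex and r :: real
  show "scaleC c (u + v) = scaleC c u + scaleC c v" "scaleC (c + d) u = scaleC c u + scaleC d u"
    "scaleC c (scaleC d u) = scaleC (c * d) u" "scaleC (complex_of_real r) u = r *\<^sub>R u"
    "scaleC c u * v = scaleC c (u * v)" "u * scaleC c v = scaleC c (u * v)"
    "star (u + v) = star u + star v" "star (scaleC c u) = scaleC (cnj c) (star u)"
    "star (u * v) = star v * star u" "star (star u) = u"
    by (simp_all add: scaleC_unitization_def star_unitization_def unitization_defs algebra_simps
        scaleC_add_right scaleC_add_left scaleC_mult_left scaleC_mult_right scaleC_scaleC scaleC_of_real
        star_simps scaleR_conv_of_real unitization.expand)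
  have lC: "lmult (scaleC c u) x = scaleC c (lmult u x)" for c u and x :: 'a
    by (simp add: lmult_def scaleC_unitization_def scaleC_mult_left scaleC_add_right scaleC_scaleC)
  have "lnorm (scaleC c u) = cmod c * lnorm u"
  proof (rule antisym)
    have le: "lnorm (scaleC c u) \<le> cmod c * lnorm u" for c and u :: "'a unitization"
    proof (rule lnorm_le)
      fix x :: 'a
      show "norm (lmult (scaleC c u) x) \<le> cmod c * lnorm u * norm x"
        by (simp add: lC norm_scaleC mult.assoc mult_left_mono norm_lmult_le)
    qed (simp add: lnorm_nonneg)
    show "lnorm (scaleC c u) \<le> cmod c * lnorm u" by (rule le)
    show "cmod c * lnorm u \<le> lnorm (scaleC c u)"
    proof (cases "c = 0")
      case False
      have "scaleC (inverse c) (scaleC c u) = u"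
        using False by (simp add: scaleC_unitization_def scaleC_scaleC unitization.expand)
      then have "lnorm u \<le> inverse (cmod c) * lnorm (scaleC c u)"
        using le[of "inverse c" "scaleC c u"] by (simp add: norm_inverse)
      with False show ?thesis by (simp add: field_simps)
    qed (simp add: lnorm_nonneg)
  qed
  then show "norm (scaleC c u) = cmod c * norm u"
    by (simp add: norm_unitization_def scaleC_unitization_def[of c u] norm_mult max_mult_distrib_left)
  show "norm (star u * u) = (norm u)\<^sup>2"
  proof -
    have "max x y ^ 2 = max (x ^ 2) (y ^ 2)" if "0 \<le> x" "0 \<le> y" for x y :: real
      using that power_mono[of x y 2] power_mono[of y x 2] by (auto simp: max_def)
    moreover have "cmod (uscal (star u * u)) = cmod (uscal u) ^ 2"
      by (simp add: times_unitization_def star_unitization_def norm_mult power2_eq_square)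
    ultimately show ?thesis
      by (simp add: norm_unitization_def lnorm_star_mult_self lnorm_nonneg)
  qed
qed

end

lemma emb_simps:
  "emb (x + y) = emb x + emb y" "emb (x - y) = emb x - emb y" "emb (- x) = - emb x"
  "emb (x * y) = emb x * emb y" "emb (star x) = star (emb x)" "emb (scaleC c x) = scaleC c (emb x)"
  "emb (r *\<^sub>R x) = r *\<^sub>R emb x" "emb 0 = 0"
  by (simp_all add: unitization_defs star_unitization_def scaleC_unitization_def)

lemma emb_sum: "emb (\<Sum>i\<in>I. f i) = (\<Sum>i\<in>I. emb (f i))"
  by (induction I rule: infinite_finite_induct) (simp_all add: emb_simps)

lemma bounded_linear_emb: "bounded_linear emb"
  by (rule bounded_linear_intro[where K = 1]) (simp_all add: emb_simps norm_emb)

lemmas tendsto_emb [tendsto_intros] = bounded_linear.tendsto[OF bounded_linear_emb]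

lemma tendsto_emb_iff: "(\<lambda>n. emb (f n)) \<longlonglongrightarrow> emb l \<longleftrightarrow> f \<longlonglongrightarrow> l"
  unfolding tendsto_iff dist_norm by (simp add: norm_emb flip: emb_simps)

lemma cstar_subalgebra_emb:
  assumes "cstar_subalgebra B" shows "cstar_subalgebra (emb ` B)"
proof -
  have "closed (emb ` B)"
    unfolding closed_sequential_limits
  proof (intro allI impI, elim conjE)
    fix x l assume x: "\<forall>n. x n \<in> emb ` B" "x \<longlonglongrightarrow> l"
    from x(1) have "\<forall>n. \<exists>b. b \<in> B \<and> x n = emb b" by blast
    then obtain y where "\<forall>n. y n \<in> B \<and> x n = emb (y n)" using choice by meson
    then have y: "y n \<in> B" "x n = emb (y n)" for n by simp_all
    have "Cauchy x" using x(2) by (rule LIMSEQ_imp_Cauchy)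
    then have "Cauchy y"
      unfolding Cauchy_def dist_norm y(2) by (simp add: norm_emb flip: emb_simps)
    then obtain m where m: "y \<longlonglongrightarrow> m" by (auto simp: Cauchy_convergent_iff convergent_def)
    have "m \<in> B" using closed_sequentially[OF cstar_subalgebraD(1)[OF assms] y(1) m] .
    moreover have "x \<longlonglongrightarrow> emb m" using m tendsto_emb_iff[of y m] y(2) by presburger
    ultimately show "l \<in> emb ` B" using x(2) LIMSEQ_unique by blast
  qed
  then show ?thesis unfolding cstar_subalgebra_def
    using cstar_subalgebraD[OF assms] by (auto simp flip: emb_simps)
qed

section \<open>Functional calculus without unit\<close>

text \<open>For continuous \<open>f\<close> with \<open>f 0 = 0\<close> and self-adjoint
  \<open>c\<close> the unital calculus stays in the image of \<open>emb\<close>, so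
  \<open>upart\<close> loses nothing; this is \<open>emb_nfc\<close>.\<close>

definition nfc :: "(real \<Rightarrow> real) \<Rightarrow> 'a::cstar_algebra \<Rightarrow> 'a"
  where "nfc f c = upart (cfc f (emb c))"

lemma cstar_subalgebra_UNIV: "cstar_subalgebra UNIV"
  by (simp add: cstar_subalgebra_def)

lemma star_emb: "star c = c \<Longrightarrow> star (emb c) = emb c"
  by (simp flip: emb_simps)

context
  fixes c :: "'a::cstar_algebra" and f :: "real \<Rightarrow> real"
  assumes c: "star c = c" and f: "continuous_on UNIV f" "f 0 = 0"
begin

lemma cfc_emb_in:
  assumes "cstar_subalgebra B" "c \<in> B" shows "cfc f (emb c) \<in> emb ` B"
  using assms by (intro cfc_in_subalgebra cstar_subalgebra_emb star_emb c f) auto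

lemma emb_nfc: "emb (nfc f c) = cfc f (emb c)"
  using cfc_emb_in[OF cstar_subalgebra_UNIV] by (auto simp: nfc_def)

lemma nfc_in: "cstar_subalgebra B \<Longrightarrow> c \<in> B \<Longrightarrow> nfc f c \<in> B"
  using cfc_emb_in by (fastforce simp: nfc_def)

lemma star_nfc: "star (nfc f c) = nfc f c"
proof -
  have "emb (star (nfc f c)) = emb (nfc f c)"
    by (simp only: emb_simps emb_nfc star_cfc[OF star_emb[OF c] f(1)])
  then show ?thesis by simp
qed

end

lemma rpoly_at_altdef: "rpoly_at p x = (\<Sum>i\<le>degree p. coeff p i *\<^sub>R x ^ i)"
proof (induction p)
  case (pCons a p)
  show ?case
  proof (cases "p = 0")
    case False
    have "(\<Sum>i\<le>degree (pCons a p). coeff (pCons a p) i *\<^sub>R x ^ i) =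
      a *\<^sub>R 1 + (\<Sum>i\<le>degree p. coeff p i *\<^sub>R (x * x ^ i))"
      using False by (simp add: sum.atMost_Suc_shift del: sum.atMost_Suc)
    also have "(\<Sum>i\<le>degree p. coeff p i *\<^sub>R (x * x ^ i)) = x * rpoly_at p x"
      by (simp add: pCons.IH sum_distrib_left)
    finally show ?thesis by (simp add: of_real_def)
  qed (simp add: of_real_def)
qed simp

lemma emb_power_Suc: "emb (power_Suc x k) = emb x ^ Suc k"
  by (induction k) (simp_all add: emb_simps)

lemma emb_poly_at:
  assumes "poly p 0 = 0" shows "emb (poly_at p x) = rpoly_at p (emb x)"
proof -
  have "rpoly_at p (emb x) = (\<Sum>i<Suc (degree p). coeff p i *\<^sub>R emb x ^ i)"
    by (simp add: rpoly_at_altdef lessThan_Suc_atMost)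
  also have "\<dots> = (\<Sum>i<degree p. coeff p (Suc i) *\<^sub>R emb x ^ Suc i)"
    using assms by (subst sum.lessThan_Suc_shift) (simp add: poly_0_coeff_0)
  finally show ?thesis by (simp only: poly_at_def emb_sum emb_simps emb_power_Suc)
qed

lemma real_spectrum_subset_spectrum_in:
  assumes "t \<in> real_spectrum (emb c)" shows "complex_of_real t \<in> spectrum_in A c"
proof (rule ccontr)
  assume "complex_of_real t \<notin> spectrum_in A c"
  then obtain b where t: "t \<noteq> 0" and b: "inverse t *\<^sub>R c + b - inverse t *\<^sub>R c * b = 0"
    "inverse t *\<^sub>R c + b - b * inverse t *\<^sub>R c = 0"
    by (auto simp: spectrum_in_def Let_def simp flip: scaleC_of_real)
  define a where "a = inverse t *\<^sub>R c"
  have "(1 - emb a) * (1 - emb b) = 1 - emb (a + b - a * b)"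
    "(1 - emb b) * (1 - emb a) = 1 - emb (a + b - b * a)"
    by (simp_all only: emb_simps) (simp_all add: algebra_simps)
  then have "(1 - emb a) * (1 - emb b) = 1" "(1 - emb b) * (1 - emb a) = 1"
    using b by (simp_all only: a_def emb_simps) simp_all
  then have "invertible_elt (1 - emb a)" by (auto simp: invertible_elt_def)
  then have "invertible_elt (t *\<^sub>R (1 - emb a))" using t by (simp add: invertible_elt_scaleR)
  moreover have "t *\<^sub>R (1 - emb a) = of_real t - emb c"
    using t unfolding a_def emb_simps by (simp add: scaleR_diff_right of_real_def)
  ultimately show False using assms by (simp add: real_spectrum_def)
qed

text \<open>For \<open>t\<close> beyond the norm the quasi-inverse of \<open>c / t\<close> is
  \<open>g(c)\<close> with \<open>g s = s / (s - t)\<close>, and \<open>g 0 = 0\<close> places it in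
  \<open>A\<close>.\<close>

lemma spectrum_in_bounded:
  assumes A: "cstar_subalgebra A" "c \<in> A" and c: "star c = c"
    and t: "complex_of_real t \<in> spectrum_in A c"
  shows "\<bar>t\<bar> \<le> norm c"
proof (rule ccontr)
  assume tn: "\<not> \<bar>t\<bar> \<le> norm c"
  define n where "n = norm c"
  \<comment> \<open>Clamping to \<open>{-n..n}\<close> makes \<open>g\<close> continuous on the
    whole line without changing it on the spectrum.\<close>
  define h where "h s = max (- n) (min n s)" for s
  define g where "g s = h s / (h s - t)" for s
  have ne: "h s \<noteq> t" for s using tn by (auto simp: h_def n_def max_def min_def)
  have g: "continuous_on UNIV g" "g 0 = 0"
    unfolding g_def using ne by (auto intro!: continuous_intros simp: h_def n_def)
  define b where "b = nfc g c"
  define a where "a = inverse t *\<^sub>R c"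
  have t0: "t \<noteq> 0" using tn by auto
  have sc: "star (emb c) = emb c" by (rule star_emb[OF c])
  define a' where "a' s = inverse t * s" for s
  have a': "continuous_on UNIV a'" unfolding a'_def by (intro continuous_intros)
  have ea: "emb a = cfc a' (emb c)"
    unfolding a_def a'_def emb_simps cfc_scaleR[OF sc continuous_on_id] cfc_ident[OF sc] ..
  have eb: "emb b = cfc g (emb c)" unfolding b_def by (rule emb_nfc[OF c g])
  have z: "cfc (\<lambda>s. a' s + g s - a' s * g s) (emb c) = cfc (\<lambda>s. 0) (emb c)"
  proof (rule cfc_cong)
    fix s assume "s \<in> real_spectrum (emb c)"
    then have "\<bar>s\<bar> \<le> n" using real_spectrum_le_norm[of s "emb c"] by (simp add: norm_emb n_def)
    then have "h s = s" by (simp add: h_def)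
    then show "a' s + g s - a' s * g s = 0"
      using ne[of s] t0 unfolding g_def a'_def by (simp add: field_simps)
  qed
  have m: "cfc (\<lambda>s. a' s * g s) (emb c) = emb a * emb b" "cfc (\<lambda>s. g s * a' s) (emb c) = emb b * emb a"
    unfolding ea eb by (rule cfc_mult[OF sc a' g(1)], rule cfc_mult[OF sc g(1) a'])
  have "cfc (\<lambda>s. a' s + g s - a' s * g s) (emb c) = emb a + emb b - emb a * emb b"
    unfolding cfc_diff[OF sc continuous_on_add[OF a' g(1)] continuous_on_mult[OF a' g(1)]]
      cfc_add[OF sc a' g(1)] m(1) by (simp only: ea eb)
  then have 1: "emb a + emb b - emb a * emb b = 0" using z sc by (simp add: cfc_const)
  have "emb a * emb b = emb b * emb a" using m by (simp add: mult.commute)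
  with 1 have 2: "emb a + emb b - emb b * emb a = 0" by simp
  have "emb (a + b - a * b) = emb 0" "emb (a + b - b * a) = emb 0"
    using 1 2 by (simp_all only: emb_simps)
  then have ab: "a + b - a * b = 0" "a + b - b * a = 0" by (simp_all only: unitization.inject)
  have bA: "b \<in> A" unfolding b_def by (rule nfc_in[OF c g A])
  have aC: "scaleC (inverse (complex_of_real t)) c = a"
    unfolding a_def by (simp flip: scaleC_of_real)
  have "\<exists>b\<in>A. (let a = scaleC (inverse (complex_of_real t)) c in a + b - a * b = 0 \<and> a + b - b * a = 0)"
    unfolding aC Let_def using ab bA by blast
  then show False using t t0 unfolding spectrum_in_def by simp
qed

text \<open>The real points of \<open>spectrum_in A c\<close> lie between
  \<open>real_spectrum (emb c)\<close> and the interval \<open>{- norm c..norm c}\<close>. The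
  interval supplies approximating polynomials and the smaller set makes the limit unique, so the
  spectrum itself need not be determined.\<close>

theorem fun_calc_eq_nfc:
  assumes A: "cstar_subalgebra A" "c \<in> A" and c: "star c = c"
    and f: "continuous_on UNIV f" "f 0 = 0"
  shows "fun_calc A f c = nfc f c"
  unfolding fun_calc_def
proof (rule the_equality)
  define S where "S = {t. complex_of_real t \<in> spectrum_in A c}"
  have sc: "star (emb c) = emb c" by (rule star_emb[OF c])
  obtain p where p: "uniform_limit {- norm c..norm c} (\<lambda>n t. poly (p n) t) f sequentially"
    using poly_approx_seq[OF f(1)] by blast
  define q where "q n = p n - [:poly (p n) 0:]" for n
  have p0: "(\<lambda>n. poly (p n) 0) \<longlonglongrightarrow> 0"
    using tendsto_uniform_limitI[OF p, of 0] f(2) by simp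
  then have "uniform_limit {- norm c..norm c} (\<lambda>n t. poly (p n) 0) (\<lambda>t. 0) sequentially"
    unfolding uniform_limit_iff tendsto_iff by (auto elim: eventually_mono)
  from uniform_limit_minus[OF p this]
  have q: "uniform_limit {- norm c..norm c} (\<lambda>n t. poly (q n) t) f sequentially"
    by (simp add: q_def)
  have "S \<subseteq> {- norm c..norm c}"
    using spectrum_in_bounded[OF A c] by (fastforce simp: S_def)
  then have u: "uniform_limit S (\<lambda>n t. poly (q n) t) f sequentially"
    using uniform_limit_on_subset[OF q] by blast
  have sub: "real_spectrum (emb c) \<subseteq> S"
    using real_spectrum_subset_spectrum_in unfolding S_def by blast
  have "(\<lambda>n. rpoly_at (q n) (emb c)) \<longlonglongrightarrow> cfc f (emb c)"
    by (rule cfc_limit[OF sc uniform_limit_on_subset[OF u sub]])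
  then have "(\<lambda>n. emb (poly_at (q n) c)) \<longlonglongrightarrow> emb (nfc f c)"
    by (simp add: emb_poly_at emb_nfc[OF c f] q_def)
  then have "(\<lambda>n. poly_at (q n) c) \<longlonglongrightarrow> nfc f c" by (simp add: tendsto_emb_iff)
  then show "\<exists>p. (\<forall>n. poly (p n) 0 = 0) \<and>
      uniform_limit {t. complex_of_real t \<in> spectrum_in A c} (\<lambda>n t. poly (p n) t) f sequentially \<and>
      (\<lambda>n. poly_at (p n) c) \<longlonglongrightarrow> nfc f c"
    using u by (intro exI[of _ q]) (simp add: S_def q_def)
  fix d assume "\<exists>p. (\<forall>n. poly (p n) 0 = 0) \<and>
      uniform_limit {t. complex_of_real t \<in> spectrum_in A c} (\<lambda>n t. poly (p n) t) f sequentially \<and>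
      (\<lambda>n. poly_at (p n) c) \<longlonglongrightarrow> d"
  then obtain r where r: "\<And>n. poly (r n) 0 = 0" "uniform_limit S (\<lambda>n t. poly (r n) t) f sequentially"
    "(\<lambda>n. poly_at (r n) c) \<longlonglongrightarrow> d" unfolding S_def by blast
  have "(\<lambda>n. rpoly_at (r n) (emb c)) \<longlonglongrightarrow> emb d"
    using tendsto_emb[OF r(3)] by (simp add: emb_poly_at r(1))
  then have "cfc f (emb c) = emb d"
    by (rule cfc_eqI[OF sc uniform_limit_on_subset[OF r(2) sub]])
  then show "d = nfc f c" by (simp add: nfc_def)
qed

lemma cut_down_eq:
  assumes "cstar_subalgebra A" "c \<in> A" "star c = c" "0 \<le> e"
  shows "cut_down A c e = nfc (\<lambda>t. max (t - e) 0) c"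
  unfolding cut_down_def using assms by (intro fun_calc_eq_nfc) (auto intro!: continuous_intros)

section \<open>Local units\<close>

text \<open>Let \<open>S\<close> be the sum of all \<open>b * star b + star b * b\<close> and
  \<open>u = S / (S + k)\<close>. Then \<open>(norm (u * b - b))\<^sup>2\<close> is at most
  \<open>norm ((1 - u) * S * (1 - u))\<close>, and
  \<open>k\<^sup>2 t / (t + k)\<^sup>2 \<le> k\<close> on the spectrum of \<open>S\<close>. The
  choice \<open>k = (e / 2)\<^sup>2\<close> gives a strict bound by \<open>e\<close>.\<close>

lemma local_unit:
  fixes B :: "'a::cstar_algebra set"
  assumes B: "cstar_subalgebra B" and F: "finite F" "F \<subseteq> B" and e: "0 < e"
  shows "\<exists>u\<in>B. star u = u \<and> norm u \<le> 1 \<and> (\<forall>b\<in>F. norm (u * b - b) < e \<and> norm (b * u - b) < e)"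
proof -
  define S where "S = (\<Sum>b\<in>F. b * star b + star b * b)"
  have SB: "S \<in> B" unfolding S_def
    using F by (intro cstar_subalgebra_sum[OF B] cstar_subalgebraD(3,4,6)[OF B]) auto
  have sS: "star S = S" by (simp add: S_def star_sum star_simps)
  define T where "T = emb S"
  have T: "T = (\<Sum>b\<in>F. emb b * star (emb b) + star (emb b) * emb b)"
    by (simp only: T_def S_def emb_sum emb_simps)
  have sT: "star T = T" unfolding T_def by (rule star_emb[OF sS])
  define k where "k = (e / 2)\<^sup>2"
  have k: "k > 0" using e by (simp add: k_def)
  have nz: "\<bar>t\<bar> + k \<noteq> 0" for t :: real using k abs_ge_zero[of t] by linarith
  define f where "f t = \<bar>t\<bar> / (\<bar>t\<bar> + k)" for t
  define h where "h t = k / (\<bar>t\<bar> + k)" for t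
  have f: "continuous_on UNIV f" "f 0 = 0" unfolding f_def using nz by (auto intro!: continuous_intros)
  have h: "continuous_on UNIV h" unfolding h_def using nz by (auto intro!: continuous_intros)
  define u where "u = nfc f S"
  define y where "y = cfc h T"
  have sy: "star y = y" unfolding y_def using sT h by simp
  have ey: "emb u = 1 - y"
  proof -
    have "cfc (\<lambda>t. f t + h t) T = cfc (\<lambda>t. 1) T"
      by (rule cfc_cong) (use nz in \<open>simp add: f_def h_def flip: add_divide_distrib\<close>)
    then have "cfc f T + y = 1" using sT by (simp add: y_def cfc_add[OF sT f(1) h] cfc_const)
    then show ?thesis by (simp add: u_def T_def emb_nfc[OF sS f] eq_diff_eq)
  qed
  have nu: "norm u \<le> 1"
  proof -
    have "norm (cfc f T) \<le> 1"
      by (rule cfc_norm_le[OF sT f(1)]) (use k in \<open>simp add: f_def abs_mult\<close>)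
    then show ?thesis by (simp add: u_def T_def emb_nfc[OF sS f, symmetric] norm_emb)
  qed
  have bound: "norm (y * R * y) \<le> k" if R: "cpos R" "cpos (T - R)" for R
  proof -
    have pT: "cpos T" using cpos_add[OF R] by simp
    have "norm (y * R * y) \<le> norm (y * T * y)"
    proof (rule cpos_norm_mono)
      show "cpos (y * R * y)" using cpos_conj[OF R(1), of y] by (simp add: sy)
      show "cpos (y * T * y - y * R * y)"
        using cpos_conj[OF R(2), of y] by (simp add: sy algebra_simps)
    qed
    also have "y * T * y = cfc (\<lambda>t. h t * t * h t) T"
      using sT h by (simp add: y_def cfc_mult cfc_ident continuous_on_mult continuous_on_id)
    also have "norm \<dots> \<le> k"
    proof (rule cfc_norm_le[OF sT])
      fix t assume "t \<in> real_spectrum T"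
      then have t: "0 \<le> t" using pT by (auto simp: cpos_def)
      have "k * t \<le> (t + k) * (t + k)" using t k by (simp add: algebra_simps)
      then have "k * (k * t) \<le> k * ((t + k) * (t + k))" using k by simp
      moreover have "t + k > 0" using t k by simp
      moreover have "h t * t * h t = k * (k * t) / ((t + k) * (t + k))" using t by (simp add: h_def)
      ultimately show "\<bar>h t * t * h t\<bar> \<le> k" using t k by (simp add: pos_divide_le_eq)
    qed (intro continuous_intros h)
    finally show ?thesis .
  qed
  have pos: "cpos (emb b * star (emb b) + star (emb b) * emb b)" for b :: 'a
    by (intro cpos_add cpos_star_mult_self cpos_mult_star_self)
  have rest: "cpos (T - (emb b * star (emb b) + star (emb b) * emb b))" if "b \<in> F" for b
    unfolding T sum.remove[OF F(1) that] by (simp add: cpos_sum pos)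
  have small: "norm (u * b - b) < e" "norm (b * u - b) < e" if b: "b \<in> F" for b
  proof -
    have 1: "cpos (T - emb b * star (emb b))" "cpos (T - star (emb b) * emb b)"
      using cpos_add[OF rest[OF b] cpos_star_mult_self[of "emb b"]]
        cpos_add[OF rest[OF b] cpos_mult_star_self[of "emb b"]] by (simp_all add: algebra_simps)
    have lt: "n < e" if "n\<^sup>2 \<le> k" "0 \<le> n" for n
      using that e power2_le_imp_le[of n "e / 2"] by (simp add: k_def)
    have "emb (u * b - b) = - (y * emb b)" by (simp only: emb_simps ey) (simp add: algebra_simps)
    then have "norm (u * b - b) ^ 2 = norm (y * (emb b * star (emb b)) * y)"
      using norm_mult_star_self[of "y * emb b"] norm_emb[of "u * b - b"]
      by (simp add: star_mult sy mult.assoc)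
    also have "\<dots> \<le> k" by (rule bound[OF cpos_mult_star_self 1(1)])
    finally show "norm (u * b - b) < e" by (rule lt) simp
    have "emb (b * u - b) = - (emb b * y)" by (simp only: emb_simps ey) (simp add: algebra_simps)
    then have "norm (b * u - b) ^ 2 = norm (y * (star (emb b) * emb b) * y)"
      using norm_star_mult_self[of "emb b * y"] norm_emb[of "b * u - b"]
      by (simp add: star_mult sy mult.assoc)
    also have "\<dots> \<le> k" by (rule bound[OF cpos_star_mult_self 1(2)])
    finally show "norm (b * u - b) < e" by (rule lt) simp
  qed
  have "u \<in> B" unfolding u_def by (rule nfc_in[OF sS f B SB])
  moreover have "star u = u" unfolding u_def by (rule star_nfc[OF sS f])
  ultimately show ?thesis using nu small by blast
qed

section \<open>Cuntz subequivalence\<close>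

lemma cuntz_le_iff:
  "cuntz_le A a b \<longleftrightarrow> (\<forall>e>0. \<exists>v\<in>A. norm (a - v * b * star v) < e)"
proof
  assume "cuntz_le A a b"
  then obtain v where v: "\<And>n. v n \<in> A" "(\<lambda>n. norm (a - v n * b * star (v n))) \<longlonglongrightarrow> 0"
    by (auto simp: cuntz_le_def)
  show "\<forall>e>0. \<exists>v\<in>A. norm (a - v * b * star v) < e"
  proof (intro allI impI)
    fix e :: real assume "e > 0"
    then have "\<exists>N. \<forall>n\<ge>N. norm (a - v n * b * star (v n)) < e"
      using LIMSEQ_D[OF v(2), of e] by simp
    then show "\<exists>v\<in>A. norm (a - v * b * star v) < e" using v(1) by blast
  qed
next
  assume r: "\<forall>e>0. \<exists>v\<in>A. norm (a - v * b * star v) < e"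
  have "\<forall>n. \<exists>v. v \<in> A \<and> norm (a - v * b * star v) < inverse (real (Suc n))"
    using r by (metis inverse_positive_iff_positive of_nat_0_less_iff zero_less_Suc)
  then obtain v where v: "\<And>n. v n \<in> A" "\<And>n. norm (a - v n * b * star (v n)) < inverse (real (Suc n))"
    by metis
  have "(\<lambda>n. norm (a - v n * b * star (v n))) \<longlonglongrightarrow> 0"
    by (rule tendsto_sandwich[OF _ _ tendsto_const LIMSEQ_inverse_real_of_nat])
      (auto intro!: always_eventually less_imp_le v simp del: of_nat_Suc)
  then show "cuntz_le A a b" using v(1) by (auto simp: cuntz_le_def)
qed

lemma cuntz_le_trans:
  assumes A: "cstar_subalgebra A" and ab: "cuntz_le A a b" and bc: "cuntz_le A b c"
  shows "cuntz_le A a c"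
  unfolding cuntz_le_iff
proof (intro allI impI)
  fix e :: real assume e: "e > 0"
  obtain v where v: "v \<in> A" "norm (a - v * b * star v) < e / 2"
    using ab e unfolding cuntz_le_iff by (meson half_gt_zero)
  define M where "M = (norm v)\<^sup>2 + 1"
  have M: "M > 0" by (simp add: M_def add_nonneg_pos)
  obtain w where w: "w \<in> A" "norm (b - w * c * star w) < e / (2 * M)"
    using bc e M unfolding cuntz_le_iff by (metis divide_pos_pos mult_pos_pos zero_less_numeral)
  have "a - (v * w) * c * star (v * w) = (a - v * b * star v) + v * (b - w * c * star w) * star v"
    by (simp add: star_mult algebra_simps)
  then have "norm (a - (v * w) * c * star (v * w)) \<le>
      norm (a - v * b * star v) + norm (v * (b - w * c * star w) * star v)"
    by (metis norm_triangle_ineq)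
  also have "norm (v * (b - w * c * star w) * star v) \<le> norm v * (e / (2 * M)) * norm v"
    using w(2) e M by (intro order_trans[OF norm_mult_ineq] mult_mono order_trans[OF norm_mult_ineq]) auto
  also have "\<dots> \<le> M * (e / (2 * M))" using e M by (simp add: M_def power2_eq_square divide_right_mono mult_right_mono)
  also have "\<dots> = e / 2" using M by simp
  finally have "norm (a - (v * w) * c * star (v * w)) < e" using v(2) by simp
  then show "\<exists>v\<in>A. norm (a - v * c * star v) < e"
    using cstar_subalgebraD(4)[OF A v(1) w(1)] by blast
qed

lemma cuntz_le_conj: "x \<in> A \<Longrightarrow> cuntz_le A (x * b * star x) b"
  unfolding cuntz_le_iff by (metis norm_zero diff_self)

text \<open>With \<open>g t = t / (t + d)\<close> and \<open>k(t)\<^sup>2 t = g(t)\<^sup>2\<close>,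
  the witness \<open>v = sqrt(p) k(q)\<close> leaves the error
  \<open>sqrt(p) w(q)\<^sup>2 sqrt(p)\<close>, where \<open>w\<^sup>2 = 1 - g\<^sup>2\<close>. Its
  norm equals that of \<open>w(q) p w(q)\<close>, is at most that of \<open>w(q) q w(q)\<close>, and
  \<open>(1 + g t) (1 - g t) t \<le> 2 * d\<close>.\<close>

lemma cuntz_le_of_le:
  fixes p q :: "'a::cstar_algebra"
  assumes A: "cstar_subalgebra A" "p \<in> A" "q \<in> A"
    and p: "cpos (emb p)" and pq: "cpos (emb q - emb p)"
  shows "cuntz_le A p q"
  unfolding cuntz_le_iff
proof (intro allI impI)
  fix e :: real assume e: "e > 0"
  define d where "d = e / 4"
  have d: "d > 0" using e by (simp add: d_def)
  have q: "cpos (emb q)" using cpos_add[OF p pq] by simp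
  have sp: "star p = p" "star q = q"
    using cpos_star[OF p] cpos_star[OF q] by (simp_all flip: emb_simps)
  note se = star_emb[OF sp(1)] star_emb[OF sp(2)]
  have nz: "\<bar>t\<bar> + d \<noteq> 0" for t :: real using d abs_ge_zero[of t] by linarith
  define k where "k t = sqrt \<bar>t\<bar> / (\<bar>t\<bar> + d)" for t
  define g where "g t = \<bar>t\<bar> / (\<bar>t\<bar> + d)" for t
  define w where "w t = sqrt (1 - g t * g t)" for t
  have k: "continuous_on UNIV k" "k 0 = 0" unfolding k_def using nz by (auto intro!: continuous_intros)
  have g: "continuous_on UNIV g" unfolding g_def using nz by (auto intro!: continuous_intros)
  have w: "continuous_on UNIV w" unfolding w_def by (intro continuous_intros g)
  have s: "continuous_on UNIV sqrt" "sqrt 0 = 0" by (auto intro!: continuous_intros)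
  have g01: "0 \<le> g t" "g t \<le> 1" for t using d by (auto simp: g_def)
  define P where "P = cfc sqrt (emb p)"
  define W where "W = cfc w (emb q)"
  have sP: "star P = P" and sW: "star W = W" unfolding P_def W_def using se s w by simp_all
  have PP: "P * P = emb p" unfolding P_def by (rule sqrt_cfc[OF p])
  define v where "v = nfc sqrt p * nfc k q"
  have v: "v \<in> A" unfolding v_def
    by (intro cstar_subalgebraD(4)[OF A(1)] nfc_in[OF sp(1) s A(1,2)] nfc_in[OF sp(2) k A(1,3)])
  have K: "cfc k (emb q) * emb q * cfc k (emb q) = cfc (\<lambda>t. k t * t * k t) (emb q)"
    using se k by (simp add: cfc_mult cfc_ident continuous_on_mult continuous_on_id)
  have "cfc (\<lambda>t. k t * t * k t) (emb q) = cfc (\<lambda>t. 1 - w t * w t) (emb q)"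
  proof (rule cfc_cong)
    fix t assume "t \<in> real_spectrum (emb q)"
    then have "0 \<le> t" using q by (auto simp: cpos_def)
    moreover have "g t * g t \<le> 1" using g01[of t] by (simp add: mult_le_one)
    ultimately show "k t * t * k t = 1 - w t * w t" by (simp add: k_def w_def g_def)
  qed
  also have "\<dots> = 1 - W * W"
    using se w by (simp add: cfc_diff cfc_const cfc_mult continuous_on_mult W_def)
  finally have KW: "cfc k (emb q) * emb q * cfc k (emb q) = 1 - W * W" using K by simp
  have "emb (v * q * star v) = P * (cfc k (emb q) * emb q * cfc k (emb q)) * P"
    unfolding v_def star_mult star_nfc[OF sp(1) s] star_nfc[OF sp(2) k] emb_simps
      emb_nfc[OF sp(1) s] emb_nfc[OF sp(2) k] P_def by (simp only: mult.assoc)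
  also have "\<dots> = emb p - P * W * (W * P)"
    unfolding KW by (simp add: right_diff_distrib left_diff_distrib PP mult.assoc)
  finally have "emb (p - v * q * star v) = star (W * P) * (W * P)"
    unfolding star_mult sP sW by (simp add: emb_simps)
  then have "norm (p - v * q * star v) = norm (star (W * P) * (W * P))" by (metis norm_emb)
  also have "\<dots> = norm (W * P * star (W * P))" by (simp only: norm_star_mult_self norm_mult_star_self)
  also have "W * P * star (W * P) = W * emb p * W"
    unfolding star_mult sP sW PP[symmetric] by (simp only: mult.assoc)
  also have "norm \<dots> \<le> norm (W * emb q * W)"
  proof (rule cpos_norm_mono)
    show "cpos (W * emb p * W)" using cpos_conj[OF p, of W] by (simp add: sW)
    show "cpos (W * emb q * W - W * emb p * W)"
      using cpos_conj[OF pq, of W] by (simp add: sW algebra_simps)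
  qed
  also have "W * emb q * W = cfc (\<lambda>t. w t * t * w t) (emb q)"
    unfolding W_def using se w by (simp add: cfc_mult cfc_ident continuous_on_mult continuous_on_id)
  also have "norm \<dots> \<le> 2 * d"
  proof (rule cfc_norm_le[OF se(2)])
    fix t assume "t \<in> real_spectrum (emb q)"
    then have t: "0 \<le> t" using q by (auto simp: cpos_def)
    have gg: "g t * g t \<le> 1" using g01[of t] by (simp add: mult_le_one)
    have td: "t + d > 0" using t d by simp
    have "w t * t * w t = (1 - g t * g t) * t" using gg by (simp add: w_def)
    also have "\<dots> = (1 + g t) * ((1 - g t) * t)" by (simp add: algebra_simps)
    also have "(1 - g t) * t = d * (t / (t + d))" using t td by (simp add: g_def field_simps)
    also have "(1 + g t) * (d * (t / (t + d))) \<le> 2 * (d * 1)"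
      using t td d g01[of t] by (intro mult_mono) auto
    finally show "\<bar>w t * t * w t\<bar> \<le> 2 * d"
      using gg t by (simp add: w_def)
  qed (intro continuous_intros w)
  also have "2 * d < e" using e by (simp add: d_def)
  finally show "\<exists>v\<in>A. norm (p - v * q * star v) < e" using v by blast
qed

text \<open>For \<open>m = norm (c - c') + d\<close> one has
  \<open>c - m \<le> c' - d \<le> max (c' - d) 0\<close>. Conjugation by \<open>R = r(c)\<close>
  turns the left side into the cut-down of \<open>c\<close> at \<open>e\<close>, because
  \<open>r(t)\<^sup>2 (t - m) = max (t - e) 0\<close>; the gap \<open>m < e\<close> makes
  \<open>r\<close> continuous.\<close>

lemma cuntz_le_perturb:
  fixes c c' :: "'a::cstar_algebra"
  assumes A: "cstar_subalgebra A" "c \<in> A" "c' \<in> A" and sc: "star c = c" "star c' = c'"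
    and d: "0 \<le> d" "norm (c - c') + d < e"
  shows "cuntz_le A (nfc (\<lambda>t. max (t - e) 0) c) (nfc (\<lambda>t. max (t - d) 0) c')"
proof -
  define m where "m = norm (c - c') + d"
  have m: "m < e" "0 \<le> m" "d \<le> m" "norm (c - c') = m - d" using d by (auto simp: m_def)
  have e: "e > 0" using m by simp
  define f where "f t = max (t - e) 0" for t
  define f' where "f' t = max (t - d) 0" for t
  define r where "r t = sqrt (max (t - e) 0 / (max t e - m))" for t
  have nz: "max t e - m \<noteq> 0" for t using m by (auto simp: max_def)
  have f: "continuous_on UNIV f" "f 0 = 0" unfolding f_def using e by (auto intro!: continuous_intros)
  have f': "continuous_on UNIV f'" "f' 0 = 0" unfolding f'_def using d by (auto intro!: continuous_intros)
  have r: "continuous_on UNIV r" "r 0 = 0" unfolding r_def using nz e by (auto intro!: continuous_intros)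
  note se = star_emb[OF sc(1)] star_emb[OF sc(2)]
  define p q R where "p = nfc f c" and "q = nfc f' c'" and "R = nfc r c"
  have ep: "emb p = cfc f (emb c)" and eq: "emb q = cfc f' (emb c')" and eR: "emb R = cfc r (emb c)"
    unfolding p_def q_def R_def using emb_nfc[OF sc(1) f] emb_nfc[OF sc(2) f'] emb_nfc[OF sc(1) r] by simp_all
  have mem: "p \<in> A" "q \<in> A" "R \<in> A"
    unfolding p_def q_def R_def
    using nfc_in[OF sc(1) f A(1,2)] nfc_in[OF sc(2) f' A(1,3)] nfc_in[OF sc(1) r A(1,2)] by simp_all
  have sR: "star R = R" unfolding R_def by (rule star_nfc[OF sc(1) r])
  have pp: "cpos (emb p)" unfolding ep by (rule cpos_cfc[OF se(1) f(1)]) (simp add: f_def)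
  have RcR: "emb R * (emb c - of_real m) * emb R = emb p"
  proof -
    have cm: "continuous_on UNIV (\<lambda>t. t - m)" by (intro continuous_intros)
    have "emb c - of_real m = cfc (\<lambda>t. t - m) (emb c)"
      using cfc_diff[OF se(1) continuous_on_id continuous_on_const, of m] by (simp add: cfc_ident cfc_const se)
    then have "emb R * (emb c - of_real m) * emb R = cfc (\<lambda>t. r t * (t - m) * r t) (emb c)"
      unfolding eR using se r cm by (simp add: cfc_mult continuous_on_mult)
    also have "\<dots> = cfc f (emb c)"
    proof (rule cfc_cong)
      fix t
      show "r t * (t - m) * r t = f t"
      proof (cases "t \<le> e")
        case False
        then have "r t * r t = (t - e) / (t - m)" using m by (simp add: r_def)
        then have "(r t * r t) * (t - m) = t - e" using False m by simp
        then show ?thesis using False by (simp add: f_def mult_ac)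
      qed (simp add: r_def f_def)
    qed
    finally show ?thesis by (simp add: ep)
  qed
  have "cpos (cfc f' (emb c') - cfc (\<lambda>t. t - d) (emb c'))"
    by (rule cpos_cfc_mono[OF se(2) _ f'(1)]) (auto intro!: continuous_intros simp: f'_def)
  moreover have "cfc (\<lambda>t. t - d) (emb c') = emb c' - of_real d"
    using cfc_diff[OF se(2) continuous_on_id continuous_on_const, of d] by (simp add: cfc_ident cfc_const se)
  ultimately have 1: "cpos (emb q - (emb c' - of_real d))" by (simp add: eq)
  have 2: "cpos (of_real (m - d) - (emb c - emb c'))"
  proof (rule cpos_norm_minus)
    show "norm (emb c - emb c') \<le> m - d" using m(4) norm_emb[of "c - c'"] by (simp add: emb_simps)
  qed (simp add: se)
  have "cpos (emb q - (emb c - of_real m))" using cpos_add[OF 1 2] by (simp add: algebra_simps)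
  from cpos_conj[OF this, of "emb R"]
  have "cpos (emb R * emb q * emb R - emb p)"
    unfolding RcR[symmetric] by (simp only: emb_simps(5)[symmetric] sR) (simp add: algebra_simps)
  then have "cpos (emb (R * q * star R) - emb p)" by (simp add: sR emb_simps)
  then have "cuntz_le A p (R * q * star R)"
    by (intro cuntz_le_of_le A mem pp cstar_subalgebraD(4,6)[OF A(1)])
  from cuntz_le_trans[OF A(1) this cuntz_le_conj[OF mem(3)]]
  show ?thesis unfolding p_def q_def f_def[abs_def] f'_def[abs_def] .
qed

section \<open>Hereditary subalgebras\<close>

text \<open>For \<open>h = s * s\<close> the element \<open>star y * h * y\<close> is at most
  \<open>norm h\<close> times \<open>star y * y\<close>, so heredity applies; a self-adjoint
  \<open>a\<close> is a difference of two such squares.\<close>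

lemma hereditary_conj_sa:
  fixes A :: "'a::cstar_algebra set"
  assumes A: "cstar_subalgebra A" and B: "hereditary_subalgebra B A"
    and a: "a \<in> A" "star a = a" and y: "y \<in> B"
  shows "star y * a * y \<in> B"
proof -
  have BA: "cstar_subalgebra B" "B \<subseteq> A" using B by (auto simp: hereditary_subalgebra_def)
  have yA: "y \<in> A" using y BA by blast
  have pos: "star y * (s * s) * y \<in> B" if s: "s \<in> A" "star s = s" for s
  proof -
    define h where "h = s * s"
    define n where "n = norm h"
    have sh: "star h = h" "h \<in> A" using s by (auto simp: h_def star_mult intro: cstar_subalgebraD(4)[OF A])
    note seh = star_emb[OF sh(1)]
    \<comment> \<open>The two sides of that inequality differ by \<open>star w * w\<close> with
      \<open>w = sqrt(n - h) y\<close>. Subtracting \<open>sqrt n\<close> makes the function vanish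
      at 0, so that \<open>w\<close> lies in \<open>A\<close> even if \<open>A\<close> has no
      unit.\<close>
    define f where "f t = sqrt (n - t) - sqrt n" for t
    have f: "continuous_on UNIV f" "f 0 = 0" unfolding f_def by (auto intro!: continuous_intros)
    define w where "w = nfc f h * y + sqrt n *\<^sub>R y"
    have wA: "w \<in> A" unfolding w_def
      by (intro cstar_subalgebraD(3,4,7)[OF A] nfc_in[OF sh(1) f A sh(2)] yA)
    define k where "k = cfc (\<lambda>t. sqrt (n - t)) (emb h)"
    have ck: "continuous_on UNIV (\<lambda>t. sqrt (n - t))" by (intro continuous_intros)
    have "cfc f (emb h) = k - of_real (sqrt n)"
      unfolding f_def[abs_def] k_def using cfc_diff[OF seh ck continuous_on_const] by (simp add: cfc_const seh)
    then have ew: "emb w = k * emb y"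
      by (simp only: w_def emb_simps emb_nfc[OF sh(1) f]) (simp add: algebra_simps of_real_def)
    have "k * k = cfc (\<lambda>t. sqrt (n - t) * sqrt (n - t)) (emb h)"
      unfolding k_def by (rule cfc_mult[OF seh ck ck, symmetric])
    also have "\<dots> = cfc (\<lambda>t. n - t) (emb h)"
    proof (rule cfc_cong)
      fix t assume "t \<in> real_spectrum (emb h)"
      then have "t \<le> n" using real_spectrum_le_norm[of t "emb h"] by (simp add: norm_emb n_def)
      then show "sqrt (n - t) * sqrt (n - t) = n - t" by simp
    qed
    also have "\<dots> = of_real n - emb h"
      using cfc_diff[OF seh continuous_on_const continuous_on_id, of n] by (simp add: cfc_const cfc_ident seh)
    finally have kk: "k * k = of_real n - emb h" .
    have sk: "star k = k" unfolding k_def using seh ck by simp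
    have "emb (star w * w) = star (emb y) * (k * k) * emb y"
      by (simp only: emb_simps ew star_mult sk mult.assoc)
    also have "\<dots> = emb (n *\<^sub>R (star y * y) - star y * h * y)"
      unfolding kk emb_simps by (simp add: algebra_simps of_real_def)
    finally have "n *\<^sub>R (star y * y) - star y * h * y = star w * w" by simp
    then have 1: "n *\<^sub>R (star y * y) - star y * h * y \<in> positives A"
      using wA by (auto simp: positives_def)
    have "star y * h * y = star (s * y) * (s * y)" using s by (simp add: h_def star_mult mult.assoc)
    then have 2: "star y * h * y \<in> positives A"
      unfolding positives_def using cstar_subalgebraD(4)[OF A s(1) yA] by blast
    have "n *\<^sub>R (star y * y) = star (sqrt n *\<^sub>R y) * (sqrt n *\<^sub>R y)" by (simp add: n_def)
    then have 3: "n *\<^sub>R (star y * y) \<in> positives B"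
      unfolding positives_def using cstar_subalgebraD(7)[OF BA(1) y] by blast
    show ?thesis using B 1 2 3 unfolding hereditary_subalgebra_def h_def by blast
  qed
  define f where "f t = sqrt (max t 0)" for t
  define g where "g t = sqrt (max (- t) 0)" for t
  have f: "continuous_on UNIV f" "f 0 = 0" unfolding f_def by (auto intro!: continuous_intros)
  have g: "continuous_on UNIV g" "g 0 = 0" unfolding g_def by (auto intro!: continuous_intros)
  note sea = star_emb[OF a(2)]
  have "emb (nfc f a * nfc f a - nfc g a * nfc g a) = cfc (\<lambda>t. f t * f t - g t * g t) (emb a)"
    using a sea f g by (simp only: emb_simps emb_nfc cfc_mult cfc_diff continuous_on_mult)
  also have "\<dots> = cfc (\<lambda>t. t) (emb a)" by (rule cfc_cong) (auto simp: f_def g_def max_def)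
  finally have e: "a = nfc f a * nfc f a - nfc g a * nfc g a" using sea by (simp add: cfc_ident)
  have "star y * a * y = star y * (nfc f a * nfc f a) * y - star y * (nfc g a * nfc g a) * y"
    by (subst e) (simp add: algebra_simps)
  also have "\<dots> \<in> B"
    using a f g A by (intro cstar_subalgebraD(9)[OF BA(1)] pos nfc_in star_nfc) auto
  finally show ?thesis .
qed

text \<open>Real and imaginary parts reduce the case \<open>x = star y\<close> to self-adjoint
  \<open>a\<close>; polarization over the four combinations \<open>star x + c y\<close> then
  separates \<open>x\<close> from \<open>y\<close>. This is the inclusion
  \<open>B A B \<subseteq> B\<close>.\<close>

lemma hereditary_mult:
  fixes A :: "'a::cstar_algebra set"
  assumes A: "cstar_subalgebra A" and B: "hereditary_subalgebra B A"
    and a: "a \<in> A" and x: "x \<in> B" and y: "y \<in> B"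
  shows "x * a * y \<in> B"
proof -
  have BA: "cstar_subalgebra B" "B \<subseteq> A" using B by (auto simp: hereditary_subalgebra_def)
  have conj: "star z * a * z \<in> B" if z: "z \<in> B" for z
  proof -
    define b where "b = (1/2) *\<^sub>R (a + star a)"
    define c where "c = scaleC (- \<i> / 2) (a - star a)"
    have bA: "b \<in> A" "c \<in> A" unfolding b_def c_def
      using a by (auto intro!: cstar_subalgebraD(3,5,6,7,9)[OF A])
    have sb: "star b = b" "star c = c"
      by (simp_all add: b_def c_def star_simps scaleC_diff_right scaleC_minus_left add.commute)
    have ab: "a = b + scaleC \<i> c"
    proof -
      have "scaleC \<i> c = (1/2) *\<^sub>R (a - star a)"
        unfolding c_def scaleC_scaleC scaleC_of_real[symmetric] by simp
      then show ?thesis by (simp add: b_def scaleR_add_right scaleR_diff_right flip: scaleR_left_distrib)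
    qed
    have "star z * a * z = star z * b * z + scaleC \<i> (star z * c * z)"
      by (subst ab) (simp add: algebra_simps scaleC_mult_left scaleC_mult_right)
    also have "\<dots> \<in> B"
      by (intro cstar_subalgebraD(3,5)[OF BA(1)] hereditary_conj_sa[OF A B] bA sb z)
    finally show ?thesis .
  qed
  define w where "w = star x"
  define q where "q c = star (w + scaleC c y) * a * (w + scaleC c y)" for c
  have qB: "q c \<in> B" for c unfolding q_def w_def
    by (intro conj cstar_subalgebraD(3,5,6)[OF BA(1)] x y)
  have "4 *\<^sub>R (x * a * y) = q 1 - scaleC \<i> (q \<i>) - q (- 1) + scaleC \<i> (q (- \<i>))"
  proof -
    have "4 *\<^sub>R (x * a * y) = x * a * y + x * a * y + (x * a * y + x * a * y)"
      by (simp flip: scaleR_2)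
    also have "\<dots> = q 1 - scaleC \<i> (q \<i>) - q (- 1) + scaleC \<i> (q (- \<i>))"
      unfolding q_def w_def
      by (simp add: star_simps algebra_simps scaleC_mult_left scaleC_mult_right scaleC_scaleC
          scaleC_minus_left scaleC_add_right scaleC_diff_right scaleC_minus_right)
    finally show ?thesis .
  qed
  also have "\<dots> \<in> B" by (intro cstar_subalgebraD(3,5,9)[OF BA(1)] qB)
  finally have "(1/4) *\<^sub>R (4 *\<^sub>R (x * a * y)) \<in> B" by (rule cstar_subalgebraD(7)[OF BA(1)])
  then show ?thesis by simp
qed

text \<open>Local units \<open>f\<close> for \<open>p\<close> and \<open>g\<close> for
  \<open>a\<close> compress a witness \<open>v\<close> from \<open>A\<close> to
  \<open>f v g\<close>, which lies in \<open>B\<close>. As \<open>g\<close> is chosen after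
  \<open>v\<close>, its accuracy can absorb \<open>(norm v)\<^sup>2\<close>.\<close>

lemma cuntz_le_hereditary:
  fixes A :: "'a::cstar_algebra set"
  assumes A: "cstar_subalgebra A" and B: "hereditary_subalgebra B A"
    and p: "p \<in> B" and a: "a \<in> B" and pa: "cuntz_le A p a"
  shows "cuntz_le B p a"
  unfolding cuntz_le_iff
proof (intro allI impI)
  fix e :: real assume e: "e > 0"
  have BA: "cstar_subalgebra B" "B \<subseteq> A" using B by (auto simp: hereditary_subalgebra_def)
  obtain f where f: "f \<in> B" "star f = f" "norm f \<le> 1" "norm (f * p - p) < e / 4" "norm (p * f - p) < e / 4"
    using local_unit[OF BA(1), of "{p}" "e / 4"] p e by auto
  obtain v where v: "v \<in> A" "norm (p - v * a * star v) < e / 4"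
    using pa e unfolding cuntz_le_iff by (meson divide_pos_pos zero_less_numeral)
  define M where "M = (norm v)\<^sup>2 + 1"
  have M: "M > 0" by (simp add: M_def add_nonneg_pos)
  obtain g where g: "g \<in> B" "star g = g" "norm g \<le> 1" "norm (g * a - a) < e / (8 * M)" "norm (a * g - a) < e / (8 * M)"
    using local_unit[OF BA(1), of "{a}" "e / (8 * M)"] a e M by auto
  define u where "u = f * v * g"
  have uB: "u \<in> B" unfolding u_def by (rule hereditary_mult[OF A B v(1) f(1) g(1)])
  have c: "norm (f * x * f) \<le> norm x" for x
  proof -
    have "norm (f * x * f) \<le> 1 * norm x * 1"
      using f(3) by (intro order_trans[OF norm_mult_ineq] mult_mono) auto
    then show ?thesis by simp
  qed
  have gag: "norm (a - g * a * g) \<le> e / (4 * M)"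
  proof -
    have "a - g * a * g = - (a * g - a) - (g * a - a) * g" by (simp add: algebra_simps)
    then have "norm (a - g * a * g) \<le> norm (a * g - a) + norm ((g * a - a) * g)"
      by (metis norm_minus_cancel norm_triangle_ineq4)
    also have "norm ((g * a - a) * g) \<le> e / (8 * M) * 1"
      using g e M by (intro order_trans[OF norm_mult_ineq] mult_mono) auto
    finally show ?thesis using g(5) by simp
  qed
  have "p - u * a * star u = - (p * f - p) - (f * p - p) * f + f * (p - v * a * star v) * f
      + f * (v * (a - g * a * g) * star v) * f"
    by (simp add: u_def star_mult f(2) g(2) algebra_simps)
  then have "norm (p - u * a * star u) \<le> norm (p * f - p) + norm ((f * p - p) * f)
      + norm (f * (p - v * a * star v) * f) + norm (f * (v * (a - g * a * g) * star v) * f)"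
    by (metis (no_types, lifting) norm_minus_cancel norm_triangle_le norm_triangle_ineq4 norm_triangle_mono order_refl)
  also have "norm ((f * p - p) * f) \<le> e / 4 * 1"
    using f e by (intro order_trans[OF norm_mult_ineq] mult_mono) auto
  also have "norm (f * (p - v * a * star v) * f) \<le> e / 4" using c v(2) by (meson less_imp_le order_trans)
  also have "norm (f * (v * (a - g * a * g) * star v) * f) \<le> norm (v * (a - g * a * g) * star v)" by (rule c)
  also have "\<dots> \<le> norm v * (e / (4 * M)) * norm v"
    using gag e M by (intro order_trans[OF norm_mult_ineq] mult_mono order_trans[OF norm_mult_ineq]) auto
  also have "\<dots> \<le> M * (e / (4 * M))" using e M by (simp add: M_def power2_eq_square divide_right_mono mult_right_mono)
  also have "\<dots> = e / 4" using M by simp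
  finally have "norm (p - u * a * star u) < e" using f(5) by simp
  then show "\<exists>v\<in>B. norm (p - v * a * star v) < e" using uB by blast
qed

section \<open>Simplicity of hereditary subalgebras\<close>

text \<open>For \<open>I \<subseteq> A\<close> the closure is the closed ideal of \<open>A\<close>
  generated by \<open>I\<close>: it contains each \<open>x\<close> in \<open>I\<close> as a limit of
  \<open>f * x * f\<close> with local units \<open>f\<close>.\<close>

definition ideal_span :: "'a::cstar_algebra set \<Rightarrow> 'a set \<Rightarrow> 'a set"
  where "ideal_span A I = {\<Sum>i<n. a i * x i * b i | n a x b. \<forall>i<(n::nat). a i \<in> A \<and> x i \<in> I \<and> b i \<in> A}"

lemma closed_ideal_closure_ideal_span:
  fixes A I :: "'a::cstar_algebra set"
  assumes A: "cstar_subalgebra A" and I: "I \<subseteq> A"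
  shows "closed_ideal (closure (ideal_span A I)) A"
proof -
  let ?J = "ideal_span A I"
  have JA: "?J \<subseteq> A"
    using I by (auto simp: ideal_span_def intro!: cstar_subalgebra_sum[OF A] cstar_subalgebraD(4)[OF A])
  have J0: "0 \<in> ?J" unfolding ideal_span_def by (auto intro!: exI[of _ "0::nat"])
  have add: "u + v \<in> ?J" if "u \<in> ?J" "v \<in> ?J" for u v
  proof -
    obtain n a x b where u: "u = (\<Sum>i<n. a i * x i * b i)" "\<forall>i<(n::nat). a i \<in> A \<and> x i \<in> I \<and> b i \<in> A"
      using \<open>u \<in> ?J\<close> unfolding ideal_span_def by blast
    obtain m a' x' b' where v: "v = (\<Sum>i<m. a' i * x' i * b' i)" "\<forall>i<(m::nat). a' i \<in> A \<and> x' i \<in> I \<and> b' i \<in> A"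
      using \<open>v \<in> ?J\<close> unfolding ideal_span_def by blast
    define c where "c f g i = (if i < n then f i else g (i - n))" for f g :: "nat \<Rightarrow> 'a" and i
    have split: "(\<Sum>i<n + m. h i) = (\<Sum>i<n. h i) + (\<Sum>i<m. h (n + i))" for h :: "nat \<Rightarrow> 'a"
      by (induction m) (simp_all add: add.assoc)
    have "u + v = (\<Sum>i<n + m. c a a' i * c x x' i * c b b' i)"
      unfolding u(1) v(1) split by (simp add: c_def)
    moreover have "\<forall>i<n + m. c a a' i \<in> A \<and> c x x' i \<in> I \<and> c b b' i \<in> A"
      using u(2) v(2) by (auto simp: c_def)
    ultimately show ?thesis unfolding ideal_span_def by blast
  qed
  have map: "F u \<in> ?J" if F: "\<And>(n::nat) f. F (\<Sum>i<n. f i) = (\<Sum>i<n. F (f i))"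
    and F': "\<And>a x b. a \<in> A \<Longrightarrow> x \<in> I \<Longrightarrow> b \<in> A \<Longrightarrow> \<exists>a'\<in>A. \<exists>b'\<in>A. F (a * x * b) = a' * x * b'"
    and u: "u \<in> ?J" for F u
  proof -
    obtain n a x b where u: "u = (\<Sum>i<n. a i * x i * b i)" "\<forall>i<(n::nat). a i \<in> A \<and> x i \<in> I \<and> b i \<in> A"
      using u unfolding ideal_span_def by blast
    have "\<forall>i\<in>{..<n}. \<exists>c. fst c \<in> A \<and> snd c \<in> A \<and> F (a i * x i * b i) = fst c * x i * snd c"
      using F' u(2) by fastforce
    from bchoice[OF this] obtain c where
      c: "\<forall>i\<in>{..<n}. fst (c i) \<in> A \<and> snd (c i) \<in> A \<and> F (a i * x i * b i) = fst (c i) * x i * snd (c i)" ..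
    then have "F u = (\<Sum>i<n. fst (c i) * x i * snd (c i))" unfolding u(1) F by (intro sum.cong) auto
    then show ?thesis unfolding ideal_span_def mem_Collect_eq
      by (intro exI[of _ n] exI[of _ "fst \<circ> c"] exI[of _ x] exI[of _ "snd \<circ> c"]) (use c u(2) in auto)
  qed
  have scale: "scaleC c u \<in> ?J" if "u \<in> ?J" for c u
  proof (rule map[OF _ _ that])
    show "\<exists>a'\<in>A. \<exists>b'\<in>A. scaleC c (a * x * b) = a' * x * b'" if "a \<in> A" "b \<in> A" for a x b
      using that cstar_subalgebraD(5)[OF A that(1)] by (metis scaleC_mult_left)
  qed (simp add: scaleC_sum_right)
  have left: "c * u \<in> ?J" if "u \<in> ?J" "c \<in> A" for c u
  proof (rule map[OF _ _ that(1)])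
    show "\<exists>a'\<in>A. \<exists>b'\<in>A. c * (a * x * b) = a' * x * b'" if "a \<in> A" "b \<in> A" for a x b
      using that cstar_subalgebraD(4)[OF A \<open>c \<in> A\<close> that(1)] by (metis mult.assoc)
  qed (simp add: sum_distrib_left)
  have right: "u * c \<in> ?J" if "u \<in> ?J" "c \<in> A" for c u
  proof (rule map[OF _ _ that(1), where F = "\<lambda>u. u * c"])
    show "\<exists>a'\<in>A. \<exists>b'\<in>A. a * x * b * c = a' * x * b'" if "a \<in> A" "b \<in> A" for a x b
      using that cstar_subalgebraD(4)[OF A that(2) \<open>c \<in> A\<close>] by (metis mult.assoc)
  qed (simp add: sum_distrib_right)
  have cl: "F u \<in> closure ?J" if F: "\<And>x l. x \<longlonglongrightarrow> l \<Longrightarrow> (\<lambda>n. F (x n)) \<longlonglongrightarrow> F l"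
    "\<And>u. u \<in> ?J \<Longrightarrow> F u \<in> ?J" and u: "u \<in> closure ?J" for F u
  proof -
    obtain x where x: "\<And>n. x n \<in> ?J" "x \<longlonglongrightarrow> u" using u unfolding closure_sequential by blast
    show ?thesis unfolding closure_sequential
      by (rule exI[of _ "\<lambda>n. F (x n)"]) (use F(1)[OF x(2)] F(2)[OF x(1)] in simp)
  qed
  show ?thesis unfolding closed_ideal_def
  proof (intro conjI ballI allI)
    show "closure ?J \<subseteq> A" by (rule closure_minimal[OF JA cstar_subalgebraD(1)[OF A]])
    show "0 \<in> closure ?J" using J0 closure_subset by blast
    fix u v assume u: "u \<in> closure ?J" and v: "v \<in> closure ?J"
    obtain x where x: "\<And>n. x n \<in> ?J" "x \<longlonglongrightarrow> u" using u unfolding closure_sequential by blast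
    obtain y where y: "\<And>n. y n \<in> ?J" "y \<longlonglongrightarrow> v" using v unfolding closure_sequential by blast
    show "u + v \<in> closure ?J"
      unfolding closure_sequential
      by (rule exI[of _ "\<lambda>n. x n + y n"]) (use tendsto_add[OF x(2) y(2)] add[OF x(1) y(1)] in simp)
  next
    fix c u assume u: "u \<in> closure ?J"
    show "scaleC c u \<in> closure ?J" by (rule cl[OF tendsto_scaleC scale u])
  next
    fix c u assume c: "c \<in> A" and u: "u \<in> closure ?J"
    show "c * u \<in> closure ?J" by (rule cl[OF tendsto_mult_left left[OF _ c] u])
    show "u * c \<in> closure ?J" by (rule cl[OF tendsto_mult_right right[OF _ c] u])
  qed simp
qed

text \<open>An ideal \<open>I\<close> of \<open>B\<close> generates one of \<open>A\<close>. If that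
  is all of \<open>A\<close>, each \<open>b\<close> in \<open>B\<close> is a limit of sums of
  \<open>a x c\<close> with \<open>x\<close> in \<open>I\<close>; sandwiching with local units of
  \<open>B\<close> turns the coefficients into \<open>g a f\<close> and \<open>f c g\<close>, which
  lie in \<open>B\<close>, so \<open>b\<close> lies in \<open>I\<close>.\<close>

theorem hereditary_simple:
  fixes A :: "'a::cstar_algebra set"
  assumes A: "simple_cstar A" and B: "hereditary_subalgebra B A"
  shows "simple_cstar B"
  unfolding simple_cstar_def
proof (intro conjI allI impI)
  have csA: "cstar_subalgebra A" using A by (simp add: simple_cstar_def)
  have BA: "cstar_subalgebra B" "B \<subseteq> A" using B by (auto simp: hereditary_subalgebra_def)
  show "cstar_subalgebra B" by fact
  fix I assume I: "closed_ideal I B"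
  have IB: "I \<subseteq> B" "closed I" using I by (auto simp: closed_ideal_def)
  let ?J = "ideal_span A I"
  have "closed_ideal (closure ?J) A"
    by (rule closed_ideal_closure_ideal_span[OF csA]) (use IB BA in blast)
  then consider "closure ?J = {0}" | "closure ?J = A" using A by (auto simp: simple_cstar_def)
  then show "I = {0} \<or> I = B"
  proof cases
    case 1
    have "x = 0" if x: "x \<in> I" for x
    proof -
      have "norm x < e" if e: "e > 0" for e
      proof -
        obtain f where f: "f \<in> B" "norm f \<le> 1" "norm (f * x - x) < e / 2" "norm (x * f - x) < e / 2"
          using local_unit[OF BA(1), of "{x}" "e / 2"] x IB e by auto
        have "f * x * f \<in> ?J" unfolding ideal_span_def mem_Collect_eq
          by (rule exI[of _ 1], rule exI[of _ "\<lambda>_. f"], rule exI[of _ "\<lambda>_. x"], rule exI[of _ "\<lambda>_. f"])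
            (use f(1) x BA in auto)
        then have "f * x * f = 0" using 1 closure_subset[of ?J] by blast
        then have "x = - (x * f - x) - (f * x - x) * f" by (simp add: algebra_simps)
        then have "norm x \<le> norm (x * f - x) + norm ((f * x - x) * f)"
          by (metis norm_minus_cancel norm_triangle_ineq4)
        also have "norm ((f * x - x) * f) \<le> e / 2 * 1"
          using f e by (intro order_trans[OF norm_mult_ineq] mult_mono) auto
        finally show ?thesis using f(4) by simp
      qed
      then show "x = 0" by (metis less_irrefl zero_less_norm_iff)
    qed
    then show ?thesis using I by (auto simp: closed_ideal_def)
  next
    case 2
    have "b \<in> I" if b: "b \<in> B" for b
    proof -
      have "\<exists>y\<in>I. dist y b < e" if e: "e > 0" for e
      proof -
        obtain g where g: "g \<in> B" "norm g \<le> 1" "norm (g * b - b) < e / 4" "norm (b * g - b) < e / 4"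
          using local_unit[OF BA(1), of "{b}" "e / 4"] b e by auto
        have "b \<in> closure ?J" using 2 b BA by blast
        then obtain u where u: "u \<in> ?J" "dist u b < e / 4"
          using e unfolding closure_approachable by (meson divide_pos_pos zero_less_numeral)
        obtain n a x c where s: "u = (\<Sum>i<n. a i * x i * c i)" "\<forall>i<(n::nat). a i \<in> A \<and> x i \<in> I \<and> c i \<in> A"
          using u(1) unfolding ideal_span_def by blast
        define M where "M = (\<Sum>i<n. norm (a i) * (norm (c i) * 2)) + 1"
        have M: "M > 0" unfolding M_def by (intro add_nonneg_pos sum_nonneg) auto
        obtain f where f: "f \<in> B" "norm f \<le> 1"
          "\<forall>y\<in>x ` {..<n}. norm (f * y - y) < e / (4 * M) \<and> norm (y * f - y) < e / (4 * M)"
          using local_unit[OF BA(1), of "x ` {..<n}" "e / (4 * M)"] s(2) IB e M by fastforce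
        \<comment> \<open>\<open>g\<close> is almost a unit for \<open>b\<close> and
          \<open>f\<close> for the finitely many \<open>x i\<close>; the accuracy of
          \<open>f\<close> depends on \<open>M\<close>, which bounds the coefficients of
          \<open>u\<close>.\<close>
        define y where "y = (\<Sum>i<n. (g * a i * f) * x i * (f * c i * g))"
        have "y \<in> I"
        proof -
          have sumI: "(\<Sum>i\<in>S. h i) \<in> I" if "\<And>i. i \<in> S \<Longrightarrow> h i \<in> I" for S and h :: "nat \<Rightarrow> 'a"
            using that I by (induction S rule: infinite_finite_induct) (auto simp: closed_ideal_def)
          show ?thesis unfolding y_def
          proof (rule sumI)
            fix i assume "i \<in> {..<n}"
            then have "g * a i * f \<in> B" "f * c i * g \<in> B" "x i \<in> I"
              using s(2) by (auto intro!: hereditary_mult[OF csA B] f g)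
            then show "(g * a i * f) * x i * (f * c i * g) \<in> I" using I by (simp add: closed_ideal_def)
          qed
        qed
        moreover have "dist y b < e"
        proof -
          have gxg: "norm (g * z * g) \<le> norm z" for z
          proof -
            have "norm (g * z * g) \<le> 1 * norm z * 1"
              using g(2) by (intro order_trans[OF norm_mult_ineq] mult_mono) auto
            then show ?thesis by simp
          qed
          have "y - g * u * g = g * (\<Sum>i<n. a i * (f * x i * f - x i) * c i) * g"
            unfolding y_def s(1) by (simp add: sum_distrib_left sum_distrib_right algebra_simps sum_subtractf)
          then have "norm (y - g * u * g) \<le> norm (\<Sum>i<n. a i * (f * x i * f - x i) * c i)"
            using gxg by metis
          also have "\<dots> \<le> (\<Sum>i<n. norm (a i) * (norm (c i) * 2) * (e / (4 * M)))"
          proof (rule sum_norm_le)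
            fix i assume "i \<in> {..<n}"
            then have fi: "norm (f * x i - x i) < e / (4 * M)" "norm (x i * f - x i) < e / (4 * M)"
              using f(3) by auto
            have "f * x i * f - x i = (f * x i - x i) * f + (x i * f - x i)" by (simp add: algebra_simps)
            then have "norm (f * x i * f - x i) \<le> norm ((f * x i - x i) * f) + norm (x i * f - x i)"
              by (metis norm_triangle_ineq)
            also have "norm ((f * x i - x i) * f) \<le> e / (4 * M) * 1"
              using f fi e M by (intro order_trans[OF norm_mult_ineq] mult_mono) auto
            finally have n: "norm (f * x i * f - x i) \<le> 2 * (e / (4 * M))" using fi(2) by simp
            have "norm (a i * (f * x i * f - x i) * c i) \<le> norm (a i) * (2 * (e / (4 * M))) * norm (c i)"
              using n e M by (intro order_trans[OF norm_mult_ineq] mult_mono order_trans[OF norm_mult_ineq]) auto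
            then show "norm (a i * (f * x i * f - x i) * c i) \<le> norm (a i) * (norm (c i) * 2) * (e / (4 * M))"
              by (simp add: mult_ac)
          qed
          also have "\<dots> = (\<Sum>i<n. norm (a i) * (norm (c i) * 2)) * (e / (4 * M))"
            by (rule sum_distrib_right[symmetric])
          also have "(\<Sum>i<n. norm (a i) * (norm (c i) * 2)) = M - 1" by (simp add: M_def)
          also have "(M - 1) * (e / (4 * M)) \<le> M * (e / (4 * M))" using e M by (intro mult_right_mono) auto
          also have "\<dots> = e / 4" using M by simp
          finally have 1: "norm (y - g * u * g) \<le> e / 4" .
          have 2: "norm (g * (u - b) * g) < e / 4"
            using gxg[of "u - b"] u(2) by (simp add: dist_norm)
          have 3: "norm ((g * b - b) * g) \<le> e / 4 * 1"
            using g e by (intro order_trans[OF norm_mult_ineq] mult_mono) auto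
          have "y - b = (y - g * u * g) + (g * (u - b) * g + ((g * b - b) * g + (b * g - b)))"
            by (simp add: algebra_simps)
          then have "norm (y - b) \<le> norm (y - g * u * g) + (norm (g * (u - b) * g) +
              (norm ((g * b - b) * g) + norm (b * g - b)))"
            by (simp only:) (intro norm_triangle_le add_left_mono norm_triangle_ineq)
          then show ?thesis using 1 2 3 g(4) by (simp add: dist_norm)
        qed
        ultimately show ?thesis by blast
      qed
      then have "b \<in> closure I" unfolding closure_approachable by blast
      then show ?thesis using IB(2) by simp
    qed
    then show ?thesis using IB by blast
  qed
qed

section \<open>Stability of the relations of order zero maps\<close>

text \<open>
  Elements \<open>w\<^sub>0, \<dots>, w\<^sub>n\<^sub>-\<^sub>1\<close> with \<open>w\<^sub>i w\<^sub>j\<^sup>* = \<delta>\<^sub>i\<^sub>j d\<close> that are given up to a small error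
  are close to elements satisfying these relations exactly. One element \<open>x\<close> is added at a time:
  first it is made orthogonal to the others by a Gram-Schmidt step, in which \<open>d\<close> is inverted
  away from 0. Then \<open>q = x x\<^sup>*\<close> and \<open>b\<^sup>2 = g(d) d g(d)\<close> are equalized by means of
  \<open>z = \<surd>q b\<close>, since \<open>z z\<^sup>*\<close> is conjugate to \<open>b\<^sup>2\<close> and \<open>z\<^sup>* z\<close> to \<open>q\<close>.
\<close>

lemma adjoin_orthogonal_row:
  fixes w :: "nat \<Rightarrow> nat \<Rightarrow> 'a::cstar_algebra_1"
  assumes B: "cstar_subalgebra B" and m: "m \<ge> 1" and e: "e > 0"
    and wB: "\<And>N j. j < m \<Longrightarrow> w j N \<in> B" and xB: "\<And>N. x N \<in> B"
    and bw: "\<And>j. j < m \<Longrightarrow> Bseq (w j)" and bx: "Bseq x"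
    and w: "\<And>N i j. i < m \<Longrightarrow> j < m \<Longrightarrow> w i N * star (w j N) = (if i = j then d N else 0)"
    and xw: "\<And>j. j < m \<Longrightarrow> (\<lambda>N. x N * star (w j N)) \<longlonglongrightarrow> 0"
    and xx: "(\<lambda>N. x N * star (x N)) \<doteq> d"
  shows "\<exists>W X D. (\<forall>N. \<forall>j<m. W j N \<in> B) \<and> (\<forall>N. X N \<in> B) \<and>
    (\<forall>N. \<forall>i<m. \<forall>j<m. W i N * star (W j N) = (if i = j then D N else 0)) \<and>
    (\<forall>N. \<forall>j<m. X N * star (W j N) = 0) \<and> (\<forall>N. X N * star (X N) = D N) \<and>
    (\<forall>j<m. \<forall>\<^sub>F N in sequentially. norm (W j N - w j N) \<le> e) \<and>
    (\<forall>\<^sub>F N in sequentially. norm (X N - x N) \<le> e)"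
proof -

  \<comment> \<open>Scalar functions for the cutoffs\<close>
  define h where "h = e\<^sup>2 / 8"
  have h: "h > 0" using e by (simp add: h_def)
  have mx: "max t h > 0" "max t h \<noteq> 0" for t using h by (auto simp: max_def)
  define g where "g t = max (t - h) 0 / max t h" for t
  define k where "k t = t / (max t h)\<^sup>2" for t
  \<comment> \<open>\<open>u t\<close> is \<open>max (t - h) 0\<close>. With
    \<open>s = u t > 0\<close> the factor \<open>sqrt (s + h)\<close> recovers
    \<open>sqrt t\<close>, and \<open>r\<close> is chosen so that
    \<open>f t = (s / max s h) ^ 3\<close>. Hence \<open>f t = 1\<close> from \<open>2 * h\<close>
    on, while vanishing at 0 keeps the values of the calculus in \<open>B\<close>.\<close>
  define r where "r s = s * sqrt (s + h) / (max s h) ^ 3" for s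
  define u where "u t = g t * t" for t
  define f where "f t = r (u t) * (u t * (sqrt t * g t))" for t
  have cg: "continuous_on UNIV g" unfolding g_def using mx by (auto intro!: continuous_intros)
  have ck: "continuous_on UNIV k" unfolding k_def using mx by (auto intro!: continuous_intros)
  have cr: "continuous_on UNIV r" unfolding r_def using mx by (auto intro!: continuous_intros)
  have cs: "continuous_on UNIV sqrt" by (intro continuous_intros)
  have cu: "continuous_on UNIV u" unfolding u_def by (intro continuous_intros cg)
  have cru: "continuous_on UNIV (\<lambda>t. r (u t))" using continuous_on_compose2[OF cr cu] by simp
  have cf: "continuous_on UNIV f" unfolding f_def by (intro continuous_intros cru cu cg)
  have z0: "g 0 = 0" "k 0 = 0" "r 0 = 0" "sqrt 0 = 0" "u 0 = 0"
    using h by (simp_all add: g_def k_def r_def u_def)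
  have gkt: "k t * t * g t = g t" for t
  proof (cases "t \<le> h")
    case False
    then have "k t * t = 1" using h by (simp add: k_def power2_eq_square)
    then show ?thesis by simp
  qed (simp add: g_def)
  have u0: "0 \<le> u t" if "0 \<le> t" for t using that h mx by (simp add: u_def g_def)
  have f1: "(f t - 1) * t * (f t - 1) \<le> 2 * h \<and> 0 \<le> (f t - 1) * t * (f t - 1)" if t: "0 \<le> t" for t
  proof -
    have "0 \<le> f t \<and> f t \<le> 1 \<and> (2 * h \<le> t \<longrightarrow> f t = 1)"
    proof (cases "t \<le> h")
      case False
      define s where "s = t - h"
      have s: "s > 0" "s + h = t" "t > 0" using False h by (auto simp: s_def)
      have "max (t - h) 0 = s" "max t h = t" using False by (auto simp: s_def)
      then have "g t = s / t" by (simp only: g_def)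
      moreover have "s / t * t = s" using s(3) by simp
      ultimately have gt: "g t = s / t" "u t = s" by (simp_all only: u_def)
      have "f t = s * sqrt t / max s h ^ 3 * (s * (sqrt t * (s / t)))"
        by (simp only: f_def gt r_def s(2))
      also have "\<dots> = s ^ 3 / max s h ^ 3 * ((sqrt t * sqrt t) / t)"
        by (simp add: power3_eq_cube field_simps del: real_sqrt_mult_self)
      also have "(sqrt t * sqrt t) / t = 1" using s(3) by simp
      finally have "f t = s ^ 3 / max s h ^ 3" by simp
      then have f: "f t = (s / max s h) ^ 3" by (simp add: power_divide)
      have "0 \<le> s / max s h" "s / max s h \<le> 1" using s mx[of s] by auto
      then have "0 \<le> f t" "f t \<le> 1" unfolding f by (simp_all add: power_le_one)
      moreover have "f t = 1" if "2 * h \<le> t"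
      proof -
        have "max s h = s" using that s(2) by simp
        then show ?thesis using s(1) by (simp add: f)
      qed
      ultimately show ?thesis by blast
    qed (use h in \<open>simp add: f_def u_def g_def\<close>)
    then have f: "0 \<le> f t" "f t \<le> 1" "2 * h \<le> t \<Longrightarrow> f t = 1" by auto
    show ?thesis
    proof (cases "2 * h \<le> t")
      case True
      then show ?thesis using f h by simp
    next
      case False
      have "(f t - 1) * t * (f t - 1) = (1 - f t) * (1 - f t) * t" by (simp add: algebra_simps)
      moreover have "(1 - f t) * (1 - f t) * t \<le> 1 * t"
        using f t by (intro mult_right_mono mult_le_one) auto
      moreover have "0 \<le> (1 - f t) * (1 - f t) * t" using f t by simp
      ultimately show ?thesis using False by linarith
    qed
  qed

  \<comment> \<open>Gram-Schmidt step with a truncated inverse of \<open>d\<close>\<close>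
  have m0: "0 < m" using m by simp
  have d_eq: "d N = w 0 N * star (w 0 N)" for N using w[OF m0 m0] by simp
  have dB: "d N \<in> B" for N unfolding d_eq by (intro cstar_subalgebraD(4,6)[OF B] wB m0)
  have pd: "cpos (d N)" for N unfolding d_eq by (rule cpos_mult_star_self)
  have sd: "star (d N) = d N" for N using cpos_star[OF pd] .
  have spd: "0 \<le> t" if "t \<in> real_spectrum (d N)" for t N using pd[of N] that by (auto simp: cpos_def)
  have bd: "Bseq d" using Bseq_mult'[OF bw[OF m0] Bseq_star[OF bw[OF m0]]] unfolding d_eq[symmetric] .
  define G where "G N = cfc g (d N)" for N
  define K where "K N = cfc k (d N)" for N
  define S where "S N = cfc sqrt (d N)" for N
  define b where "b N = S N * G N" for N
  have sGKS: "star (G N) = G N" "star (K N) = K N" "star (S N) = S N" for N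
    unfolding G_def K_def S_def using sd cg ck cs by simp_all
  have bGKS: "Bseq G" "Bseq K" "Bseq S" unfolding G_def K_def S_def by (intro Bseq_cfc bd sd cg ck cs)+
  have GKSB: "G N \<in> B" "K N \<in> B" "S N \<in> B" for N
    unfolding G_def K_def S_def by (intro cfc_in_subalgebra B sd dB cg ck cs z0)+
  have SS: "S N * S N = d N" for N unfolding S_def by (rule sqrt_cfc[OF pd])
  have SG: "S N * G N = G N * S N" for N
    unfolding S_def G_def cfc_mult[OF sd cs cg, symmetric] cfc_mult[OF sd cg cs, symmetric]
    by (simp only: mult.commute)
  have sb: "star (b N) = b N" for N by (simp add: b_def star_mult sGKS SG)
  have bb: "b N * b N = G N * d N * G N" for N
    unfolding b_def by (metis SG SS mult.assoc)
  have bB: "b N \<in> B" for N unfolding b_def by (intro cstar_subalgebraD(4)[OF B] GKSB)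
  have bb': "Bseq b" unfolding b_def by (intro Bseq_mult' bGKS)
  \<comment> \<open>\<open>K\<close> inverts \<open>d\<close> only where \<open>G\<close> lives, so
    exact orthogonality is obtained for \<open>x' * star (w j) * G\<close>; this is why the rows
    \<open>W\<close> receive the factor \<open>G\<close>.\<close>
  define x' where "x' N = x N - (\<Sum>j<m. x N * star (w j N) * K N * w j N)" for N
  have x'B: "x' N \<in> B" for N
    unfolding x'_def
    by (intro cstar_subalgebraD(4,6,9)[OF B] cstar_subalgebra_sum[OF B] xB GKSB wB) auto
  have KdG: "K N * d N * G N = G N" for N
  proof -
    have "K N * d N * G N = cfc (\<lambda>t. k t * t * g t) (d N)"
      unfolding K_def G_def using sd ck cg
      by (simp add: cfc_mult cfc_ident continuous_on_mult continuous_on_id)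
    then show ?thesis by (simp add: gkt G_def)
  qed
  have orth: "x' N * star (w j N) * G N = 0" if j: "j < m" for N j
  proof -
    have "(\<Sum>i<m. x N * star (w i N) * K N * w i N) * star (w j N) =
      (\<Sum>i<m. if i = j then x N * star (w i N) * K N * d N else 0)"
      unfolding sum_distrib_right by (rule sum.cong) (use w j in \<open>auto simp: mult.assoc\<close>)
    also have "\<dots> = x N * star (w j N) * K N * d N" using j by simp
    finally have "x' N * star (w j N) * G N = x N * star (w j N) * G N - x N * star (w j N) * (K N * d N * G N)"
      unfolding x'_def left_diff_distrib by (simp only: mult.assoc)
    then show ?thesis by (simp add: KdG)
  qed
  have x'x: "x' \<doteq> x"
  proof -
    have "(\<lambda>N. x N * star (w j N) * K N * w j N) \<longlonglongrightarrow> 0" if "j < m" for j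
      using Bseq_mult_null(2)[OF bw[OF that] Bseq_mult_null(2)[OF bGKS(2) xw[OF that]]] .
    then have "(\<lambda>N. \<Sum>j<m. x N * star (w j N) * K N * w j N) \<longlonglongrightarrow> 0" by (intro tendsto_null_sum) auto
    from tendsto_minus[OF this] show ?thesis unfolding asymp_eq_def x'_def by simp
  qed
  have bx': "Bseq x'" using Bseq_asymp_eq[OF bx asymp_eq_sym[OF x'x]] .

  \<comment> \<open>Equalizing the squares of the old rows and of the new one\<close>
  define q where "q N = x' N * star (x' N)" for N
  have pq: "cpos (q N)" for N unfolding q_def by (rule cpos_mult_star_self)
  have sq: "star (q N) = q N" for N using cpos_star[OF pq] .
  have qB: "q N \<in> B" for N unfolding q_def by (intro cstar_subalgebraD(4,6)[OF B] x'B)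
  have bq: "Bseq q" unfolding q_def by (intro Bseq_mult' Bseq_star bx')
  have qd: "q \<doteq> d"
    unfolding q_def using asymp_eq_mult[OF x'x asymp_eq_star[OF x'x] bx' Bseq_star[OF bx]] xx
    by (rule asymp_eq_trans)
  define a where "a N = cfc sqrt (q N)" for N
  have sa: "star (a N) = a N" for N unfolding a_def using sq cs by simp
  have aa: "a N * a N = q N" for N unfolding a_def by (rule sqrt_cfc[OF pq])
  have aB: "a N \<in> B" for N unfolding a_def by (intro cfc_in_subalgebra B sq qB cs z0)
  have ba: "Bseq a" unfolding a_def by (intro Bseq_cfc bq sq cs)
  have aS: "a \<doteq> S" unfolding a_def S_def by (intro asymp_eq_cfc qd bq sq sd cs)
  define z where "z N = a N * b N" for N
  have zB: "z N \<in> B" for N unfolding z_def by (intro cstar_subalgebraD(4)[OF B] aB bB)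
  have bz: "Bseq z" unfolding z_def by (intro Bseq_mult' ba bb')
  define p where "p N = z N * star (z N)" for N
  have pp: "cpos (p N)" for N unfolding p_def by (rule cpos_mult_star_self)
  have sp: "star (p N) = p N" for N using cpos_star[OF pp] .
  have pB: "p N \<in> B" for N unfolding p_def by (intro cstar_subalgebraD(4,6)[OF B] zB)
  have bp: "Bseq p" unfolding p_def by (intro Bseq_mult' Bseq_star bz)
  define y where "y N = cfc sqrt (p N)" for N
  have sy: "star (y N) = y N" for N unfolding y_def using sp cs by simp
  have yy: "y N * y N = p N" for N unfolding y_def by (rule sqrt_cfc[OF pp])
  have yB: "y N \<in> B" for N unfolding y_def by (intro cfc_in_subalgebra B sp pB cs z0)
  have "Bseq y" unfolding y_def by (intro Bseq_cfc bp sp cs)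
  note by' = this
  define P where "P N = cfc r (y N)" for N
  have sP: "star (P N) = P N" for N unfolding P_def using sy cr by simp
  have PB: "P N \<in> B" for N unfolding P_def by (intro cfc_in_subalgebra B sy yB cr z0)
  have bP: "Bseq P" unfolding P_def by (intro Bseq_cfc by' sy cr)
  \<comment> \<open>Since \<open>a G d G a = z * star z = p\<close> and
    \<open>b q b = star z * z\<close>, the rows \<open>y a G w_j\<close> and \<open>z b x'\<close>,
    multiplied by their adjoints, both give \<open>p * p\<close>; the common left factor
    \<open>P\<close> turns this into \<open>D\<close>.\<close>
  define W where "W j N = P N * y N * a N * G N * w j N" for j N
  define X where "X N = P N * z N * b N * x' N" for N
  define D where "D N = P N * p N * p N * P N" for N
  have WB: "W j N \<in> B" if "j < m" for j N
    unfolding W_def by (intro cstar_subalgebraD(4)[OF B] PB yB aB GKSB wB that)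
  have XB: "X N \<in> B" for N unfolding X_def by (intro cstar_subalgebraD(4)[OF B] PB zB bB x'B)
  have WW: "W i N * star (W j N) = (if i = j then D N else 0)" if ij: "i < m" "j < m" for i j N
  proof -
    have "W i N * star (W j N) = P N * y N * a N * G N * (w i N * star (w j N)) * G N * a N * y N * P N"
      unfolding W_def by (simp only: star_mult sGKS sa sy sP mult.assoc)
    moreover have "P N * y N * a N * G N * d N * G N * a N * y N * P N = D N"
    proof -
      have "P N * y N * a N * G N * d N * G N * a N * y N * P N = P N * y N * (a N * (G N * d N * G N) * a N) * y N * P N"
        by (simp only: mult.assoc)
      also have "a N * (G N * d N * G N) * a N = p N"
        unfolding p_def z_def star_mult sb sa bb[symmetric] by (simp only: mult.assoc)
      also have "P N * y N * p N * y N * P N = D N"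
        unfolding D_def yy[symmetric] by (simp only: mult.assoc)
      finally show ?thesis .
    qed
    ultimately show ?thesis using w[OF ij, of N] by simp
  qed
  have XW: "X N * star (W j N) = 0" if "j < m" for j N
  proof -
    have "X N * star (W j N) = P N * z N * b N * (x' N * star (w j N) * G N) * a N * y N * P N"
      unfolding X_def W_def by (simp only: star_mult sGKS sa sy sP mult.assoc)
    then show ?thesis by (simp add: orth[OF that])
  qed
  have XX: "X N * star (X N) = D N" for N
  proof -
    have "X N * star (X N) = P N * z N * b N * (x' N * star (x' N)) * b N * star (z N) * P N"
      unfolding X_def by (simp only: star_mult sb sP mult.assoc)
    also have "\<dots> = P N * z N * (b N * (a N * a N) * b N) * star (z N) * P N"
      unfolding q_def[symmetric] aa by (simp only: mult.assoc)
    also have "b N * (a N * a N) * b N = star (z N) * z N"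
      unfolding z_def star_mult sb sa by (simp only: mult.assoc)
    also have "P N * z N * (star (z N) * z N) * star (z N) * P N = D N"
      unfolding D_def p_def by (simp only: mult.assoc)
    finally show ?thesis .
  qed

  \<comment> \<open>Distance of the corrected rows from the given ones\<close>
  define Y where "Y N = cfc u (d N)" for N
  have sY: "star (Y N) = Y N" for N unfolding Y_def using sd cu by simp
  have bY: "Bseq Y" unfolding Y_def by (intro Bseq_cfc bd sd cu)
  have cuu: "continuous_on UNIV (\<lambda>t. u t * u t)" by (intro continuous_intros cu)
  have yY: "y \<doteq> Y"
  proof -
    have "z \<doteq> (\<lambda>N. S N * b N)" unfolding z_def by (rule asymp_eq_mult_right[OF aS bb'])
    note zS = this
    have bSb: "Bseq (\<lambda>N. S N * b N)" by (intro Bseq_mult' bGKS bb')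
    have 1: "p \<doteq> (\<lambda>N. S N * b N * star (S N * b N))"
      unfolding p_def by (intro asymp_eq_mult asymp_eq_star zS bz Bseq_star bSb)
    have 2: "S N * b N * star (S N * b N) = cfc (\<lambda>t. u t * u t) (d N)" for N
    proof -
      have "S N * b N * star (S N * b N) = S N * (b N * b N) * S N"
        by (simp only: star_mult sb sGKS mult.assoc)
      also have "\<dots> = S N * (G N * d N * G N) * S N" unfolding bb ..
      also have "\<dots> = cfc (\<lambda>t. sqrt t * (g t * t * g t) * sqrt t) (d N)"
        unfolding S_def G_def using sd cs cg
        by (simp add: cfc_mult cfc_ident continuous_on_mult continuous_on_id)
      also have "\<dots> = cfc (\<lambda>t. u t * u t) (d N)"
      proof (rule cfc_cong)
        fix t assume "t \<in> real_spectrum (d N)"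
        then have "sqrt t * sqrt t = t" using spd by simp
        moreover have "sqrt t * (g t * t * g t) * sqrt t = (sqrt t * sqrt t) * (g t * t * g t)"
          by (simp only: mult_ac)
        ultimately have "sqrt t * (g t * t * g t) * sqrt t = t * (g t * t * g t)" by (simp only:)
        also have "\<dots> = u t * u t" by (simp add: u_def)
        finally show "sqrt t * (g t * t * g t) * sqrt t = u t * u t" .
      qed
      finally show ?thesis .
    qed
    have "y \<doteq> (\<lambda>N. cfc sqrt (cfc (\<lambda>t. u t * u t) (d N)))"
      unfolding y_def using 1 unfolding 2 by (intro asymp_eq_cfc bp sp cs star_cfc sd cuu)
    also have "(\<lambda>N. cfc sqrt (cfc (\<lambda>t. u t * u t) (d N))) = Y"
    proof
      fix N
      have "cfc sqrt (cfc (\<lambda>t. u t * u t) (d N)) = cfc (\<lambda>t. sqrt (u t * u t)) (d N)"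
        by (rule cfc_compose[OF sd cs cuu])
      also have "\<dots> = cfc u (d N)" by (rule cfc_cong) (use spd u0 in auto)
      finally show "cfc sqrt (cfc (\<lambda>t. u t * u t) (d N)) = Y N" by (simp add: Y_def)
    qed
    finally show ?thesis .
  qed
  define R where "R N = cfc (\<lambda>t. r (u t)) (d N)" for N
  have bR: "Bseq R" unfolding R_def by (intro Bseq_cfc bd sd cru)
  have PR: "P \<doteq> R"
    using asymp_eq_cfc[OF yY by' sy sY cr]
    unfolding P_def R_def Y_def cfc_compose[OF sd cr cu] .
  \<comment> \<open>Common limit of the left factors in \<open>W\<close> and \<open>X\<close>: up to
    null sequences the correction only multiplies the given rows by \<open>f(d)\<close>.\<close>
  define F where "F N = cfc f (d N)" for N
  have sF: "star (F N) = F N" for N unfolding F_def using sd cf by simp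
  have bF: "Bseq F" unfolding F_def by (intro Bseq_cfc bd sd cf)
  have F1: "F N = R N * (Y N * (S N * G N))" for N
    unfolding F_def R_def Y_def S_def G_def f_def[abs_def]
    using sd cru cu cs cg by (simp add: cfc_mult continuous_on_mult)
  have F2: "R N * (S N * (b N * b N)) = F N" for N
  proof -
    have "R N * (S N * (b N * b N)) = cfc (\<lambda>t. r (u t) * (sqrt t * (g t * t * g t))) (d N)"
      unfolding bb R_def S_def G_def
      using sd cru cs cg by (simp add: cfc_mult cfc_ident continuous_on_mult continuous_on_id)
    also have "\<dots> = F N" unfolding F_def by (rule cfc_cong) (simp add: f_def u_def)
    finally show ?thesis .
  qed
  have WF: "W j \<doteq> (\<lambda>N. F N * w j N)" if "j < m" for j
  proof -
    have "(\<lambda>N. P N * (y N * (a N * G N))) \<doteq> (\<lambda>N. R N * (Y N * (S N * G N)))"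
      by (intro asymp_eq_mult PR yY aS asymp_eq_refl Bseq_mult' bP by' ba bY bGKS)
    then have "(\<lambda>N. P N * (y N * (a N * G N))) \<doteq> F" unfolding F1[symmetric] .
    from asymp_eq_mult_right[OF this bw[OF that]] show ?thesis
      unfolding W_def by (simp only: mult.assoc)
  qed
  have XF: "X \<doteq> (\<lambda>N. F N * x N)"
  proof -
    have "z \<doteq> (\<lambda>N. S N * b N)" unfolding z_def by (rule asymp_eq_mult_right[OF aS bb'])
    then have "(\<lambda>N. P N * (z N * b N)) \<doteq> (\<lambda>N. R N * (S N * b N * b N))"
      by (intro asymp_eq_mult PR asymp_eq_refl Bseq_mult' bP bz bGKS bb')
    then have "(\<lambda>N. P N * (z N * b N)) \<doteq> F" unfolding mult.assoc F2 .
    from asymp_eq_mult[OF this x'x] show ?thesis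
      unfolding X_def using bP bz bb' bx by (simp only: mult.assoc Bseq_mult')
  qed
  have FdF: "norm ((F N - 1) * d N * (F N - 1)) \<le> 2 * h" for N
  proof -
    have cf1: "continuous_on UNIV (\<lambda>t. f t - 1)" by (intro continuous_intros cf)
    have "F N - 1 = cfc (\<lambda>t. f t - 1) (d N)"
      unfolding F_def using cfc_diff[OF sd cf continuous_on_const, of 1] sd by (simp add: cfc_const)
    then have "(F N - 1) * d N * (F N - 1) = cfc (\<lambda>t. (f t - 1) * t * (f t - 1)) (d N)"
      using sd cf1 by (simp add: cfc_mult cfc_ident continuous_on_mult continuous_on_id)
    also have "norm \<dots> \<le> 2 * h"
    proof (rule cfc_norm_le[OF sd])
      fix t assume "t \<in> real_spectrum (d N)"
      then show "\<bar>(f t - 1) * t * (f t - 1)\<bar> \<le> 2 * h" using f1[of t] spd by fastforce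
    qed (intro continuous_intros cf1)
    finally show ?thesis .
  qed
  \<comment> \<open>This explains \<open>h = e\<^sup>2 / 8\<close>: multiplication by
    \<open>F\<close> moves \<open>w j\<close> by at most \<open>e / 2\<close>, and the other half of
    \<open>e\<close> is left for null sequences.\<close>
  have h2: "2 * h = (e / 2)\<^sup>2" by (simp add: h_def power2_eq_square)
  have Fw: "norm (F N * w j N - w j N) \<le> e / 2" if "j < m" for j N
  proof -
    have "F N * w j N - w j N = (F N - 1) * w j N" by (simp add: algebra_simps)
    then have "norm (F N * w j N - w j N) ^ 2 = norm ((F N - 1) * w j N * star ((F N - 1) * w j N))"
      by (simp only: norm_mult_star_self)
    also have "(F N - 1) * w j N * star ((F N - 1) * w j N) = (F N - 1) * (w j N * star (w j N)) * (F N - 1)"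
      by (simp add: star_mult sF mult.assoc)
    also have "norm \<dots> \<le> (e / 2)\<^sup>2" using FdF[of N] w[OF that that] unfolding h2 by simp
    finally show ?thesis by (rule power2_le_imp_le) (use e in simp)
  qed
  have "\<forall>\<^sub>F N in sequentially. norm (W j N - w j N) \<le> e" if j: "j < m" for j
  proof -
    have "(\<lambda>N. W j N - F N * w j N) \<longlonglongrightarrow> 0" using WF[OF j] by (simp add: asymp_eq_def)
    then have "\<forall>\<^sub>F N in sequentially. norm (W j N - F N * w j N) < e / 2"
      using order_tendstoD(2)[OF tendsto_norm_zero half_gt_zero[OF e]] by blast
    then show ?thesis
    proof eventually_elim
      case (elim N)
      then show ?case
        using Fw[OF j, of N] norm_triangle_ineq[of "W j N - F N * w j N" "F N * w j N - w j N"] by simp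
    qed
  qed
  moreover have "\<forall>\<^sub>F N in sequentially. norm (X N - x N) \<le> e"
  proof -
    have b1: "Bseq (\<lambda>N. F N - 1)" using Bseq_add'[OF bF Bseq_const[of "- 1"]] by simp
    have "(\<lambda>N. (F N - 1) * (x N * star (x N)) * (F N - 1)) \<doteq> (\<lambda>N. (F N - 1) * d N * (F N - 1))"
      by (intro asymp_eq_mult_right asymp_eq_mult_left xx b1)
    then have "(\<lambda>N. (F N - 1) * (x N * star (x N)) * (F N - 1) - (F N - 1) * d N * (F N - 1)) \<longlonglongrightarrow> 0"
      by (simp add: asymp_eq_def)
    \<comment> \<open>\<open>5/16 + 1/4 = (3/4)\<^sup>2\<close>, which leaves \<open>e / 4\<close>
      for the distance between \<open>X\<close> and \<open>F x\<close>.\<close>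
    then have "\<forall>\<^sub>F N in sequentially.
        norm ((F N - 1) * (x N * star (x N)) * (F N - 1) - (F N - 1) * d N * (F N - 1)) < 5 / 16 * e\<^sup>2"
      using e by (intro order_tendstoD(2)[OF tendsto_norm_zero]) auto
    moreover have "(\<lambda>N. X N - F N * x N) \<longlonglongrightarrow> 0" using XF by (simp add: asymp_eq_def)
    then have "\<forall>\<^sub>F N in sequentially. norm (X N - F N * x N) < e / 4"
      using e by (intro order_tendstoD(2)[OF tendsto_norm_zero]) auto
    ultimately show ?thesis
    proof eventually_elim
      case (elim N)
      have eq: "F N * x N - x N = (F N - 1) * x N" by (simp add: algebra_simps)
      then have "norm (F N * x N - x N) ^ 2 = norm ((F N - 1) * x N * star ((F N - 1) * x N))"
        by (simp only: norm_mult_star_self)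
      also have "(F N - 1) * x N * star ((F N - 1) * x N) = (F N - 1) * (x N * star (x N)) * (F N - 1)"
        by (simp add: star_mult sF mult.assoc)
      also have "norm \<dots> \<le> 5 / 16 * e\<^sup>2 + 2 * h"
        using elim(1) FdF[of N] norm_triangle_sub[of "(F N - 1) * (x N * star (x N)) * (F N - 1)"
          "(F N - 1) * d N * (F N - 1)"] by linarith
      also have "\<dots> = (3 / 4 * e)\<^sup>2" by (simp add: h_def power2_eq_square)
      finally have "norm (F N * x N - x N) \<le> 3 / 4 * e" by (rule power2_le_imp_le) (use e in simp)
      then show ?case
        using elim(2) norm_triangle_ineq[of "X N - F N * x N" "F N * x N - x N"] by simp
    qed
  qed
  ultimately show ?thesis using WB XB WW XW XX by blast
qed

definition orthogonal_rows :: "nat \<Rightarrow> (nat \<Rightarrow> 'a::cstar_algebra) \<Rightarrow> 'a \<Rightarrow> bool"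
  where "orthogonal_rows n w d \<longleftrightarrow> (\<forall>i<n. \<forall>j<n. w i * star (w j) = (if i = j then d else 0))"

text \<open>Without such a \<open>\<delta>\<close>, counterexamples for
  \<open>\<delta> = 1 / (N + 1)\<close> would form sequences, bounded by \<open>K\<close>, that
  contradict the sequential version.\<close>

lemma adjoin_orthogonal_row_uniform:
  fixes B :: "'a::cstar_algebra_1 set"
  assumes B: "cstar_subalgebra B" and m: "m \<ge> 1" and e: "e > 0"
  shows "\<exists>\<delta>>0. \<forall>w d. (\<forall>j\<le>m. w j \<in> B \<and> norm (w j) \<le> K) \<and> orthogonal_rows m w d \<and>
    (\<forall>j<m. norm (w m * star (w j)) \<le> \<delta>) \<and> norm (w m * star (w m) - d) \<le> \<delta> \<longrightarrow>
    (\<exists>w' d'. orthogonal_rows (Suc m) w' d' \<and> (\<forall>j\<le>m. w' j \<in> B \<and> norm (w' j - w j) \<le> e))"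
proof (rule ccontr)
  define good where "good w = (\<exists>w' d'. orthogonal_rows (Suc m) w' d' \<and>
    (\<forall>j\<le>m. w' j \<in> B \<and> norm (w' j - w j) \<le> e))" for w
  assume c: "\<not> ?thesis"
  have "\<exists>w d. ((\<forall>j\<le>m. w j \<in> B \<and> norm (w j) \<le> K) \<and> orthogonal_rows m w d \<and>
    (\<forall>j<m. norm (w m * star (w j)) \<le> inverse (real (Suc N))) \<and>
    norm (w m * star (w m) - d) \<le> inverse (real (Suc N))) \<and> \<not> good w" for N
  proof -
    have "inverse (real (Suc N)) > 0" by simp
    then show ?thesis using c unfolding good_def by blast
  qed
  then obtain w d where wd: "\<And>N. (\<forall>j\<le>m. w N j \<in> B \<and> norm (w N j) \<le> K) \<and> orthogonal_rows m (w N) (d N) \<and>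
    (\<forall>j<m. norm (w N m * star (w N j)) \<le> inverse (real (Suc N))) \<and>
    norm (w N m * star (w N m) - d N) \<le> inverse (real (Suc N))" and bad: "\<And>N. \<not> good (w N)"
    by metis
  have lim: "f \<longlonglongrightarrow> 0" if "\<And>N. norm (f N) \<le> inverse (real (Suc N))" for f :: "nat \<Rightarrow> 'a"
    by (rule Lim_null_comparison[OF always_eventually LIMSEQ_inverse_real_of_nat]) (use that in blast)
  have "\<exists>W X D. (\<forall>N. \<forall>j<m. W j N \<in> B) \<and> (\<forall>N. X N \<in> B) \<and>
    (\<forall>N. \<forall>i<m. \<forall>j<m. W i N * star (W j N) = (if i = j then D N else 0)) \<and>
    (\<forall>N. \<forall>j<m. X N * star (W j N) = 0) \<and> (\<forall>N. X N * star (X N) = D N) \<and>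
    (\<forall>j<m. \<forall>\<^sub>F N in sequentially. norm (W j N - w N j) \<le> e) \<and>
    (\<forall>\<^sub>F N in sequentially. norm (X N - w N m) \<le> e)"
  proof (rule adjoin_orthogonal_row[OF B m e, of "\<lambda>j N. w N j" "\<lambda>N. w N m" d])
    show "Bseq (\<lambda>N. w N j)" if "j < m" for j using wd that by (intro BseqI'[of _ K]) auto
    show "Bseq (\<lambda>N. w N m)" using wd by (intro BseqI'[of _ K]) auto
    show "(\<lambda>N. w N m * star (w N j)) \<longlonglongrightarrow> 0" if "j < m" for j using wd that by (intro lim) blast
    show "(\<lambda>N. w N m * star (w N m)) \<doteq> d" unfolding asymp_eq_def using wd by (intro lim) blast
    show "w N i * star (w N j) = (if i = j then d N else 0)" if "i < m" "j < m" for N i j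
      using wd[of N] that by (simp add: orthogonal_rows_def)
  qed (use wd in auto)
  then obtain W X D where W: "\<And>N j. j < m \<Longrightarrow> W j N \<in> B" "\<And>N. X N \<in> B"
    "\<And>N i j. i < m \<Longrightarrow> j < m \<Longrightarrow> W i N * star (W j N) = (if i = j then D N else 0)"
    "\<And>N j. j < m \<Longrightarrow> X N * star (W j N) = 0" "\<And>N. X N * star (X N) = D N"
    and ev: "\<forall>j\<in>{..<m}. \<forall>\<^sub>F N in sequentially. norm (W j N - w N j) \<le> e"
    "\<forall>\<^sub>F N in sequentially. norm (X N - w N m) \<le> e" by blast
  have "\<forall>\<^sub>F N in sequentially. (\<forall>j\<in>{..<m}. norm (W j N - w N j) \<le> e) \<and> norm (X N - w N m) \<le> e"
    using eventually_ball_finite[OF finite_lessThan ev(1)] ev(2) by (rule eventually_conj)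
  then obtain N where N: "\<And>j. j < m \<Longrightarrow> norm (W j N - w N j) \<le> e" "norm (X N - w N m) \<le> e"
    using eventually_happens'[OF sequentially_bot] by fastforce
  define w' where "w' j = (if j < m then W j N else X N)" for j
  have WX: "W j N * star (X N) = 0" if "j < m" for j
    using arg_cong[OF W(4)[OF that, of N], of star] by (simp add: star_simps)
  have "orthogonal_rows (Suc m) w' (D N)"
    unfolding orthogonal_rows_def w'_def using W(3,4,5) WX by (auto simp: less_Suc_eq)
  moreover have "\<forall>j\<le>m. w' j \<in> B \<and> norm (w' j - w N j) \<le> e"
    using W(1,2) N by (auto simp: w'_def le_less)
  ultimately have "good (w N)" unfolding good_def by blast
  then show False using bad by blast
qed

text \<open>Induction on the number of rows: the first \<open>n\<close> are repaired by the
  induction hypothesis, the next one is adjoined as it stands. A single row satisfies the relations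
  with \<open>d\<close> its own square.\<close>

lemma orthogonal_rows_stable_unital:
  fixes B :: "'a::cstar_algebra_1 set"
  assumes B: "cstar_subalgebra B" and n: "n \<ge> 1" and e: "e > 0" and K: "K > 0"
  shows "\<exists>\<delta>>0. \<forall>x. (\<forall>j<n. x j \<in> B \<and> norm (x j) \<le> K) \<and>
    (\<forall>i<n. \<forall>j<n. norm (x i * star (x j) - (if i = j then x 0 * star (x 0) else 0)) \<le> \<delta>) \<longrightarrow>
    (\<exists>w d. orthogonal_rows n w d \<and> (\<forall>j<n. w j \<in> B \<and> norm (w j - x j) \<le> e))"
  using n e
proof (induction n arbitrary: e rule: dec_induct)
  case base
  show ?case
    by (intro exI[of _ 1] conjI allI impI, simp, rule exI, rule exI, rule conjI[of "orthogonal_rows 1 _ _"])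
      (auto simp: orthogonal_rows_def intro!: less_imp_le[OF base])
next
  case (step n)
  obtain \<delta>1 where d1: "\<delta>1 > 0" and T: "\<And>w d. (\<forall>j\<le>n. w j \<in> B \<and> norm (w j) \<le> K + 1) \<Longrightarrow>
    orthogonal_rows n w d \<Longrightarrow> (\<forall>j<n. norm (w n * star (w j)) \<le> \<delta>1) \<Longrightarrow> norm (w n * star (w n) - d) \<le> \<delta>1 \<Longrightarrow>
    (\<exists>w' d'. orthogonal_rows (Suc n) w' d' \<and> (\<forall>j\<le>n. w' j \<in> B \<and> norm (w' j - w j) \<le> e / 2))"
    using adjoin_orthogonal_row_uniform[OF B step.hyps(1) half_gt_zero[OF step.prems], of "K + 1"] by blast
  \<comment> \<open>\<open>e' \<le> 1\<close> keeps the repaired rows within \<open>K + 1\<close>,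
    the bound for which \<open>\<delta>1\<close> was obtained. The last entry limits the change of
    the products caused by the repair to \<open>\<delta>1 / 2\<close>; the other half is granted to
    \<open>\<delta>\<close>.\<close>
  define e' where "e' = min (e / 2) (min 1 (\<delta>1 / (4 * (K + 1))))"
  have e': "e' > 0" "e' \<le> 1" using step.prems d1 K by (auto simp: e'_def)
  have e'2: "e' \<le> e / 2" unfolding e'_def by (rule min.cobounded1)
  have "e' \<le> \<delta>1 / (4 * (K + 1))" by (simp add: e'_def)
  then have e'K: "(K + 1) * e' \<le> \<delta>1 / 4" using K by (simp add: field_simps)
  obtain \<delta>2 where d2: "\<delta>2 > 0" and IH: "\<And>x. (\<forall>j<n. x j \<in> B \<and> norm (x j) \<le> K) \<Longrightarrow>
    (\<forall>i<n. \<forall>j<n. norm (x i * star (x j) - (if i = j then x 0 * star (x 0) else 0)) \<le> \<delta>2) \<Longrightarrow>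
    (\<exists>w d. orthogonal_rows n w d \<and> (\<forall>j<n. w j \<in> B \<and> norm (w j - x j) \<le> e'))"
    using step.IH[OF e'(1)] by blast
  define \<delta> where "\<delta> = min \<delta>2 (\<delta>1 / 2)"
  have d: "\<delta> > 0" "\<delta> \<le> \<delta>2" "\<delta> \<le> \<delta>1 / 2" using d1 d2 by (auto simp: \<delta>_def)
  show ?case
  proof (intro exI[of _ \<delta>] conjI allI impI d(1), elim conjE)
    fix x assume x: "\<forall>j<Suc n. x j \<in> B \<and> norm (x j) \<le> K"
      and xx: "\<forall>i<Suc n. \<forall>j<Suc n. norm (x i * star (x j) - (if i = j then x 0 * star (x 0) else 0)) \<le> \<delta>"
    have xx': "norm (x i * star (x j) - (if i = j then x 0 * star (x 0) else 0)) \<le> \<delta>"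
      if "i < Suc n" "j < Suc n" for i j using xx that by blast
    have "\<exists>w d. orthogonal_rows n w d \<and> (\<forall>j<n. w j \<in> B \<and> norm (w j - x j) \<le> e')"
    proof (rule IH)
      show "\<forall>i<n. \<forall>j<n. norm (x i * star (x j) - (if i = j then x 0 * star (x 0) else 0)) \<le> \<delta>2"
        using xx' d(2) by (meson less_SucI order_trans)
    qed (use x in auto)
    then obtain w d where w: "orthogonal_rows n w d" "\<And>j. j < n \<Longrightarrow> w j \<in> B" "\<And>j. j < n \<Longrightarrow> norm (w j - x j) \<le> e'"
      by blast
    have n0: "0 < n" using step.hyps(1) by simp
    have nw: "norm (w j) \<le> K + 1" if "j < n" for j
      using w(3)[OF that] x that e'(2) norm_triangle_sub[of "w j" "x j"] by (smt (verit) less_SucI)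
    have nx: "norm (x j) \<le> K" if "j < Suc n" for j using x that by blast
    define v where "v j = (if j < n then w j else x n)" for j
    have "\<exists>w' d'. orthogonal_rows (Suc n) w' d' \<and> (\<forall>j\<le>n. w' j \<in> B \<and> norm (w' j - v j) \<le> e / 2)"
    proof (rule T)
      show "\<forall>j\<le>n. v j \<in> B \<and> norm (v j) \<le> K + 1"
        using w(2) nw x nx[of n] by (auto simp: v_def)
      show "orthogonal_rows n v d" using w(1) by (simp add: orthogonal_rows_def v_def)
      show "\<forall>j<n. norm (v n * star (v j)) \<le> \<delta>1"
      proof (intro allI impI)
        fix j assume j: "j < n"
        have 1: "norm (x n * star (x j)) \<le> \<delta>" using xx'[of n j] j by simp
        have 2: "norm (x n * star (w j - x j)) \<le> K * e'"
          using nx[of n] w(3)[OF j] K by (intro order_trans[OF norm_mult_ineq] mult_mono) (auto simp del: star_diff)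
        have "v n * star (v j) = x n * star (x j) + x n * star (w j - x j)"
          using j by (simp add: v_def algebra_simps)
        then have "norm (v n * star (v j)) \<le> \<delta> + K * e'"
          using 1 2 norm_triangle_ineq[of "x n * star (x j)" "x n * star (w j - x j)"] by simp
        also have "\<dots> \<le> \<delta>1" using e'K d(3) d1 e'(1) by (simp add: algebra_simps)
        finally show "norm (v n * star (v j)) \<le> \<delta>1" .
      qed
      show "norm (v n * star (v n) - d) \<le> \<delta>1"
      proof -
        have d_eq: "d = w 0 * star (w 0)" using w(1) n0 by (simp add: orthogonal_rows_def)
        have 1: "norm (x n * star (x n) - x 0 * star (x 0)) \<le> \<delta>" using xx'[of n n] by simp
        have 2: "norm ((w 0 - x 0) * star (x 0)) \<le> e' * K"
          using nx[of 0] w(3)[OF n0] e'(1) by (intro order_trans[OF norm_mult_ineq] mult_mono) auto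
        have 3: "norm (w 0 * star (w 0 - x 0)) \<le> (K + 1) * e'"
          using nw[OF n0] w(3)[OF n0] K by (intro order_trans[OF norm_mult_ineq] mult_mono) (auto simp del: star_diff)
        have "v n * star (v n) - d = (x n * star (x n) - x 0 * star (x 0)) -
          ((w 0 - x 0) * star (x 0) + w 0 * star (w 0 - x 0))"
          unfolding d_eq by (simp add: v_def algebra_simps)
        then have "norm (v n * star (v n) - d) \<le> norm (x n * star (x n) - x 0 * star (x 0)) +
          (norm ((w 0 - x 0) * star (x 0)) + norm (w 0 * star (w 0 - x 0)))"
          by (simp only:) (intro order_trans[OF norm_triangle_ineq4] add_left_mono norm_triangle_ineq)
        also have "\<dots> \<le> \<delta> + (e' * K + (K + 1) * e')" by (intro add_mono 1 2 3)
        also have "\<dots> \<le> \<delta>1" using e'K d(3) e'(1) by (simp add: algebra_simps)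
        finally show ?thesis .
      qed
    qed
    then obtain w' d' where w': "orthogonal_rows (Suc n) w' d'"
      "\<And>j. j \<le> n \<Longrightarrow> w' j \<in> B" "\<And>j. j \<le> n \<Longrightarrow> norm (w' j - v j) \<le> e / 2" by blast
    have "norm (w' j - x j) \<le> e" if "j < Suc n" for j
    proof -
      have "norm (v j - x j) \<le> e / 2"
        using that w(3)[of j] e'2 step.prems by (auto simp: v_def less_Suc_eq)
      moreover have "norm (w' j - x j) \<le> norm (w' j - v j) + norm (v j - x j)"
        using norm_triangle_ineq[of "w' j - v j" "v j - x j"] by simp
      ultimately show ?thesis using w'(3)[of j] that by simp
    qed
    then show "\<exists>w d. orthogonal_rows (Suc n) w d \<and> (\<forall>j<Suc n. w j \<in> B \<and> norm (w j - x j) \<le> e)"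
      using w'(1,2) by (meson less_Suc_eq_le)
  qed
qed

text \<open>The corrected rows stay in the embedded copy of \<open>B\<close>, so
  \<open>upart\<close> preserves both the relations and the distances.\<close>

lemma orthogonal_rows_stable:
  fixes B :: "'a::cstar_algebra set"
  assumes B: "cstar_subalgebra B" and n: "n \<ge> 1" and e: "e > 0" and K: "K > 0"
  shows "\<exists>\<delta>>0. \<forall>x. (\<forall>j<n. x j \<in> B \<and> norm (x j) \<le> K) \<and>
    (\<forall>i<n. \<forall>j<n. norm (x i * star (x j) - (if i = j then x 0 * star (x 0) else 0)) \<le> \<delta>) \<longrightarrow>
    (\<exists>w d. orthogonal_rows n w d \<and> (\<forall>j<n. w j \<in> B \<and> norm (w j - x j) \<le> e))"
proof -
  obtain \<delta> where d: "\<delta> > 0" and S: "\<And>x. (\<forall>j<n. x j \<in> emb ` B \<and> norm (x j) \<le> K) \<Longrightarrow>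
    (\<forall>i<n. \<forall>j<n. norm (x i * star (x j) - (if i = j then x 0 * star (x 0) else 0)) \<le> \<delta>) \<Longrightarrow>
    (\<exists>w d. orthogonal_rows n w d \<and> (\<forall>j<n. w j \<in> emb ` B \<and> norm (w j - x j) \<le> e))"
    using orthogonal_rows_stable_unital[OF cstar_subalgebra_emb[OF B] n e K] by blast
  show ?thesis
  proof (intro exI[of _ \<delta>] conjI allI impI d(1), elim conjE)
    fix x assume x: "\<forall>j<n. x j \<in> B \<and> norm (x j) \<le> K"
      and xx: "\<forall>i<n. \<forall>j<n. norm (x i * star (x j) - (if i = j then x 0 * star (x 0) else 0)) \<le> \<delta>"
    have "norm (emb (x i) * star (emb (x j)) - (if i = j then emb (x 0) * star (emb (x 0)) else 0)) =
      norm (x i * star (x j) - (if i = j then x 0 * star (x 0) else 0))" for i j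
      by (subst norm_emb[symmetric]) (simp add: emb_simps)
    then have "\<exists>w d. orthogonal_rows n w d \<and> (\<forall>j<n. w j \<in> emb ` B \<and> norm (w j - emb (x j)) \<le> e)"
      using x xx by (intro S) (simp_all add: norm_emb)
    then obtain w d where w: "orthogonal_rows n w d" "\<And>j. j < n \<Longrightarrow> w j \<in> emb ` B"
      "\<And>j. j < n \<Longrightarrow> norm (w j - emb (x j)) \<le> e" by blast
    have ew: "w j = emb (upart (w j))" "upart (w j) \<in> B" if "j < n" for j using w(2)[OF that] by auto
    have "d = w 0 * star (w 0)" using w(1) n by (simp add: orthogonal_rows_def)
    also have "\<dots> = emb (upart (w 0) * star (upart (w 0)))" using ew(1)[of 0] n by (simp add: emb_simps)
    finally have ed: "d = emb (upart (w 0) * star (upart (w 0)))" .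
    have "orthogonal_rows n (\<lambda>j. upart (w j)) (upart (w 0) * star (upart (w 0)))"
      unfolding orthogonal_rows_def
    proof (intro allI impI)
      fix i j assume ij: "i < n" "j < n"
      have "emb (upart (w i) * star (upart (w j))) = w i * star (w j)"
        unfolding emb_simps using ew(1)[OF ij(1)] ew(1)[OF ij(2)] by simp
      also have "\<dots> = (if i = j then d else 0)" using w(1) ij by (simp add: orthogonal_rows_def)
      also have "\<dots> = emb (if i = j then upart (w 0) * star (upart (w 0)) else 0)"
        using ed by (simp add: emb_simps)
      finally show "upart (w i) * star (upart (w j)) = (if i = j then upart (w 0) * star (upart (w 0)) else 0)"
        by simp
    qed
    moreover have "norm (upart (w j) - x j) \<le> e" if "j < n" for j
      using w(3)[OF that] ew(1)[OF that] norm_emb[of "upart (w j) - x j"] by (metis emb_simps(2))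
    ultimately show "\<exists>w d. orthogonal_rows n w d \<and> (\<forall>j<n. w j \<in> B \<and> norm (w j - x j) \<le> e)"
      using ew(2) by blast
  qed
qed

section \<open>Complex matrices and their norm\<close>

lemma index_mult_mat_sum:
  fixes y :: "'a::semiring_0 mat"
  assumes "y \<in> carrier_mat n m" "z \<in> carrier_mat m l" "i < n" "j < l"
  shows "(y * z) $$ (i, j) = (\<Sum>k<m. y $$ (i, k) * z $$ (k, j))"
  using assms by (auto simp: scalar_prod_def atLeast0LessThan intro!: sum.cong)

lemma mat_star_carrier: "z \<in> carrier_mat n m \<Longrightarrow> mat_star z \<in> carrier_mat m n"
  by (simp add: mat_star_def)

lemma index_mat_star: "z \<in> carrier_mat n m \<Longrightarrow> i < m \<Longrightarrow> j < n \<Longrightarrow> mat_star z $$ (i, j) = star (z $$ (j, i))"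
  by (simp add: mat_star_def)

lemma index_mult_vec_sum:
  fixes y :: "'a::semiring_0 mat"
  assumes "y \<in> carrier_mat n m" "v \<in> carrier_vec m" "i < n"
  shows "(y *\<^sub>v v) $ i = (\<Sum>k<m. y $$ (i, k) * v $ k)"
  using assms by (auto simp: scalar_prod_def atLeast0LessThan intro!: sum.cong)

lemma vec_l2_nonneg: "0 \<le> vec_l2 v"
  by (simp add: vec_l2_def)

lemma vec_l2_eq_0_iff: "vec_l2 v = 0 \<longleftrightarrow> (\<forall>i<dim_vec v. v $ i = 0)"
  by (auto simp: vec_l2_def L2_set_eq_0_iff)

lemma vec_l2_smult: "vec_l2 (c \<cdot>\<^sub>v v) = cmod c * vec_l2 v"
proof -
  have "vec_l2 (c \<cdot>\<^sub>v v) = L2_set (\<lambda>i. cmod c * cmod (v $ i)) {..<dim_vec v}"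
    unfolding vec_l2_def by (intro L2_set_cong) (auto simp: norm_mult)
  then show ?thesis by (simp add: vec_l2_def L2_set_right_distrib)
qed

lemma cmod_index_le_vec_l2: "i < dim_vec v \<Longrightarrow> cmod (v $ i) \<le> vec_l2 v"
  unfolding vec_l2_def by (rule member_le_L2_set) auto

lemma vec_l2_unit_vec: "j < n \<Longrightarrow> vec_l2 (unit_vec n j) = 1"
proof -
  assume j: "j < n"
  have "(\<Sum>i<n. (cmod (unit_vec n j $ i))\<^sup>2) = (\<Sum>i<n. if i = j then 1 else 0)"
    by (rule sum.cong) (use j in auto)
  then show ?thesis using j by (simp add: vec_l2_def L2_set_def)
qed

text \<open>Explicit bounds instead of a supremum: products and adjoints are easy to handle, and the
  passage to \<open>op_norm\<close> happens only at both ends.\<close>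

definition l2_bound :: "nat \<Rightarrow> complex mat \<Rightarrow> real \<Rightarrow> bool"
  where "l2_bound n z c \<longleftrightarrow> 0 \<le> c \<and> (\<forall>v\<in>carrier_vec n. vec_l2 (z *\<^sub>v v) \<le> c * vec_l2 v)"

lemma l2_bound_exists:
  assumes z: "z \<in> carrier_mat n n" shows "\<exists>c. l2_bound n z c"
proof -
  define c where "c = (\<Sum>i<n. \<Sum>j<n. cmod (z $$ (i, j)))"
  have "vec_l2 (z *\<^sub>v v) \<le> c * vec_l2 v" if v: "v \<in> carrier_vec n" for v
  proof -
    have "vec_l2 (z *\<^sub>v v) \<le> (\<Sum>i<n. cmod ((z *\<^sub>v v) $ i))"
      unfolding vec_l2_def using z by (intro order_trans[OF L2_set_le_sum]) auto
    also have "\<dots> \<le> (\<Sum>i<n. \<Sum>j<n. cmod (z $$ (i, j)) * vec_l2 v)"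
    proof (rule sum_mono)
      fix i assume "i \<in> {..<n}"
      then have "cmod ((z *\<^sub>v v) $ i) = cmod (\<Sum>j<n. z $$ (i, j) * v $ j)"
        by (simp only: index_mult_vec_sum[OF z v] lessThan_iff)
      also have "\<dots> \<le> (\<Sum>j<n. cmod (z $$ (i, j)) * vec_l2 v)"
        using v by (intro sum_norm_le) (auto simp: norm_mult intro!: mult_left_mono cmod_index_le_vec_l2)
      finally show "cmod ((z *\<^sub>v v) $ i) \<le> (\<Sum>j<n. cmod (z $$ (i, j)) * vec_l2 v)" .
    qed
    finally show ?thesis by (simp add: c_def sum_distrib_right)
  qed
  moreover have "0 \<le> c" by (simp add: c_def sum_nonneg)
  ultimately show ?thesis unfolding l2_bound_def by blast
qed

lemma op_norm_le:
  assumes "l2_bound n z c" shows "op_norm n z \<le> c"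
  unfolding op_norm_def
proof (rule cSup_least)
  have "vec_l2 (0\<^sub>v n) = 0" by (simp add: vec_l2_eq_0_iff)
  then show "{vec_l2 (z *\<^sub>v v) |v. v \<in> carrier_vec n \<and> vec_l2 v \<le> 1} \<noteq> {}"
    using zero_carrier_vec by (metis (mono_tags, lifting) empty_iff mem_Collect_eq zero_le_one)
  fix x assume "x \<in> {vec_l2 (z *\<^sub>v v) |v. v \<in> carrier_vec n \<and> vec_l2 v \<le> 1}"
  then obtain v where v: "x = vec_l2 (z *\<^sub>v v)" "v \<in> carrier_vec n" "vec_l2 v \<le> 1" by blast
  have "x \<le> c * vec_l2 v" using assms v by (simp add: l2_bound_def)
  also have "\<dots> \<le> c * 1" using assms v by (intro mult_left_mono) (auto simp: l2_bound_def)
  finally show "x \<le> c" by simp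
qed

lemma l2_bound_op_norm:
  assumes z: "z \<in> carrier_mat n n" shows "l2_bound n z (op_norm n z)"
proof -
  obtain c where c: "l2_bound n z c" using l2_bound_exists[OF z] by blast
  have bdd: "bdd_above {vec_l2 (z *\<^sub>v v) |v. v \<in> carrier_vec n \<and> vec_l2 v \<le> 1}"
  proof (rule bdd_aboveI)
    fix x assume "x \<in> {vec_l2 (z *\<^sub>v v) |v. v \<in> carrier_vec n \<and> vec_l2 v \<le> 1}"
    then obtain v where v: "x = vec_l2 (z *\<^sub>v v)" "v \<in> carrier_vec n" "vec_l2 v \<le> 1" by blast
    have "x \<le> c * vec_l2 v" using c v by (simp add: l2_bound_def)
    also have "\<dots> \<le> c * 1" using c v by (intro mult_left_mono) (auto simp: l2_bound_def)
    finally show "x \<le> c" by simp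
  qed
  have le: "vec_l2 (z *\<^sub>v v) \<le> op_norm n z" if "v \<in> carrier_vec n" "vec_l2 v \<le> 1" for v
    unfolding op_norm_def by (rule cSup_upper[OF _ bdd]) (use that in blast)
  have "vec_l2 (z *\<^sub>v v) \<le> op_norm n z * vec_l2 v" if v: "v \<in> carrier_vec n" for v
  proof (cases "vec_l2 v = 0")
    case True
    then have "vec_l2 (z *\<^sub>v v) \<le> 0" using c v by (force simp: l2_bound_def)
    then show ?thesis using True by simp
  next
    case False
    define a where "a = inverse (vec_l2 v)"
    have a: "a > 0" "a * vec_l2 v = 1" using False vec_l2_nonneg[of v] by (simp_all add: a_def)
    have "z *\<^sub>v (complex_of_real a \<cdot>\<^sub>v v) = complex_of_real a \<cdot>\<^sub>v (z *\<^sub>v v)"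
      by (rule mult_mat_vec[OF z v])
    then have "a * vec_l2 (z *\<^sub>v v) = vec_l2 (z *\<^sub>v (complex_of_real a \<cdot>\<^sub>v v))"
      using a by (simp add: vec_l2_smult)
    also have "\<dots> \<le> op_norm n z" using v a by (intro le) (auto simp: vec_l2_smult)
    also have "\<dots> = a * (op_norm n z * vec_l2 v)" using a by (simp add: mult.left_commute)
    finally show ?thesis using a by simp
  qed
  moreover have "0 \<le> op_norm n z"
    using le[of "0\<^sub>v n"] order_trans[OF vec_l2_nonneg] by (simp add: vec_l2_eq_0_iff[THEN iffD2])
  ultimately show ?thesis unfolding l2_bound_def by blast
qed

lemma l2_bound_mult:
  assumes "y \<in> carrier_mat n n" "z \<in> carrier_mat n n" "l2_bound n y c" "l2_bound n z d"
  shows "l2_bound n (y * z) (c * d)"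
  unfolding l2_bound_def
proof (intro conjI ballI)
  show "0 \<le> c * d" using assms by (simp add: l2_bound_def)
  fix v :: "complex Matrix.vec" assume v: "v \<in> carrier_vec n"
  have "vec_l2 (y * z *\<^sub>v v) = vec_l2 (y *\<^sub>v (z *\<^sub>v v))" using assms v by (simp add: assoc_mult_mat_vec)
  also have "\<dots> \<le> c * vec_l2 (z *\<^sub>v v)"
    using assms(3) mult_mat_vec_carrier[OF assms(2) v] by (simp add: l2_bound_def)
  also have "\<dots> \<le> c * (d * vec_l2 v)"
    using assms(3,4) v by (intro mult_left_mono) (auto simp: l2_bound_def)
  finally show "vec_l2 (y * z *\<^sub>v v) \<le> c * d * vec_l2 v" by (simp add: mult.assoc)
qed

text \<open>For \<open>u = mat_star z *\<^sub>v v\<close> the squared length of \<open>u\<close> is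
  the inner product of \<open>v\<close> with \<open>z *\<^sub>v u\<close>; after Cauchy-Schwarz one
  factor \<open>vec_l2 u\<close> cancels.\<close>

lemma l2_bound_mat_star:
  assumes z: "z \<in> carrier_mat n n" and c: "l2_bound n z c" shows "l2_bound n (mat_star z) c"
  unfolding l2_bound_def
proof (intro conjI ballI)
  show c0: "0 \<le> c" using c by (simp add: l2_bound_def)
  fix v :: "complex Matrix.vec" assume v: "v \<in> carrier_vec n"
  define u where "u = mat_star z *\<^sub>v v"
  have u: "u \<in> carrier_vec n" unfolding u_def using mat_star_carrier[OF z] v by (rule mult_mat_vec_carrier)
  have ui: "u $ i = (\<Sum>k<n. cnj (z $$ (k, i)) * v $ k)" if "i < n" for i
    unfolding u_def index_mult_vec_sum[OF mat_star_carrier[OF z] v that]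
    by (rule sum.cong) (use z that in \<open>auto simp: index_mat_star star_complex_def\<close>)
  have zu: "z *\<^sub>v u \<in> carrier_vec n" using z u by (rule mult_mat_vec_carrier)
  have "(vec_l2 u)\<^sup>2 = (\<Sum>i<n. (cmod (u $ i))\<^sup>2)"
    using u by (simp add: vec_l2_def L2_set_def sum_nonneg)
  then have "complex_of_real ((vec_l2 u)\<^sup>2) = (\<Sum>i<n. u $ i * cnj (u $ i))"
    by (simp only: of_real_sum complex_norm_square)
  also have "\<dots> = (\<Sum>i<n. \<Sum>k<n. v $ k * cnj (z $$ (k, i) * u $ i))"
    by (rule sum.cong) (auto simp: ui sum_distrib_right mult_ac)
  also have "\<dots> = (\<Sum>k<n. v $ k * cnj ((z *\<^sub>v u) $ k))"
    by (subst sum.swap) (auto simp: index_mult_vec_sum[OF z u] sum_distrib_left intro!: sum.cong)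
  finally have "(vec_l2 u)\<^sup>2 = cmod (\<Sum>k<n. v $ k * cnj ((z *\<^sub>v u) $ k))"
    by (metis norm_of_real abs_of_nonneg zero_le_power2)
  also have "\<dots> \<le> (\<Sum>k<n. cmod (v $ k) * cmod ((z *\<^sub>v u) $ k))"
    by (rule order_trans[OF norm_sum]) (simp add: norm_mult)
  also have "\<dots> \<le> vec_l2 v * vec_l2 (z *\<^sub>v u)"
    using L2_set_mult_ineq[of "\<lambda>k. cmod (v $ k)" "\<lambda>k. cmod ((z *\<^sub>v u) $ k)" "{..<n}"] v z
    by (simp add: vec_l2_def del: index_mult_mat_vec)
  also have "\<dots> \<le> vec_l2 v * (c * vec_l2 u)"
    using c u by (intro mult_left_mono vec_l2_nonneg) (simp add: l2_bound_def)
  finally have "vec_l2 u * vec_l2 u \<le> (c * vec_l2 v) * vec_l2 u" by (simp add: power2_eq_square mult_ac)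
  then show "vec_l2 (mat_star z *\<^sub>v v) \<le> c * vec_l2 v"
    unfolding u_def[symmetric] using vec_l2_nonneg[of u] vec_l2_nonneg[of v] c0
    by (cases "vec_l2 u = 0") (auto simp: mult_le_cancel_right)
qed

lemma cmod_index_le_l2_bound:
  assumes z: "z \<in> carrier_mat n n" and c: "l2_bound n z c" and ij: "i < n" "j < n"
  shows "cmod (z $$ (i, j)) \<le> c"
proof -
  have "(z *\<^sub>v unit_vec n j) $ i = (\<Sum>k<n. z $$ (i, k) * unit_vec n j $ k)"
    using z ij by (intro index_mult_vec_sum) auto
  also have "\<dots> = (\<Sum>k<n. if k = j then z $$ (i, j) else 0)"
    by (rule sum.cong) (use ij in auto)
  also have "\<dots> = z $$ (i, j)" using ij by simp
  finally have "cmod (z $$ (i, j)) \<le> vec_l2 (z *\<^sub>v unit_vec n j)"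
    using cmod_index_le_vec_l2[of i "z *\<^sub>v unit_vec n j"] z ij by simp
  also have "\<dots> \<le> c * vec_l2 (unit_vec n j)"
    using c unit_vec_carrier[of n j] unfolding l2_bound_def by blast
  also have "\<dots> = c" by (simp add: vec_l2_unit_vec[OF ij(2)])
  finally show ?thesis .
qed

section \<open>Order zero maps from orthogonal rows\<close>

text \<open>Adjoint of the column \<open>v\<close> times scalar matrix times column
  \<open>w\<close>. Keeping \<open>v\<close> and \<open>w\<close> apart lets one product rule serve
  the order zero map, its powers and the square roots for complete positivity.\<close>

definition mat_form :: "nat \<Rightarrow> (nat \<Rightarrow> 'a::cstar_algebra) \<Rightarrow> (nat \<Rightarrow> 'a) \<Rightarrow> complex mat \<Rightarrow> 'a"
  where "mat_form n v w z = (\<Sum>i<n. \<Sum>j<n. scaleC (z $$ (i, j)) (star (v i) * w j))"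

lemma mat_form_mult:
  assumes y: "y \<in> carrier_mat n n" and z: "z \<in> carrier_mat n n"
    and d: "\<And>j k. j < n \<Longrightarrow> k < n \<Longrightarrow> w j * star (v' k) = (if j = k then d else 0)"
  shows "mat_form n v w y * mat_form n v' w' z = mat_form n v (\<lambda>l. d * w' l) (y * z)"
proof -
  have "mat_form n v w y * mat_form n v' w' z =
    (\<Sum>i<n. \<Sum>j<n. \<Sum>k<n. \<Sum>l<n. scaleC (y $$ (i, j) * z $$ (k, l)) (star (v i) * (w j * star (v' k)) * w' l))"
    unfolding mat_form_def sum_distrib_right unfolding sum_distrib_left
    by (intro sum.cong refl) (simp add: scaleC_mult_left scaleC_mult_right scaleC_scaleC mult.assoc mult.commute)
  also have "\<dots> = (\<Sum>i<n. \<Sum>j<n. \<Sum>l<n. scaleC (y $$ (i, j) * z $$ (j, l)) (star (v i) * (d * w' l)))"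
  proof (rule sum.cong[OF refl], rule sum.cong[OF refl])
    fix i j assume j: "j \<in> {..<n}"
    have "(\<Sum>k<n. \<Sum>l<n. scaleC (y $$ (i, j) * z $$ (k, l)) (star (v i) * (w j * star (v' k)) * w' l)) =
      (\<Sum>k<n. if k = j then \<Sum>l<n. scaleC (y $$ (i, j) * z $$ (k, l)) (star (v i) * (d * w' l)) else 0)"
      by (rule sum.cong) (use j in \<open>auto simp: d mult.assoc\<close>)
    then show "(\<Sum>k<n. \<Sum>l<n. scaleC (y $$ (i, j) * z $$ (k, l)) (star (v i) * (w j * star (v' k)) * w' l)) =
      (\<Sum>l<n. scaleC (y $$ (i, j) * z $$ (j, l)) (star (v i) * (d * w' l)))" using j by simp
  qed
  also have "\<dots> = (\<Sum>i<n. \<Sum>l<n. \<Sum>j<n. scaleC (y $$ (i, j) * z $$ (j, l)) (star (v i) * (d * w' l)))"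
    by (intro sum.cong refl sum.swap)
  also have "\<dots> = mat_form n v (\<lambda>l. d * w' l) (y * z)"
    unfolding mat_form_def
    by (intro sum.cong refl) (simp only: lessThan_iff index_mult_mat_sum[OF y z] scaleC_sum_left)
  finally show ?thesis .
qed

lemma star_mat_form:
  assumes "z \<in> carrier_mat n n" shows "star (mat_form n v w z) = mat_form n w v (mat_star z)"
proof -
  have "star (mat_form n v w z) = (\<Sum>j<n. \<Sum>i<n. scaleC (cnj (z $$ (i, j))) (star (w j) * v i))"
    unfolding mat_form_def star_sum by (subst sum.swap) (simp add: star_simps)
  also have "\<dots> = mat_form n w v (mat_star z)"
    unfolding mat_form_def using assms by (intro sum.cong refl) (simp add: index_mat_star star_complex_def)
  finally show ?thesis .
qed

lemma mat_form_0: "mat_form n v w (0\<^sub>m n n) = 0"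
  by (simp add: mat_form_def)

lemma norm_mat_form_le:
  assumes "z \<in> carrier_mat n n" "l2_bound n z c"
    and "\<And>i j. i < n \<Longrightarrow> j < n \<Longrightarrow> norm (star (v i) * w j) \<le> 1"
  shows "norm (mat_form n v w z) \<le> real n * real n * c"
proof -
  have "norm (mat_form n v w z) \<le> (\<Sum>i<n. \<Sum>j<n. c * 1)"
    unfolding mat_form_def
  proof (intro sum_norm_le)
    fix i j assume "i \<in> {..<n}" "j \<in> {..<n}"
    then show "norm (scaleC (z $$ (i, j)) (star (v i) * w j)) \<le> c * 1"
      unfolding norm_scaleC using assms
      by (intro mult_mono cmod_index_le_l2_bound[OF assms(1,2)]) (auto simp: l2_bound_def)
  qed
  then show ?thesis by (simp add: mult.assoc)
qed

lemma power_Suc_add: "power_Suc x a * power_Suc x b = power_Suc x (Suc (a + b))"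
  by (induction a) (simp_all add: mult.assoc)

text \<open>Taking roots of order \<open>2 ^ k\<close> sends the constant \<open>M\<close> to 1; an
  estimate that loses a constant factor becomes sharp by repeated squaring.\<close>

lemma le_of_power_le_const_mult:
  fixes a c M :: real
  assumes "0 \<le> a" "0 \<le> c" "\<And>k. a ^ (2 ^ k) \<le> M * c ^ (2 ^ k)"
  shows "a \<le> c"
proof (rule ccontr)
  assume ac: "\<not> a \<le> c"
  show False
  proof (cases "c = 0")
    case True
    then show False using assms(3)[of 0] ac by simp
  next
    case False
    then have c: "c > 0" using assms by simp
    then have "a / c > 1" using ac by simp
    then obtain k where k: "M < (a / c) ^ k" using real_arch_pow by blast
    have "(a / c) ^ k \<le> (a / c) ^ (2 ^ k)"
      using \<open>a / c > 1\<close> by (intro power_increasing) (auto simp: less_imp_le)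
    also have "\<dots> = a ^ (2 ^ k) / c ^ (2 ^ k)" by (rule power_divide)
    also have "\<dots> \<le> M" using assms(3)[of k] c by (simp add: divide_le_eq)
    finally show False using k by simp
  qed
qed

context
  fixes n :: nat and w :: "nat \<Rightarrow> 'a::cstar_algebra" and d :: 'a
  assumes w: "orthogonal_rows n w d" and n: "1 \<le> n" and d1: "norm d \<le> 1"
begin

private definition psi :: "complex mat \<Rightarrow> 'a" where "psi = mat_form n w (\<lambda>j. d * w j)"

private lemma d_eq: "d = w 0 * star (w 0)"
  using w n by (simp add: orthogonal_rows_def)

private lemma sd: "star d = d"
  by (subst (1 2) d_eq) (simp add: star_simps)

private lemma ww: "i < n \<Longrightarrow> j < n \<Longrightarrow> w i * star (w j) = (if i = j then d else 0)"
  using w by (simp add: orthogonal_rows_def)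

private lemma norm_w: "j < n \<Longrightarrow> norm (w j) \<le> 1"
proof -
  assume "j < n"
  then have "(norm (w j))\<^sup>2 \<le> 1\<^sup>2" using ww[of j j] d1 by (simp flip: norm_mult_star_self)
  then show ?thesis by (rule power2_le_imp_le) simp
qed

text \<open>\<open>power_Suc d a\<close> has exponent \<open>a + 1\<close>, and the contact of the
  two forms contributes one more \<open>d\<close>: the total exponent is \<open>a + b + 3\<close>,
  which is index \<open>a + b + 2\<close>.\<close>

private lemma mat_form_power_mult:
  assumes "y \<in> carrier_mat n n" "z \<in> carrier_mat n n"
  shows "mat_form n w (\<lambda>j. power_Suc d a * w j) y * mat_form n w (\<lambda>j. power_Suc d b * w j) z =
    mat_form n w (\<lambda>j. power_Suc d (a + b + 2) * w j) (y * z)"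
proof -
  have p: "power_Suc d a * d * (power_Suc d b * w j) = power_Suc d (a + b + 2) * w j" for j
  proof -
    have "power_Suc d a * d = power_Suc d (Suc a)" using power_Suc_add[of d a 0] by simp
    then show ?thesis using power_Suc_add[of d "Suc a" b] by (simp flip: mult.assoc)
  qed
  have "mat_form n w (\<lambda>j. power_Suc d a * w j) y * mat_form n w (\<lambda>j. power_Suc d b * w j) z =
    mat_form n w (\<lambda>j. power_Suc d a * d * (power_Suc d b * w j)) (y * z)"
    by (rule mat_form_mult[OF assms]) (simp add: mult.assoc ww)
  then show ?thesis by (simp only: p)
qed

private lemma psi_power: "psi = mat_form n w (\<lambda>j. power_Suc d 0 * w j)"
  by (simp add: psi_def)

private lemma star_psi: "z \<in> carrier_mat n n \<Longrightarrow> star (psi z) = psi (mat_star z)"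
  unfolding psi_def by (simp only: star_mat_form) (simp add: mat_form_def star_mult sd mult.assoc)

text \<open>A direct estimate loses the factor \<open>n * n\<close>. For the self-adjoint
  \<open>T\<close> the C*-identity makes the norm multiplicative under repeated squaring, and the
  iterated squares of \<open>T\<close> are again matrix forms, with the iterated squares of
  \<open>mat_star z * z\<close> as matrices; so the factor disappears in the limit.\<close>

private lemma norm_psi:
  assumes z: "z \<in> carrier_mat n n" shows "norm (psi z) \<le> op_norm n z"
proof -
  define c where "c = op_norm n z"
  have c: "l2_bound n z c" unfolding c_def by (rule l2_bound_op_norm[OF z])
  define T where "T = star (psi z) * psi z"
  have nz: "norm (power_Suc d a) \<le> 1" for a
  proof (induction a)
    case (Suc a)
    have "norm (d * power_Suc d a) \<le> 1 * 1"
      using d1 Suc by (intro order_trans[OF norm_mult_ineq] mult_mono) auto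
    then show ?case by simp
  qed (simp add: d1)
  have nf: "norm (mat_form n w (\<lambda>j. power_Suc d a * w j) y) \<le> real n * real n * b"
    if "y \<in> carrier_mat n n" "l2_bound n y b" for a y b
  proof (rule norm_mat_form_le[OF that])
    fix i j assume ij: "i < n" "j < n"
    have "norm (star (w i) * (power_Suc d a * w j)) \<le> 1 * (1 * 1)"
      using norm_w[OF ij(1)] norm_w[OF ij(2)] nz[of a]
      by (intro order_trans[OF norm_mult_ineq] mult_mono order_trans[OF norm_mult_ineq]) auto
    then show "norm (star (w i) * (power_Suc d a * w j)) \<le> 1" by simp
  qed
  have sz: "mat_star z \<in> carrier_mat n n" by (rule mat_star_carrier[OF z])
  have step: "\<exists>S y a. norm S = norm (psi z) ^ (2 ^ Suc k) \<and> star S = S \<and> y \<in> carrier_mat n n \<and>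
    l2_bound n y (c ^ (2 ^ Suc k)) \<and> S = mat_form n w (\<lambda>j. power_Suc d a * w j) y" for k
  proof (induction k)
    case 0
    have "T = mat_form n w (\<lambda>j. power_Suc d (0 + 0 + 2) * w j) (mat_star z * z)"
      unfolding T_def star_psi[OF z] unfolding psi_power by (rule mat_form_power_mult[OF sz z])
    moreover have "norm T = norm (psi z) ^ 2" by (simp add: T_def norm_star_mult_self)
    moreover have "l2_bound n (mat_star z * z) (c ^ 2)"
      unfolding power2_eq_square by (intro l2_bound_mult l2_bound_mat_star c z sz)
    moreover have "mat_star z * z \<in> carrier_mat n n" using sz z by (rule mult_carrier_mat)
    moreover have "star T = T" by (simp add: T_def star_simps)
    moreover have p2: "(2::nat) ^ Suc 0 = 2" by simp
    ultimately show ?case unfolding p2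
      by (intro exI[of _ T] exI[of _ "mat_star z * z"] exI[of _ "0 + 0 + 2"] conjI) assumption+
  next
    case (Suc k)
    then obtain S y a where S: "norm S = norm (psi z) ^ (2 ^ Suc k)" "star S = S" and y: "y \<in> carrier_mat n n"
      "l2_bound n y (c ^ (2 ^ Suc k))" and Sy: "S = mat_form n w (\<lambda>j. power_Suc d a * w j) y" by blast
    have e: "b ^ (2 ^ Suc (Suc k)) = b ^ (2 ^ Suc k) * b ^ (2 ^ Suc k)" for b :: real
      by (simp add: power_add[symmetric] mult_2)
    have "norm (S * S) = norm (psi z) ^ (2 ^ Suc (Suc k))"
      unfolding e using norm_star_mult_self[of S] by (simp only: S power2_eq_square)
    moreover have "star (S * S) = S * S" by (simp add: star_mult S)
    moreover have "y * y \<in> carrier_mat n n" using y(1) y(1) by (rule mult_carrier_mat)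
    moreover have "l2_bound n (y * y) (c ^ (2 ^ Suc (Suc k)))" unfolding e by (intro l2_bound_mult y)
    moreover have "S * S = mat_form n w (\<lambda>j. power_Suc d (a + a + 2) * w j) (y * y)"
      unfolding Sy by (rule mat_form_power_mult[OF y(1) y(1)])
    ultimately show ?case by blast
  qed
  have "norm (psi z) ^ 2 \<le> c ^ 2"
  proof (rule le_of_power_le_const_mult)
    fix k
    obtain S y a where S: "norm S = norm (psi z) ^ (2 ^ Suc k)" "y \<in> carrier_mat n n"
      "l2_bound n y (c ^ (2 ^ Suc k))" "S = mat_form n w (\<lambda>j. power_Suc d a * w j) y" using step by blast
    have "(norm (psi z) ^ 2) ^ (2 ^ k) = norm S" using S(1) by (simp flip: power_mult)
    also have "\<dots> \<le> real n * real n * c ^ (2 ^ Suc k)" unfolding S(4) by (rule nf[OF S(2,3)])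
    finally show "(norm (psi z) ^ 2) ^ (2 ^ k) \<le> real n * real n * (c ^ 2) ^ (2 ^ k)"
      by (simp flip: power_mult)
  qed auto
  moreover have "0 \<le> c" using c by (simp add: l2_bound_def)
  ultimately show ?thesis unfolding c_def by (rule power2_le_imp_le)
qed

lemma cpc_order_zero_mat_form:
  assumes B: "cstar_subalgebra B" "\<And>j. j < n \<Longrightarrow> w j \<in> B"
  shows "cpc_order_zero n B (mat_form n w (\<lambda>j. d * w j))"
  unfolding psi_def[symmetric] cpc_order_zero_def completely_positive_def
proof (intro conjI allI ballI impI)
  have dB: "d \<in> B" using n by (subst d_eq) (intro cstar_subalgebraD(4,6)[OF B(1)] B(2), auto)
  have formB: "mat_form n w v z \<in> B" if "\<And>j. j < n \<Longrightarrow> v j \<in> B" for v z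
    unfolding mat_form_def using that
    by (intro cstar_subalgebra_sum[OF B(1)] cstar_subalgebraD(4,5,6)[OF B(1)] B(2)) auto
  show lin: "linear_from_mats n B psi"
    unfolding linear_from_mats_def psi_def
  proof (intro conjI ballI allI)
    show "mat_form n w (\<lambda>j. d * w j) y \<in> B" for y
      by (intro formB cstar_subalgebraD(4)[OF B(1)] dB B(2))
    show "mat_form n w (\<lambda>j. d * w j) (y + z) = mat_form n w (\<lambda>j. d * w j) y + mat_form n w (\<lambda>j. d * w j) z"
      if "y \<in> carrier_mat n n" "z \<in> carrier_mat n n" for y z
      using that unfolding mat_form_def sum.distrib[symmetric]
      by (intro sum.cong refl) (simp add: scaleC_add_left)
    show "mat_form n w (\<lambda>j. d * w j) (c \<cdot>\<^sub>m y) = scaleC c (mat_form n w (\<lambda>j. d * w j) y)"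
      if "y \<in> carrier_mat n n" for y c
      using that unfolding mat_form_def scaleC_sum_right
      by (intro sum.cong refl) (simp add: scaleC_scaleC)
  qed
  fix k and X :: "complex mat" assume k: "1 \<le> k" and X: "X \<in> positive_mats UNIV (k * n)"
  then obtain Y where Y: "Y \<in> carrier_mat (k * n) (k * n)" and XY: "X = mat_star Y * Y"
    unfolding positive_mats_def by blast
  \<comment> \<open>The blocks of a root \<open>Y\<close> of \<open>X\<close> give a root of the
    amplified image: the contact \<open>w j * star (w j)\<close> between two adjacent forms produces
    exactly the \<open>d\<close> inside \<open>psi\<close>.\<close>
  define C where "C = mat k k (\<lambda>(a, b). mat_form n w w (block n Y a b))"
  have C: "C \<in> carrier_mat k k" by (simp add: C_def)
  have CB: "elements_mat C \<subseteq> B"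
    unfolding elements_mat_def C_def by (auto intro!: formB B(2))
  have lt: "i * n + p < k * n" if "i < k" "p < n" for i p
  proof -
    have "i * n + p < Suc i * n" using that by simp
    also have "\<dots> \<le> k * n" using that by (intro mult_le_mono1) simp
    finally show ?thesis .
  qed
  have bl: "block n Z i j \<in> carrier_mat n n" for Z i j by (simp add: block_def)
  have blX: "block n X i j $$ (p, q) = (\<Sum>a<k. (mat_star (block n Y a i) * block n Y a j) $$ (p, q))"
    if ij: "i < k" "j < k" and pq: "p < n" "q < n" for i j p q
  proof -
    have "block n X i j $$ (p, q) = X $$ (i * n + p, j * n + q)" using pq by (simp add: block_def)
    also have "\<dots> = (\<Sum>s<k * n. mat_star Y $$ (i * n + p, s) * Y $$ (s, j * n + q))"
      unfolding XY by (rule index_mult_mat_sum[OF mat_star_carrier[OF Y] Y lt[OF ij(1) pq(1)] lt[OF ij(2) pq(2)]])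
    also have "\<dots> = (\<Sum>s<k * n. cnj (Y $$ (s, i * n + p)) * Y $$ (s, j * n + q))"
      using Y lt[OF ij(1) pq(1)] by (intro sum.cong refl) (simp add: index_mat_star star_complex_def)
    also have "\<dots> = (\<Sum>a<k. \<Sum>s\<in>{a * n..<a * n + n}. cnj (Y $$ (s, i * n + p)) * Y $$ (s, j * n + q))"
      by (rule sum.nat_group[symmetric])
    also have "\<dots> = (\<Sum>a<k. \<Sum>r<n. cnj (Y $$ (a * n + r, i * n + p)) * Y $$ (a * n + r, j * n + q))"
    proof (rule sum.cong[OF refl])
      fix a
      show "(\<Sum>s\<in>{a * n..<a * n + n}. cnj (Y $$ (s, i * n + p)) * Y $$ (s, j * n + q)) =
        (\<Sum>r<n. cnj (Y $$ (a * n + r, i * n + p)) * Y $$ (a * n + r, j * n + q))"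
        using sum.shift_bounds_nat_ivl[of "\<lambda>s. cnj (Y $$ (s, i * n + p)) * Y $$ (s, j * n + q)" 0 "a * n" n]
        by (simp add: atLeast0LessThan add.commute)
    qed
    also have "\<dots> = (\<Sum>a<k. (mat_star (block n Y a i) * block n Y a j) $$ (p, q))"
    proof (rule sum.cong[OF refl])
      fix a
      show "(\<Sum>r<n. cnj (Y $$ (a * n + r, i * n + p)) * Y $$ (a * n + r, j * n + q)) =
        (mat_star (block n Y a i) * block n Y a j) $$ (p, q)"
        unfolding index_mult_mat_sum[OF mat_star_carrier[OF bl] bl pq]
        by (rule sum.cong[OF refl], use pq in \<open>simp add: index_mat_star[OF bl] star_complex_def\<close>)
          (use pq in \<open>simp add: block_def\<close>)
    qed
    finally show ?thesis .
  qed
  have "psi (block n X i j) = (\<Sum>a<k. star (C $$ (a, i)) * C $$ (a, j))" if ij: "i < k" "j < k" for i j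
  proof -
    have "(\<Sum>a<k. star (C $$ (a, i)) * C $$ (a, j)) = (\<Sum>a<k. psi (mat_star (block n Y a i) * block n Y a j))"
    proof (rule sum.cong[OF refl])
      fix a assume "a \<in> {..<k}"
      then have "star (C $$ (a, i)) * C $$ (a, j) =
          mat_form n w w (mat_star (block n Y a i)) * mat_form n w w (block n Y a j)"
        using ij by (simp add: C_def star_mat_form[OF bl])
      also have "\<dots> = psi (mat_star (block n Y a i) * block n Y a j)"
        unfolding psi_def by (rule mat_form_mult[OF mat_star_carrier[OF bl] bl ww])
      finally show "star (C $$ (a, i)) * C $$ (a, j) = psi (mat_star (block n Y a i) * block n Y a j)" .
    qed
    also have "\<dots> = (\<Sum>p<n. \<Sum>q<n. \<Sum>a<k. scaleC ((mat_star (block n Y a i) * block n Y a j) $$ (p, q)) (star (w p) * (d * w q)))"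
      unfolding psi_def mat_form_def by (subst sum.swap, rule sum.cong[OF refl], rule sum.swap)
    also have "\<dots> = psi (block n X i j)"
      unfolding psi_def mat_form_def scaleC_sum_left[symmetric]
      by (intro sum.cong refl) (simp only: lessThan_iff blX[OF ij])
    finally show ?thesis ..
  qed
  note amp = this
  have "amplification k n psi X = mat_star C * C"
  proof (rule eq_matI)
    fix i j assume "i < dim_row (mat_star C * C)" "j < dim_col (mat_star C * C)"
    then have ij: "i < k" "j < k" using C by (auto simp: mat_star_def)
    show "amplification k n psi X $$ (i, j) = (mat_star C * C) $$ (i, j)"
      unfolding index_mult_mat_sum[OF mat_star_carrier[OF C] C ij]
      using ij by (simp add: amplification_def amp index_mat_star[OF C])
  qed (use C in \<open>auto simp: amplification_def mat_star_def\<close>)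
  then show "amplification k n psi X \<in> positive_mats B k"
    unfolding positive_mats_def using C CB by blast
next
  fix z :: "complex mat" assume "z \<in> carrier_mat n n"
  then show "norm (psi z) \<le> op_norm n z" by (rule norm_psi)
next
  fix y z :: "complex mat"
  assume y: "y \<in> positive_mats UNIV n" and z: "z \<in> positive_mats UNIV n" and yz: "y * z = 0\<^sub>m n n"
  have pc: "x \<in> carrier_mat n n" if "x \<in> positive_mats UNIV n" for x :: "complex mat"
  proof -
    obtain C where "x = mat_star C * C" "C \<in> carrier_mat n n"
      using \<open>x \<in> positive_mats UNIV n\<close> unfolding positive_mats_def by blast
    then show ?thesis using mult_carrier_mat[OF mat_star_carrier] by blast
  qed
  note c = pc[OF y] pc[OF z]
  have "psi y * psi z = mat_form n w (\<lambda>j. power_Suc d (0 + 0 + 2) * w j) (y * z)"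
    unfolding psi_power by (rule mat_form_power_mult[OF c])
  then show "psi y * psi z = 0" by (simp add: yz mat_form_0)
qed

end

section \<open>Structure of order zero maps on matrices\<close>

definition matrix_unit :: "nat \<Rightarrow> nat \<Rightarrow> nat \<Rightarrow> complex mat"
  where "matrix_unit n i j = mat n n (\<lambda>(p, q). if p = i \<and> q = j then 1 else 0)"

lemma matrix_unit_carrier [simp]: "matrix_unit n i j \<in> carrier_mat n n"
  by (simp add: matrix_unit_def)

lemma op_norm_matrix_unit_le:
  assumes "i < n" "j < n" shows "op_norm n (matrix_unit n i j) \<le> 1"
proof (rule op_norm_le, unfold l2_bound_def, intro conjI ballI)
  fix v :: "complex Matrix.vec" assume v: "v \<in> carrier_vec n"
  have "(matrix_unit n i j *\<^sub>v v) $ p = (if p = i then v $ j else 0)" if p: "p < n" for p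
  proof -
    have "(matrix_unit n i j *\<^sub>v v) $ p = (\<Sum>q<n. matrix_unit n i j $$ (p, q) * v $ q)"
      by (rule index_mult_vec_sum[OF matrix_unit_carrier v p])
    also have "\<dots> = (\<Sum>q<n. if q = j then (if p = i then v $ j else 0) else 0)"
      by (rule sum.cong) (use p in \<open>auto simp: matrix_unit_def\<close>)
    finally show ?thesis using assms by simp
  qed
  then have "(\<Sum>p<n. (cmod ((matrix_unit n i j *\<^sub>v v) $ p))\<^sup>2) = (\<Sum>p<n. if p = i then (cmod (v $ j))\<^sup>2 else 0)"
    by (intro sum.cong) auto
  then have "vec_l2 (matrix_unit n i j *\<^sub>v v) = cmod (v $ j)"
    using assms by (simp add: vec_l2_def L2_set_def matrix_unit_def)
  then show "vec_l2 (matrix_unit n i j *\<^sub>v v) \<le> 1 * vec_l2 v"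
    using cmod_index_le_vec_l2[of j v] v assms by simp
qed simp

lemma op_norm_one_le: "op_norm n (1\<^sub>m n) \<le> 1"
  by (rule op_norm_le) (simp add: l2_bound_def)

lemma linear_from_mats_expansion:
  assumes lin: "linear_from_mats n A \<phi>" and z: "z \<in> carrier_mat n n"
  shows "\<phi> z = (\<Sum>i<n. \<Sum>j<n. scaleC (z $$ (i, j)) (\<phi> (matrix_unit n i j)))"
proof -
  define P where "P S = mat n n (\<lambda>(p, q). if (p, q) \<in> S then z $$ (p, q) else 0)" for S
  have P: "P S \<in> carrier_mat n n" for S by (simp add: P_def)
  have add: "\<phi> (x + y) = \<phi> x + \<phi> y" if "x \<in> carrier_mat n n" "y \<in> carrier_mat n n" for x y
    using lin that by (simp add: linear_from_mats_def)
  have scale: "\<phi> (c \<cdot>\<^sub>m x) = scaleC c (\<phi> x)" if "x \<in> carrier_mat n n" for c x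
    using lin that by (simp add: linear_from_mats_def)
  have "\<phi> (P S) = (\<Sum>(i, j)\<in>S. scaleC (z $$ (i, j)) (\<phi> (matrix_unit n i j)))"
    if "finite S" "S \<subseteq> {..<n} \<times> {..<n}" for S
    using that
  proof (induction S)
    case empty
    have "P {} = 0 \<cdot>\<^sub>m P {}" by (rule eq_matI) (auto simp: P_def)
    then have "\<phi> (P {}) = scaleC 0 (\<phi> (P {}))" by (metis scale P)
    then show ?case by simp
  next
    case (insert x S)
    obtain i j where x: "x = (i, j)" by force
    have "P (insert x S) = z $$ (i, j) \<cdot>\<^sub>m matrix_unit n i j + P S"
      by (rule eq_matI) (use insert.hyps x in \<open>auto simp: P_def matrix_unit_def\<close>)
    then have "\<phi> (P (insert x S)) = scaleC (z $$ (i, j)) (\<phi> (matrix_unit n i j)) + \<phi> (P S)"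
      using P by (simp add: add scale)
    then show ?case using insert x by simp
  qed
  from this[of "{..<n} \<times> {..<n}"]
  have "\<phi> (P ({..<n} \<times> {..<n})) = (\<Sum>i<n. \<Sum>j<n. scaleC (z $$ (i, j)) (\<phi> (matrix_unit n i j)))"
    by (simp add: sum.cartesian_product)
  moreover have "P ({..<n} \<times> {..<n}) = z" by (rule eq_matI) (use z in \<open>auto simp: P_def\<close>)
  ultimately show ?thesis by simp
qed

lemma sum_star_mult_eq_0':
  fixes c :: "'i \<Rightarrow> 'a::cstar_algebra"
  assumes "finite I" "(\<Sum>i\<in>I. star (c i) * c i) = 0" "i \<in> I"
  shows "c i = 0"
proof -
  have "(\<Sum>i\<in>I. star (emb (c i)) * emb (c i)) = emb (\<Sum>i\<in>I. star (c i) * c i)"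
    by (simp only: emb_sum emb_simps)
  then have "emb (c i) = 0"
    using assms by (intro sum_star_mult_eq_0[of I "\<lambda>i. emb (c i)"]) (simp_all add: emb_simps)
  then show ?thesis by (simp add: zero_unitization_def)
qed

text \<open>The order zero condition only speaks about orthogonal positive matrices; rank one
  matrices of the real vectors \<open>e_j\<close> and \<open>e_j \<plusminus> e_k\<close> suffice to
  exploit it.\<close>

definition dyad :: "nat \<Rightarrow> (nat \<Rightarrow> real) \<Rightarrow> complex mat"
  where "dyad n x = mat n n (\<lambda>(p, q). complex_of_real (x p * x q))"

lemma dyad_carrier [simp]: "dyad n x \<in> carrier_mat n n"
  by (simp add: dyad_def)

lemma dyad_positive: "dyad n x \<in> positive_mats UNIV n"
proof (cases "n = 0")
  case True
  then have "dyad n x = mat_star (dyad n x) * dyad n x" by (intro eq_matI) (auto simp: dyad_def mat_star_def)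
  then show ?thesis unfolding positive_mats_def using dyad_carrier by blast
next
  case False
  define Y where "Y = mat n n (\<lambda>(s, q). if s = 0 then complex_of_real (x q) else 0)"
  have Y: "Y \<in> carrier_mat n n" by (simp add: Y_def)
  have "dyad n x = mat_star Y * Y"
  proof (rule eq_matI)
    fix i j assume "i < dim_row (mat_star Y * Y)" "j < dim_col (mat_star Y * Y)"
    then have ij: "i < n" "j < n" using Y by (auto simp: mat_star_def)
    have "(mat_star Y * Y) $$ (i, j) = (\<Sum>s<n. if s = 0 then complex_of_real (x i * x j) else 0)"
      unfolding index_mult_mat_sum[OF mat_star_carrier[OF Y] Y ij]
      by (rule sum.cong[OF refl], use ij in \<open>simp add: index_mat_star[OF Y] star_complex_def\<close>)
        (use ij in \<open>simp add: Y_def\<close>)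
    then show "dyad n x $$ (i, j) = (mat_star Y * Y) $$ (i, j)" using ij False by (simp add: dyad_def)
  qed (use Y in \<open>auto simp: dyad_def mat_star_def\<close>)
  then show ?thesis unfolding positive_mats_def using Y by blast
qed

lemma dyad_mult_0:
  assumes "(\<Sum>q<n. x q * y q) = 0" shows "dyad n x * dyad n y = 0\<^sub>m n n"
proof (rule eq_matI)
  fix i j assume "i < dim_row (0\<^sub>m n n :: complex mat)" "j < dim_col (0\<^sub>m n n :: complex mat)"
  then have ij: "i < n" "j < n" by auto
  have "(dyad n x * dyad n y) $$ (i, j) = (\<Sum>q<n. complex_of_real (x i * y j) * complex_of_real (x q * y q))"
    unfolding index_mult_mat_sum[OF dyad_carrier dyad_carrier ij]
    by (rule sum.cong) (use ij in \<open>auto simp: dyad_def\<close>)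
  also have "\<dots> = complex_of_real (x i * y j) * complex_of_real (\<Sum>q<n. x q * y q)"
    unfolding of_real_sum sum_distrib_left ..
  finally show "(dyad n x * dyad n y) $$ (i, j) = 0\<^sub>m n n $$ (i, j)" using assms ij by simp
qed (auto simp: dyad_def)

text \<open>
  The matrix \<open>C\<close> is a square root of the image of the positive matrix of all matrix units;
  it plays the role of the Choi matrix of \<open>\<phi>\<close>.
\<close>

lemma order_zero_choi:
  assumes \<phi>: "cpc_order_zero n A \<phi>" and n: "1 \<le> n"
  obtains C where "\<And>i j. i < n \<Longrightarrow> j < n \<Longrightarrow> \<phi> (matrix_unit n i j) = (\<Sum>r<n. star (C r i) * C r j)"
proof -
  \<comment> \<open>The only nonzero row has ones at the positions \<open>i * n + i\<close>, so the
    blocks of \<open>mat_star Y * Y\<close> are the matrix units.\<close>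
  define Y where "Y = mat (n * n) (n * n) (\<lambda>(s, b). if s = 0 \<and> b div n = b mod n then 1 else (0::complex))"
  define X where "X = mat_star Y * Y"
  have Y: "Y \<in> carrier_mat (n * n) (n * n)" by (simp add: Y_def)
  have "X \<in> positive_mats UNIV (n * n)" unfolding positive_mats_def X_def using Y by blast
  then have "amplification n n \<phi> X \<in> positive_mats A n"
    using \<phi> n by (auto simp: cpc_order_zero_def completely_positive_def)
  then obtain D where D: "D \<in> carrier_mat n n" "amplification n n \<phi> X = mat_star D * D"
    unfolding positive_mats_def by blast
  have lt: "i * n + p < n * n" if "i < n" "p < n" for i p
  proof -
    have "i * n + p < Suc i * n" using that by simp
    also have "\<dots> \<le> n * n" using that by (intro mult_le_mono1) simp
    finally show ?thesis .
  qed
  have bl: "block n X i j = matrix_unit n i j" if ij: "i < n" "j < n" for i j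
  proof (rule eq_matI)
    fix p q assume "p < dim_row (matrix_unit n i j)" "q < dim_col (matrix_unit n i j)"
    then have pq: "p < n" "q < n" by (auto simp: matrix_unit_def)
    have "block n X i j $$ (p, q) = X $$ (i * n + p, j * n + q)" using pq by (simp add: block_def)
    also have "\<dots> = (\<Sum>s<n * n. cnj (Y $$ (s, i * n + p)) * Y $$ (s, j * n + q))"
      unfolding X_def index_mult_mat_sum[OF mat_star_carrier[OF Y] Y lt[OF ij(1) pq(1)] lt[OF ij(2) pq(2)]]
      by (rule sum.cong) (use lt[OF ij(1) pq(1)] in \<open>auto simp: index_mat_star[OF Y] star_complex_def\<close>)
    also have "\<dots> = (\<Sum>s<n * n. if s = 0 then (if i = p \<and> j = q then 1 else 0) else 0)"
      by (rule sum.cong) (use lt[OF ij(1) pq(1)] lt[OF ij(2) pq(2)] pq in \<open>auto simp: Y_def\<close>)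
    also have "\<dots> = (if i = p \<and> j = q then 1 else 0)" using n by simp
    finally show "block n X i j $$ (p, q) = matrix_unit n i j $$ (p, q)"
      using pq by (auto simp: matrix_unit_def)
  qed (auto simp: block_def matrix_unit_def)
  have "\<phi> (matrix_unit n i j) = (\<Sum>r<n. star (D $$ (r, i)) * D $$ (r, j))" if ij: "i < n" "j < n" for i j
  proof -
    have "\<phi> (matrix_unit n i j) = (mat_star D * D) $$ (i, j)"
      unfolding D(2)[symmetric] using ij by (simp add: amplification_def bl)
    also have "\<dots> = (\<Sum>r<n. star (D $$ (r, i)) * D $$ (r, j))"
      unfolding index_mult_mat_sum[OF mat_star_carrier[OF D(1)] D(1) ij]
      by (rule sum.cong) (use ij in \<open>auto simp: index_mat_star[OF D(1)]\<close>)
    finally show ?thesis .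
  qed
  then show ?thesis using that[of "\<lambda>r i. D $$ (r, i)"] by blast
qed

locale order_zero =
  fixes n :: nat and A :: "'a::cstar_algebra set" and \<phi> :: "complex mat \<Rightarrow> 'a"
  assumes \<phi>: "cpc_order_zero n A \<phi>" and n: "1 \<le> n"
begin

definition R :: "nat \<Rightarrow> nat \<Rightarrow> 'a" where "R i j = \<phi> (matrix_unit n i j)"

definition h :: 'a where "h = \<phi> (1\<^sub>m n)"

lemma lin: "linear_from_mats n A \<phi>"
  using \<phi> by (simp add: cpc_order_zero_def completely_positive_def)

lemma R_in: "R i j \<in> A" and h_in: "h \<in> A"
  using lin by (simp_all add: linear_from_mats_def R_def h_def)

lemma norm_phi_le: "z \<in> carrier_mat n n \<Longrightarrow> norm (\<phi> z) \<le> op_norm n z"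
  using \<phi> by (simp add: cpc_order_zero_def)

lemma norm_R: "i < n \<Longrightarrow> j < n \<Longrightarrow> norm (R i j) \<le> 1"
  unfolding R_def using norm_phi_le[OF matrix_unit_carrier] op_norm_matrix_unit_le order_trans by blast

lemma norm_h: "norm h \<le> 1"
  unfolding h_def using norm_phi_le[of "1\<^sub>m n"] op_norm_one_le[of n] by simp

lemma phi_expansion: "z \<in> carrier_mat n n \<Longrightarrow> \<phi> z = (\<Sum>i<n. \<Sum>j<n. scaleC (z $$ (i, j)) (R i j))"
  unfolding R_def by (rule linear_from_mats_expansion[OF lin])

lemma h_eq: "h = (\<Sum>i<n. R i i)"
proof -
  have "h = (\<Sum>i<n. \<Sum>j<n. if j = i then R i i else 0)"
    unfolding h_def phi_expansion[OF one_carrier_mat] by (intro sum.cong refl) auto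
  then show ?thesis by simp
qed

text \<open>In the factorization \<open>R i j = (\<Sum>r<n. star (C r i) * C r j)\<close> orthogonal
  real vectors \<open>x\<close>, \<open>y\<close> force \<open>c r x * star (c s y) = 0\<close>. The
  pair \<open>e_j\<close>, \<open>e_k\<close> gives the vanishing products; the pair
  \<open>e_j + e_k\<close>, \<open>e_j - e_k\<close> shows that \<open>C r j * star (C s j)\<close>
  does not depend on \<open>j\<close>.\<close>

lemma R_relations:
  shows star_R: "\<And>i j. i < n \<Longrightarrow> j < n \<Longrightarrow> star (R i j) = R j i"
    and R_mult_0: "\<And>i j k l. i < n \<Longrightarrow> j < n \<Longrightarrow> k < n \<Longrightarrow> l < n \<Longrightarrow> j \<noteq> k \<Longrightarrow> R i j * R k l = 0"
    and R_mult_eq: "\<And>i j k l. i < n \<Longrightarrow> j < n \<Longrightarrow> k < n \<Longrightarrow> l < n \<Longrightarrow> R i j * R j l = R i k * R k l"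
proof -
  obtain C where C: "\<And>i j. i < n \<Longrightarrow> j < n \<Longrightarrow> R i j = (\<Sum>r<n. star (C r i) * C r j)"
    unfolding R_def using order_zero_choi[OF \<phi> n] by blast
  show "star (R i j) = R j i" if "i < n" "j < n" for i j
    using that by (simp add: C star_sum star_simps)
  define c where "c r x = (\<Sum>j<n. x j *\<^sub>R C r j)" for r and x :: "nat \<Rightarrow> real"
  have phi_dyad: "\<phi> (dyad n x) = (\<Sum>r<n. star (c r x) * c r x)" for x
  proof -
    have "\<phi> (dyad n x) = (\<Sum>i<n. \<Sum>j<n. (x i * x j) *\<^sub>R (\<Sum>r<n. star (C r i) * C r j))"
      unfolding phi_expansion[OF dyad_carrier]
      by (intro sum.cong refl) (simp add: dyad_def C scaleC_of_real del: of_real_mult)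
    also have "\<dots> = (\<Sum>i<n. \<Sum>j<n. \<Sum>r<n. star (x i *\<^sub>R C r i) * (x j *\<^sub>R C r j))"
      by (simp add: scaleR_sum_right mult.commute)
    also have "\<dots> = (\<Sum>i<n. \<Sum>r<n. \<Sum>j<n. star (x i *\<^sub>R C r i) * (x j *\<^sub>R C r j))"
      by (intro sum.cong[OF refl] sum.swap)
    also have "\<dots> = (\<Sum>r<n. \<Sum>i<n. \<Sum>j<n. star (x i *\<^sub>R C r i) * (x j *\<^sub>R C r j))"
      by (rule sum.swap)
    also have "\<dots> = (\<Sum>r<n. star (c r x) * c r x)"
      unfolding c_def star_sum sum_distrib_right unfolding sum_distrib_left ..
    finally show ?thesis .
  qed
  have star_dyad: "star (\<phi> (dyad n x)) = \<phi> (dyad n x)" for x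
    by (simp add: phi_dyad star_sum star_simps)
  \<comment> \<open>A finite sum of terms \<open>star u * u\<close> vanishes only if every
    \<open>u\<close> does; this extracts the single summands of
    \<open>\<phi> (dyad n x)\<close>.\<close>
  have kill: "c r x * y = 0" if "\<phi> (dyad n x) * y = 0" "r < n" for r x y
  proof -
    have "(\<Sum>r<n. star (c r x * y) * (c r x * y)) = star y * (\<phi> (dyad n x) * y)"
      unfolding phi_dyad sum_distrib_left sum_distrib_right by (simp add: star_mult mult.assoc)
    then have "(\<Sum>r<n. star (c r x * y) * (c r x * y)) = 0" using that by simp
    then show ?thesis using that by (intro sum_star_mult_eq_0'[of "{..<n}" "\<lambda>r. c r x * y"]) auto
  qed
  have orth: "c r x * star (c s y) = 0" if xy: "(\<Sum>q<n. x q * y q) = 0" and rs: "r < n" "s < n" for x y r s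
  proof -
    have "\<phi> (dyad n x) * \<phi> (dyad n y) = 0"
      using \<phi> dyad_positive dyad_mult_0[OF xy] by (auto simp: cpc_order_zero_def)
    then have "c r x * \<phi> (dyad n y) = 0" by (rule kill[OF _ rs(1)])
    then have "\<phi> (dyad n y) * star (c r x) = 0" using star_dyad[of y] by (metis star_0 star_mult)
    then have "c s y * star (c r x) = 0" by (rule kill[OF _ rs(2)])
    then show ?thesis by (metis star_0 star_mult star_star)
  qed
  define e where "e j q = (if q = j then 1 else 0::real)" for j q :: nat
  have ce: "c r (e j) = C r j" if "j < n" for r j
  proof -
    have "c r (e j) = (\<Sum>q<n. if q = j then C r j else 0)" unfolding c_def e_def by (rule sum.cong) auto
    then show ?thesis using that by simp
  qed
  have ee: "(\<Sum>q<n. e j q * e k q) = (if j = k then 1 else 0)" if "j < n" for j k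
  proof -
    have "(\<Sum>q<n. e j q * e k q) = (\<Sum>q<n. if q = j then (if j = k then 1 else 0) else 0)"
      unfolding e_def by (rule sum.cong) auto
    then show ?thesis using that by simp
  qed
  have C0: "C r j * star (C s k) = 0" if "j < n" "k < n" "j \<noteq> k" "r < n" "s < n" for r s j k
    using orth[of "e j" "e k" r s] that by (simp add: ce ee)
  have CC: "C r j * star (C s j) = C r k * star (C s k)" if jk: "j < n" "k < n" "j \<noteq> k" "r < n" "s < n" for r s j k
  proof -
    have "(\<Sum>q<n. (e j q + e k q) * (e j q - e k q)) =
      (\<Sum>q<n. e j q * e j q) - (\<Sum>q<n. e k q * e k q)"
      unfolding sum_subtractf[symmetric] by (rule sum.cong) (auto simp: algebra_simps)
    then have "(\<Sum>q<n. (e j q + e k q) * (e j q - e k q)) = 0" using jk by (simp add: ee)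
    from orth[OF this jk(4,5)]
    have "(c r (e j) + c r (e k)) * (star (c s (e j)) - star (c s (e k))) = 0"
      unfolding c_def by (simp add: scaleR_left_distrib scaleR_left_diff_distrib sum.distrib sum_subtractf)
    then show ?thesis using jk C0[of j k r s] C0[of k j r s] by (simp add: ce algebra_simps)
  qed
  have RR: "R i j * R k l = (\<Sum>r<n. \<Sum>s<n. star (C r i) * (C r j * star (C s k)) * C s l)"
    if "i < n" "j < n" "k < n" "l < n" for i j k l
    using that by (simp add: C sum_distrib_right) (simp add: sum_distrib_left mult.assoc)
  show "R i j * R k l = 0" if "i < n" "j < n" "k < n" "l < n" "j \<noteq> k" for i j k l
    using that by (simp add: RR C0)
  show "R i j * R j l = R i k * R k l" if "i < n" "j < n" "k < n" "l < n" for i j k l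
  proof (cases "j = k")
    case False
    have "(\<Sum>r<n. \<Sum>s<n. star (C r i) * (C r j * star (C s j)) * C s l) =
      (\<Sum>r<n. \<Sum>s<n. star (C r i) * (C r k * star (C s k)) * C s l)"
      by (intro sum.cong refl) (use CC[of j k] that False in simp)
    then show ?thesis using that by (simp add: RR)
  qed simp
qed

lemma cpos_h: "cpos (emb h)"
proof -
  obtain C where C: "\<And>i j. i < n \<Longrightarrow> j < n \<Longrightarrow> R i j = (\<Sum>r<n. star (C r i) * C r j)"
    unfolding R_def using order_zero_choi[OF \<phi> n] by blast
  have "emb h = (\<Sum>i<n. \<Sum>r<n. star (emb (C r i)) * emb (C r i))"
    unfolding h_eq emb_sum by (rule sum.cong[OF refl]) (simp only: lessThan_iff C emb_sum emb_simps)
  also have "cpos \<dots>" by (intro cpos_sum cpos_star_mult_self)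
  finally show ?thesis .
qed

lemma star_h: "star h = h"
  by (simp add: h_eq star_sum star_R)

text \<open>Only the summand \<open>R i i\<close> of \<open>h\<close> survives, and the middle index
  may be moved from \<open>i\<close> to \<open>j\<close>. On matrix units this is the rule
  \<open>\<phi>(1) \<phi>(y z) = \<phi>(y) \<phi>(z)\<close>.\<close>

lemma h_R:
  assumes "i < n" "j < n" "l < n" shows "h * R i l = R i j * R j l"
proof -
  have "h * R i l = (\<Sum>k<n. if k = i then R i i * R i l else 0)"
    unfolding h_eq sum_distrib_right by (rule sum.cong) (use assms in \<open>auto simp: R_mult_0\<close>)
  then show ?thesis using assms R_mult_eq[of i i j l] by simp
qed

lemma R_h:
  assumes "i < n" "l < n" shows "R i l * h = h * R i l"
proof -
  have "R i l * h = (\<Sum>k<n. if k = l then R i l * R l l else 0)"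
    unfolding h_eq sum_distrib_left by (rule sum.cong) (use assms in \<open>auto simp: R_mult_0\<close>)
  then show ?thesis using assms h_R[of i l l] by simp
qed

end

section \<open>Compressing order zero maps to hereditary subalgebras\<close>

lemma asymp_eq_emb_iff: "(\<lambda>N. emb (X N)) \<doteq> (\<lambda>N. emb (Y N)) \<longleftrightarrow> X \<doteq> Y"
  unfolding asymp_eq_def emb_simps(2)[symmetric]
  using tendsto_emb_iff[of "\<lambda>N. X N - Y N" 0] by (simp only: emb_simps(8))

lemma Bseq_emb_iff: "Bseq (\<lambda>N. emb (X N)) \<longleftrightarrow> Bseq X"
  by (simp add: Bseq_def norm_emb)

lemma asymp_eq_commute_nfc:
  fixes a y :: "nat \<Rightarrow> 'a::cstar_algebra"
  assumes ay: "(\<lambda>N. a N * y N) \<doteq> (\<lambda>N. y N * a N)" and B: "Bseq a" "Bseq y"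
    and sa: "\<And>N. star (a N) = a N" and f: "continuous_on UNIV f" "f 0 = 0"
  shows "(\<lambda>N. nfc f (a N) * y N) \<doteq> (\<lambda>N. y N * nfc f (a N))"
proof -
  have "(\<lambda>N. cfc f (emb (a N)) * emb (y N)) \<doteq> (\<lambda>N. emb (y N) * cfc f (emb (a N)))"
    using ay B sa f by (intro asymp_eq_commute_cfc star_emb)
      (simp_all add: Bseq_emb_iff asymp_eq_emb_iff flip: emb_simps)
  then have "(\<lambda>N. emb (nfc f (a N) * y N)) \<doteq> (\<lambda>N. emb (y N * nfc f (a N)))"
    by (simp only: emb_simps emb_nfc[OF sa f])
  then show ?thesis by (simp only: asymp_eq_emb_iff)
qed

lemma nfc_commute:
  assumes c: "star c = c" and f: "continuous_on UNIV f" "f 0 = 0" and y: "c * y = y * c"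
  shows "nfc f c * y = y * nfc f c"
proof -
  have "cfc f (emb c) * emb y = emb y * cfc f (emb c)"
    by (rule cfc_commute[OF star_emb[OF c] f(1)]) (simp only: y flip: emb_simps)
  then have "emb (nfc f c * y) = emb (y * nfc f c)" by (simp only: emb_simps emb_nfc[OF c f])
  then show ?thesis by simp
qed

text \<open>Collects constant factors, in practice powers of \<open>e\<close>, in front of a
  product; only the inner part of the first factor has to move past a constant.\<close>

lemma asymp_eq_factor:
  fixes X Y X' Y' :: "nat \<Rightarrow> 'a::real_normed_algebra"
  assumes X: "X \<doteq> (\<lambda>N. u * X' N)" and Y: "Y \<doteq> (\<lambda>N. v * Y' N)"
    and c: "(\<lambda>N. X' N * v) \<doteq> (\<lambda>N. v * X' N)" and B: "Bseq X" "Bseq Y'"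
  shows "(\<lambda>N. X N * Y N) \<doteq> (\<lambda>N. u * v * (X' N * Y' N))"
proof -
  have "(\<lambda>N. X N * Y N) \<doteq> (\<lambda>N. u * X' N * (v * Y' N))"
    by (intro asymp_eq_mult X Y B Bseq_mult' Bseq_const)
  also have "(\<lambda>N. u * X' N * (v * Y' N)) \<doteq> (\<lambda>N. u * v * (X' N * Y' N))"
    using asymp_eq_mult_left[OF asymp_eq_mult_right[OF c B(2)] Bseq_const[of u]] by (simp only: mult.assoc)
  finally show ?thesis .
qed

lemma asymp_commute_mult:
  fixes X Y :: "nat \<Rightarrow> 'a::real_normed_algebra"
  assumes X: "(\<lambda>N. X N * v) \<doteq> (\<lambda>N. v * X N)" and Y: "(\<lambda>N. Y N * v) \<doteq> (\<lambda>N. v * Y N)"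
    and B: "Bseq X" "Bseq Y"
  shows "(\<lambda>N. X N * Y N * v) \<doteq> (\<lambda>N. v * (X N * Y N))"
proof -
  have "(\<lambda>N. X N * Y N * v) \<doteq> (\<lambda>N. X N * v * Y N)"
    using asymp_eq_mult_left[OF Y B(1)] by (simp only: mult.assoc)
  also have "(\<lambda>N. X N * v * Y N) \<doteq> (\<lambda>N. v * (X N * Y N))"
    using asymp_eq_mult_right[OF X B(2)] by (simp only: mult.assoc)
  finally show ?thesis .
qed

lemma asymp_commute_mult_const:
  fixes X :: "nat \<Rightarrow> 'a::real_normed_algebra"
  assumes u: "(\<lambda>N. X N * u) \<doteq> (\<lambda>N. u * X N)" and v: "(\<lambda>N. X N * v) \<doteq> (\<lambda>N. v * X N)"
  shows "(\<lambda>N. X N * (u * v)) \<doteq> (\<lambda>N. u * v * X N)"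
proof -
  have "(\<lambda>N. X N * (u * v)) \<doteq> (\<lambda>N. u * (X N * v))"
    using asymp_eq_mult_right[OF u Bseq_const[of v]] by (simp only: mult.assoc)
  also have "(\<lambda>N. u * (X N * v)) \<doteq> (\<lambda>N. u * v * X N)"
    using asymp_eq_mult_left[OF v Bseq_const[of u]] by (simp only: mult.assoc)
  finally show ?thesis .
qed

lemma asymp_commute_star:
  fixes X :: "nat \<Rightarrow> 'a::cstar_algebra"
  assumes "(\<lambda>N. X N * v) \<doteq> (\<lambda>N. v * X N)" "star v = v"
  shows "(\<lambda>N. star (X N) * v) \<doteq> (\<lambda>N. v * star (X N))"
  using asymp_eq_star[OF asymp_eq_sym[OF assms(1)]] assms(2) by (simp add: star_mult)

lemma norm_mult_le:
  fixes x y :: "'a::real_normed_algebra"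
  assumes "norm x \<le> a" "norm y \<le> b" shows "norm (x * y) \<le> a * b"
  using assms by (intro order_trans[OF norm_mult_ineq] mult_mono) (auto intro: order_trans[OF norm_ge_zero])

lemma norm_mult_diff_le:
  fixes x y x' y' :: "'a::real_normed_algebra"
  assumes "norm (x - x') \<le> d" "norm (y - y') \<le> e" "norm x \<le> a" "norm y' \<le> b"
  shows "norm (x * y - x' * y') \<le> a * e + d * b"
proof -
  have "x * y - x' * y' = x * (y - y') + (x - x') * y'" by (simp add: algebra_simps)
  then show ?thesis using norm_mult_le[OF assms(3,2)] norm_mult_le[OF assms(1,4)] norm_triangle_ineq
    by (metis add_mono order_trans)
qed

text \<open>
  If \<open>e\<close> almost commutes with the range of \<open>\<phi>\<close>, the rows \<open>e k(h) \<phi>(e\<^sub>0\<^sub>j) e\<close> almost satisfy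
  the relations of an order zero map with values in \<open>B\<close>. The function \<open>k(t)\<close> behaves like
  \<open>t\<^bsup>-3/4\<^esup>\<close> away from 0, which makes \<open>k(h)\<^sup>4 h\<^sup>3 \<phi>(z)\<close> close to \<open>\<phi>(z)\<close>.
\<close>

lemma order_zero_compress:
  fixes A B :: "'a::cstar_algebra set"
  assumes A: "cstar_subalgebra A" and B: "hereditary_subalgebra B A"
    and e: "e \<in> B" "star e = e" "norm e \<le> 1" and n: "1 \<le> n"
    and \<phi>: "\<And>N. cpc_order_zero n A (\<phi> N)"
    and comm: "\<And>i j. i < n \<Longrightarrow> j < n \<Longrightarrow>
      (\<lambda>N. \<phi> N (matrix_unit n i j) * e) \<doteq> (\<lambda>N. e * \<phi> N (matrix_unit n i j))"
    and s: "s > 0"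
  defines "e8 \<equiv> e * e * (e * e) * (e * e * (e * e))"
  shows "\<forall>\<^sub>F N in sequentially. \<exists>\<psi>. cpc_order_zero n B \<psi> \<and>
    (\<forall>i<n. \<forall>j<n. norm (\<psi> (matrix_unit n i j) - e8 * \<phi> N (matrix_unit n i j)) \<le> s)"
proof -
  have csB: "cstar_subalgebra B" using B by (simp add: hereditary_subalgebra_def)

  \<comment> \<open>Relations of the given maps on matrix units\<close>
  interpret oz: order_zero n A "\<phi> N" for N using \<phi> n by unfold_locales
  define R where "R i j N = oz.R N i j" for i j N
  define H where "H N = oz.h N" for N
  have R_phi: "\<phi> N (matrix_unit n i j) = R i j N" for i j N by (simp add: R_def oz.R_def)
  have n0: "0 < n" using n by simp
  have RA: "R i j N \<in> A" and HA: "H N \<in> A" for i j N by (simp_all add: R_def H_def oz.R_in oz.h_in)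
  have sR: "star (R i j N) = R j i N" if "i < n" "j < n" for i j N using that by (simp add: R_def oz.star_R)
  have sH: "star (H N) = H N" for N by (simp add: H_def oz.star_h)
  have nR: "norm (R i j N) \<le> 1" if "i < n" "j < n" for i j N using that by (simp add: R_def oz.norm_R)
  have nH: "norm (H N) \<le> 1" for N by (simp add: H_def oz.norm_h)
  have bR: "Bseq (R i j)" if "i < n" "j < n" for i j using nR[OF that] by (rule BseqI')
  have bH: "Bseq H" using nH by (rule BseqI')
  have HR: "H N * R i l N = R i j N * R j l N" if "i < n" "j < n" "l < n" for i j l N
    using oz.h_R[OF that] by (simp add: R_def H_def)
  have RH: "R i l N * H N = H N * R i l N" if "i < n" "l < n" for i l N
    using oz.R_h[OF that] by (simp add: R_def H_def)
  have R0: "R i j N * R k l N = 0" if "i < n" "j < n" "k < n" "l < n" "j \<noteq> k" for i j k l N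
    using oz.R_mult_0[OF that] by (simp add: R_def)
  have cR: "(\<lambda>N. R i j N * e) \<doteq> (\<lambda>N. e * R i j N)" if "i < n" "j < n" for i j
    using comm[OF that] by (simp only: R_phi)
  have cH: "(\<lambda>N. H N * e) \<doteq> (\<lambda>N. e * H N)"
  proof -
    have "(\<lambda>N. \<Sum>i<n. R i i N * e) \<doteq> (\<lambda>N. \<Sum>i<n. e * R i i N)" by (intro asymp_eq_sum cR) auto
    then show ?thesis by (simp add: H_def oz.h_eq R_def sum_distrib_left sum_distrib_right)
  qed
  \<comment> \<open>The final error is \<open>s0\<close> before rescaling plus \<open>4 * s0\<close>
    from rescaling. The first part consists of three thirds: repairing the rows, collecting the
    powers of \<open>e\<close>, and replacing \<open>k(h)\<^sup>4 h\<^sup>3\<close> by 1.\<close>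
  define s0 where "s0 = min 1 (s / 5)"
  have s0: "0 < s0" "s0 \<le> 1" "5 * s0 \<le> s" using s by (auto simp: s0_def min_def)
  define q where "q = (s0 / 3)\<^sup>2"
  have q: "q > 0" using s0 by (simp add: q_def)
  have mx: "max t q > 0" for t using q by (auto simp: max_def)
  define m where "m t = max t q" for t
  \<comment> \<open>The denominator is \<open>m t\<close> to the power \<open>7/4\<close>, written
    with square roots. So \<open>k t\<close> is \<open>t\<close> to the power \<open>-3/4\<close>
    for \<open>t \<ge> q\<close>, \<open>k 0 = 0\<close>, and
    \<open>f t = (t / m t) ^ 7\<close>.\<close>
  define k where "k t = t / (m t * (sqrt (m t) * sqrt (sqrt (m t))))" for t
  define f where "f t = k t * k t * (k t * k t) * (t * t * t)" for t
  have m: "continuous_on UNIV m" unfolding m_def by (intro continuous_intros)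
  have m0: "0 < m t" for t using mx by (simp add: m_def)
  have k: "continuous_on UNIV k" "k 0 = 0"
    unfolding k_def using m0 by (auto intro!: continuous_intros m simp: less_imp_neq[THEN not_sym])
  have cf: "continuous_on UNIV f" unfolding f_def by (intro continuous_intros k)
  have f_eq: "f t = (t / m t) ^ 7" for t
  proof -
    define a where "a = sqrt (sqrt (m t))"
    have a: "a > 0" using m0 by (simp add: a_def)
    have aa: "sqrt (m t) = a ^ 2" using m0[of t] by (simp add: a_def)
    have "m t = (sqrt (m t)) ^ 2" using m0[of t] by simp
    then have aa4: "m t = a ^ 4" unfolding aa by (simp flip: power_mult)
    have "k t = t / (m t * (sqrt (m t) * a))" by (simp only: k_def a_def)
    also have "\<dots> = t / (a ^ 4 * (a ^ 2 * a))" unfolding aa unfolding aa4 ..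
    also have "a ^ 4 * (a ^ 2 * a) = a ^ 7" by (simp flip: power_add power_Suc2)
    finally have "k t = t / a ^ 7" .
    then have "f t = (t / a ^ 7) ^ 4 * t ^ 3" unfolding f_def by (simp add: power4_eq_xxxx power3_eq_cube)
    also have "\<dots> = (t / a ^ 4) ^ 7" by (simp add: power_divide flip: power_mult power_add)
    finally show ?thesis unfolding aa4[symmetric] .
  qed
  have f1: "\<bar>(f t - 1) * t * (f t - 1)\<bar> \<le> q" if t: "0 \<le> t" for t
  proof (cases "q \<le> t")
    case True
    then have "f t = 1" using q by (simp add: f_eq m_def)
    then show ?thesis using q by simp
  next
    case False
    have "0 \<le> t / m t" "t / m t \<le> 1" using t m0[of t] by (auto simp: m_def)
    then have "0 \<le> f t" "f t \<le> 1" unfolding f_eq by (simp_all add: power_le_one)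
    then have "(1 - f t) * (1 - f t) \<le> 1" by (intro mult_le_one) auto
    then have "(1 - f t) * (1 - f t) * t \<le> 1 * t" using t by (rule mult_right_mono)
    moreover have "0 \<le> (1 - f t) * (1 - f t) * t" using t by simp
    moreover have "(f t - 1) * t * (f t - 1) = (1 - f t) * (1 - f t) * t" by (simp add: algebra_simps)
    ultimately show ?thesis using False by linarith
  qed

  \<comment> \<open>Approximate rows in \<open>B\<close>\<close>
  define K where "K N = nfc k (H N)" for N
  have sK: "star (K N) = K N" for N unfolding K_def by (rule star_nfc[OF sH k])
  have KA: "K N \<in> A" for N unfolding K_def by (rule nfc_in[OF sH k A HA])
  have bK: "Bseq K"
    using Bseq_cfc[of "\<lambda>N. emb (H N)" k] bH sH k unfolding K_def
    by (simp add: Bseq_emb_iff star_emb flip: emb_nfc)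
  have KR: "K N * R i j N = R i j N * K N" if "i < n" "j < n" for i j N
    unfolding K_def by (rule nfc_commute[OF sH k]) (use RH that in simp)
  have cK: "(\<lambda>N. K N * e) \<doteq> (\<lambda>N. e * K N)"
    unfolding K_def by (rule asymp_eq_commute_nfc[OF cH bH Bseq_const sH k])
  define c where "c j N = K N * R 0 j N" for j N
  have cA: "c j N \<in> A" for j N unfolding c_def by (intro cstar_subalgebraD(4)[OF A] KA RA)
  have bc: "Bseq (c j)" if "j < n" for j unfolding c_def by (intro Bseq_mult' bK bR n0 that)
  have bcs: "Bseq (\<lambda>N. star (c j N))" if "j < n" for j by (intro Bseq_star bc that)
  have cc: "(\<lambda>N. c j N * e) \<doteq> (\<lambda>N. e * c j N)" if "j < n" for j
    unfolding c_def by (intro asymp_commute_mult cK cR bK bR n0 that)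
  have ccs: "(\<lambda>N. star (c j N) * e) \<doteq> (\<lambda>N. e * star (c j N))" if "j < n" for j
    by (rule asymp_commute_star[OF cc[OF that] e(2)])
  define x where "x j N = e * c j N * e" for j N
  have xB: "x j N \<in> B" for j N unfolding x_def by (rule hereditary_mult[OF A B cA e(1) e(1)])
  have "\<exists>K0>0. \<forall>N. norm (K N) \<le> K0" using BseqD[OF bK] by blast
  then obtain K0 where K0: "K0 > 0" "\<And>N. norm (K N) \<le> K0" by blast
  have nx: "norm (x j N) \<le> K0" if "j < n" for j N
  proof -
    have "norm (x j N) \<le> 1 * (K0 * 1) * 1"
      unfolding x_def c_def by (intro norm_mult_le e K0 nR n0 that)
    then show ?thesis by simp
  qed
  have bx: "Bseq (x j)" if "j < n" for j using nx[OF that] by (rule BseqI')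
  have bxs: "Bseq (\<lambda>N. star (x j N))" if "j < n" for j by (intro Bseq_star bx that)
  define e2 where "e2 = e * e"
  define e4 where "e4 = e2 * e2"
  have c2: "(\<lambda>N. c j N * e2) \<doteq> (\<lambda>N. e2 * c j N)" "(\<lambda>N. star (c j N) * e2) \<doteq> (\<lambda>N. e2 * star (c j N))"
    if "j < n" for j unfolding e2_def by (intro asymp_commute_mult_const cc ccs that)+
  have xe: "x j \<doteq> (\<lambda>N. e2 * c j N)" if "j < n" for j
    using asymp_eq_mult_left[OF cc[OF that] Bseq_const[of e]] unfolding x_def e2_def by (simp only: mult.assoc)
  have xse: "(\<lambda>N. star (x j N)) \<doteq> (\<lambda>N. e2 * star (c j N))" if "j < n" for j
  proof -
    have "(\<lambda>N. star (x j N)) \<doteq> (\<lambda>N. star (c j N) * e2)"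
      using asymp_eq_star[OF xe[OF that]] e(2) by (simp add: star_mult e2_def mult.assoc)
    also have "(\<lambda>N. star (c j N) * e2) \<doteq> (\<lambda>N. e2 * star (c j N))" by (rule c2(2)[OF that])
    finally show ?thesis .
  qed
  have xx: "(\<lambda>N. x i N * star (x j N)) \<doteq> (\<lambda>N. e4 * (c i N * star (c j N)))" if "i < n" "j < n" for i j
    unfolding e4_def by (intro asymp_eq_factor xe xse c2 bx bcs that)
  have ccstar: "c i N * star (c j N) = (if i = j then K N * (H N * R 0 0 N) * K N else 0)"
    if "i < n" "j < n" for i j N
  proof -
    have "c i N * star (c j N) = K N * (R 0 i N * R j 0 N) * K N"
      using that n0 by (simp only: c_def star_mult sK sR mult.assoc)
    then show ?thesis using that n0 HR[OF n0 that(2) n0, of N] by (auto simp: R0)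
  qed
  have rel: "(\<lambda>N. x i N * star (x j N) - (if i = j then x 0 N * star (x 0 N) else 0)) \<longlonglongrightarrow> 0"
    if ij: "i < n" "j < n" for i j
  proof (cases "i = j")
    case True
    have "(\<lambda>N. x i N * star (x i N)) \<doteq> (\<lambda>N. e4 * (c 0 N * star (c 0 N)))"
      using xx[OF ij(1) ij(1)] ij n0 by (simp add: ccstar)
    also have "(\<lambda>N. e4 * (c 0 N * star (c 0 N))) \<doteq> (\<lambda>N. x 0 N * star (x 0 N))"
      by (rule asymp_eq_sym[OF xx[OF n0 n0]])
    finally show ?thesis using True by (simp add: asymp_eq_def)
  next
    case False
    then show ?thesis using xx[OF ij] ij by (simp add: ccstar asymp_eq_def)
  qed
  \<comment> \<open>What the four rows produce when \<open>e\<close> is left out: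
    \<open>Z i j = f(h) R i j\<close>.\<close>
  define Z where "Z i j N = star (c i N) * c 0 N * (star (c 0 N) * c j N)" for i j N
  have xZ: "(\<lambda>N. star (x i N) * x 0 N * (star (x 0 N) * x j N)) \<doteq> (\<lambda>N. e8 * Z i j N)"
    if "i < n" "j < n" for i j
  proof -
    have 1: "(\<lambda>N. star (x i N) * x 0 N) \<doteq> (\<lambda>N. e4 * (star (c i N) * c 0 N))"
      unfolding e4_def by (intro asymp_eq_factor xe xse c2 bxs bc that n0)
    have 2: "(\<lambda>N. star (x 0 N) * x j N) \<doteq> (\<lambda>N. e4 * (star (c 0 N) * c j N))"
      unfolding e4_def by (intro asymp_eq_factor xe xse c2 bxs bc that n0)
    have 3: "(\<lambda>N. star (c i N) * c 0 N * e4) \<doteq> (\<lambda>N. e4 * (star (c i N) * c 0 N))"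
      unfolding e4_def by (intro asymp_commute_mult_const asymp_commute_mult c2 bcs bc that n0)
    have "e8 = e4 * e4" by (simp add: e8_def e4_def e2_def)
    then show ?thesis unfolding Z_def
      using asymp_eq_factor[OF 1 2 3] Bseq_mult'[OF bxs[OF that(1)] bx[OF n0]] Bseq_mult'[OF bcs[OF n0] bc[OF that(2)]]
      by simp
  qed
  \<comment> \<open>Since \<open>R i j * star (R i j) = h * R i i\<close>, the squared distance is
    bounded by the supremum of \<open>(f t - 1)\<^sup>2 t\<close>. It is small although
    \<open>f\<close> is far from 1 near 0, because there \<open>t\<close> itself is small.\<close>
  have ZR: "norm (Z i j N - R i j N) \<le> s0 / 3" if ij: "i < n" "j < n" for i j N
  proof -
    have seH: "star (emb (H N)) = emb (H N)" by (rule star_emb[OF sH])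
    define g where "g t = f t - 1" for t
    have g: "continuous_on UNIV g" unfolding g_def by (intro continuous_intros cf)
    define Gg where "Gg = cfc g (emb (H N))"
    have sG: "star Gg = Gg" unfolding Gg_def using seH g by simp
    define W where "W = K N * K N * (K N * K N) * (H N * H N * H N)"
    have "Z i j N = R i 0 N * K N * (K N * R 0 0 N) * (R 0 0 N * K N * (K N * R 0 j N))"
      unfolding Z_def c_def using ij n0 by (simp only: star_mult sK sR)
    also have "\<dots> = K N * K N * (K N * K N) * (R i 0 N * R 0 0 N * (R 0 0 N * R 0 j N))"
      using KR[OF ij(1) n0, of N] KR[OF n0 n0, of N] KR[OF n0 ij(2), of N]
      by (metis (no_types, lifting) mult.assoc)
    also have "R i 0 N * R 0 0 N * (R 0 0 N * R 0 j N) = H N * H N * H N * R i j N"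
    proof -
      have "R i 0 N * R 0 0 N = H N * R i 0 N" using HR[OF ij(1) n0 n0] by simp
      moreover have "R 0 0 N * R 0 j N = H N * R 0 j N" using HR[OF n0 n0 ij(2)] by simp
      moreover have "R i 0 N * (H N * R 0 j N) = H N * (R i 0 N * R 0 j N)"
        using RH[OF ij(1) n0, of N] by (simp flip: mult.assoc)
      moreover have "R i 0 N * R 0 j N = H N * R i j N" using HR[OF ij(1) n0 ij(2)] by simp
      ultimately show ?thesis by (simp add: mult.assoc)
    qed
    finally have Z: "Z i j N = W * R i j N" by (simp only: W_def mult.assoc)
    have "emb W = cfc f (emb (H N))"
      unfolding W_def emb_simps K_def emb_nfc[OF sH k] f_def[abs_def]
      using seH k by (simp add: cfc_mult cfc_ident continuous_on_mult continuous_on_id)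
    also have "\<dots> = Gg + 1"
      unfolding Gg_def g_def using cfc_diff[OF seH cf continuous_on_const, of 1] seH by (simp add: cfc_const)
    finally have "emb (Z i j N - R i j N) = Gg * emb (R i j N)"
      unfolding Z emb_simps by (simp add: algebra_simps)
    then have "norm (Z i j N - R i j N) ^ 2 = norm (Gg * emb (R i j N) * star (Gg * emb (R i j N)))"
      by (metis norm_emb norm_mult_star_self)
    also have "Gg * emb (R i j N) * star (Gg * emb (R i j N)) = Gg * (emb (H N) * emb (R i i N)) * Gg"
    proof -
      have e: "emb (R i j N) * star (emb (R i j N)) = emb (H N) * emb (R i i N)"
        using HR[OF ij(1) ij(2) ij(1), of N] sR[OF ij, of N] by (simp flip: emb_simps)
      have "Gg * emb (R i j N) * star (Gg * emb (R i j N)) = Gg * (emb (R i j N) * star (emb (R i j N))) * Gg"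
        by (simp only: star_mult sG mult.assoc)
      then show ?thesis by (simp only: e)
    qed
    also have "\<dots> = Gg * emb (H N) * Gg * emb (R i i N)"
    proof -
      have "emb (H N) * emb (R i i N) = emb (R i i N) * emb (H N)"
        using RH[OF ij(1) ij(1), of N] by (simp flip: emb_simps)
      then have "Gg * emb (R i i N) = emb (R i i N) * Gg"
        unfolding Gg_def by (rule cfc_commute[OF seH g])
      then show ?thesis by (simp only: mult.assoc)
    qed
    also have "norm \<dots> \<le> q * 1"
    proof (rule norm_mult_le)
      have "Gg * emb (H N) * Gg = cfc (\<lambda>t. g t * t * g t) (emb (H N))"
        unfolding Gg_def using seH g by (simp add: cfc_mult cfc_ident continuous_on_mult continuous_on_id)
      also have "norm \<dots> \<le> q"
      proof (rule cfc_norm_le[OF seH])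
        fix t assume "t \<in> real_spectrum (emb (H N))"
        then have "0 \<le> t" using oz.cpos_h[of N] by (auto simp: cpos_def H_def)
        then show "\<bar>g t * t * g t\<bar> \<le> q" unfolding g_def by (rule f1)
      qed (intro continuous_intros g)
      finally show "norm (Gg * emb (H N) * Gg) \<le> q" .
      show "norm (emb (R i i N)) \<le> 1" using nR[OF ij(1) ij(1)] by (simp add: norm_emb)
    qed
    finally have "norm (Z i j N - R i j N) ^ 2 \<le> (s0 / 3)\<^sup>2" by (simp add: q_def)
    then show ?thesis by (rule power2_le_imp_le) (use s0 in simp)
  qed

  \<comment> \<open>Exact rows, rescaling and the resulting map\<close>
  define L where "L = K0 + 1"
  have L: "L > 0" "K0 \<le> L" using K0 by (auto simp: L_def)
  \<comment> \<open>Changing each of four factors of norm at most \<open>L\<close> by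
    \<open>e1\<close> changes their product by at most \<open>4 * L ^ 3 * e1\<close>.\<close>
  define e1 where "e1 = min 1 (s0 / 3 / (4 * L ^ 3))"
  have e1: "e1 > 0" "e1 \<le> 1" using s0 L by (auto simp: e1_def)
  have "e1 \<le> s0 / 3 / (4 * L ^ 3)" unfolding e1_def by (rule min.cobounded2)
  then have e1L: "4 * L ^ 3 * e1 \<le> s0 / 3" using L by (simp add: field_simps)
  obtain \<delta> where \<delta>: "\<delta> > 0" and stable: "\<And>x. (\<forall>j<n. x j \<in> B \<and> norm (x j) \<le> K0) \<Longrightarrow>
    (\<forall>i<n. \<forall>j<n. norm (x i * star (x j) - (if i = j then x 0 * star (x 0) else 0)) \<le> \<delta>) \<Longrightarrow>
    (\<exists>w d. orthogonal_rows n w d \<and> (\<forall>j<n. w j \<in> B \<and> norm (w j - x j) \<le> e1))"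
    using orthogonal_rows_stable[OF csB n e1(1) K0(1)] by blast
  have ev1: "\<forall>\<^sub>F N in sequentially. \<forall>i\<in>{..<n}. \<forall>j\<in>{..<n}.
      norm (x i N * star (x j N) - (if i = j then x 0 N * star (x 0 N) else 0)) < \<delta>"
    by (intro eventually_ball_finite ballI finite_lessThan order_tendstoD(2)[OF tendsto_norm_zero[OF rel] \<delta>]) auto
  have ev2: "\<forall>\<^sub>F N in sequentially. \<forall>i\<in>{..<n}. \<forall>j\<in>{..<n}.
      norm (star (x i N) * x 0 N * (star (x 0 N) * x j N) - e8 * Z i j N) < s0 / 3"
    using s0 by (intro eventually_ball_finite ballI finite_lessThan order_tendstoD(2)[OF tendsto_norm_zero])
      (use xZ in \<open>auto simp: asymp_eq_def\<close>)
  have ne8: "norm e8 \<le> 1"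
  proof -
    have "norm e8 \<le> 1 * 1 * (1 * 1) * (1 * 1 * (1 * 1))" unfolding e8_def by (intro norm_mult_le e)
    then show ?thesis by simp
  qed
  from ev1 ev2 show ?thesis
  proof eventually_elim
    case (elim N)
    have "\<exists>w d. orthogonal_rows n w d \<and> (\<forall>j<n. w j \<in> B \<and> norm (w j - x j N) \<le> e1)"
    proof (rule stable)
      show "\<forall>i<n. \<forall>j<n. norm (x i N * star (x j N) - (if i = j then x 0 N * star (x 0 N) else 0)) \<le> \<delta>"
        using elim(1) less_imp_le unfolding lessThan_iff Ball_def by blast
    qed (use xB nx in auto)
    then obtain w d where w: "orthogonal_rows n w d" "\<And>j. j < n \<Longrightarrow> w j \<in> B" "\<And>j. j < n \<Longrightarrow> norm (w j - x j N) \<le> e1"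
      by blast
    have d: "d = w 0 * star (w 0)" using w(1) n0 by (simp add: orthogonal_rows_def)
    define p where "p i j = star (w i) * w 0 * (star (w 0) * w j)" for i j
    have nxL: "norm (x j N) \<le> L" if "j < n" for j using nx[OF that, of N] L by linarith
    have nwL: "norm (w j) \<le> L" if "j < n" for j
      using w(3)[OF that] nx[OF that, of N] e1(2) norm_triangle_sub[of "w j" "x j N"] by (simp add: L_def)
    have pR: "norm (p i j - e8 * R i j N) \<le> s0" if ij: "i < n" "j < n" for i j
    proof -
      have 1: "norm (star (w i) * w 0 - star (x i N) * x 0 N) \<le> L * e1 + e1 * L"
        using w(3)[OF ij(1)] w(3)[OF n0] nwL[OF ij(1)] nxL[OF n0]
        by (intro norm_mult_diff_le) (simp_all flip: star_diff)
      have 2: "norm (star (w 0) * w j - star (x 0 N) * x j N) \<le> L * e1 + e1 * L"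
        using w(3)[OF ij(2)] w(3)[OF n0] nwL[OF n0] nxL[OF ij(2)]
        by (intro norm_mult_diff_le) (simp_all flip: star_diff)
      have "norm (p i j - star (x i N) * x 0 N * (star (x 0 N) * x j N)) \<le>
          (L * L) * (L * e1 + e1 * L) + (L * e1 + e1 * L) * (L * L)"
        unfolding p_def by (rule norm_mult_diff_le[OF 1 2])
          (rule norm_mult_le; simp add: nwL nxL ij n0)+
      also have "\<dots> = 4 * L ^ 3 * e1" by (simp add: power3_eq_cube algebra_simps)
      finally have A1: "norm (p i j - star (x i N) * x 0 N * (star (x 0 N) * x j N)) \<le> s0 / 3" using e1L by simp
      have A2: "norm (star (x i N) * x 0 N * (star (x 0 N) * x j N) - e8 * Z i j N) \<le> s0 / 3"
        using elim(2) ij by (auto intro: less_imp_le)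
      have A3: "norm (e8 * (Z i j N - R i j N)) \<le> 1 * (s0 / 3)" by (intro norm_mult_le ne8 ZR ij)
      have "p i j - e8 * R i j N = (p i j - star (x i N) * x 0 N * (star (x 0 N) * x j N)) +
        ((star (x i N) * x 0 N * (star (x 0 N) * x j N) - e8 * Z i j N) + e8 * (Z i j N - R i j N))"
        by (simp add: algebra_simps)
      then have "norm (p i j - e8 * R i j N) \<le> s0 / 3 + (s0 / 3 + 1 * (s0 / 3))"
        by (simp only:) (intro norm_triangle_le[OF add_mono] norm_triangle_le[OF add_mono, THEN order_trans] A1 A2 A3 order_refl)
      then show ?thesis by simp
    qed
    have np: "norm (p i j) \<le> 1 + s0" if ij: "i < n" "j < n" for i j
    proof -
      have "norm (e8 * R i j N) \<le> 1 * 1" by (intro norm_mult_le ne8 nR ij)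
      then show ?thesis using pR[OF ij] norm_triangle_sub[of "p i j" "e8 * R i j N"] by simp
    qed
    have nd: "(norm d)\<^sup>2 \<le> 1 + s0"
    proof -
      have "p 0 0 = star (star (w 0) * w 0) * (star (w 0) * w 0)" by (simp add: p_def star_simps)
      then have "norm (p 0 0) = ((norm (w 0))\<^sup>2)\<^sup>2" by (simp add: norm_star_mult_self)
      also have "\<dots> = (norm d)\<^sup>2" by (simp add: d norm_mult_star_self)
      finally show ?thesis using np[OF n0 n0] by simp
    qed
    \<comment> \<open>The order zero construction requires \<open>norm d \<le> 1\<close>, but only
      \<open>1 + s0\<close> is known. Scaling the rows by \<open>r\<close> divides \<open>d\<close>
      by \<open>1 + s0\<close> and the map by the square of this number.\<close>
    define r where "r = 1 / sqrt (1 + s0)"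
    have r: "0 < r" "r * r = 1 / (1 + s0)" using s0 by (simp_all add: r_def)
    define w' where "w' j = r *\<^sub>R w j" for j
    define d' where "d' = (r * r) *\<^sub>R d"
    have w'd': "orthogonal_rows n w' d'"
      using w(1) by (simp add: orthogonal_rows_def w'_def d'_def)
    have "norm d \<le> 1 + s0"
    proof (rule power2_le_imp_le)
      have "(1 + s0) * 1 \<le> (1 + s0) * (1 + s0)" using s0 by (intro mult_left_mono) auto
      then show "(norm d)\<^sup>2 \<le> (1 + s0)\<^sup>2" using nd by (simp add: power2_eq_square[of "1 + s0"])
    qed (use s0 in simp)
    then have nd': "norm d' \<le> 1" using s0 unfolding d'_def r(2) by simp
    define \<psi> where "\<psi> = mat_form n w' (\<lambda>j. d' * w' j)"
    have cpc: "cpc_order_zero n B \<psi>"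
      unfolding \<psi>_def by (rule cpc_order_zero_mat_form[OF w'd' n nd' csB])
        (auto simp: w'_def intro!: cstar_subalgebraD(7)[OF csB] w(2))
    have "norm (\<psi> (matrix_unit n i j) - e8 * R i j N) \<le> s" if ij: "i < n" "j < n" for i j
    proof -
      have "\<psi> (matrix_unit n i j) = (\<Sum>a<n. \<Sum>b<n. if b = j then (if a = i then star (w' i) * (d' * w' j) else 0) else 0)"
        unfolding \<psi>_def mat_form_def by (intro sum.cong refl) (auto simp: matrix_unit_def)
      also have "\<dots> = star (w' i) * (d' * w' j)" using ij by simp
      also have "\<dots> = (r * r * (r * r)) *\<^sub>R p i j" by (simp add: w'_def d'_def d p_def mult.assoc)
      finally have psi: "\<psi> (matrix_unit n i j) = (1 / (1 + s0))\<^sup>2 *\<^sub>R p i j" by (simp add: r power2_eq_square)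
      define \<mu> where "\<mu> = (1 / (1 + s0))\<^sup>2"
      have mu: "\<mu> \<le> 1" "(1 - \<mu>) * (1 + s0) \<le> 4 * s0"
      proof -
        have u: "1 - s0 \<le> 1 / (1 + s0)" "1 / (1 + s0) \<le> 1" "0 \<le> 1 / (1 + s0)"
          using s0 by (simp_all add: field_simps)
        then show "\<mu> \<le> 1" unfolding \<mu>_def by (simp add: power_le_one)
        have "1 - \<mu> = (1 - 1 / (1 + s0)) * (1 + 1 / (1 + s0))" by (simp add: \<mu>_def power2_eq_square algebra_simps)
        also have "\<dots> \<le> s0 * 2" using u s0 by (intro mult_mono) auto
        finally have "(1 - \<mu>) * (1 + s0) \<le> s0 * 2 * 2" using s0 \<open>\<mu> \<le> 1\<close> by (intro mult_mono) auto
        then show "(1 - \<mu>) * (1 + s0) \<le> 4 * s0" by simp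
      qed
      have "\<psi> (matrix_unit n i j) - e8 * R i j N = (p i j - e8 * R i j N) - (1 - \<mu>) *\<^sub>R p i j"
        unfolding psi \<mu>_def[symmetric] by (simp add: algebra_simps)
      then have "norm (\<psi> (matrix_unit n i j) - e8 * R i j N) \<le> norm (p i j - e8 * R i j N) + norm ((1 - \<mu>) *\<^sub>R p i j)"
        by (metis norm_triangle_ineq4)
      also have "norm ((1 - \<mu>) *\<^sub>R p i j) \<le> (1 - \<mu>) * (1 + s0)"
        using np[OF ij] mu(1) by (simp add: mult_left_mono)
      finally show ?thesis using pR[OF ij] mu(2) s0(3) by simp
    qed
    then show ?case using cpc by (auto simp: R_phi)
  qed
qed

section \<open>Tracial absorption passes to hereditary subalgebras\<close>

text \<open>One sequence of maps whose tolerance tends to 0 replaces a separate choice for each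
  \<open>\<epsilon>\<close>. Commutators are kept only for matrix units, which determine the
  map.\<close>

lemma tracially_Z_absorbing_sequence:
  fixes A :: "'a::cstar_algebra set"
  assumes A: "tracially_Z_absorbing A" and xa: "x \<in> positives A" "a \<in> positives A" "a \<noteq> 0"
    and F: "finite F" "F \<subseteq> A" and n: "1 \<le> n"
  obtains \<phi> where "\<And>N. cpc_order_zero n A (\<phi> N)"
    "\<And>N. cuntz_le A (cut_down A (x * x - x * \<phi> N (1\<^sub>m n) * x) (inverse (real (Suc N)))) a"
    "\<And>i j b. i < n \<Longrightarrow> j < n \<Longrightarrow> b \<in> F \<Longrightarrow>
      (\<lambda>N. \<phi> N (matrix_unit n i j) * b) \<doteq> (\<lambda>N. b * \<phi> N (matrix_unit n i j))"
proof -
  have "\<exists>\<phi>. cpc_order_zero n A \<phi> \<and>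
      cuntz_le A (cut_down A (x * x - x * \<phi> (1\<^sub>m n) * x) (inverse (real (Suc N)))) a \<and>
      (\<forall>z\<in>carrier_mat n n. \<forall>b\<in>F. op_norm n z \<le> 1 \<longrightarrow> norm (\<phi> z * b - b * \<phi> z) < inverse (real (Suc N)))" for N
    using A xa F n unfolding tracially_Z_absorbing_def by simp
  then obtain \<phi> where \<phi>: "\<And>N. cpc_order_zero n A (\<phi> N)"
      "\<And>N. cuntz_le A (cut_down A (x * x - x * \<phi> N (1\<^sub>m n) * x) (inverse (real (Suc N)))) a"
      "\<And>N z b. z \<in> carrier_mat n n \<Longrightarrow> b \<in> F \<Longrightarrow> op_norm n z \<le> 1 \<Longrightarrow>
        norm (\<phi> N z * b - b * \<phi> N z) < inverse (real (Suc N))" by metis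
  have "(\<lambda>N. \<phi> N (matrix_unit n i j) * b) \<doteq> (\<lambda>N. b * \<phi> N (matrix_unit n i j))"
    if "i < n" "j < n" "b \<in> F" for i j b
    unfolding asymp_eq_def
    by (rule Lim_null_comparison[OF always_eventually LIMSEQ_inverse_real_of_nat])
      (use \<phi>(3)[OF matrix_unit_carrier that(3) op_norm_matrix_unit_le[OF that(1,2)]] in \<open>auto intro: less_imp_le\<close>)
  with \<phi>(1,2) show ?thesis by (rule that)
qed

text \<open>Cutting down at \<open>1 / (N + 1)\<close> differs in norm by at most that number from
  taking the positive part, and the positive part is continuous and fixes \<open>x\<close>.\<close>

lemma asymp_eq_nfc_cut_down:
  fixes c :: "nat \<Rightarrow> 'a::cstar_algebra"
  assumes c: "\<And>N. star (c N) = c N" "Bseq c" "c \<doteq> (\<lambda>_. x)" and x: "cpos (emb x)"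
  shows "(\<lambda>N. nfc (\<lambda>t. max (t - inverse (real (Suc N))) 0) (c N)) \<doteq> (\<lambda>_. x)"
proof -
  define f where "f N t = max (t - inverse (real (Suc N))) 0" for N t
  define g where "g t = max t 0" for t :: real
  have f: "continuous_on UNIV (f N)" "f N 0 = 0" for N unfolding f_def by (auto intro!: continuous_intros)
  have g: "continuous_on UNIV g" "g 0 = 0" unfolding g_def by (auto intro!: continuous_intros)
  have sx: "star (emb x) = emb x" using cpos_star[OF x] .
  note sc = star_emb[OF c(1)]
  have "norm (cfc (f N) (emb (c N)) - cfc g (emb (c N))) \<le> inverse (real (Suc N))" for N
  proof -
    have "norm (cfc (\<lambda>t. f N t - g t) (emb (c N))) \<le> inverse (real (Suc N))"
    proof (rule cfc_norm_le[OF sc])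
      have "0 < inverse (real (Suc N))" by simp
      then show "\<bar>f N t - g t\<bar> \<le> inverse (real (Suc N))" for t
        unfolding f_def g_def by linarith
    qed (intro continuous_intros f g)
    then show ?thesis by (simp add: cfc_diff[OF sc f(1) g(1)])
  qed
  then have "(\<lambda>N. cfc (f N) (emb (c N))) \<doteq> (\<lambda>N. cfc g (emb (c N)))"
    unfolding asymp_eq_def
    by (intro Lim_null_comparison[OF always_eventually LIMSEQ_inverse_real_of_nat]) blast
  also have "(\<lambda>N. cfc g (emb (c N))) \<doteq> (\<lambda>_. cfc g (emb x))"
    using c(2,3) by (intro asymp_eq_cfc sc sx g) (simp_all add: asymp_eq_emb_iff Bseq_emb_iff)
  also have "cfc g (emb x) = cfc (\<lambda>t. t) (emb x)"
    by (rule cfc_cong) (use x in \<open>auto simp: cpos_def g_def\<close>)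
  finally have "(\<lambda>N. emb (nfc (f N) (c N))) \<doteq> (\<lambda>_. emb x)"
    unfolding emb_nfc[OF c(1) f] by (simp add: cfc_ident sx)
  then show ?thesis unfolding asymp_eq_emb_iff f_def[abs_def] .
qed

text \<open>
  Otherwise \<open>B\<close> is spanned by a projection \<open>p\<close> with \<open>p A p = \<complex> p\<close>, and there is \<open>r \<in> A\<close> with
  \<open>r\<^sup>* r = p\<close> and \<open>p r = 0\<close>. If \<open>\<phi> : M\<^sub>2 \<rightarrow> A\<close> almost commutes with \<open>p\<close> and \<open>r\<close>, then \<open>z \<mapsto> p \<phi>(z) p\<close>
  is almost an order zero map to the scalars, hence almost 0. So the rank two projection
  \<open>p + r r\<^sup>*\<close> would be Cuntz below \<open>p\<close>.
\<close>

lemma hereditary_not_scalars: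
  fixes A B :: "'a::cstar_algebra set"
  assumes A: "tracially_Z_absorbing A" and B: "hereditary_subalgebra B A"
  shows "\<not> star_isomorphic B (UNIV :: complex set)"
proof
  assume "star_isomorphic B (UNIV :: complex set)"
  then obtain F where bij: "bij_betw F B (UNIV :: complex set)"
    and hom: "\<And>x y. x \<in> B \<Longrightarrow> y \<in> B \<Longrightarrow> F (x + y) = F x + F y \<and> F (x * y) = F x * F y"
    and lin: "\<And>c x. x \<in> B \<Longrightarrow> F (scaleC c x) = scaleC c (F x)"
    and st: "\<And>x. x \<in> B \<Longrightarrow> F (star x) = star (F x)"
    unfolding star_isomorphic_def by blast
  have csB: "cstar_subalgebra B" "B \<subseteq> A" using B by (simp_all add: hereditary_subalgebra_def)
  have simple: "simple_cstar A" and csA: "cstar_subalgebra A" and notC: "\<not> star_isomorphic A (UNIV :: complex set)"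
    using A by (simp_all add: tracially_Z_absorbing_def simple_cstar_def)
  note memA = cstar_subalgebraD[OF csA]
  have inj: "x = y" if "x \<in> B" "y \<in> B" "F x = F y" for x y
    using bij that by (auto simp: bij_betw_def inj_on_def)

  \<comment> \<open>The projection spanning \<open>B\<close> and a partial isometry out of
    it\<close>
  obtain p where p: "p \<in> B" "F p = 1" using bij by (metis UNIV_I bij_betw_def imageE)
  have pA: "p \<in> A" using p csB by blast
  have pp: "p * p = p" by (rule inj) (use p hom in \<open>auto intro: cstar_subalgebraD(4)[OF csB(1)]\<close>)
  have sp: "star p = p"
    by (rule inj) (use p st in \<open>auto intro: cstar_subalgebraD(6)[OF csB(1)] simp: star_complex_def\<close>)
  have span: "b = scaleC (F b) p" if "b \<in> B" for b
    by (rule inj) (use p lin that in \<open>auto intro: cstar_subalgebraD(5)[OF csB(1)] simp: scaleC_complex_def\<close>)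
  have F0: "F 0 = 0" using lin[OF p(1), of 0] by (simp add: scaleC_complex_def)
  have p0: "p \<noteq> 0" using p F0 by auto
  have np: "norm p = 1"
  proof -
    have "norm p * norm p = norm p" using norm_star_mult_self[of p] by (simp add: sp pp power2_eq_square)
    then show ?thesis using p0 by simp
  qed
  define \<omega> where "\<omega> y = F (p * y * p)" for y
  have corner: "p * y * p = scaleC (\<omega> y) p" if "y \<in> A" for y
    unfolding \<omega>_def by (rule span[OF hereditary_mult[OF csA B that p(1) p(1)]])
  have notspan: "\<exists>y\<in>A. \<forall>c. y \<noteq> scaleC c p"
  proof (rule ccontr)
    assume "\<not> ?thesis"
    then have s: "\<exists>c. y = scaleC c p" if "y \<in> A" for y using that by blast
    have AB: "A = B" using s csB cstar_subalgebraD(5)[OF csB(1) p(1)] by (metis subsetI subset_antisym)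
    show False using notC \<open>star_isomorphic B UNIV\<close> AB by simp
  qed
  have "\<exists>y\<in>A. y * p \<noteq> p * y * p"
  proof (rule ccontr)
    assume "\<not> ?thesis"
    then have r: "y * p = p * y * p" if "y \<in> A" for y using that by blast
    have l: "p * y = p * y * p" if "y \<in> A" for y
      using arg_cong[OF r[OF memA(6)[OF that]], of star] unfolding star_mult star_star sp mult.assoc .
    \<comment> \<open>If \<open>y p\<close> lay in the corner for every \<open>y\<close>, the corner
      \<open>p A p\<close> would be an ideal, hence all of \<open>A\<close> by simplicity, against
      \<open>notspan\<close>.\<close>
    define I where "I = {y \<in> A. p * y * p = y}"
    have I_iff: "y \<in> I \<longleftrightarrow> y \<in> A \<and> p * y * p = y" for y by (simp add: I_def)
    have Ir: "y * p = y" and Il: "p * y = y" if "y \<in> I" for y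
      using that pp unfolding I_iff by (metis mult.assoc)+
    have "closed_ideal I A"
      unfolding closed_ideal_def
    proof (intro conjI ballI allI)
      have "closed {y. p * y * p = y}" by (intro closed_Collect_eq continuous_intros)
      then show "closed I" unfolding I_def Collect_conj_eq Collect_mem_eq by (intro closed_Int memA(1))
      show "y + z \<in> I" if "y \<in> I" "z \<in> I" for y z
        using that memA(3) by (simp add: I_iff algebra_simps)
      show "scaleC c y \<in> I" if "y \<in> I" for c y
        using that memA(5) by (simp add: I_iff scaleC_mult_left scaleC_mult_right)
      fix y z assume y: "y \<in> A" and z: "z \<in> I"
      have zA: "z \<in> A" using z by (simp add: I_iff)
      have "y * z = y * p * z" using Il[OF z] by (simp add: mult.assoc)
      also have "\<dots> = p * (y * p * z)" using r[OF y] pp by (metis mult.assoc)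
      finally have "p * (y * z) * p = y * z" using Ir[OF z] Il[OF z] by (simp add: mult.assoc)
      then show "y * z \<in> I" using memA(4)[OF y zA] by (simp add: I_iff)
      have "z * y = z * (p * y)" using Ir[OF z] by (simp flip: mult.assoc)
      also have "\<dots> = z * (p * y) * p" using l[OF y] by (metis mult.assoc)
      also have "\<dots> = z * y * p" using Ir[OF z] by (simp flip: mult.assoc)
      finally have "p * (z * y) * p = z * y" using Il[OF z] by (simp flip: mult.assoc)
      then show "z * y \<in> I" using memA(4)[OF zA y] by (simp add: I_iff)
    qed (auto simp: I_iff memA(2))
    then have "I = {0} \<or> I = A" using simple by (auto simp: simple_cstar_def)
    moreover have "p \<in> I" using pA pp by (simp add: I_iff)
    ultimately have "I = A" using p0 by auto
    then have "\<forall>y\<in>A. y = scaleC (\<omega> y) p" using corner I_iff by metis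
    then show False using notspan by blast
  qed
  then obtain y0 where y0: "y0 \<in> A" "y0 * p \<noteq> p * y0 * p" by blast
  \<comment> \<open>The part of \<open>y0\<close> leading from \<open>p\<close> to its complement,
    nonzero by choice of \<open>y0\<close>. As \<open>star t * t\<close> is a positive multiple of
    \<open>p\<close>, rescaling gives the partial isometry \<open>r\<close>.\<close>
  define t where "t = y0 * p - p * y0 * p"
  have t: "t \<in> A" "t \<noteq> 0" "p * t = 0" "t * p = t"
    unfolding t_def using y0 pA pp memA(4,9)
    by (auto simp: algebra_simps) (simp_all flip: mult.assoc)
  obtain r where r: "r \<in> A" "star r * r = p" "p * r = 0" "r * p = r"
  proof -
    define \<mu> where "\<mu> = \<omega> (star t * t)"
    have stt: "star t * t = scaleC \<mu> p"
    proof -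
      have "star t * t = p * (star t * t) * p" using t(4) sp by (metis mult.assoc star_mult)
      then show ?thesis unfolding \<mu>_def using corner[OF memA(4)[OF memA(6)[OF t(1)] t(1)]] by simp
    qed
    have "scaleC (cnj \<mu>) p = star (scaleC \<mu> p)" by (simp only: star_scaleC sp)
    also have "\<dots> = star (star t * t)" by (simp only: stt)
    also have "\<dots> = star t * t" by (simp only: star_mult star_star)
    also have "\<dots> = scaleC \<mu> p" by (rule stt)
    finally have "scaleC (cnj \<mu>) p = scaleC \<mu> p" .
    then have "scaleC (cnj \<mu> - \<mu>) p = 0" by (simp add: scaleC_diff_left)
    then have "cmod (cnj \<mu> - \<mu>) = 0" using norm_scaleC[of "cnj \<mu> - \<mu>" p] np by simp
    then have "cnj \<mu> = \<mu>" by simp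
    then have \<mu>: "\<mu> = complex_of_real (Re \<mu>)" by (simp add: complex_eq_iff)
    then have stt': "star t * t = Re \<mu> *\<^sub>R p" using stt by (metis scaleC_of_real)
    have ppos: "cpos (emb p)" using cpos_star_mult_self[of "emb p"] by (simp add: sp pp flip: emb_simps)
    have "Re \<mu> > 0"
    proof (rule ccontr)
      assume "\<not> Re \<mu> > 0"
      then have "cpos ((- Re \<mu>) *\<^sub>R emb p)" by (intro cpos_scaleR ppos) simp
      also have "(- Re \<mu>) *\<^sub>R emb p = - (star (emb t) * emb t)"
        using stt' by (simp flip: emb_simps)
      finally have "star (emb t) * emb t = 0" using cpos_antisym[OF cpos_star_mult_self] by blast
      then have "emb t = emb 0" unfolding star_mult_self_eq_0 emb_simps .
      then show False using t by simp
    qed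
    then obtain q where q: "q > 0" "Re \<mu> = q * q"
      by (metis less_imp_le real_sqrt_gt_0_iff real_sqrt_mult_self abs_of_pos)
    then have "inverse q * (inverse q * Re \<mu>) = 1" by (simp add: field_simps)
    then show ?thesis
      using t by (intro that[of "inverse q *\<^sub>R t"]) (simp_all add: stt' memA(7))
  qed
  have sr: "star r * p = 0" "p * star r = star r"
    using arg_cong[OF r(3), of star] arg_cong[OF r(4), of star] by (simp_all add: star_mult sp)
  have srA: "star r \<in> A" using memA(6)[OF r(1)] .
  have nr: "norm r = 1" using norm_star_mult_self[of r] r(2) np norm_ge_zero[of r] by (auto simp: power2_eq_1_iff)
  \<comment> \<open>Sum of two orthogonal projections that are equivalent through \<open>r\<close>;
    it will be too large to lie below \<open>p\<close>.\<close>
  define x where "x = p + r * star r"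
  have xA: "x \<in> A" unfolding x_def by (intro memA(3,4) pA r srA)
  have sx: "star x = x" by (simp add: x_def star_simps sp)
  have rr: "r * (star r * (r * z)) = r * z" for z using r(2,4) by (metis mult.assoc)
  have xx: "x * x = x"
  proof -
    have "r * star r * (r * star r) = r * star r" using rr by (simp add: mult.assoc)
    moreover have "p * (r * star r) = 0" using r(3) by (simp flip: mult.assoc)
    moreover have "r * star r * p = 0" using sr(1) by (simp add: mult.assoc)
    ultimately show ?thesis by (simp add: x_def distrib_left distrib_right pp)
  qed
  have "x = star x * x" "p = star p * p" by (simp_all add: sx xx sp pp)
  then have pos: "x \<in> positives A" "p \<in> positives A" unfolding positives_def using xA pA by blast+
  obtain \<phi> where \<phi>: "\<And>N. cpc_order_zero 2 A (\<phi> N)"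
    "\<And>N. cuntz_le A (cut_down A (x * x - x * \<phi> N (1\<^sub>m 2) * x) (inverse (real (Suc N)))) p"
    and comm: "\<And>i j b. i < 2 \<Longrightarrow> j < 2 \<Longrightarrow> b \<in> {p, r, star r} \<Longrightarrow>
      (\<lambda>N. \<phi> N (matrix_unit 2 i j) * b) \<doteq> (\<lambda>N. b * \<phi> N (matrix_unit 2 i j))"
    using tracially_Z_absorbing_sequence[OF A pos p0, of "{p, r, star r}" 2] pA r(1) srA by auto

  \<comment> \<open>Asymptotic vanishing on the corner\<close>
  interpret oz: order_zero 2 A "\<phi> N" for N using \<phi>(1) by unfold_locales auto
  define R where "R i j N = oz.R N i j" for i j N
  define H where "H N = oz.h N" for N
  have RA: "R i j N \<in> A" and HA: "H N \<in> A" for i j N by (simp_all add: R_def H_def oz.R_in oz.h_in)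
  have sH: "star (H N) = H N" for N by (simp add: H_def oz.star_h)
  have bR: "Bseq (R i j)" if "i < 2" "j < 2" for i j
    by (rule BseqI'[of _ 1]) (use that in \<open>simp add: R_def oz.norm_R\<close>)
  have bH: "Bseq H" by (rule BseqI'[of _ 1]) (simp add: H_def oz.norm_h)
  have H_eq: "H N = R 0 0 N + R 1 1 N" for N
    unfolding H_def R_def oz.h_eq by (simp add: numeral_2_eq_2)
  have cR: "(\<lambda>N. R i j N * b) \<doteq> (\<lambda>N. b * R i j N)" if "i < 2" "j < 2" "b \<in> {p, r, star r}" for i j b
    using comm[OF that] by (simp add: R_def oz.R_def)
  have cH: "(\<lambda>N. H N * b) \<doteq> (\<lambda>N. b * H N)" if "b \<in> {p, r, star r}" for b
    unfolding H_eq distrib_left distrib_right by (intro asymp_eq_add cR that) auto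
  define c where "c i j N = \<omega> (R i j N)" for i j N
  have cp: "p * R i j N * p = scaleC (c i j N) p" for i j N unfolding c_def by (rule corner[OF RA])
  have cmod_c: "cmod (c i j N) \<le> 1" if "i < 2" "j < 2" for i j N
  proof -
    have "norm (p * R i j N * p) \<le> 1 * 1 * 1" by (intro norm_mult_le) (use that in \<open>auto simp: np R_def oz.norm_R\<close>)
    then show ?thesis by (simp add: cp norm_scaleC np)
  qed
  have scal: "(\<lambda>N. u N - v N) \<longlonglongrightarrow> 0" if "(\<lambda>N. scaleC (u N) p) \<doteq> (\<lambda>N. scaleC (v N) p)" for u v
  proof -
    have "(\<lambda>N. norm (scaleC (u N - v N) p)) \<longlonglongrightarrow> 0"
      using that unfolding asymp_eq_def scaleC_diff_left[symmetric] by (rule tendsto_norm_zero)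
    then show ?thesis by (simp add: norm_scaleC np tendsto_norm_zero_iff)
  qed
  have prod: "(\<lambda>N. p * (R i j N * R k l N) * p) \<doteq> (\<lambda>N. scaleC (c i j N * c k l N) p)"
    if "i < 2" "j < 2" "k < 2" "l < 2" for i j k l
  proof -
    have "(\<lambda>N. p * (R i j N * (p * (R k l N * p)))) \<doteq> (\<lambda>N. p * (p * (R i j N * (R k l N * p))))"
      using asymp_eq_mult_left[OF asymp_eq_mult_right[OF cR[OF that(1,2), of p] Bseq_mult'[OF bR[OF that(3,4)] Bseq_const[of p]]] Bseq_const[of p]]
      by (simp only: mult.assoc insertI1)
    moreover have "p * (p * z) = p * z" for z using pp by (simp flip: mult.assoc)
    moreover have "p * (R i j N * (p * (R k l N * p))) = scaleC (c i j N * c k l N) p" for N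
    proof -
      have "p * (R i j N * (p * (R k l N * p))) = (p * R i j N * p) * (p * R k l N * p)"
        using pp by (metis mult.assoc)
      then show ?thesis unfolding cp by (simp add: scaleC_mult_left scaleC_mult_right scaleC_scaleC pp mult.commute)
    qed
    ultimately show ?thesis by (simp add: mult.assoc asymp_eq_sym)
  qed
  define \<alpha> where "\<alpha> = c 0 0"
  define \<beta> where "\<beta> = c 1 1"
  have bc: "Bseq (c i j)" if "i < 2" "j < 2" for i j using cmod_c[OF that] by (rule BseqI')
  have ab: "(\<lambda>N. \<alpha> N * \<beta> N) \<longlonglongrightarrow> 0"
  proof -
    have "R 0 0 N * R 1 1 N = 0" for N unfolding R_def by (rule oz.R_mult_0) auto
    then have "(\<lambda>_. 0) \<doteq> (\<lambda>N. scaleC (c 0 0 N * c 1 1 N) p)" using prod[of 0 0 1 1] by simp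
    then have "(\<lambda>N. 0 - c 0 0 N * c 1 1 N) \<longlonglongrightarrow> 0" by (intro scal) simp
    from tendsto_minus[OF this] show ?thesis by (simp add: \<alpha>_def \<beta>_def)
  qed
  \<comment> \<open>The squares of \<open>R 0 0\<close> and \<open>R 1 1\<close> are the products of
    \<open>R 0 1\<close> and \<open>R 1 0\<close> in the two orders; compressed to the corner these
    become products of scalars, which commute.\<close>
  have sq: "(\<lambda>N. \<alpha> N * \<alpha> N - \<beta> N * \<beta> N) \<longlonglongrightarrow> 0"
  proof -
    have e: "R 0 1 N * R 1 0 N = R 0 0 N * R 0 0 N" "R 1 0 N * R 0 1 N = R 1 1 N * R 1 1 N" for N
      unfolding R_def by (rule oz.R_mult_eq; simp)+
    have "(\<lambda>N. scaleC (c 0 1 N * c 1 0 N) p) \<doteq> (\<lambda>N. scaleC (c 0 0 N * c 0 0 N) p)"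
      using asymp_eq_trans[OF asymp_eq_sym[OF prod[of 0 1 1 0]] prod[of 0 0 0 0, folded e]] by simp
    then have 1: "(\<lambda>N. c 0 1 N * c 1 0 N - c 0 0 N * c 0 0 N) \<longlonglongrightarrow> 0" by (rule scal)
    have "(\<lambda>N. scaleC (c 1 0 N * c 0 1 N) p) \<doteq> (\<lambda>N. scaleC (c 1 1 N * c 1 1 N) p)"
      using asymp_eq_trans[OF asymp_eq_sym[OF prod[of 1 0 0 1]] prod[of 1 1 1 1, folded e]] by simp
    then have 2: "(\<lambda>N. c 1 0 N * c 0 1 N - c 1 1 N * c 1 1 N) \<longlonglongrightarrow> 0" by (rule scal)
    from tendsto_diff[OF 2 1] show ?thesis by (simp add: \<alpha>_def \<beta>_def algebra_simps)
  qed
  have b\<alpha>\<beta>: "Bseq \<alpha>" "Bseq \<beta>" unfolding \<alpha>_def \<beta>_def by (intro bc; simp)+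
  have z4: "(\<lambda>N. u N ^ 4) \<longlonglongrightarrow> 0 \<Longrightarrow> u \<longlonglongrightarrow> 0" for u :: "nat \<Rightarrow> complex"
  proof -
    assume "(\<lambda>N. u N ^ 4) \<longlonglongrightarrow> 0"
    then have "(\<lambda>N. root 4 (norm (u N ^ 4))) \<longlonglongrightarrow> root 4 0" by (intro tendsto_real_root tendsto_norm_zero)
    then show "u \<longlonglongrightarrow> 0" by (simp add: norm_power real_root_power_cancel tendsto_norm_zero_iff)
  qed
  have \<alpha>0: "\<alpha> \<longlonglongrightarrow> 0"
  proof (rule z4)
    \<comment> \<open>The mixed terms cancel and leave \<open>\<alpha> N ^ 4\<close>, so
      \<open>\<alpha>\<close> tends to 0; likewise for \<open>\<beta>\<close> below.\<close>
    have "(\<lambda>N. \<alpha> N * \<alpha> N * (\<alpha> N * \<alpha> N - \<beta> N * \<beta> N) + \<alpha> N * \<beta> N * (\<alpha> N * \<beta> N)) \<longlonglongrightarrow> 0"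
      by (intro tendsto_add_zero Bseq_mult_null(1) Bseq_mult' b\<alpha>\<beta> sq ab)
    then show "(\<lambda>N. \<alpha> N ^ 4) \<longlonglongrightarrow> 0" by (simp add: algebra_simps power4_eq_xxxx)
  qed
  have \<beta>0: "\<beta> \<longlonglongrightarrow> 0"
  proof (rule z4)
    have "(\<lambda>N. \<alpha> N * \<beta> N * (\<alpha> N * \<beta> N) - \<beta> N * \<beta> N * (\<alpha> N * \<alpha> N - \<beta> N * \<beta> N)) \<longlonglongrightarrow> 0 - 0"
      by (intro tendsto_diff Bseq_mult_null(1) Bseq_mult' b\<alpha>\<beta> sq ab)
    then show "(\<lambda>N. \<beta> N ^ 4) \<longlonglongrightarrow> 0" by (simp add: algebra_simps power4_eq_xxxx)
  qed
  have php: "(\<lambda>N. p * H N * p) \<longlonglongrightarrow> 0"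
  proof -
    have "p * H N * p = scaleC (\<alpha> N + \<beta> N) p" for N
      unfolding H_eq distrib_left distrib_right cp scaleC_add_left \<alpha>_def \<beta>_def ..
    then have "norm (p * H N * p) = cmod (\<alpha> N + \<beta> N)" for N by (simp add: norm_scaleC np)
    moreover have "(\<lambda>N. cmod (\<alpha> N + \<beta> N)) \<longlonglongrightarrow> 0" by (intro tendsto_norm_zero tendsto_add_zero \<alpha>0 \<beta>0)
    ultimately have "(\<lambda>N. norm (p * H N * p)) \<longlonglongrightarrow> 0" by (simp only:)
    then show ?thesis by (rule tendsto_norm_zero_cancel)
  qed
  \<comment> \<open>Moving \<open>H\<close> past \<open>r\<close> turns \<open>p H r\<close> into
    \<open>p r H = 0\<close> and \<open>star r H r\<close> into \<open>p H\<close>, so all four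
    pieces reduce to \<open>p H p\<close> or vanish.\<close>
  have "(\<lambda>N. x * H N * x) \<longlonglongrightarrow> 0"
  proof -
    have 1: "(\<lambda>N. p * (H N * r)) \<longlonglongrightarrow> 0"
    proof -
      have "(\<lambda>N. p * (H N * r)) \<doteq> (\<lambda>N. p * (r * H N))" by (intro asymp_eq_mult_left cH Bseq_const) simp
      moreover have "p * (r * z) = 0" for z using r(3) by (simp flip: mult.assoc)
      ultimately show ?thesis by (simp add: asymp_eq_def)
    qed
    have 2: "(\<lambda>N. star r * (H N * p)) \<longlonglongrightarrow> 0"
      using tendsto_star[OF 1] by (simp add: star_mult sH sp mult.assoc)
    have 3: "(\<lambda>N. star r * (H N * r)) \<longlonglongrightarrow> 0"
    proof -
      have "(\<lambda>N. star r * (H N * r)) \<doteq> (\<lambda>N. star r * (r * H N))" by (intro asymp_eq_mult_left cH Bseq_const) simp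
      also have "(\<lambda>N. star r * (r * H N)) = (\<lambda>N. p * (p * H N))"
        using r(2) pp by (metis mult.assoc)
      also have "(\<lambda>N. p * (p * H N)) \<doteq> (\<lambda>N. p * (H N * p))"
        by (intro asymp_eq_mult_left asymp_eq_sym[OF cH] Bseq_const) simp
      also have "(\<lambda>N. p * (H N * p)) \<doteq> (\<lambda>_. 0)" using php by (simp add: asymp_eq_tendsto_0 mult.assoc)
      finally show ?thesis by (simp add: asymp_eq_tendsto_0)
    qed
    have "x * H N * x = p * H N * p + (p * (H N * r) * star r + (r * (star r * (H N * p)) + r * (star r * (H N * r)) * star r))" for N
      by (simp add: x_def distrib_left distrib_right mult.assoc)
    moreover have "(\<lambda>N. p * H N * p + (p * (H N * r) * star r + (r * (star r * (H N * p)) + r * (star r * (H N * r)) * star r))) \<longlonglongrightarrow> 0"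
      by (intro tendsto_add_zero php tendsto_mult_left_zero tendsto_mult_right_zero 1 2 3)
    ultimately show ?thesis by simp
  qed

  \<comment> \<open>Contradiction by a rank argument\<close>
  then have cx: "(\<lambda>N. x * x - x * H N * x) \<doteq> (\<lambda>_. x)"
    using tendsto_minus by (fastforce simp: asymp_eq_def xx)
  have bcx: "Bseq (\<lambda>N. x * x - x * H N * x)"
    using Bseq_asymp_eq[OF Bseq_const asymp_eq_sym[OF cx]] .
  have scx: "star (x * x - x * H N * x) = x * x - x * H N * x" for N by (simp add: star_mult sx sH mult.assoc)
  have xpos: "cpos (emb x)" using cpos_star_mult_self[of "emb x"] by (simp add: sx xx flip: emb_simps)
  define q where "q N = nfc (\<lambda>t. max (t - inverse (real (Suc N))) 0) (x * x - x * H N * x)" for N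
  have "q \<doteq> (\<lambda>_. x)" unfolding q_def by (rule asymp_eq_nfc_cut_down[OF scx bcx cx xpos])
  then have "(\<lambda>N. norm (q N - x)) \<longlonglongrightarrow> 0" unfolding asymp_eq_def by (rule tendsto_norm_zero)
  from LIMSEQ_D[OF this, of "1/8"] obtain N where N: "norm (q N - x) < 1/8" by auto
  have "cut_down A (x * x - x * H N * x) (inverse (real (Suc N))) = q N"
    unfolding q_def by (intro cut_down_eq csA scx memA(4,9) xA HA) simp
  then have "cuntz_le A (q N) p" using \<phi>(2)[of N] by (simp add: H_def oz.h_def)
  moreover have "(0::real) < 1/8" by simp
  ultimately have "\<exists>v\<in>A. norm (q N - v * p * star v) < 1/8" unfolding cuntz_le_iff by blast
  then obtain v where v: "v \<in> A" "norm (q N - v * p * star v) < 1/8" by blast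
  \<comment> \<open>Relative to \<open>p\<close> and \<open>r\<close>, \<open>x\<close> is the unit
    matrix of size 2, while \<open>T\<close> is the rank one matrix with entries
    \<open>a * cnj a\<close>, \<open>a * cnj b\<close>, \<open>b * cnj b\<close>. Diagonal entries
    near 1 force a large off-diagonal entry, which the distance \<open>1/4\<close> forbids.\<close>
  define T where "T = v * p * star v"
  have xT: "norm (x - T) < 1/4"
    using N v(2) norm_triangle_ineq4[of "q N - T" "q N - x"] by (simp add: T_def norm_minus_commute)
  define a where "a = \<omega> v"
  define b where "b = \<omega> (star r * v)"
  have pvp: "p * v * p = scaleC a p" unfolding a_def by (rule corner[OF v(1)])
  have rvp: "star r * v * p = scaleC b p"
    unfolding b_def corner[OF memA(4)[OF srA v(1)], symmetric] by (simp add: sr(2) flip: mult.assoc)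
  have pvs: "p * star v * p = scaleC (cnj a) p" "p * star v * r = scaleC (cnj b) p"
    using arg_cong[OF pvp, of star] arg_cong[OF rvp, of star] by (simp_all add: star_simps sp mult.assoc)
  have split: "y * T * z = (y * v * p) * (p * star v * z)" for y z
    unfolding T_def using pp by (metis mult.assoc)
  have 1: "p * T * p = scaleC (a * cnj a) p" "star r * T * r = scaleC (b * cnj b) p" "p * T * r = scaleC (a * cnj b) p"
    unfolding split pvp rvp pvs by (simp_all add: scaleC_mult_left scaleC_mult_right scaleC_scaleC pp mult.commute)
  have 2: "p * x * p = p" "star r * x * r = p" "p * x * r = 0"
    using r sr by (simp_all add: x_def distrib_left distrib_right mult.assoc pp)
  have small: "norm (y * x * z - y * T * z) \<le> 1/4" if "norm y \<le> 1" "norm z \<le> 1" for y z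
  proof -
    have "y * x * z - y * T * z = y * (x - T) * z" by (simp add: algebra_simps)
    moreover have "norm (y * (x - T) * z) \<le> 1 * (1/4) * 1"
      using that xT by (intro norm_mult_le) auto
    ultimately show ?thesis by simp
  qed
  have "norm (scaleC (1 - a * cnj a) p) \<le> 1/4" "norm (scaleC (1 - b * cnj b) p) \<le> 1/4" "norm (scaleC (- (a * cnj b)) p) \<le> 1/4"
    using small[of p p] small[of "star r" r] small[of p r] unfolding 1 2
    by (simp_all add: np nr scaleC_diff_left scaleC_minus_left)
  then have "cmod (1 - a * cnj a) \<le> 1/4" "cmod (1 - b * cnj b) \<le> 1/4" and ab4: "cmod a * cmod b \<le> 1/4"
    by (simp_all add: norm_scaleC np norm_mult)
  then have "3/4 \<le> cmod (a * cnj a)" "3/4 \<le> cmod (b * cnj b)"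
    using norm_triangle_sub[of 1 "a * cnj a"] norm_triangle_sub[of 1 "b * cnj b"] by simp_all
  then have "3/4 * (3/4) \<le> (cmod a * cmod a) * (cmod b * cmod b)" by (intro mult_mono) (auto simp: norm_mult)
  also have "\<dots> = (cmod a * cmod b) * (cmod a * cmod b)" by (simp add: mult_ac)
  also have "\<dots> \<le> 1/4 * (1/4)" using ab4 by (intro mult_mono) auto
  finally show False by simp
qed

theorem theorem4p1:
  fixes A B :: "'a::cstar_algebra set"
  assumes "simple_cstar A"
    and "tracially_Z_absorbing A"
    and "hereditary_subalgebra B A"
  shows "tracially_Z_absorbing B"
  unfolding tracially_Z_absorbing_def
proof (intro conjI ballI allI impI)
  note A = assms(2) and B = assms(3)
  have csA: "cstar_subalgebra A" using assms(1) by (simp add: simple_cstar_def)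
  have csB: "cstar_subalgebra B" "B \<subseteq> A" using B by (simp_all add: hereditary_subalgebra_def)
  note memB = cstar_subalgebraD[OF csB(1)] and memA = cstar_subalgebraD[OF csA]
  show "simple_cstar B" by (rule hereditary_simple[OF assms(1) B])
  show "\<not> star_isomorphic B (UNIV :: complex set)" by (rule hereditary_not_scalars[OF A B])
  fix x a F and \<epsilon> :: real and n :: nat
  assume xB: "x \<in> positives B" and aB: "a \<in> positives B"
    and "a \<noteq> 0 \<and> finite F \<and> F \<subseteq> B \<and> \<epsilon> > 0 \<and> n \<ge> 1"
  then have a0: "a \<noteq> 0" and F: "finite F" "F \<subseteq> B" and \<epsilon>: "\<epsilon> > 0" and n: "1 \<le> n" by auto
  obtain x1 where x1: "x = star x1 * x1" "x1 \<in> B" using xB by (auto simp: positives_def)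
  obtain a1 where a1: "a = star a1 * a1" "a1 \<in> B" using aB by (auto simp: positives_def)
  have x: "x \<in> B" "star x = x" unfolding x1(1) using x1(2) by (auto intro: memB(4,6) simp: star_simps)
  have a: "a \<in> B" unfolding a1(1) using a1(2) by (auto intro: memB(4,6))
  have posA: "x \<in> positives A" "a \<in> positives A"
    using x1 a1 csB(2) unfolding positives_def by blast+
  \<comment> \<open>\<open>e\<close> must also be almost a unit for \<open>x\<close>, for comparing
    \<open>x \<psi>(1) x\<close> with \<open>x \<phi>(1) x\<close>.\<close>
  define G where "G = insert x F"
  have G: "finite G" "G \<subseteq> B" using F x(1) by (auto simp: G_def)
  define K where "K = 1 + (\<Sum>b\<in>G. norm b)"
  have K1: "K \<ge> 1" by (simp add: K_def sum_nonneg)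
  have K: "norm b \<le> K" if "b \<in> G" for b
    using member_le_sum[OF that, of norm] G(1) by (simp add: K_def)
  \<comment> \<open>The commutators will cost at most \<open>19 n\<^sup>2 K s\<close>, and the
    elements to be cut down differ by at most \<open>n K\<^sup>2 s + 8 K s\<close>. The denominator
    keeps the first below \<open>\<epsilon>\<close> and the second below
    \<open>\<epsilon> / 2\<close>, leaving \<open>\<epsilon> / 2\<close> for the tolerance of
    \<open>\<phi> N\<close>.\<close>
  define s where "s = \<epsilon> / (100 * (real n)\<^sup>2 * K\<^sup>2)"
  have nn: "1 \<le> real n" using n by simp
  have s: "s > 0" using \<epsilon> K1 nn by (simp add: s_def)
  have sK: "(real n)\<^sup>2 * K\<^sup>2 * s = \<epsilon> / 100" using K1 nn by (simp add: s_def)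
  obtain e where e: "e \<in> B" "star e = e" "norm e \<le> 1" "\<And>b. b \<in> G \<Longrightarrow> norm (e * b - b) < s"
      "\<And>b. b \<in> G \<Longrightarrow> norm (b * e - b) < s"
    using local_unit[OF csB(1) G s] by blast
  define e8 where "e8 = e * e * (e * e) * (e * e * (e * e))"
  have lstep: "norm (u * v * b - b) \<le> c + d" if "norm (u * b - b) \<le> c" "norm (v * b - b) \<le> d" "norm u \<le> 1"
    for u v b :: 'a and c d
  proof -
    have "u * v * b - b = u * (v * b - b) + (u * b - b)" by (simp add: algebra_simps)
    then have "norm (u * v * b - b) \<le> norm (u * (v * b - b)) + norm (u * b - b)" by (metis norm_triangle_ineq)
    moreover have "norm (u * (v * b - b)) \<le> 1 * d" by (intro norm_mult_le that)
    ultimately show ?thesis using that(1) by simp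
  qed
  have rstep: "norm (b * (u * v) - b) \<le> c + d" if "norm (b * u - b) \<le> c" "norm (b * v - b) \<le> d" "norm v \<le> 1"
    for u v b :: 'a and c d
  proof -
    have "b * (u * v) - b = (b * u - b) * v + (b * v - b)" by (simp add: algebra_simps)
    then have "norm (b * (u * v) - b) \<le> norm ((b * u - b) * v) + norm (b * v - b)" by (metis norm_triangle_ineq)
    moreover have "norm ((b * u - b) * v) \<le> c * 1" by (intro norm_mult_le that)
    ultimately show ?thesis using that(2) by simp
  qed
  have ne2: "norm (e * e) \<le> 1" using norm_mult_le[OF e(3,3)] by simp
  have ne4: "norm (e * e * (e * e)) \<le> 1" using norm_mult_le[OF ne2 ne2] by simp
  have e8l: "norm (e8 * b - b) \<le> 8 * s" if "b \<in> G" for b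
  proof -
    note 1 = less_imp_le[OF e(4)[OF that]]
    note 2 = lstep[OF 1 1 e(3)]
    note 4 = lstep[OF 2 2 ne2]
    show ?thesis using lstep[OF 4 4 ne4] by (simp add: e8_def)
  qed
  have e8r: "norm (b * e8 - b) \<le> 8 * s" if "b \<in> G" for b
  proof -
    note 1 = less_imp_le[OF e(5)[OF that]]
    note 2 = rstep[OF 1 1 e(3)]
    note 4 = rstep[OF 2 2 ne2]
    show ?thesis using rstep[OF 4 4 ne4] by (simp add: e8_def)
  qed
  have ne8: "norm e8 \<le> 1" using norm_mult_le[OF ne4 ne4] by (simp add: e8_def)
  obtain \<phi> where \<phi>: "\<And>N. cpc_order_zero n A (\<phi> N)"
    "\<And>N. cuntz_le A (cut_down A (x * x - x * \<phi> N (1\<^sub>m n) * x) (inverse (real (Suc N)))) a"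
    and comm: "\<And>i j b. i < n \<Longrightarrow> j < n \<Longrightarrow> b \<in> insert e G \<Longrightarrow>
      (\<lambda>N. \<phi> N (matrix_unit n i j) * b) \<doteq> (\<lambda>N. b * \<phi> N (matrix_unit n i j))"
    by (rule tracially_Z_absorbing_sequence[OF A posA a0, of "insert e G" n]) (use G e(1) csB(2) n in auto)
  have "\<forall>\<^sub>F N in sequentially. \<exists>\<psi>. cpc_order_zero n B \<psi> \<and>
    (\<forall>i<n. \<forall>j<n. norm (\<psi> (matrix_unit n i j) - e8 * \<phi> N (matrix_unit n i j)) \<le> s)"
    unfolding e8_def by (rule order_zero_compress[OF csA B e(1,2,3) n \<phi>(1) comm s]) auto
  moreover have "\<forall>\<^sub>F N in sequentially. \<forall>i\<in>{..<n}. \<forall>j\<in>{..<n}. \<forall>b\<in>G.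
      norm (\<phi> N (matrix_unit n i j) * b - b * \<phi> N (matrix_unit n i j)) < s"
    using comm by (intro eventually_ball_finite ballI finite_lessThan G(1) order_tendstoD(2)[OF tendsto_norm_zero s])
      (auto simp: asymp_eq_def intro: s)
  moreover have "\<forall>\<^sub>F N in sequentially. inverse (real (Suc N)) < \<epsilon> / 2"
    by (rule order_tendstoD(2)[OF LIMSEQ_inverse_real_of_nat]) (use \<epsilon> in simp)
  ultimately have ev: "\<forall>\<^sub>F N in sequentially. (\<exists>\<psi>. cpc_order_zero n B \<psi> \<and>
      (\<forall>i<n. \<forall>j<n. norm (\<psi> (matrix_unit n i j) - e8 * \<phi> N (matrix_unit n i j)) \<le> s)) \<and>
      (\<forall>i\<in>{..<n}. \<forall>j\<in>{..<n}. \<forall>b\<in>G.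
        norm (\<phi> N (matrix_unit n i j) * b - b * \<phi> N (matrix_unit n i j)) < s) \<and>
      inverse (real (Suc N)) < \<epsilon> / 2"
    by eventually_elim blast
  obtain N where H: "(\<exists>\<psi>. cpc_order_zero n B \<psi> \<and>
      (\<forall>i<n. \<forall>j<n. norm (\<psi> (matrix_unit n i j) - e8 * \<phi> N (matrix_unit n i j)) \<le> s)) \<and>
      (\<forall>i\<in>{..<n}. \<forall>j\<in>{..<n}. \<forall>b\<in>G.
        norm (\<phi> N (matrix_unit n i j) * b - b * \<phi> N (matrix_unit n i j)) < s) \<and>
      inverse (real (Suc N)) < \<epsilon> / 2"
    using eventually_happens'[OF sequentially_bot ev] by blast
  then obtain \<psi> where \<psi>: "cpc_order_zero n B \<psi>"
      "\<And>i j. i < n \<Longrightarrow> j < n \<Longrightarrow> norm (\<psi> (matrix_unit n i j) - e8 * \<phi> N (matrix_unit n i j)) \<le> s"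
    by blast
  have cN: "norm (\<phi> N (matrix_unit n i j) * b - b * \<phi> N (matrix_unit n i j)) < s"
    if "i < n" "j < n" "b \<in> G" for i j b using H that by blast
  have N: "inverse (real (Suc N)) < \<epsilon> / 2" using H by blast
  interpret P: order_zero n B \<psi> using \<psi>(1) n by unfold_locales
  interpret Q: order_zero n A "\<phi> N" using \<phi>(1) n by unfold_locales
  have near: "norm (P.R i j - e8 * Q.R i j) \<le> s" if "i < n" "j < n" for i j
    using \<psi>(2)[OF that] by (simp add: P.R_def Q.R_def)
  have nQ: "norm (Q.R i j) \<le> 1" if "i < n" "j < n" for i j using that by (rule Q.norm_R)
  have ii: "real n * (K\<^sup>2 * s) \<le> \<epsilon> / 100"
  proof -
    have "real n * (K\<^sup>2 * s) \<le> (real n)\<^sup>2 * (K\<^sup>2 * s)"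
      using nn s by (intro mult_right_mono) (auto simp: power2_eq_square)
    then show ?thesis using sK by (simp add: mult.assoc)
  qed
  have Ks: "K * s \<le> \<epsilon> / 100" "s \<le> \<epsilon> / 100"
  proof -
    have "K * s \<le> real n * (K\<^sup>2 * s)"
    proof -
      have "1 * (K * s) \<le> (real n * K) * (K * s)"
        using K1 nn s by (intro mult_right_mono mult_ge1_I) auto
      then show ?thesis by (simp add: power2_eq_square mult_ac)
    qed
    then show "K * s \<le> \<epsilon> / 100" using ii by linarith
    moreover have "1 * s \<le> K * s" using K1 s by (intro mult_right_mono) auto
    ultimately show "s \<le> \<epsilon> / 100" by simp
  qed
  show "\<exists>\<phi>. cpc_order_zero n B \<phi> \<and>
      cuntz_le B (cut_down B (x * x - x * \<phi> (1\<^sub>m n) * x) \<epsilon>) a \<and>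
      (\<forall>z\<in>carrier_mat n n. \<forall>b\<in>F. op_norm n z \<le> 1 \<longrightarrow> norm (\<phi> z * b - b * \<phi> z) < \<epsilon>)"
  proof (intro exI[of _ \<psi>] conjI ballI impI \<psi>(1))
    define c where "c = x * x - x * P.h * x"
    define c' where "c' = x * x - x * Q.h * x"
    define d where "d = inverse (real (Suc N))"
    have sc: "star c = c" "star c' = c'" by (simp_all add: c_def c'_def star_mult x(2) P.star_h Q.star_h mult.assoc)
    have cB: "c \<in> B" unfolding c_def by (intro memB(4,9) x(1) P.h_in)
    have cA: "c \<in> A" using cB csB by blast
    have c'A: "c' \<in> A" unfolding c'_def using x(1) csB(2) by (intro memA(4,9) Q.h_in) auto
    have xG: "x \<in> G" by (simp add: G_def)
    have hh: "norm (P.h - e8 * Q.h) \<le> real n * s"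
    proof -
      have "P.h - e8 * Q.h = (\<Sum>i<n. P.R i i - e8 * Q.R i i)"
        by (simp add: P.h_eq Q.h_eq sum_distrib_left sum_subtractf)
      also have "norm \<dots> \<le> (\<Sum>i<n. s)" by (rule sum_norm_le) (simp add: near)
      finally show ?thesis by simp
    qed
    have "norm (c - c') \<le> K * (real n * s) * K + 8 * s * 1 * K"
    proof -
      have eq: "c' - c = x * (P.h - e8 * Q.h) * x + (x * e8 - x) * Q.h * x"
        by (simp add: c_def c'_def algebra_simps)
      have 1: "norm (x * (P.h - e8 * Q.h) * x) \<le> K * (real n * s) * K" by (intro norm_mult_le hh K xG)
      have 2: "norm ((x * e8 - x) * Q.h * x) \<le> 8 * s * 1 * K" by (intro norm_mult_le e8r K xG Q.norm_h)
      have "norm (c - c') = norm (c' - c)" by (rule norm_minus_commute)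
      also have "\<dots> \<le> norm (x * (P.h - e8 * Q.h) * x) + norm ((x * e8 - x) * Q.h * x)"
        unfolding eq by (rule norm_triangle_ineq)
      finally show ?thesis using 1 2 by linarith
    qed
    also have "\<dots> = real n * (K\<^sup>2 * s) + 8 * (K * s)" by (simp add: power2_eq_square algebra_simps)
    also have "\<dots> \<le> \<epsilon> / 100 + 8 * (\<epsilon> / 100)" using ii Ks by (intro add_mono) auto
    finally have cc: "norm (c - c') + d < \<epsilon>" using N \<epsilon> by (simp add: d_def)
    have d0: "0 \<le> d" by (simp add: d_def)
    define p where "p = nfc (\<lambda>t. max (t - \<epsilon>) 0) c"
    \<comment> \<open>Raising the cut-down level from \<open>d\<close> to \<open>\<epsilon>\<close>
      pays for the replacement of \<open>\<phi> N\<close> by \<open>\<psi>\<close>.\<close>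
    have "cuntz_le A p (nfc (\<lambda>t. max (t - d) 0) c')"
      unfolding p_def by (rule cuntz_le_perturb[OF csA cA c'A sc d0 cc])
    moreover have "cuntz_le A (nfc (\<lambda>t. max (t - d) 0) c') a"
      using \<phi>(2)[of N] cut_down_eq[OF csA c'A sc(2) d0] by (simp add: c'_def d_def Q.h_def)
    ultimately have "cuntz_le A p a" by (rule cuntz_le_trans[OF csA])
    moreover have "p \<in> B" unfolding p_def using \<epsilon>
      by (intro nfc_in sc csB cB) (auto intro!: continuous_intros)
    ultimately have "cuntz_le B p a" using cuntz_le_hereditary[OF csA B _ a] by blast
    moreover have "cut_down B (x * x - x * \<psi> (1\<^sub>m n) * x) \<epsilon> = p"
      unfolding p_def using cut_down_eq[OF csB(1) cB sc(1)] \<epsilon> by (simp add: c_def P.h_def)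
    ultimately show "cuntz_le B (cut_down B (x * x - x * \<psi> (1\<^sub>m n) * x) \<epsilon>) a" by simp
  next
    fix z b assume z: "z \<in> carrier_mat n n" and b: "b \<in> F" and z1: "op_norm n z \<le> 1"
    have bG: "b \<in> G" using b by (simp add: G_def)
    have ij: "norm (P.R i j * b - b * P.R i j) \<le> 19 * (K * s)" if ij: "i < n" "j < n" for i j
    proof -
      \<comment> \<open>\<open>\<psi>\<close> is replaced by \<open>e8 \<phi>\<close>, then
        \<open>e8\<close> is absorbed by \<open>b\<close> from either side, leaving
        \<open>e8\<close> times the commutator of \<open>\<phi>\<close> with \<open>b\<close>. The
        errors add up to \<open>2 K s + 17 s \<le> 19 K s\<close>.\<close>
      have eq: "P.R i j * b - b * P.R i j = (P.R i j - e8 * Q.R i j) * b +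
         (e8 * (Q.R i j * b - b * Q.R i j) + ((e8 * b - b) * Q.R i j - (b * e8 - b) * Q.R i j
         - b * (P.R i j - e8 * Q.R i j)))"
        by (simp add: algebra_simps)
      have 1: "norm ((P.R i j - e8 * Q.R i j) * b) \<le> s * K" "norm (b * (P.R i j - e8 * Q.R i j)) \<le> K * s"
        by (intro norm_mult_le near K bG ij)+
      have 2: "norm (e8 * (Q.R i j * b - b * Q.R i j)) \<le> 1 * s"
        using cN[OF ij bG] by (intro norm_mult_le ne8) (simp add: Q.R_def)
      have 3: "norm ((e8 * b - b) * Q.R i j) \<le> 8 * s * 1" "norm ((b * e8 - b) * Q.R i j) \<le> 8 * s * 1"
        by (intro norm_mult_le e8l e8r nQ bG ij)+
      have "norm (P.R i j * b - b * P.R i j) \<le> s * K + (1 * s + (8 * s * 1 + 8 * s * 1 + K * s))"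
        unfolding eq
        by (intro order_trans[OF norm_triangle_ineq] order_trans[OF norm_triangle_ineq4] add_mono 1 2 3)
      moreover have "1 * s \<le> K * s" using K1 s by (intro mult_right_mono) auto
      ultimately show ?thesis by (simp add: mult.commute[of s K])
    qed
    have "\<psi> z * b - b * \<psi> z = (\<Sum>i<n. \<Sum>j<n. scaleC (z $$ (i, j)) (P.R i j * b - b * P.R i j))"
      unfolding P.phi_expansion[OF z] sum_distrib_left sum_distrib_right sum_subtractf[symmetric]
      by (simp add: scaleC_mult_left scaleC_mult_right scaleC_diff_right)
    also have "norm \<dots> \<le> (\<Sum>i<n. \<Sum>j<n. 1 * (19 * (K * s)))"
    proof (intro sum_norm_le)
      fix i j assume "i \<in> {..<n}" "j \<in> {..<n}"
      then have i: "i < n" and j: "j < n" by auto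
      have "cmod (z $$ (i, j)) \<le> 1"
        using cmod_index_le_l2_bound[OF z l2_bound_op_norm[OF z] i j] z1 by linarith
      then show "norm (scaleC (z $$ (i, j)) (P.R i j * b - b * P.R i j)) \<le> 1 * (19 * (K * s))"
        unfolding norm_scaleC using ij[OF i j] by (intro mult_mono) auto
    qed
    also have "\<dots> = 19 * ((real n)\<^sup>2 * K * s)" by (simp add: power2_eq_square)
    also have "\<dots> \<le> 19 * (\<epsilon> / 100)"
    proof -
      have "(real n)\<^sup>2 * K * s * 1 \<le> (real n)\<^sup>2 * K * s * K" using K1 s nn by (intro mult_left_mono) auto
      then show ?thesis using sK by (simp add: power2_eq_square mult_ac)
    qed
    also have "\<dots> < \<epsilon>" using \<epsilon> by simp
    finally show "norm (\<psi> z * b - b * \<psi> z) < \<epsilon>" .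
  qed
qed

end
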